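(* Let $a,a'\in \mathbb{R}$, $m \in \mathbb{N}$ and $m'\in\mathbb{N}_0$. Let the pair $(D,M)$, with $D\subset\mathbb{R}^d$, be of generalized polyhedral type. (i) Let $1 < p < \infty$. Then $\mathcal{K}^m_{a,p}(D,M)$ is (continuously) embedded into $\mathcal{K}^{m'}_{a',\infty}(D,M)$ if, and only if, $$m-\frac{d}{p} > m'\qquad\text{and} \qquad a-\frac{d}{p} \geq a'.$$ (ii) Let $p = 1$. Then $\mathcal{K}^m_{a,1}(D,M)$ is (continuously) embedded into $\mathcal{K}^{m'}_{a',\infty}(D,M)$ if, and only if, $$m-d \ge m'\qquad\text{and} \qquad a-d \geq a'.$$
   Context: $\mathbb{N}=\{1,2,\dots\}$, $\mathbb{N}_0=\mathbb{N}\cup\{0\}$, $d\ge 2$; a domain is a bounded open subset of $\mathbb{R}^d$; $B_r(x)$ is the open ball of radius $r$ centred at $x$. **Kondratiev spaces.** Let $\Omega\subset\mathbb{R}^d$ be a domain, $M$ a nontrivial (non-empty) closed subset of $\partial\Omega$, and $\rho(x)=\min\{1,\operatorname{dist}(x,M)\}$ for $x\in\Omega$. For $m\in\mathbb{N}_0$, $a\in\mathbb{R}$, $1\le p<\infty$, the space $\mathcal{K}^m_{a,p}(\Omega,M)$ consists of all measurable functions $u$ on $\Omega$ which admit $m$ weak derivatives in $\Omega$ (i.e. all weak derivatives $\partial^\alpha u$, $|\alpha|\le m$) with $\|u|\mathcal{K}^m_{a,p}(\Omega,M)\|=\big(\sum_{|\alpha|\le m}\int_\Omega|\rho(x)^{|\alpha|-a}\partial^\alpha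 u(x)|^p\,dx\big)^{1/p}<\infty$; for $p=\infty$ the norm is $\|u|\mathcal{K}^m_{a,\infty}(\Omega,M)\|=\sum_{|\alpha|\le m}\|\rho^{|\alpha|-a}\partial^\alpha u|L_\infty(\Omega)\|$. Spaces differing by an equivalent norm are not distinguished. **Standard pairs.** An infinite smooth cone with vertex at the origin is a set $K'=\{x\in\mathbb{R}^d: 0<|x|<\infty,\ x/|x|\in\omega\}$ with $\omega$ a subdomain of the unit sphere $S^{d-1}$ with $C^\infty$ boundary. Let $I=\{x\in\mathbb{R}^d: 0<x_i<1,\ i=1,\dots,d\}$. - Case I (smooth cone): $K'$ an infinite smooth cone, rotationally invariant with respect to the axis $\{(0,\dots,0,x_d):x_d\in\mathbb{R}\}$, with opening angle $\gamma\in(0,\pi)$; the pair is $(K,\{0\})$ with $K=K'\cap B_1(0)$. - Case II (specific nonsmooth cone): $K'$ as in Case I; the pair is $(P,\Gamma)$ with $P=K'\cap I$, $\Gamma=\{(0,\dots,0,x_d): 0\le x_d\le 1\}$. - Case III (specific dihedral domain): $1\le\ell<d$; the pair is $(I,M_\ell)$ with $M_\ell=\{x\in\partial I: x_1=\dots=x_{d-\ell}=0\}$. - Case IV (polyhedral cone, $d=3$): $K'$ an infinite cone in the half space $x_3>0$ of $\mathbb{R}^3$ with vertex at the origin, whose boundary consists of the vertex $0$, edges (half lines) $M_1,\dots,M_n$ and smooth faces $\Gamma_1,\dots,\Gamma_n$ (so $K'\cap S^2$ is a domain of polygonal type on the sphere with sides $\Gamma_k\cap S^2$); the pair is $(Q,M)$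 with $Q=K'\cap\{0<x_3<1\}$, $M=(M_1\cup\dots\cup M_n)\cap\overline Q$. **Domains of polyhedral type.** The singularity set $S$ of a domain $D$ is the set of all $x\in\partial D$ such that for any $\varepsilon>0$ the set $\partial D\cap B_\varepsilon(x)$ is not smooth. $D$ is of polyhedral type if $\overline D$ is covered by finitely many bounded open sets $U_i$, each of one of the following kinds: ($\Lambda_1$) $U_i$ is a ball with $\overline{U_i}\cap S=\emptyset$; ($\Lambda_2$) there is a $C^\infty$-diffeomorphism $\eta_i:\overline{U_i}\to\eta_i(\overline{U_i})\subset\mathbb{R}^d$ such that $\eta_i(U_i\cap D)$ is a smooth cone $K$ as in Case I and, on $U_i\cap D$, the distance to $S$ is equivalent to the distance to the point $\eta_i^{-1}(0)$; ($\Lambda_3$) the same with $\eta_i(U_i\cap D)$ a nonsmooth cone $P$ as in Case II and the distance to $S$ equivalent to the distance to $\eta_i^{-1}(\Gamma)$; ($\Lambda_4$) the same with $\eta_i(U_i\cap D)$ a specific dihedral domain as in Case III and the distance to $S$ equivalent to the distance to $\eta_i^{-1}(M_n)$ for some $n\in\{1,\dots,d-1\}$; and, only if $d=3$, ($\Lambda_5$) the same with $\eta_i(U_i\cap D)$ a polyhedral cone $Q$ as in Case IV and the distance to $S$ equivalent to the distance to $\eta_i^{-1}(M)$. The associated pair is $(D,S)$. **Generalized polyhedral type.** Let $D$ be a domain and $M$ a nontrivial closed subset of $\partial D$. The pair $(D,M)$ is of generalized polyhedral type if either it coincides with one of the pairs in Cases I–IV; or $D$ is of polyhedral type and $M=S$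 is its singularity set; or the following holds: (a) $D=\bigcup_{j=1}^N D_j$ with finitely many open sets $D_j$; (b) with $M_j=M\cap\overline{D_j}$, each pair $(D_j,M_j)$ is the ($C^\infty$-)diffeomorphic image of one of the pairs in Cases I–IV; (c) each $x\in D$ belongs to at most two different sets $D_j$, and for each $j$ there is at least one $k\neq j$ with $D_j\cap D_k\neq\emptyset$. *)

theory Defs
  imports "HOL-Analysis.Analysis" "HOL-Probability.Essential_Supremum"
begin

type_synonym 'n rvec = "(real, 'n) vec"

section \<open>Coordinates and partial derivatives\<close>

text \<open>
  The index type \<open>'n\<close> is finite and linearly ordered, so that its elements can be numbered
  \<open>1, \<dots>, d\<close> with \<open>d = CARD('n)\<close>; \<open>crd x k\<close> is the usual coordinate \<open>x\<^sub>k\<close>.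
\<close>

definition crd :: "'n::{finite,linorder} rvec \<Rightarrow> nat \<Rightarrow> real" where
  "crd x k = x $ (sorted_list_of_set (UNIV :: 'n set) ! (k - 1))"

fun iter_partial :: "'n::finite list \<Rightarrow> ('n rvec \<Rightarrow> 'b::real_normed_vector) \<Rightarrow> 'n rvec \<Rightarrow> 'b"
  where
    "iter_partial [] f = f"
  | "iter_partial (i # is) f = (\<lambda>x. frechet_derivative (iter_partial is f) (at x) (axis i 1))"

text \<open>
  Infinite differentiability on an open set \<open>U\<close>: all iterated partial derivatives exist and are
  (totally) differentiable, hence continuous, at every point of \<open>U\<close>.
\<close>

definition smooth_on :: "('n::finite rvec) set \<Rightarrow> ('n rvec \<Rightarrow> 'b::real_normed_vector) \<Rightarrow> bool" where
  "smooth_on U f \<longleftrightarrow> (\<forall>is. \<forall>x\<in>U. iter_partial is f differentiable (at x))"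

definition mi_order :: "('n::finite \<Rightarrow> nat) \<Rightarrow> nat" where
  "mi_order \<alpha> = (\<Sum>i\<in>UNIV. \<alpha> i)"

definition mi_upto :: "nat \<Rightarrow> ('n::finite \<Rightarrow> nat) set" where
  "mi_upto m = {\<alpha>. mi_order \<alpha> \<le> m}"

lemma finite_mi_upto: "finite (mi_upto m :: ('n::finite \<Rightarrow> nat) set)"
proof (rule finite_subset)
  show "mi_upto m \<subseteq> (PiE UNIV (\<lambda>_. {..m}) :: ('n \<Rightarrow> nat) set)"
  proof
    fix \<alpha> :: "'n \<Rightarrow> nat" assume "\<alpha> \<in> mi_upto m"
    hence le: "sum \<alpha> UNIV \<le> m" by (simp add: mi_upto_def mi_order_def)
    have "\<alpha> i \<le> sum \<alpha> UNIV" for i by (rule member_le_sum) auto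
    with le have "\<alpha> i \<le> m" for i using order_trans by blast
    thus "\<alpha> \<in> PiE UNIV (\<lambda>_. {..m})" by auto
  qed
qed (simp add: finite_PiE)

definition mi_partial :: "('n::{finite,linorder} \<Rightarrow> nat) \<Rightarrow> ('n rvec \<Rightarrow> real) \<Rightarrow> 'n rvec \<Rightarrow> real" where
  "mi_partial \<alpha> = iter_partial (concat (map (\<lambda>i. replicate (\<alpha> i) i) (sorted_list_of_set UNIV)))"

section \<open>Weak derivatives and Kondratiev spaces\<close>

definition test_function :: "('n::finite rvec) set \<Rightarrow> ('n rvec \<Rightarrow> real) \<Rightarrow> bool" where
  "test_function \<Omega> \<phi> \<longleftrightarrow>
     smooth_on UNIV \<phi> \<and> compact (closure {x. \<phi> x \<noteq> 0}) \<and> closure {x. \<phi> x \<noteq> 0} \<subseteq> \<Omega>"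

definition locally_integrable :: "('n::finite rvec) set \<Rightarrow> ('n rvec \<Rightarrow> real) \<Rightarrow> bool" where
  "locally_integrable \<Omega> u \<longleftrightarrow> (\<forall>K. compact K \<and> K \<subseteq> \<Omega> \<longrightarrow> integrable (lebesgue_on K) u)"

definition has_weak_deriv ::
  "('n::{finite,linorder} rvec) set \<Rightarrow> ('n \<Rightarrow> nat) \<Rightarrow> ('n rvec \<Rightarrow> real) \<Rightarrow> ('n rvec \<Rightarrow> real) \<Rightarrow> bool" where
  "has_weak_deriv \<Omega> \<alpha> u v \<longleftrightarrow>
     locally_integrable \<Omega> u \<and> locally_integrable \<Omega> v \<and>
     (\<forall>\<phi>. test_function \<Omega> \<phi> \<longrightarrow>
        (LINT x|lebesgue_on \<Omega>. u x * mi_partial \<alpha> \<phi> x) =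
        (- 1) ^ mi_order \<alpha> * (LINT x|lebesgue_on \<Omega>. v x * \<phi> x))"

text \<open>Weak derivatives are unique up to null sets; the choice below is immaterial.\<close>

definition weak_deriv ::
  "('n::{finite,linorder} rvec) set \<Rightarrow> ('n \<Rightarrow> nat) \<Rightarrow> ('n rvec \<Rightarrow> real) \<Rightarrow> 'n rvec \<Rightarrow> real" where
  "weak_deriv \<Omega> \<alpha> u = (SOME v. has_weak_deriv \<Omega> \<alpha> u v)"

definition weakly_differentiable ::
  "nat \<Rightarrow> ('n::{finite,linorder} rvec) set \<Rightarrow> ('n rvec \<Rightarrow> real) \<Rightarrow> bool" where
  "weakly_differentiable m \<Omega> u \<longleftrightarrow>
     u \<in> borel_measurable (lebesgue_on \<Omega>) \<and> (\<forall>\<alpha>\<in>mi_upto m. \<exists>v. has_weak_deriv \<Omega> \<alpha> u v)"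

definition weight :: "('n::finite rvec) set \<Rightarrow> 'n rvec \<Rightarrow> real" where
  "weight M x = min 1 (infdist x M)"

definition weighted_deriv ::
  "('n::{finite,linorder} rvec) set \<Rightarrow> ('n rvec) set \<Rightarrow> real \<Rightarrow> ('n \<Rightarrow> nat) \<Rightarrow>
   ('n rvec \<Rightarrow> real) \<Rightarrow> 'n rvec \<Rightarrow> real" where
  "weighted_deriv \<Omega> M a \<alpha> u x = weight M x powr (real (mi_order \<alpha>) - a) * weak_deriv \<Omega> \<alpha> u x"

definition kondratiev_energy ::
  "('n::{finite,linorder} rvec) set \<Rightarrow> ('n rvec) set \<Rightarrow> nat \<Rightarrow> real \<Rightarrow> real \<Rightarrow> ('n rvec \<Rightarrow> real) \<Rightarrow> ennreal" where
  "kondratiev_energy \<Omega> M m a p u =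
     (\<Sum>\<alpha>\<in>mi_upto m. \<integral>\<^sup>+x. ennreal (\<bar>weighted_deriv \<Omega> M a \<alpha> u x\<bar> powr p) \<partial>lebesgue_on \<Omega>)"

definition kondratiev_space ::
  "('n::{finite,linorder} rvec) set \<Rightarrow> ('n rvec) set \<Rightarrow> nat \<Rightarrow> real \<Rightarrow> real \<Rightarrow> ('n rvec \<Rightarrow> real) set" where
  "kondratiev_space \<Omega> M m a p = {u. weakly_differentiable m \<Omega> u \<and> kondratiev_energy \<Omega> M m a p u < \<infinity>}"

definition kondratiev_norm ::
  "('n::{finite,linorder} rvec) set \<Rightarrow> ('n rvec) set \<Rightarrow> nat \<Rightarrow> real \<Rightarrow> real \<Rightarrow> ('n rvec \<Rightarrow> real) \<Rightarrow> real" where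
  "kondratiev_norm \<Omega> M m a p u = enn2real (kondratiev_energy \<Omega> M m a p u) powr (1 / p)"

definition kondratiev_sup ::
  "('n::{finite,linorder} rvec) set \<Rightarrow> ('n rvec) set \<Rightarrow> nat \<Rightarrow> real \<Rightarrow> ('n rvec \<Rightarrow> real) \<Rightarrow> ennreal" where
  "kondratiev_sup \<Omega> M m a u =
     (\<Sum>\<alpha>\<in>mi_upto m. esssup (lebesgue_on \<Omega>) (\<lambda>x. ennreal \<bar>weighted_deriv \<Omega> M a \<alpha> u x\<bar>))"

definition kondratiev_space_inf ::
  "('n::{finite,linorder} rvec) set \<Rightarrow> ('n rvec) set \<Rightarrow> nat \<Rightarrow> real \<Rightarrow> ('n rvec \<Rightarrow> real) set" where
  "kondratiev_space_inf \<Omega> M m a = {u. weakly_differentiable m \<Omega> u \<and> kondratiev_sup \<Omega> M m a u < \<infinity>}"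

definition kondratiev_norm_inf ::
  "('n::{finite,linorder} rvec) set \<Rightarrow> ('n rvec) set \<Rightarrow> nat \<Rightarrow> real \<Rightarrow> ('n rvec \<Rightarrow> real) \<Rightarrow> real" where
  "kondratiev_norm_inf \<Omega> M m a u = enn2real (kondratiev_sup \<Omega> M m a u)"

definition continuously_embedded ::
  "'f set \<Rightarrow> ('f \<Rightarrow> real) \<Rightarrow> 'f set \<Rightarrow> ('f \<Rightarrow> real) \<Rightarrow> bool" where
  "continuously_embedded X normX Y normY \<longleftrightarrow> X \<subseteq> Y \<and> (\<exists>C. \<forall>u\<in>X. normY u \<le> C * normX u)"

section \<open>Diffeomorphisms and smooth hypersurfaces\<close>

definition diffeo_open :: "('n::finite rvec) set \<Rightarrow> ('n rvec \<Rightarrow> 'n rvec) \<Rightarrow> bool" where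
  "diffeo_open W \<eta> \<longleftrightarrow>
     open W \<and> open (\<eta> ` W) \<and> inj_on \<eta> W \<and> smooth_on W \<eta> \<and> smooth_on (\<eta> ` W) (inv_into W \<eta>)"

text \<open>On a set that is not open, smoothness of a map and of its inverse means, as usual, that
  they extend to a diffeomorphism between open neighbourhoods.\<close>

definition diffeo_on :: "('n::finite rvec) set \<Rightarrow> ('n rvec \<Rightarrow> 'n rvec) \<Rightarrow> bool" where
  "diffeo_on A \<eta> \<longleftrightarrow> (\<exists>W. A \<subseteq> W \<and> diffeo_open W \<eta>)"

definition smooth_hypersurface :: "('n::{finite,linorder} rvec) set \<Rightarrow> bool" where
  "smooth_hypersurface A \<longleftrightarrow>
     (\<forall>x\<in>A. \<exists>W \<eta>. x \<in> W \<and> diffeo_open W \<eta> \<and> \<eta> ` (W \<inter> A) = \<eta> ` W \<inter> {y. crd y CARD('n) = 0})"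

section \<open>Standard pairs\<close>

definition bounded_domain :: "('n::finite rvec) set \<Rightarrow> bool" where
  "bounded_domain D \<longleftrightarrow> open D \<and> bounded D"

definition infinite_cone :: "('n::finite rvec) set \<Rightarrow> ('n rvec) set" where
  "infinite_cone \<omega> = {x. x \<noteq> 0 \<and> x /\<^sub>R norm x \<in> \<omega>}"

text \<open>
  The angle \<open>\<gamma> \<in> (0, \<pi>)\<close> is measured between the axis and the generating lines, so nonconvex
  cones are included. A full aperture \<open>\<gamma>'\<close> below \<open>\<pi>\<close> corresponds to \<open>\<gamma> = \<gamma>' / 2\<close>.
\<close>

definition round_cone :: "real \<Rightarrow> ('n::{finite,linorder} rvec) set" where
  "round_cone \<gamma> = infinite_cone {\<xi> \<in> sphere 0 1. crd \<xi> CARD('n) > cos \<gamma>}"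

definition unit_cube :: "('n::finite rvec) set" where
  "unit_cube = {x. \<forall>i. 0 < x $ i \<and> x $ i < 1}"

text \<open>
  \<open>spherical_angle_at \<omega> \<xi> \<theta>\<close>: in a suitable smooth chart of the unit sphere of \<open>\<real>\<^sup>3\<close> around \<open>\<xi>\<close>
  (the restriction of a local diffeomorphism of \<open>\<real>\<^sup>3\<close> that flattens the sphere), \<open>\<omega>\<close> is a
  plane sector of angle \<open>\<theta>\<close> with vertex \<open>\<xi>\<close>. For \<open>\<theta> = \<pi>\<close> this says that \<open>\<omega>\<close> has a smooth
  boundary near \<open>\<xi>\<close>.
\<close>

definition spherical_angle_at ::
  "('n::{finite,linorder} rvec) set \<Rightarrow> 'n rvec \<Rightarrow> real \<Rightarrow> bool" where
  "spherical_angle_at \<omega> \<xi> \<theta> \<longleftrightarrow>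
     (\<exists>W \<eta>. \<xi> \<in> W \<and> diffeo_open W \<eta> \<and> \<eta> \<xi> = 0 \<and>
        \<eta> ` (W \<inter> sphere 0 1) = \<eta> ` W \<inter> {y. crd y 3 = 0} \<and>
        \<eta> ` (W \<inter> \<omega>) = \<eta> ` W \<inter>
          {y. crd y 3 = 0 \<and>
              (\<exists>r>0. \<exists>\<phi>. 0 < \<phi> \<and> \<phi> < \<theta> \<and> crd y 1 = r * cos \<phi> \<and> crd y 2 = r * sin \<phi>)})"

text \<open>
  Infinite polyhedral cones \<open>K'\<close> in the half space \<open>x\<^sub>3 > 0\<close> with edges \<open>E 1, \<dots>, E n\<close>, taken as
  closed half lines. The faces are the connected components of what remains of the boundary.
  The last two conditions say that \<open>K' \<inter> S\<^sup>2\<close> is of polygonal type: smooth along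
  its sides, with an angle in \<open>(0, 2\<pi>)\<close> (neither a cusp nor a crack) at each corner.
\<close>

definition polyhedral_cone ::
  "nat \<Rightarrow> (nat \<Rightarrow> ('n::{finite,linorder} rvec) set) \<Rightarrow> ('n rvec) set \<Rightarrow> bool" where
  "polyhedral_cone n E K' \<longleftrightarrow>
     CARD('n) = 3 \<and> n \<ge> 1 \<and>
     (\<exists>\<omega>. openin (top_of_set (sphere 0 1)) \<omega> \<and> K' = infinite_cone \<omega>) \<and>
     K' \<subseteq> {x. crd x 3 > 0} \<and>
     (\<exists>v \<Gamma>. inj_on v {1..n} \<and>
        (\<forall>k\<in>{1..n}. norm (v k) = 1 \<and> E k = {t *\<^sub>R v k |t. t \<ge> 0}) \<and>
        bij_betw \<Gamma> {1..n} (components (frontier K' - (\<Union>k\<in>{1..n}. E k))) \<and>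
        frontier K' = {0} \<union> (\<Union>k\<in>{1..n}. E k) \<union> (\<Union>k\<in>{1..n}. \<Gamma> k) \<and>
        (\<forall>k\<in>{1..n}. \<forall>\<xi> \<in> \<Gamma> k \<inter> sphere 0 1. spherical_angle_at (K' \<inter> sphere 0 1) \<xi> pi) \<and>
        (\<forall>k\<in>{1..n}. \<exists>\<theta>. 0 < \<theta> \<and> \<theta> < 2 * pi \<and> spherical_angle_at (K' \<inter> sphere 0 1) (v k) \<theta>))"

text \<open>
  In the polyhedral case boundedness of \<open>Q\<close> must be required: it fails if \<open>K'\<close> touches the plane
  \<open>x\<^sub>3 = 0\<close> away from the origin, and then \<open>Q\<close> is not a domain.
\<close>

inductive standard_pair :: "('n::{finite,linorder} rvec) set \<Rightarrow> ('n rvec) set \<Rightarrow> bool" where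
  smooth_cone:
    "0 < \<gamma> \<Longrightarrow> \<gamma> < pi \<Longrightarrow> standard_pair (round_cone \<gamma> \<inter> ball 0 1) {0}"
| nonsmooth_cone:
    "0 < \<gamma> \<Longrightarrow> \<gamma> < pi \<Longrightarrow>
     standard_pair (round_cone \<gamma> \<inter> unit_cube)
       {x. (\<forall>k\<in>{1..<CARD('n)}. crd x k = 0) \<and> 0 \<le> crd x CARD('n) \<and> crd x CARD('n) \<le> 1}"
| dihedral:
    "1 \<le> l \<Longrightarrow> l < CARD('n) \<Longrightarrow>
     standard_pair unit_cube {x \<in> frontier unit_cube. \<forall>k\<in>{1..CARD('n) - l}. crd x k = 0}"
| polyhedral:
    "polyhedral_cone n E K' \<Longrightarrow> Q = K' \<inter> {x. 0 < crd x 3 \<and> crd x 3 < 1} \<Longrightarrow> bounded Q \<Longrightarrow>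
     standard_pair Q ((\<Union>k\<in>{1..n}. E k) \<inter> closure Q)"

section \<open>Domains of (generalized) polyhedral type\<close>

definition singularity_set :: "('n::{finite,linorder} rvec) set \<Rightarrow> ('n rvec) set" where
  "singularity_set D = {x \<in> frontier D. \<forall>\<epsilon>>0. \<not> smooth_hypersurface (frontier D \<inter> ball x \<epsilon>)}"

definition equivalent_on :: "'a set \<Rightarrow> ('a \<Rightarrow> real) \<Rightarrow> ('a \<Rightarrow> real) \<Rightarrow> bool" where
  "equivalent_on A f g \<longleftrightarrow> (\<exists>c>0. \<exists>C>0. \<forall>x\<in>A. c * f x \<le> g x \<and> g x \<le> C * f x)"

text \<open>
  The local models at singular points are exactly the standard pairs, those of polyhedral cones
  occurring only in dimension three.
\<close>

definition polyhedral_type :: "('n::{finite,linorder} rvec) set \<Rightarrow> bool" where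
  "polyhedral_type D \<longleftrightarrow> bounded_domain D \<and>
     (\<exists>\<U>. finite \<U> \<and> closure D \<subseteq> \<Union>\<U> \<and>
        (\<forall>U\<in>\<U>. open U \<and> bounded U \<and>
           ((\<exists>c r. U = ball c r \<and> closure U \<inter> singularity_set D = {}) \<or>
            (\<exists>\<eta> \<Omega>\<^sub>0 M\<^sub>0. standard_pair \<Omega>\<^sub>0 M\<^sub>0 \<and> diffeo_on (closure U) \<eta> \<and> \<eta> ` (U \<inter> D) = \<Omega>\<^sub>0 \<and>
               equivalent_on (U \<inter> D) (\<lambda>x. infdist x (singularity_set D))
                 (\<lambda>x. infdist x {y \<in> closure U. \<eta> y \<in> M\<^sub>0})))))"

definition diffeomorphic_to_standard_pair ::
  "('n::{finite,linorder} rvec) set \<Rightarrow> ('n rvec) set \<Rightarrow> bool" where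
  "diffeomorphic_to_standard_pair D M \<longleftrightarrow>
     (\<exists>\<Omega>\<^sub>0 M\<^sub>0 \<eta>. standard_pair \<Omega>\<^sub>0 M\<^sub>0 \<and> diffeo_on (closure \<Omega>\<^sub>0) \<eta> \<and> D = \<eta> ` \<Omega>\<^sub>0 \<and> M = \<eta> ` M\<^sub>0)"

definition generalized_polyhedral_type ::
  "('n::{finite,linorder} rvec) set \<Rightarrow> ('n rvec) set \<Rightarrow> bool" where
  "generalized_polyhedral_type D M \<longleftrightarrow>
     bounded_domain D \<and> closed M \<and> M \<noteq> {} \<and> M \<subseteq> frontier D \<and>
     (standard_pair D M \<or>
      polyhedral_type D \<and> M = singularity_set D \<or>
      (\<exists>(N::nat) D'. D = (\<Union>j\<in>{1..N}. D' j) \<and>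
         (\<forall>j\<in>{1..N}. open (D' j) \<and> diffeomorphic_to_standard_pair (D' j) (M \<inter> closure (D' j))) \<and>
         (\<forall>x\<in>D. card {j \<in> {1..N}. x \<in> D' j} \<le> 2) \<and>
         (\<forall>j\<in>{1..N}. \<exists>k\<in>{1..N}. k \<noteq> j \<and> D' j \<inter> D' k \<noteq> {})))"

end

theory Submission
  imports Defs "HOL-Real_Asymp.Real_Asymp"
begin

text \<open>
  Everything is reduced to a uniform cone condition: from each \<open>x \<in> D\<close> a cone of fixed size and
  opening, with a direction depending on \<open>x\<close>, is contained in \<open>D\<close>. It is local, invariant under
  diffeomorphisms and inherited by finite unions, so it holds for all pairs of generalized polyhedral
  type, and no extension operators enter.

  Sufficiency. For \<open>x \<in> D\<close> take a cone with vertex \<open>x\<close> and height comparable to \<open>\<rho>(x)\<close>, so that \<open>\<rho>\<close> is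
  essentially constant on it. A Taylor formula along the lines \<open>t \<mapsto> x + t w\<close>, averaged over the directions
  \<open>w\<close> of the cone, bounds \<open>\<rho>(x)\<^bsup>\<bar>\<beta>\<bar> - a + d/p\<^esup> \<bar>\<partial>\<^sup>\<beta>u(x)\<bar>\<close> by the Kondratiev norm. Mollification is avoided
  by pairing \<open>u\<close> with translates of a test function: the pairings \<open>\<Psi>\<^sub>j(t)\<close> of the weak derivatives of order
  \<open>j\<close> satisfy \<open>\<Psi>\<^sub>j' = \<Psi>\<^sub>j\<^sub>+\<^sub>1\<close>.

  Necessity. The condition on \<open>a\<close> is tested with bumps in balls of radius comparable to their distance to
  \<open>M\<close>, which the cone condition provides near any point of \<open>M\<close>; the condition on \<open>m\<close> with dyadic rescalings
  of a bump around an interior point, and with sums of those in the limiting case.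
\<close>

section \<open>Smooth functions\<close>

text \<open>The exponents come from the remainder term. It integrates \<open>t ^ (k - 1)\<close>
  against averages of derivatives over balls of radius proportional to t, and an L_p bound makes
  such an average of size \<open>t powr - (d / p)\<close>; the product is integrable at 0 exactly
  when k > d/p. For p = 1 and k = d this fails by a logarithm, and exchanging the integrations over
  t and over space rescues the bound, provided that the axis of the cone is long compared with its
  opening. The shaping obstacle is that statements about weak derivatives hold only almost
  everywhere, while the direction of the cone varies with x. Directions are therefore moved into a
  countable set. For one direction and one dyadic shell of the weight the admissible vertices form
  an open set; testing with functions supported there gives an almost everywhere bound, and only
  countably many null sets arise. On a shell of size r the cone has height c r, and an additional
  derivative costs one power of r in the weight but gains one from the height, so that all orders
  scale alike. The surplus k is m - m' for p > 1 and d for p = 1.\<close>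

definition partial :: "'n::finite \<Rightarrow> ('n rvec \<Rightarrow> 'b::real_normed_vector) \<Rightarrow> 'n rvec \<Rightarrow> 'b" where
  "partial i f x = frechet_derivative f (at x) (axis i 1)"

lemma iter_partial_Cons: "iter_partial (i # js) f = partial i (iter_partial js f)"
  by (simp add: partial_def fun_eq_iff)

declare iter_partial.simps(2) [simp del]

lemma iter_partial_append: "iter_partial (xs @ ys) f = iter_partial xs (iter_partial ys f)"
  by (induction xs) (simp_all add: iter_partial_Cons)

lemma iter_partial_snoc: "iter_partial (xs @ [i]) f = iter_partial xs (partial i f)"
  by (simp add: iter_partial_append iter_partial_Cons)

lemma partial_eqI: "(f has_derivative f') (at x) \<Longrightarrow> partial i f x = f' (axis i 1)"
  by (simp add: partial_def frechet_derivative_at[symmetric])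

lemma smooth_onD: "smooth_on U f \<Longrightarrow> x \<in> U \<Longrightarrow> f differentiable (at x)"
  unfolding smooth_on_def by (metis iter_partial.simps(1))

lemma smooth_on_iter_partial: "smooth_on U f \<Longrightarrow> smooth_on U (iter_partial xs f)"
  unfolding smooth_on_def by (metis iter_partial_append)

lemma smooth_on_partial: "smooth_on U f \<Longrightarrow> smooth_on U (partial i f)"
  using smooth_on_iter_partial[of U f "[i]"] by (simp add: iter_partial_Cons)

text \<open>Smoothness quantifies over all words of partial derivatives. A class stable under
  \<open>partial\<close> contains every iterate of its members, so a single differentiation rule per
  class suffices.\<close>

lemma smooth_coinduct:
  assumes "f \<in> S"
    and "\<And>g x. g \<in> S \<Longrightarrow> g differentiable (at x)"
    and "\<And>g i. g \<in> S \<Longrightarrow> partial i g \<in> S"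
  shows "smooth_on UNIV f"
proof -
  have "iter_partial xs f \<in> S" for xs
    by (induction xs) (auto simp: iter_partial_Cons assms)
  then show ?thesis
    unfolding smooth_on_def using assms(2) by blast
qed

lemma has_derivative_partial_sum:
  fixes f :: "'n::finite rvec \<Rightarrow> 'b::real_normed_vector"
  assumes "f differentiable (at x)"
  shows "(f has_derivative (\<lambda>v. \<Sum>i\<in>UNIV. (v $ i) *\<^sub>R partial i f x)) (at x)"
proof -
  have D: "(f has_derivative frechet_derivative f (at x)) (at x)"
    using assms frechet_derivative_works by blast
  then have lin: "linear (frechet_derivative f (at x))"
    by (rule has_derivative_linear)
  have "frechet_derivative f (at x) v = (\<Sum>i\<in>UNIV. (v $ i) *\<^sub>R partial i f x)" for v
  proof -
    have "v = (\<Sum>i\<in>UNIV. (v $ i) *\<^sub>R axis i 1)"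
      by (simp add: vec_eq_iff axis_def if_distrib cong: if_cong)
    then have "frechet_derivative f (at x) v
        = frechet_derivative f (at x) (\<Sum>i\<in>UNIV. (v $ i) *\<^sub>R axis i 1)" by simp
    also have "\<dots> = (\<Sum>i\<in>UNIV. (v $ i) *\<^sub>R partial i f x)"
      by (simp add: linear_sum[OF lin] linear_scale[OF lin] partial_def)
    finally show ?thesis .
  qed
  with D show ?thesis by (metis (no_types, lifting) ext)
qed

lemma smooth_has_derivative:
  fixes f :: "'n::finite rvec \<Rightarrow> 'b::real_normed_vector"
  assumes "smooth_on UNIV f"
  shows "(f has_derivative (\<lambda>v. \<Sum>i\<in>UNIV. (v $ i) *\<^sub>R partial i f x)) (at x)"
  using has_derivative_partial_sum smooth_onD[OF assms] by blast

lemma smooth_has_derivative_line: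
  fixes f :: "'n::finite rvec \<Rightarrow> real"
  assumes "smooth_on UNIV f"
  shows "((\<lambda>t. f (x + t *\<^sub>R w)) has_real_derivative (\<Sum>i\<in>UNIV. (w $ i) * partial i f (x + t *\<^sub>R w))) (at t)"
proof -
  have "((\<lambda>t. x + t *\<^sub>R w) has_derivative (\<lambda>s. s *\<^sub>R w)) (at t)"
    by (auto intro!: derivative_eq_intros)
  from has_derivative_compose[OF this smooth_has_derivative[OF assms]]
  have "((\<lambda>t. f (x + t *\<^sub>R w)) has_derivative (\<lambda>s. \<Sum>i\<in>UNIV. ((s *\<^sub>R w) $ i) *\<^sub>R partial i f (x + t *\<^sub>R w))) (at t)" .
  moreover have "(\<lambda>s. \<Sum>i\<in>UNIV. ((s *\<^sub>R w) $ i) *\<^sub>R partial i f (x + t *\<^sub>R w))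
      = (*) (\<Sum>i\<in>UNIV. (w $ i) * partial i f (x + t *\<^sub>R w))"
    by (simp add: fun_eq_iff sum_distrib_left sum_distrib_right mult_ac)
  ultimately show ?thesis
    by (simp add: has_field_derivative_def)
qed

lemma smooth_has_derivative_axis:
  fixes f :: "'n::finite rvec \<Rightarrow> real"
  assumes "smooth_on UNIV f"
  shows "((\<lambda>t. f (x + t *\<^sub>R axis i 1)) has_real_derivative partial i f (x + t *\<^sub>R axis i 1)) (at t)"
proof -
  have "(\<Sum>j\<in>UNIV. (axis i (1::real) $ j) * partial j f y) = partial i f y" for y
    by (simp add: axis_def if_distrib if_distribR cong: if_cong)
  then show ?thesis using smooth_has_derivative_line[OF assms, of x "axis i 1" t] by simp
qed

lemma smooth_continuous_on:
  fixes f :: "'n::finite rvec \<Rightarrow> 'b::real_normed_vector"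
  shows "smooth_on UNIV f \<Longrightarrow> continuous_on A f"
  by (meson UNIV_I continuous_at_imp_continuous_on differentiable_imp_continuous_within smooth_onD)

lemma smooth_isCont:
  fixes f :: "'n::finite rvec \<Rightarrow> 'b::real_normed_vector"
  shows "smooth_on UNIV f \<Longrightarrow> isCont f x"
  by (meson UNIV_I differentiable_imp_continuous_within smooth_onD)

lemma smooth_borel_measurable [measurable (raw)]:
  fixes f :: "'n::finite rvec \<Rightarrow> real"
  shows "smooth_on UNIV f \<Longrightarrow> f \<in> borel_measurable borel"
  by (intro borel_measurable_continuous_onI smooth_continuous_on)

text \<open>Schwarz's theorem. Both mixed derivatives are limits of one second difference quotient,
  which is symmetric in the two directions; the mean value theorem, used once per direction, writes
  it as a mixed derivative at a nearby point, and continuity does the rest.\<close>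

lemma partial_commute:
  fixes f :: "'n::finite rvec \<Rightarrow> real"
  assumes f: "smooth_on UNIV f"
  shows "partial i (partial j f) x = partial j (partial i f) x"
proof -
  have fi: "smooth_on UNIV (partial k f)" for k by (rule smooth_on_partial[OF f])
  have second_diff: "\<exists>s1 s2. 0 < s1 \<and> s1 < h \<and> 0 < s2 \<and> s2 < h \<and>
      f (x + h *\<^sub>R axis k 1 + h *\<^sub>R axis l 1) - f (x + h *\<^sub>R axis k 1) - f (x + h *\<^sub>R axis l 1) + f x
        = h * h * partial l (partial k f) (x + s1 *\<^sub>R axis k 1 + s2 *\<^sub>R axis l 1)"
    if h: "h > 0" for h and k l :: 'n
  proof -
    \<comment> \<open>The difference in direction \<open>l\<close> as a function of the step in
      direction \<open>k\<close>; its increment from 0 to \<open>h\<close> is the second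
      difference.\<close>
    define G where "G s = f (x + h *\<^sub>R axis l 1 + s *\<^sub>R axis k 1) - f (x + s *\<^sub>R axis k 1)" for s
    have dG: "(G has_real_derivative (partial k f (x + h *\<^sub>R axis l 1 + s *\<^sub>R axis k 1)
        - partial k f (x + s *\<^sub>R axis k 1))) (at s)" for s
      unfolding G_def by (intro DERIV_diff smooth_has_derivative_axis f)
    obtain s1 where s1: "0 < s1" "s1 < h"
      "G h - G 0 = (h - 0) * (partial k f (x + h *\<^sub>R axis l 1 + s1 *\<^sub>R axis k 1) - partial k f (x + s1 *\<^sub>R axis k 1))"
      using MVT2[OF h, of G, OF dG] by blast
    obtain s2 where s2: "0 < s2" "s2 < h"
      "partial k f (x + s1 *\<^sub>R axis k 1 + h *\<^sub>R axis l 1) - partial k f (x + s1 *\<^sub>R axis k 1 + 0 *\<^sub>R axis l 1)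
        = (h - 0) * partial l (partial k f) (x + s1 *\<^sub>R axis k 1 + s2 *\<^sub>R axis l 1)"
      using MVT2[OF h, of "\<lambda>t. partial k f (x + s1 *\<^sub>R axis k 1 + t *\<^sub>R axis l 1)",
        OF smooth_has_derivative_axis[OF fi]] by blast
    have "G h - G 0 = h * h * partial l (partial k f) (x + s1 *\<^sub>R axis k 1 + s2 *\<^sub>R axis l 1)"
      using s1(3) s2(3) by (simp add: add_ac)
    then show ?thesis using s1 s2 unfolding G_def
      by (intro exI[of _ s1] exI[of _ s2]) (simp add: add_ac algebra_simps)
  qed
  have lim: "(\<lambda>n. (f (x + h n *\<^sub>R axis k 1 + h n *\<^sub>R axis l 1) - f (x + h n *\<^sub>R axis k 1)
        - f (x + h n *\<^sub>R axis l 1) + f x) / (h n * h n)) \<longlonglongrightarrow> partial l (partial k f) x"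
    if h: "\<And>n. h n > 0" "h \<longlonglongrightarrow> 0" for h :: "nat \<Rightarrow> real" and k l
  proof -
    obtain s1 s2 where s: "\<And>n. 0 < s1 n \<and> s1 n < h n \<and> 0 < s2 n \<and> s2 n < h n \<and>
        f (x + h n *\<^sub>R axis k 1 + h n *\<^sub>R axis l 1) - f (x + h n *\<^sub>R axis k 1) - f (x + h n *\<^sub>R axis l 1) + f x
        = h n * h n * partial l (partial k f) (x + s1 n *\<^sub>R axis k 1 + s2 n *\<^sub>R axis l 1)"
      using second_diff[OF h(1), where k=k and l=l] by metis
    have s0: "s1 \<longlonglongrightarrow> 0" "s2 \<longlonglongrightarrow> 0"
      by (rule tendsto_sandwich[OF _ _ tendsto_const h(2)]; use s in \<open>auto intro!: always_eventually less_imp_le\<close>)+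
    have "(\<lambda>n. x + s1 n *\<^sub>R axis k 1 + s2 n *\<^sub>R axis l 1) \<longlonglongrightarrow> x + 0 *\<^sub>R axis k 1 + 0 *\<^sub>R axis l 1"
      by (intro tendsto_intros s0)
    then have "(\<lambda>n. partial l (partial k f) (x + s1 n *\<^sub>R axis k 1 + s2 n *\<^sub>R axis l 1)) \<longlonglongrightarrow> partial l (partial k f) x"
      using isCont_tendsto_compose[OF smooth_isCont[OF smooth_on_partial[OF fi]]] by fastforce
    then show ?thesis
      using s h(1) by (simp add: less_imp_neq[symmetric])
  qed
  have h: "inverse (real (Suc n)) > 0" for n by simp
  show ?thesis
    using LIMSEQ_unique[OF lim[OF h LIMSEQ_inverse_real_of_nat, of j i]]
        lim[OF h LIMSEQ_inverse_real_of_nat, of i j]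
    by (simp add: algebra_simps)
qed

lemma iter_partial_partial:
  fixes f :: "'n::finite rvec \<Rightarrow> real"
  assumes "smooth_on UNIV f"
  shows "iter_partial xs (partial i f) = partial i (iter_partial xs f)"
proof (induction xs)
  case (Cons a xs)
  then show ?case
    using partial_commute[OF smooth_on_iter_partial[OF assms]]
    by (simp add: iter_partial_Cons ext)
qed simp

lemma iter_partial_append_commute:
  fixes f :: "'n::finite rvec \<Rightarrow> real"
  assumes "smooth_on UNIV f"
  shows "iter_partial (xs @ ys) f = iter_partial (ys @ xs) f"
proof (induction xs)
  case (Cons a xs)
  have "iter_partial (ys @ a # xs) f = iter_partial ys (partial a (iter_partial xs f))"
    by (simp add: iter_partial_append iter_partial_Cons)
  also have "\<dots> = partial a (iter_partial ys (iter_partial xs f))"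
    by (rule iter_partial_partial[OF smooth_on_iter_partial[OF assms]])
  finally show ?case using Cons by (simp add: iter_partial_Cons iter_partial_append)
qed simp

text \<open>\<open>mi_partial\<close> lists its letters in sorted order; this permits words that are
  built letter by letter instead. The first letter of one word is brought to the front of the other
  by a cyclic rotation.\<close>

lemma iter_partial_mset_cong:
  fixes f :: "'n::finite rvec \<Rightarrow> real"
  assumes "smooth_on UNIV f" "mset xs = mset ys"
  shows "iter_partial xs f = iter_partial ys f"
  using assms(2)
proof (induction xs arbitrary: ys)
  case (Cons a xs)
  have "a \<in> set ys" using Cons.prems by (metis list.set_intros(1) set_mset_mset)
  then obtain us vs where ys: "ys = us @ a # vs" by (meson split_list)
  have "mset xs = mset (vs @ us)" using Cons.prems ys by simp
  then have "iter_partial xs f = iter_partial (vs @ us) f" by (rule Cons.IH)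
  then have "iter_partial (a # xs) f = iter_partial ((a # vs) @ us) f" by (simp add: iter_partial_Cons)
  also have "\<dots> = iter_partial ys f"
    unfolding ys by (rule iter_partial_append_commute[OF assms(1)])
  finally show ?case .
qed simp

section \<open>Smooth functions: algebra, composition and affine substitution\<close>

lemma partial_add:
  fixes f g :: "'n::finite rvec \<Rightarrow> 'b::real_normed_vector"
  assumes "f differentiable (at x)" "g differentiable (at x)"
  shows "partial i (\<lambda>x. f x + g x) x = partial i f x + partial i g x"
  using assms unfolding partial_def frechet_derivative_works
  by (subst frechet_derivative_at[symmetric, OF has_derivative_add]) (auto simp: partial_def)

lemma partial_mult:
  fixes f g :: "'n::finite rvec \<Rightarrow> real"
  assumes "f differentiable (at x)" "g differentiable (at x)"
  shows "partial i (\<lambda>x. f x * g x) x = f x * partial i g x + partial i f x * g x"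
  using assms unfolding partial_def frechet_derivative_works
  by (subst frechet_derivative_at[symmetric, OF has_derivative_mult]) (auto simp: partial_def)

lemma partial_comp_real:
  fixes g :: "'n::finite rvec \<Rightarrow> real"
  assumes F: "(F has_real_derivative F') (at (g x))" and g: "g differentiable (at x)"
  shows "((\<lambda>x. F (g x)) has_derivative (\<lambda>v. F' * frechet_derivative g (at x) v)) (at x)"
    and "partial i (\<lambda>x. F (g x)) x = F' * partial i g x"
proof -
  show "((\<lambda>x. F (g x)) has_derivative (\<lambda>v. F' * frechet_derivative g (at x) v)) (at x)"
    using has_derivative_compose[OF g[unfolded frechet_derivative_works] F[unfolded has_field_derivative_def]]
    by simp
  from partial_eqI[OF this] show "partial i (\<lambda>x. F (g x)) x = F' * partial i g x"
    by (simp add: partial_def)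
qed

text \<open>Closing the smooth functions under the algebra operations and composition with the members of a
  family closed under differentiation gives a class that is closed under partial derivatives.\<close>

inductive_set smooth_closure :: "('n::finite rvec \<Rightarrow> real) set" where
  base: "smooth_on UNIV f \<Longrightarrow> f \<in> smooth_closure"
| add: "f \<in> smooth_closure \<Longrightarrow> g \<in> smooth_closure \<Longrightarrow> (\<lambda>x. f x + g x) \<in> smooth_closure"
| mult: "f \<in> smooth_closure \<Longrightarrow> g \<in> smooth_closure \<Longrightarrow> (\<lambda>x. f x * g x) \<in> smooth_closure"
| comp: "(\<And>n t. (F n has_real_derivative F (Suc n) t) (at t)) \<Longrightarrow> g \<in> smooth_closure \<Longrightarrow>
    (\<lambda>x. F (k::nat) (g x)) \<in> smooth_closure"

lemma smooth_closure_partial: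
  assumes "f \<in> smooth_closure"
  shows "(\<forall>x. f differentiable (at x)) \<and> partial i f \<in> smooth_closure"
  using assms
proof induction
  case (base f)
  then show ?case by (auto intro: smooth_closure.base smooth_on_partial smooth_onD)
next
  case (add f g)
  then have "partial i (\<lambda>x. f x + g x) = (\<lambda>x. partial i f x + partial i g x)"
    by (intro ext partial_add) auto
  with add show ?case by (auto intro: smooth_closure.add)
next
  case (mult f g)
  then have "partial i (\<lambda>x. f x * g x) = (\<lambda>x. f x * partial i g x + partial i f x * g x)"
    by (intro ext partial_mult) auto
  with mult show ?case by (auto intro!: smooth_closure.add smooth_closure.mult)
next
  case (comp F g k)
  then have "partial i (\<lambda>x. F k (g x)) = (\<lambda>x. F (Suc k) (g x) * partial i g x)"
    by (intro ext partial_comp_real(2)) auto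
  moreover have "(\<lambda>x. F k (g x)) differentiable (at x)" for x
    using partial_comp_real(1)[OF comp(1)] comp.IH unfolding differentiable_def by blast
  moreover have "(\<lambda>x. F (Suc k) (g x) * partial i g x) \<in> smooth_closure"
    using comp.IH by (intro smooth_closure.mult smooth_closure.comp[of F, OF comp.hyps(1,2)]) blast
  ultimately show ?case by simp
qed

lemma smooth_closure_smooth: "f \<in> smooth_closure \<Longrightarrow> smooth_on UNIV f"
  by (rule smooth_coinduct[of _ smooth_closure]) (auto dest: smooth_closure_partial)

lemma smooth_on_const: "smooth_on UNIV (\<lambda>x::'n::finite rvec. c :: 'b::real_normed_vector)"
proof (rule smooth_coinduct[of _ "range (\<lambda>c x. c)"])
  fix g :: "'n rvec \<Rightarrow> 'b" and x i assume "g \<in> range (\<lambda>c x. c)"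
  then obtain c where g: "g = (\<lambda>x. c)" by blast
  show "g differentiable (at x)" by (simp add: g)
  have "partial i g = (\<lambda>x. 0)" by (simp add: g partial_def fun_eq_iff)
  then show "partial i g \<in> range (\<lambda>c x. c)" by blast
qed blast

lemma smooth_on_coord: "smooth_on UNIV (\<lambda>x::'n::finite rvec. x $ i :: real)"
proof (rule smooth_coinduct[of _ "insert (\<lambda>x. x $ i) (range (\<lambda>c x. c))"])
  have D: "((\<lambda>x::'n rvec. x $ i) has_derivative (\<lambda>v. v $ i)) (at x)" for x
    by (intro bounded_linear_imp_has_derivative bounded_linear_vec_nth)
  fix g :: "'n rvec \<Rightarrow> real" and x j assume g: "g \<in> insert (\<lambda>x. x $ i) (range (\<lambda>c x. c))"
  show "g differentiable (at x)"
  proof (cases "g = (\<lambda>x. x $ i)")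
    case True
    then show ?thesis using D unfolding differentiable_def by blast
  next
    case False
    then obtain c where "g = (\<lambda>x. c)" using g by blast
    then show ?thesis by simp
  qed
  show "partial j g \<in> insert (\<lambda>x. x $ i) (range (\<lambda>c x. c))"
  proof -
    have "partial j g \<in> range (\<lambda>c x. c)"
    proof (cases "g = (\<lambda>x. x $ i)")
      case True
      have "partial j g = (\<lambda>x. axis j 1 $ i)"
        unfolding True by (rule ext) (rule partial_eqI[OF D])
      then show ?thesis by blast
    next
      case False
      then obtain c where c: "g = (\<lambda>x. c)" using g by blast
      have "partial j g = (\<lambda>x. 0)" unfolding c by (simp add: partial_def fun_eq_iff)
      then show ?thesis by blast
    qed
    then show ?thesis by blast
  qed
qed blast

lemma smooth_on_add:
  fixes f g :: "'n::finite rvec \<Rightarrow> real"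
  shows "smooth_on UNIV f \<Longrightarrow> smooth_on UNIV g \<Longrightarrow> smooth_on UNIV (\<lambda>x. f x + g x)"
  by (rule smooth_closure_smooth, rule smooth_closure.add; rule smooth_closure.base)

lemma smooth_on_mult:
  fixes f g :: "'n::finite rvec \<Rightarrow> real"
  shows "smooth_on UNIV f \<Longrightarrow> smooth_on UNIV g \<Longrightarrow> smooth_on UNIV (\<lambda>x. f x * g x)"
  by (rule smooth_closure_smooth, rule smooth_closure.mult; rule smooth_closure.base)

lemma smooth_on_sum:
  fixes f :: "'a \<Rightarrow> 'n::finite rvec \<Rightarrow> real"
  shows "(\<And>k. k \<in> A \<Longrightarrow> smooth_on UNIV (f k)) \<Longrightarrow> smooth_on UNIV (\<lambda>x. \<Sum>k\<in>A. f k x)"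
  by (induction A rule: infinite_finite_induct) (simp_all add: smooth_on_const smooth_on_add)

lemma smooth_on_comp:
  fixes g :: "'n::finite rvec \<Rightarrow> real" and F :: "nat \<Rightarrow> real \<Rightarrow> real"
  assumes "\<And>n t. (F n has_real_derivative F (Suc n) t) (at t)" "smooth_on UNIV g"
  shows "smooth_on UNIV (\<lambda>x. F 0 (g x))"
  by (rule smooth_closure_smooth, rule smooth_closure.comp, rule assms(1), rule smooth_closure.base, rule assms(2))

text \<open>With \<open>l = 1\<close> this serves the translates of test functions, with large
  \<open>l\<close> the concentrated bumps that refute embeddings.\<close>

lemma iter_partial_affine:
  fixes f :: "'n::finite rvec \<Rightarrow> real"
  assumes f: "smooth_on UNIV f"
  shows "iter_partial js (\<lambda>x. f (z + l *\<^sub>R (x - c))) = (\<lambda>x. l ^ length js * iter_partial js f (z + l *\<^sub>R (x - c)))"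
proof (induction js)
  case (Cons j js)
  have "partial j (\<lambda>x. l ^ length js * iter_partial js f (z + l *\<^sub>R (x - c))) x
      = l ^ length (j # js) * iter_partial (j # js) f (z + l *\<^sub>R (x - c))" for x
  proof -
    let ?g = "iter_partial js f"
    have g: "(?g has_derivative frechet_derivative ?g (at y)) (at y)" for y
      using smooth_onD[OF smooth_on_iter_partial[OF f]] frechet_derivative_works by blast
    have "((\<lambda>x. z + l *\<^sub>R (x - c)) has_derivative (\<lambda>v. l *\<^sub>R v)) (at x)"
      by (auto intro!: derivative_eq_intros)
    from has_derivative_mult_right[OF has_derivative_compose[OF this g], of "l ^ length js"]
    show ?thesis
      by (subst partial_eqI, assumption) (simp add: iter_partial_Cons partial_def linear_scale[OF has_derivative_linear[OF g]])
  qed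
  then show ?case by (simp add: iter_partial_Cons Cons fun_eq_iff)
qed simp

lemma smooth_on_affine:
  fixes f :: "'n::finite rvec \<Rightarrow> real"
  assumes f: "smooth_on UNIV f"
  shows "smooth_on UNIV (\<lambda>x. f (z + l *\<^sub>R (x - c)))"
  unfolding smooth_on_def iter_partial_affine[OF f]
proof (intro allI ballI)
  fix js and x :: "'n rvec"
  have "(\<lambda>x. iter_partial js f (z + l *\<^sub>R (x - c))) differentiable (at x)"
    by (rule differentiable_compose[of "iter_partial js f"])
      (auto intro!: smooth_onD[OF smooth_on_iter_partial[OF f]] derivative_intros)
  then show "(\<lambda>x. l ^ length js * iter_partial js f (z + l *\<^sub>R (x - c))) differentiable (at x)"
    by (intro differentiable_mult differentiable_const)
qed

lemma iter_partial_cmult: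
  fixes f :: "'n::finite rvec \<Rightarrow> real"
  assumes f: "smooth_on UNIV f"
  shows "iter_partial js (\<lambda>x. c * f x) = (\<lambda>x. c * iter_partial js f x)"
proof (induction js)
  case (Cons j js)
  have "partial j (\<lambda>x. c * iter_partial js f x) x = c * partial j (iter_partial js f) x" for x
    using smooth_onD[OF smooth_on_iter_partial[OF f]]
    by (subst partial_mult) (auto simp: partial_def)
  then show ?case by (simp only: iter_partial_Cons Cons)
qed simp

lemma iter_partial_sum:
  fixes f :: "'a \<Rightarrow> 'n::finite rvec \<Rightarrow> real"
  assumes f: "\<And>k. k \<in> A \<Longrightarrow> smooth_on UNIV (f k)"
  shows "iter_partial js (\<lambda>x. \<Sum>k\<in>A. f k x) = (\<lambda>x. \<Sum>k\<in>A. iter_partial js (f k) x)"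
proof (induction js)
  case (Cons j js)
  have "((\<lambda>x. \<Sum>k\<in>A. iter_partial js (f k) x) has_derivative
     (\<lambda>v. \<Sum>k\<in>A. frechet_derivative (iter_partial js (f k)) (at x) v)) (at x)" for x
    using smooth_onD[OF smooth_on_iter_partial[OF f]] frechet_derivative_works
    by (intro has_derivative_sum) blast
  from partial_eqI[OF this] show ?case
    by (simp only: iter_partial_Cons Cons) (simp add: partial_def)
qed simp

subsection \<open>Bump functions\<close>

text \<open>The classical flat function; \<open>P = 1\<close> is the profile of \<open>bump\<close>.
  The polynomial in \<open>1 / t\<close> is carried along because differentiation reproduces exactly
  this form.\<close>

definition flat_exp :: "real poly \<Rightarrow> real \<Rightarrow> real" where
  "flat_exp P t = (if t > 0 then poly P (1 / t) * exp (- (1 / t)) else 0)"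

lemma poly_over_exp_tendsto_0: "((\<lambda>s. poly P s * exp (- s)) \<longlongrightarrow> (0::real)) at_top"
proof -
  have "((\<lambda>s. \<Sum>i\<le>degree P. coeff P i * (s ^ i / exp s)) \<longlongrightarrow> (\<Sum>i\<le>degree P. coeff P i * 0)) at_top"
    by (intro tendsto_intros tendsto_power_div_exp_0)
  then show ?thesis
    by (simp add: poly_altdef sum_divide_distrib exp_minus field_simps)
qed

text \<open>For \<open>t > 0\<close> the chain rule produces the factor \<open>1 / t\<^sup>2\<close>
  times the value of \<open>P - pderiv P\<close> at \<open>1 / t\<close>, whence the polynomial. At
  0 the right difference quotient is \<open>s * poly P s * exp (- s)\<close> with
  \<open>s = 1 / t\<close>, and the exponential wins.\<close>

lemma flat_exp_DERIV:
  "(flat_exp P has_real_derivative flat_exp ([:0, 0, 1:] * (P - pderiv P)) t) (at t)"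
proof -
  consider "t > 0" | "t < 0" | "t = 0" by linarith
  then show ?thesis
  proof cases
    case 1
    have "((\<lambda>t. poly P (1 / t) * exp (- (1 / t))) has_real_derivative
       flat_exp ([:0, 0, 1:] * (P - pderiv P)) t) (at t)"
      using 1 by (auto intro!: derivative_eq_intros DERIV_chain2[OF poly_DERIV]
          simp: flat_exp_def algebra_simps power2_eq_square divide_simps)
    moreover have "\<forall>\<^sub>F s in nhds t. flat_exp P s = poly P (1 / s) * exp (- (1 / s))"
      using eventually_nhds_in_open[of "{0<..}" t] 1 by (auto elim!: eventually_mono simp: flat_exp_def)
    ultimately show ?thesis
      by (rule DERIV_cong_ev[OF refl _ refl, THEN iffD2, rotated])
  next
    case 2
    have "\<forall>\<^sub>F s in nhds t. flat_exp P s = 0"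
      using eventually_nhds_in_open[of "{..<0}" t] 2 by (auto elim!: eventually_mono simp: flat_exp_def)
    then have "(flat_exp P has_real_derivative 0) (at t)"
      using DERIV_cong_ev[of t t "flat_exp P" "\<lambda>_. 0" 0 0] by simp
    then show ?thesis using 2 by (simp add: flat_exp_def)
  next
    case 3
    have "((\<lambda>s. poly (pCons 0 P) (1 / s) * exp (- (1 / s))) \<longlongrightarrow> 0) (at_right (0::real))"
      using filterlim_compose[OF poly_over_exp_tendsto_0 filterlim_inverse_at_top_right, of "pCons 0 P"]
      by (simp add: inverse_eq_divide)
    then have R: "((\<lambda>s. (flat_exp P s - flat_exp P 0) / (s - 0)) \<longlongrightarrow> 0) (at_right 0)"
      by (rule tendsto_cong[THEN iffD1, rotated])
        (auto simp: flat_exp_def eventually_at_filter)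
    have L: "((\<lambda>s. (flat_exp P s - flat_exp P 0) / (s - 0)) \<longlongrightarrow> 0) (at_left 0)"
      by (rule tendsto_cong[THEN iffD1, rotated, OF tendsto_const])
        (auto simp: flat_exp_def eventually_at_filter)
    have "(flat_exp P has_real_derivative 0) (at 0)"
      unfolding has_field_derivative_iff using L R filterlim_split_at by fastforce
    then show ?thesis using 3 by (simp add: flat_exp_def)
  qed
qed

text \<open>The squared norm is a polynomial in the coordinates, so the centre needs no separate
  argument for smoothness.\<close>

definition bump :: "'n::finite rvec \<Rightarrow> real \<Rightarrow> 'n rvec \<Rightarrow> real" where
  "bump c r x = flat_exp 1 (r\<^sup>2 - (norm (x - c))\<^sup>2)"

lemma smooth_on_flat_exp:
  assumes "smooth_on UNIV g"
  shows "smooth_on UNIV (\<lambda>x. flat_exp P (g x))"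
proof -
  define op where "op P = [:0, 0, 1:] * (P - pderiv P)" for P :: "real poly"
  have "(flat_exp ((op ^^ n) P) has_real_derivative flat_exp ((op ^^ Suc n) P) t) (at t)" for n t
    using flat_exp_DERIV[of "(op ^^ n) P" t] by (simp only: funpow.simps o_apply op_def)
  from smooth_on_comp[of "\<lambda>n. flat_exp ((op ^^ n) P)", OF this assms] show ?thesis by (simp only: funpow_0)
qed

lemma smooth_on_bump: "smooth_on UNIV (bump c r)"
proof -
  have "(norm (x - c))\<^sup>2 = (\<Sum>i\<in>UNIV. (x $ i + - c $ i) * (x $ i + - c $ i))" for x
    by (simp add: power2_norm_eq_inner inner_vec_def)
  then have "bump c r = (\<lambda>x. flat_exp 1 (r\<^sup>2 + (-1) * (\<Sum>i\<in>UNIV. (x $ i + - c $ i) * (x $ i + - c $ i))))"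
    by (simp add: bump_def fun_eq_iff)
  then show ?thesis
    by (simp only:) (intro smooth_on_flat_exp smooth_on_add smooth_on_mult smooth_on_sum smooth_on_const smooth_on_coord)
qed

lemma bump_nonneg: "bump c r x \<ge> 0"
  by (simp add: bump_def flat_exp_def)

lemma bump_pos_iff: "r > 0 \<Longrightarrow> bump c r x > 0 \<longleftrightarrow> x \<in> ball c r"
proof -
  assume "r > 0"
  then have "(norm (x - c))\<^sup>2 < r\<^sup>2 \<longleftrightarrow> norm (x - c) < r"
    by (meson less_imp_le norm_ge_zero power2_less_imp_less power_strict_mono zero_less_numeral)
  then show ?thesis by (auto simp: bump_def flat_exp_def dist_norm norm_minus_commute)
qed

lemma test_functionI:
  assumes "smooth_on UNIV \<phi>" "compact K" "K \<subseteq> \<Omega>" "\<And>x. \<phi> x \<noteq> 0 \<Longrightarrow> x \<in> K"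
  shows "test_function \<Omega> \<phi>"
proof -
  have "closure {x. \<phi> x \<noteq> 0} \<subseteq> K"
    using assms(2,4) by (intro closure_minimal compact_imp_closed) auto
  moreover from this have "compact (closure {x. \<phi> x \<noteq> 0})"
    using closed_Int_compact[OF closed_closure assms(2), of "{x. \<phi> x \<noteq> 0}"] by (simp add: Int_absorb2)
  ultimately show ?thesis using assms(1,3) unfolding test_function_def by blast
qed

lemma test_function_smooth: "test_function \<Omega> \<phi> \<Longrightarrow> smooth_on UNIV \<phi>"
  by (simp add: test_function_def)

lemma test_function_support:
  assumes "test_function \<Omega> \<phi>"
  obtains K where "compact K" "K \<subseteq> \<Omega>" "\<And>x. x \<notin> K \<Longrightarrow> \<phi> x = 0"
proof
  show "compact (closure {x. \<phi> x \<noteq> 0})" "closure {x. \<phi> x \<noteq> 0} \<subseteq> \<Omega>"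
    using assms by (auto simp: test_function_def)
  show "\<phi> x = 0" if "x \<notin> closure {x. \<phi> x \<noteq> 0}" for x
    using that closure_subset[of "{x. \<phi> x \<noteq> 0}"] by auto
qed

lemma partial_zero_outside:
  assumes "closed K" "\<And>x. x \<notin> K \<Longrightarrow> \<phi> x = 0" "x \<notin> K"
  shows "partial i \<phi> x = (0::'b::real_normed_vector)"
proof -
  have "(\<phi> has_derivative (\<lambda>_. 0)) (at x)"
    by (rule has_derivative_transform_within_open[of "\<lambda>_. 0" _ _ _ "- K"])
      (use assms in \<open>auto intro!: derivative_eq_intros\<close>)
  then show ?thesis using partial_eqI by blast
qed

lemma iter_partial_zero_outside:
  assumes "closed K" "\<And>x. x \<notin> K \<Longrightarrow> \<phi> x = 0" "x \<notin> K"
  shows "iter_partial js \<phi> x = (0::'b::real_normed_vector)"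
  using assms(3)
proof (induction js arbitrary: x)
  case (Cons j js)
  show ?case unfolding iter_partial_Cons
    by (rule partial_zero_outside[OF assms(1) _ Cons.prems]) (use Cons.IH in auto)
qed (use assms in auto)

lemma test_function_iter_partial:
  assumes "test_function \<Omega> \<phi>"
  shows "test_function \<Omega> (iter_partial js \<phi>)"
proof -
  obtain K where K: "compact K" "K \<subseteq> \<Omega>" "\<And>x. x \<notin> K \<Longrightarrow> \<phi> x = 0"
    using test_function_support[OF assms] by blast
  show ?thesis
  proof (rule test_functionI[OF smooth_on_iter_partial[OF test_function_smooth[OF assms]] K(1,2)])
    show "x \<in> K" if "iter_partial js \<phi> x \<noteq> 0" for x
      using that iter_partial_zero_outside[of K \<phi> x js] compact_imp_closed[OF K(1)] K(3) by blast
  qed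
qed

lemma test_function_mono: "test_function \<Omega> \<phi> \<Longrightarrow> \<Omega> \<subseteq> \<Omega>' \<Longrightarrow> test_function \<Omega>' \<phi>"
  by (auto simp: test_function_def)

lemma test_function_bounded:
  assumes "test_function \<Omega> \<phi>"
  obtains B where "B \<ge> 0" "\<And>x. \<bar>\<phi> x\<bar> \<le> B"
proof -
  obtain K where K: "compact K" "K \<subseteq> \<Omega>" "\<And>x. x \<notin> K \<Longrightarrow> \<phi> x = 0"
    using test_function_support[OF assms] by blast
  have "bounded (\<phi> ` K)"
    by (intro compact_imp_bounded compact_continuous_image K(1) smooth_continuous_on test_function_smooth[OF assms])
  then obtain B where B: "\<And>x. x \<in> K \<Longrightarrow> \<bar>\<phi> x\<bar> \<le> B" unfolding bounded_iff by auto
  show ?thesis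
    by (rule that[of "max B 0"]) (use B K(3) in \<open>fastforce simp: le_max_iff_disj\<close>)+
qed

text \<open>With \<open>S\<^sub>n\<close> a sum of \<open>n\<close> bumps whose balls exhaust \<open>G\<close>, take \<open>\<phi>\<^sub>n = 1 - exp (-n S\<^sub>n)\<close>.\<close>

lemma test_functions_approx_open:
  assumes "open G"
  obtains \<phi> :: "nat \<Rightarrow> 'n::finite rvec \<Rightarrow> real" where "\<And>n. test_function G (\<phi> n)"
    "\<And>n x. 0 \<le> \<phi> n x" "\<And>n x. \<phi> n x \<le> indicator G x" "\<And>x. (\<lambda>n. \<phi> n x) \<longlonglongrightarrow> indicator G x"
proof (cases "G = {}")
  case True
  show ?thesis
    by (rule that[of "\<lambda>_ _. 0"]) (auto simp: True intro!: test_functionI[of _ "{}"] smooth_on_const)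
next
  case False
  \<comment> \<open>The closed balls also lie in \<open>G\<close>, which makes finite unions of the
    supports compact subsets of \<open>G\<close>.\<close>
  define \<B> where "\<B> = (\<lambda>x. ball x (SOME r. r > 0 \<and> cball x r \<subseteq> G)) ` G"
  have rad: "(SOME r. r > 0 \<and> cball x r \<subseteq> G) > 0 \<and> cball x (SOME r. r > 0 \<and> cball x r \<subseteq> G) \<subseteq> G" if "x \<in> G" for x
    using someI_ex[of "\<lambda>r. r > 0 \<and> cball x r \<subseteq> G"] open_contains_cball[of G] assms that by blast
  obtain \<B>' where B': "\<B>' \<subseteq> \<B>" "countable \<B>'" "\<Union>\<B>' = \<Union>\<B>"
    using Lindelof[of \<B>] by (metis (no_types, lifting) \<B>_def imageE open_ball)
  have UB: "\<Union>\<B> = G"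
  proof
    show "\<Union>\<B> \<subseteq> G"
      unfolding \<B>_def using rad ball_subset_cball by fastforce
    show "G \<subseteq> \<Union>\<B>"
      unfolding \<B>_def using rad centre_in_ball by blast
  qed
  have ne: "\<B>' \<noteq> {}" using False UB B'(3) by auto
  have "\<forall>B\<in>\<B>'. \<exists>c r. r > 0 \<and> B = ball c r \<and> cball c r \<subseteq> G"
    using B'(1) rad unfolding \<B>_def by blast
  then obtain c r where cr: "\<And>B. B \<in> \<B>' \<Longrightarrow> r B > 0 \<and> B = ball (c B) (r B) \<and> cball (c B) (r B) \<subseteq> G"
    by metis
  define E where "E n = from_nat_into \<B>' n" for n
  have E: "E n \<in> \<B>'" for n unfolding E_def by (rule from_nat_into[OF ne])
  have E_surj: "\<exists>n. E n = B" if "B \<in> \<B>'" for B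
    unfolding E_def using from_nat_into_surj[OF B'(2) that] .
  define S where "S n x = (\<Sum>i\<le>n. bump (c (E i)) (r (E i)) x)" for n x
  define \<phi> where "\<phi> n x = 1 + (-1) * exp (- real n * S n x)" for n x
  have S0: "S n x \<ge> 0" for n x unfolding S_def by (intro sum_nonneg bump_nonneg)
  have Spos: "S n x > 0 \<longleftrightarrow> (\<exists>i\<le>n. x \<in> E i)" for n x
  proof -
    have "S n x > 0 \<longleftrightarrow> (\<exists>i\<in>{..n}. bump (c (E i)) (r (E i)) x > 0)"
    proof -
      have "S n x = 0 \<longleftrightarrow> (\<forall>i\<in>{..n}. bump (c (E i)) (r (E i)) x = 0)"
        unfolding S_def by (intro sum_nonneg_eq_0_iff bump_nonneg) simp
      moreover have "bump (c (E i)) (r (E i)) x = 0 \<longleftrightarrow> \<not> bump (c (E i)) (r (E i)) x > 0" for i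
        using bump_nonneg[of "c (E i)" "r (E i)" x] by linarith
      ultimately show ?thesis using S0[of n x] by force
    qed
    also have "\<dots> \<longleftrightarrow> (\<exists>i\<le>n. x \<in> E i)"
      using bump_pos_iff cr[OF E] by (metis atMost_iff)
    finally show ?thesis .
  qed
  show ?thesis
  proof (rule that[of \<phi>])
    fix n x
    have expd: "((\<lambda>s. exp s) has_real_derivative exp t) (at t)" for t :: real by (rule DERIV_exp)
    show "test_function G (\<phi> n)"
    proof (rule test_functionI)
      show "smooth_on UNIV (\<phi> n)" unfolding \<phi>_def S_def
        by (intro smooth_on_add smooth_on_const smooth_on_mult smooth_on_sum smooth_on_bump
            smooth_on_comp[of "\<lambda>_. exp"] expd)
      show "compact (\<Union>i\<le>n. cball (c (E i)) (r (E i)))" by (intro compact_UN) auto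
      show "(\<Union>i\<le>n. cball (c (E i)) (r (E i))) \<subseteq> G" using cr[OF E] by blast
      fix x assume "\<phi> n x \<noteq> 0"
      then have "S n x \<noteq> 0" by (auto simp: \<phi>_def)
      then obtain i where "i \<le> n" "x \<in> E i" using S0[of n x] Spos[of n x] by force
      then show "x \<in> (\<Union>i\<le>n. cball (c (E i)) (r (E i)))"
        using cr[OF E[of i]] ball_subset_cball by blast
    qed
    show nn: "0 \<le> \<phi> n x" using S0 by (simp add: \<phi>_def)
    show "\<phi> n x \<le> indicator G x"
    proof (cases "x \<in> G")
      case False
      then have "\<not> S n x > 0" using Spos E UB B'(3) by blast
      then show ?thesis using S0[of n x] False by (simp add: \<phi>_def)
    qed (simp add: \<phi>_def)
  next
    fix x
    show "(\<lambda>n. \<phi> n x) \<longlonglongrightarrow> indicator G x"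
    proof (cases "x \<in> G")
      case True
      then obtain B where "B \<in> \<B>'" "x \<in> B" using UB B'(3) by blast
      then obtain k where k: "x \<in> E k" using E_surj by metis
      then have pos: "S k x > 0" using Spos by blast
      have mono: "S n x \<ge> S k x" if "n \<ge> k" for n
        unfolding S_def using that by (intro sum_mono2) (auto intro: bump_nonneg)
      define s where "s = S k x"
      have "(\<lambda>n. exp (- (s * real n))) \<longlonglongrightarrow> 0"
        using pos unfolding s_def[symmetric] by real_asymp
      then have "(\<lambda>n. exp (- real n * S n x)) \<longlonglongrightarrow> 0"
      proof (rule tendsto_sandwich[OF _ _ tendsto_const, rotated -1])
        show "\<forall>\<^sub>F n in sequentially. exp (- real n * S n x) \<le> exp (- (s * real n))"
          using eventually_ge_at_top[of k] by eventually_elim (auto simp: s_def mult.commute intro!: mult_left_mono mono)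
      qed auto
      then have "(\<lambda>n. 1 + (-1) * exp (- real n * S n x)) \<longlonglongrightarrow> 1 + (-1) * 0"
        by (intro tendsto_intros)
      then show ?thesis using True by (simp add: \<phi>_def)
    next
      case False
      have "S n x = 0" for n
      proof -
        have "\<not> S n x > 0" using Spos E UB B'(3) False by blast
        then show ?thesis using S0[of n x] by linarith
      qed
      then show ?thesis using False by (simp add: \<phi>_def)
    qed
  qed
qed

section \<open>Test functions and weak derivatives\<close>

lemma smooth_borel_test [measurable (raw)]:
  fixes \<phi> :: "'n::finite rvec \<Rightarrow> real"
  assumes "test_function \<Omega> \<phi>"
  shows "\<phi> \<in> borel_measurable borel"
  by (rule smooth_borel_measurable[OF test_function_smooth[OF assms]])

lemma test_function_integrable:
  fixes \<phi> :: "'n::finite rvec \<Rightarrow> real"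
  assumes "test_function \<Omega> \<phi>"
  shows "integrable lborel \<phi>"
proof -
  obtain K where K: "compact K" "K \<subseteq> \<Omega>" "\<And>x. x \<notin> K \<Longrightarrow> \<phi> x = 0"
    using test_function_support[OF assms] by blast
  have "integrable lborel (\<lambda>x. indicator K x *\<^sub>R \<phi> x)"
    by (rule borel_integrable_compact[OF K(1) smooth_continuous_on[OF test_function_smooth[OF assms]]])
  moreover have "(\<lambda>x. indicator K x *\<^sub>R \<phi> x) = \<phi>"
    using K(3) by (auto simp: fun_eq_iff indicator_def)
  ultimately show ?thesis by simp
qed

lemma lborel_integral_translate:
  fixes f :: "'a::euclidean_space \<Rightarrow> real"
  assumes [measurable]: "f \<in> borel_measurable borel"
  shows "(LINT x|lborel. f (c + x)) = (LINT x|lborel. f x)"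
  by (subst (2) lborel_distr_plus[of c, symmetric]) (simp add: integral_distr)

lemma lborel_nn_integral_translate:
  fixes f :: "'a::euclidean_space \<Rightarrow> ennreal"
  assumes [measurable]: "f \<in> borel_measurable borel"
  shows "(\<integral>\<^sup>+x. f (c + x) \<partial>lborel) = (\<integral>\<^sup>+x. f x \<partial>lborel)"
  by (subst (2) lborel_distr_plus[of c, symmetric]) (simp add: nn_integral_distr)

text \<open>Difference quotients have integral 0 by translation invariance. They converge
  dominatedly: the mean value theorem bounds them by the supremum of the derivative, and steps of
  length at most 1 keep them supported in the ball of radius \<open>R + 1\<close>.\<close>

lemma integral_partial_eq_0:
  fixes \<phi> :: "'n::finite rvec \<Rightarrow> real"
  assumes \<phi>: "test_function UNIV \<phi>"
  shows "(LINT x|lborel. partial i \<phi> x) = 0"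
proof -
  note sm = test_function_smooth[OF \<phi>]
  have p: "test_function UNIV (partial i \<phi>)"
    using test_function_iter_partial[OF \<phi>, of "[i]"] by (simp add: iter_partial_Cons)
  obtain B where B: "B \<ge> 0" "\<And>x. \<bar>partial i \<phi> x\<bar> \<le> B" using test_function_bounded[OF p] by blast
  obtain K where K: "compact K" "K \<subseteq> UNIV" "\<And>x. x \<notin> K \<Longrightarrow> \<phi> x = 0" using test_function_support[OF \<phi>] by blast
  obtain R where R: "\<And>x. x \<in> K \<Longrightarrow> norm x \<le> R" using compact_imp_bounded[OF K(1)] bounded_iff by blast
  define h where "h n = inverse (real (Suc n))" for n
  have h: "h n > 0" "h n \<le> 1" for n by (auto simp: h_def field_simps)
  have h0: "h \<longlonglongrightarrow> 0" unfolding h_def by (rule LIMSEQ_inverse_real_of_nat)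
  define q where "q n x = (\<phi> (h n *\<^sub>R axis i 1 + x) - \<phi> x) / h n" for n x
  have [measurable]: "\<phi> \<in> borel_measurable borel" "partial i \<phi> \<in> borel_measurable borel"
    using \<phi> p smooth_borel_test by blast+
  have q0: "(LINT x|lborel. q n x) = 0" for n
  proof -
    have i: "integrable lborel (\<lambda>x. \<phi> (h n *\<^sub>R axis i 1 + x))"
      using test_function_integrable[OF \<phi>]
      by (subst (asm) lborel_distr_plus[of "h n *\<^sub>R axis i 1", symmetric])
        (simp add: integrable_distr_eq)
    show ?thesis unfolding q_def
      using i test_function_integrable[OF \<phi>] by (simp add: lborel_integral_translate)
  qed
  have "(\<lambda>n. LINT x|lborel. q n x) \<longlonglongrightarrow> (LINT x|lborel. partial i \<phi> x)"
  proof (rule integral_dominated_convergence[where w = "\<lambda>x. B * indicator (cball 0 (R + 1)) x"])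
    show "integrable lborel (\<lambda>x::'n rvec. B * indicator (cball 0 (R + 1)) x)"
      by (intro integrable_mult_right integrable_real_indicator) (use emeasure_bounded_finite[OF bounded_cball] in \<open>auto simp: less_top\<close>)
    show "AE x in lborel. (\<lambda>n. q n x) \<longlonglongrightarrow> partial i \<phi> x"
    proof (rule AE_I2)
      fix x
      have "((\<lambda>t. (\<phi> (x + t *\<^sub>R axis i 1) - \<phi> (x + 0 *\<^sub>R axis i 1)) / (t - 0)) \<longlongrightarrow> partial i \<phi> (x + 0 *\<^sub>R axis i 1)) (at 0)"
        using smooth_has_derivative_axis[OF sm, of x i 0] unfolding has_field_derivative_iff by simp
      then have "((\<lambda>t. (\<phi> (x + t *\<^sub>R axis i 1) - \<phi> x) / t) \<longlongrightarrow> partial i \<phi> x) (at 0)" by simp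
      then have "(\<lambda>n. (\<phi> (x + h n *\<^sub>R axis i 1) - \<phi> x) / h n) \<longlonglongrightarrow> partial i \<phi> x"
      proof (rule filterlim_compose)
        have "h n \<noteq> 0" for n using h(1)[of n] by simp
        then show "filterlim h (at 0) sequentially" by (intro filterlim_atI h0 always_eventually) blast
      qed
      then show "(\<lambda>n. q n x) \<longlonglongrightarrow> partial i \<phi> x" by (simp add: q_def add.commute)
    qed
    show "AE x in lborel. norm (q n x) \<le> B * indicator (cball 0 (R + 1)) x" for n
    proof (rule AE_I2)
      fix x
      obtain s where s: "\<phi> (x + h n *\<^sub>R axis i 1) - \<phi> (x + 0 *\<^sub>R axis i 1) = (h n - 0) * partial i \<phi> (x + s *\<^sub>R axis i 1)"
        using MVT2[OF h(1)[of n], of "\<lambda>t. \<phi> (x + t *\<^sub>R axis i 1)", OF smooth_has_derivative_axis[OF sm]] by blast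
      then have "q n x = partial i \<phi> (x + s *\<^sub>R axis i 1)"
        using h(1)[of n] by (simp add: q_def add.commute)
      then have b: "norm (q n x) \<le> B" using B(2) by simp
      show "norm (q n x) \<le> B * indicator (cball 0 (R + 1)) x"
      proof (cases "x \<in> cball 0 (R + 1)")
        case False
        have "x \<notin> K" using False R by force
        moreover have "h n *\<^sub>R axis i 1 + x \<notin> K"
        proof
          assume "h n *\<^sub>R axis i 1 + x \<in> K"
          then have "norm (h n *\<^sub>R axis i 1 + x) \<le> R" by (rule R)
          moreover have "norm x \<le> norm (h n *\<^sub>R axis i 1 + x) + norm (h n *\<^sub>R axis i (1::real) :: 'n rvec)"
            by (metis add_diff_cancel_left' norm_triangle_ineq4 add.commute)
          ultimately show False using False h[of n] by simp
        qed
        ultimately show ?thesis using K(3) False by (simp add: q_def)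
      qed (use b in simp)
    qed
  qed (auto simp: q_def)
  then show ?thesis using q0 by (simp add: LIMSEQ_const_iff)
qed

section \<open>Integration by parts against test functions\<close>

lemma test_function_mult:
  assumes "smooth_on UNIV u" "test_function \<Omega> \<phi>"
  shows "test_function \<Omega> (\<lambda>x. u x * \<phi> x)"
proof -
  obtain K where K: "compact K" "K \<subseteq> \<Omega>" "\<And>x. x \<notin> K \<Longrightarrow> \<phi> x = 0"
    using test_function_support[OF assms(2)] by blast
  show ?thesis
    by (rule test_functionI[OF smooth_on_mult[OF assms(1) test_function_smooth[OF assms(2)]] K(1,2)])
      (use K(3) in force)
qed

lemma integration_by_parts_partial:
  fixes u \<phi> :: "'n::finite rvec \<Rightarrow> real"
  assumes u: "smooth_on UNIV u" and \<phi>: "test_function UNIV \<phi>"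
  shows "(LINT x|lborel. u x * partial i \<phi> x) = - (LINT x|lborel. partial i u x * \<phi> x)"
proof -
  have p: "test_function UNIV (partial i \<phi>)"
    using test_function_iter_partial[OF \<phi>, of "[i]"] by (simp add: iter_partial_Cons)
  have "partial i (\<lambda>x. u x * \<phi> x) = (\<lambda>x. u x * partial i \<phi> x + partial i u x * \<phi> x)"
    using smooth_onD[OF u] smooth_onD[OF test_function_smooth[OF \<phi>]] by (intro ext partial_mult) auto
  then have "0 = (LINT x|lborel. u x * partial i \<phi> x + partial i u x * \<phi> x)"
    using integral_partial_eq_0[OF test_function_mult[OF u \<phi>], of i] by simp
  also have "\<dots> = (LINT x|lborel. u x * partial i \<phi> x) + (LINT x|lborel. partial i u x * \<phi> x)"
    by (intro Bochner_Integration.integral_add test_function_integrable[of UNIV] test_function_mult u \<phi> p smooth_on_partial)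
  finally show ?thesis by simp
qed

lemma integration_by_parts:
  fixes u \<phi> :: "'n::finite rvec \<Rightarrow> real"
  assumes u: "smooth_on UNIV u" and \<phi>: "test_function UNIV \<phi>"
  shows "(LINT x|lborel. u x * iter_partial js \<phi> x) = (- 1) ^ length js * (LINT x|lborel. iter_partial js u x * \<phi> x)"
  using u
proof (induction js arbitrary: u)
  case (Cons j js)
  have "(LINT x|lborel. u x * iter_partial (j # js) \<phi> x) = - (LINT x|lborel. partial j u x * iter_partial js \<phi> x)"
    unfolding iter_partial_Cons by (rule integration_by_parts_partial[OF Cons.prems test_function_iter_partial[OF \<phi>]])
  also have "\<dots> = - ((- 1) ^ length js * (LINT x|lborel. iter_partial js (partial j u) x * \<phi> x))"
    using Cons.IH[OF smooth_on_partial[OF Cons.prems]] by simp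
  also have "iter_partial js (partial j u) = iter_partial (j # js) u"
    unfolding iter_partial_Cons by (rule iter_partial_partial[OF Cons.prems])
  finally show ?case by simp
qed simp

section \<open>Multi-indices as words of coordinate directions\<close>

definition mi_list :: "('n::{finite,linorder} \<Rightarrow> nat) \<Rightarrow> 'n list" where
  "mi_list \<alpha> = concat (map (\<lambda>i. replicate (\<alpha> i) i) (sorted_list_of_set UNIV))"

lemma mi_partial_eq: "mi_partial \<alpha> = iter_partial (mi_list \<alpha>)"
  by (simp add: mi_partial_def mi_list_def)

lemma count_mi_list: "count (mset (mi_list \<alpha>)) i = \<alpha> i"
proof -
  have "count (mset (concat (map (\<lambda>i. replicate (\<alpha> i) i) xs))) i = (if i \<in> set xs then \<alpha> i else 0)"
    if "distinct xs" for xs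
    using that by (induction xs) auto
  from this[of "sorted_list_of_set UNIV"] show ?thesis by (simp add: mi_list_def)
qed

lemma length_mi_list: "length (mi_list \<alpha>) = mi_order \<alpha>"
proof -
  have "length (mi_list \<alpha>) = (\<Sum>i\<leftarrow>sorted_list_of_set UNIV. \<alpha> i)"
    by (simp add: mi_list_def length_concat o_def)
  also have "\<dots> = mi_order \<alpha>"
    by (simp add: mi_order_def sum_list_distinct_conv_sum_set)
  finally show ?thesis .
qed

lemma mset_mi_list_count: "mset (mi_list (count (mset js))) = mset js"
  by (rule multiset_eqI) (simp add: count_mi_list)

lemma mi_order_count: "mi_order (count (mset js)) = length js" for js :: "'n::{finite,linorder} list"
  using mset_eq_length[OF mset_mi_list_count[of js]] by (simp only: length_mi_list)

lemma mi_order_add: "mi_order (\<lambda>i. \<alpha> i + \<beta> i) = mi_order \<alpha> + mi_order \<beta>"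
  by (simp add: mi_order_def sum.distrib)

subsection \<open>Borel representatives of locally integrable functions\<close>

text \<open>A weak derivative is only Lebesgue measurable and arbitrary outside \<open>D\<close>.
  Translation, Tonelli and pairing with test functions are convenient for Borel functions on the
  whole space, hence representatives that are Borel and vanish off \<open>D\<close>.\<close>

definition borel_loc_int :: "('n::finite rvec) set \<Rightarrow> ('n rvec \<Rightarrow> real) \<Rightarrow> bool" where
  "borel_loc_int D g \<longleftrightarrow> g \<in> borel_measurable borel \<and> (\<forall>x. x \<notin> D \<longrightarrow> g x = 0) \<and>
     (\<forall>K. compact K \<and> K \<subseteq> D \<longrightarrow> integrable lborel (\<lambda>x. indicator K x * g x))"

lemma open_exhaustion:
  fixes D :: "'n::finite rvec set"
  assumes "open D"
  obtains C :: "nat \<Rightarrow> 'n rvec set" where "\<And>n. compact (C n)" "\<And>n. C n \<subseteq> D" "(\<Union>n. C n) = D"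
proof -
  obtain C :: "nat \<Rightarrow> 'n rvec set" where "\<And>n. compact (C n)" "\<And>n. C n \<subseteq> D" "\<Union>(range C) = D"
    using open_Union_compact_subsets[OF assms] by metis
  then show ?thesis using that by blast
qed

text \<open>Integrability is given on compact subsets only; measurability reaches \<open>D\<close>
  as a pointwise limit along an exhaustion.\<close>

lemma locally_integrable_measurable:
  fixes D :: "'n::finite rvec set"
  assumes D: "open D" and v: "locally_integrable D v"
  shows "(\<lambda>x. indicator D x * v x) \<in> borel_measurable lebesgue"
proof -
  obtain C :: "nat \<Rightarrow> 'n rvec set" where C: "\<And>n. compact (C n)" "\<And>n. C n \<subseteq> D" "(\<Union>n. C n) = D"
    using open_exhaustion[OF D] by metis
  define C' where "C' n = (\<Union>i\<le>n. C i)" for n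
  have C': "compact (C' n)" "C' n \<subseteq> D" for n unfolding C'_def using C by (auto intro!: compact_UN)
  have m: "(\<lambda>x. indicator (C' n) x *\<^sub>R v x) \<in> borel_measurable lebesgue" for n
  proof -
    have "C' n \<in> sets lebesgue" using C'(1) by (simp add: borel_compact)
    moreover have "integrable (lebesgue_on (C' n)) v" using v C' unfolding locally_integrable_def by blast
    ultimately show ?thesis
      by (subst (asm) integrable_restrict_space) (auto intro: borel_measurable_integrable)
  qed
  have lim: "(\<lambda>n. indicator (C' n) x *\<^sub>R v x) \<longlonglongrightarrow> indicator D x * v x" for x
  proof (cases "x \<in> D")
    case True
    then obtain k where k: "x \<in> C k" using C(3) by blast
    have "\<forall>\<^sub>F n in sequentially. indicator (C' n) x *\<^sub>R v x = v x"
      using eventually_ge_at_top[of k]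
    proof eventually_elim
      case (elim n)
      then have "x \<in> C' n" unfolding C'_def using k by blast
      then show ?case by simp
    qed
    then show ?thesis using True by (simp add: tendsto_eventually)
  next
    case False
    then have "x \<notin> C' n" for n using C'(2) by blast
    then show ?thesis using False by simp
  qed
  show ?thesis by (rule borel_measurable_LIMSEQ_real[OF lim m])
qed

lemma borel_representative:
  fixes D :: "'n::finite rvec set"
  assumes D: "open D" and v: "locally_integrable D v"
  obtains g where "borel_loc_int D g" "AE x in lborel. x \<in> D \<longrightarrow> g x = v x"
proof -
  obtain g0 where g0: "g0 \<in> borel_measurable lborel" "AE x in lborel. indicator D x * v x = g0 x"
    using completion_ex_borel_measurable_real[OF locally_integrable_measurable[OF assms]] by blast
  define g where "g x = indicator D x * g0 x" for x
  have [measurable]: "g0 \<in> borel_measurable borel" "D \<in> sets borel" using g0(1) D by auto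
  have gm [measurable]: "g \<in> borel_measurable borel" unfolding g_def by measurable
  have ae: "AE x in lborel. x \<in> D \<longrightarrow> g x = v x"
    using g0(2) by eventually_elim (auto simp: g_def)
  have "integrable lborel (\<lambda>x. indicator K x * g x)" if K: "compact K" "K \<subseteq> D" for K
  proof -
    have Kb [measurable]: "K \<in> sets borel" using K(1) by (rule borel_compact)
    have "integrable (lebesgue_on K) v" using v K unfolding locally_integrable_def by blast
    then have "integrable lebesgue (\<lambda>x. indicator K x *\<^sub>R v x)"
      by (subst (asm) integrable_restrict_space) auto
    moreover have "AE x in lebesgue. indicator K x *\<^sub>R v x = indicator K x * g x"
      unfolding AE_completion_iff using ae by eventually_elim (use K(2) in \<open>auto simp: indicator_def\<close>)
    ultimately have "integrable lebesgue (\<lambda>x. indicator K x * g x)"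
      by (intro integrable_cong_AE_imp[of lebesgue "\<lambda>x. indicator K x *\<^sub>R v x" "\<lambda>x. indicator K x * g x"])
        (auto intro: measurable_completion)
    then show ?thesis by (subst (asm) integrable_completion) auto
  qed
  then have "borel_loc_int D g" using gm by (auto simp: borel_loc_int_def g_def)
  then show ?thesis using ae that by blast
qed

lemma lebesgue_on_integral_representative:
  fixes D :: "'n::finite rvec set"
  assumes D: "open D" and v: "locally_integrable D v" and g: "borel_loc_int D g" "AE x in lborel. x \<in> D \<longrightarrow> g x = v x"
    and \<phi> [measurable]: "\<phi> \<in> borel_measurable borel"
  shows "(LINT x|lebesgue_on D. v x * \<phi> x) = (LINT x|lborel. g x * \<phi> x)"
proof -
  have [measurable]: "g \<in> borel_measurable borel" using g(1) by (simp add: borel_loc_int_def)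
  have "(LINT x|lebesgue_on D. v x * \<phi> x) = (LINT x|lebesgue. indicator D x *\<^sub>R (v x * \<phi> x))"
    using D by (subst integral_restrict_space) auto
  also have "\<dots> = (LINT x|lebesgue. g x * \<phi> x)"
  proof (rule integral_cong_AE)
    have "(\<lambda>x. (indicator D x * v x) * \<phi> x) \<in> borel_measurable lebesgue"
      by (intro borel_measurable_times locally_integrable_measurable[OF D v] measurable_completion) auto
    then show "(\<lambda>x. indicator D x *\<^sub>R (v x * \<phi> x)) \<in> borel_measurable lebesgue" by (simp add: mult.assoc)
    show "(\<lambda>x. g x * \<phi> x) \<in> borel_measurable lebesgue" by (intro measurable_completion) auto
    show "AE x in lebesgue. indicator D x *\<^sub>R (v x * \<phi> x) = g x * \<phi> x"
      unfolding AE_completion_iff using g(2)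
      by eventually_elim (use g(1) in \<open>auto simp: borel_loc_int_def indicator_def\<close>)
  qed
  also have "\<dots> = (LINT x|lborel. g x * \<phi> x)" by (rule integral_completion) auto
  finally show ?thesis .
qed

lemma borel_loc_int_times_integrable:
  fixes g :: "'n::finite rvec \<Rightarrow> real"
  assumes g: "borel_loc_int D g" and \<phi>: "test_function D \<phi>"
  shows "integrable lborel (\<lambda>x. g x * \<phi> x)"
proof -
  obtain K where K: "compact K" "K \<subseteq> D" "\<And>x. x \<notin> K \<Longrightarrow> \<phi> x = 0"
    using test_function_support[OF \<phi>] by blast
  obtain B where B: "B \<ge> 0" "\<And>x. \<bar>\<phi> x\<bar> \<le> B" using test_function_bounded[OF \<phi>] by blast
  have [measurable]: "g \<in> borel_measurable borel" "\<phi> \<in> borel_measurable borel"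
    using g smooth_borel_test[OF \<phi>] by (auto simp: borel_loc_int_def)
  have i: "integrable lborel (\<lambda>x. indicator K x * g x)" using g K by (simp add: borel_loc_int_def)
  show ?thesis
  proof (rule Bochner_Integration.integrable_bound[OF integrable_mult_right[OF i, of B]])
    show "AE x in lborel. norm (g x * \<phi> x) \<le> norm (B * (indicator K x * g x))"
    proof (rule AE_I2)
      fix x show "norm (g x * \<phi> x) \<le> norm (B * (indicator K x * g x))"
        using B(1) B(2)[of x] K(3)[of x]
        by (cases "x \<in> K") (auto simp: abs_mult mult.commute[of "\<bar>g x\<bar>"] intro!: mult_right_mono)
    qed
  qed auto
qed

subsection \<open>The fundamental lemma of the calculus of variations\<close>

text \<open>In a ball the inequality passes from test functions to indicators of open sets and, by
  outer regularity, to the indicator of the set where \<open>g > b\<close>. There the integrand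
  \<open>g - b\<close> is positive while its integral is at most 0, so the set is null.\<close>

lemma AE_le_const_of_test_functions:
  fixes g :: "'n::finite rvec \<Rightarrow> real"
  assumes V: "open V" and g [measurable]: "g \<in> borel_measurable borel"
    and loc: "\<And>K. compact K \<Longrightarrow> K \<subseteq> V \<Longrightarrow> integrable lborel (\<lambda>x. indicator K x * g x)"
    and test: "\<And>\<phi>. test_function V \<phi> \<Longrightarrow> (\<And>x. 0 \<le> \<phi> x) \<Longrightarrow>
      (LINT x|lborel. g x * \<phi> x) \<le> b * (LINT x|lborel. \<phi> x)"
  shows "AE x in lborel. x \<in> V \<longrightarrow> g x \<le> b"
proof -
  have ball: "AE x in lborel. x \<in> ball c r \<longrightarrow> g x \<le> b" if cr: "cball c r \<subseteq> V" for c r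
  proof -
    \<comment> \<open>The function \<open>g - b\<close>, cut off to a closed ball inside
      \<open>V\<close>. It is integrable, so its absolute value dominates both limits taken
      below.\<close>
    define w where "w x = indicator (cball c r) x * g x - b * indicator (cball c r) x" for x
    have w: "integrable lborel w" unfolding w_def
      using cr by (intro Bochner_Integration.integrable_diff loc integrable_mult_right integrable_real_indicator)
        (use emeasure_bounded_finite[OF bounded_cball] in \<open>auto simp: less_top\<close>)
    then have [measurable]: "w \<in> borel_measurable borel" by simp
    have op: "(LINT x|lborel. indicator G x * w x) \<le> 0" if G: "open G" "G \<subseteq> ball c r" for G
    proof -
      obtain \<phi> :: "nat \<Rightarrow> 'n rvec \<Rightarrow> real" where \<phi>: "\<And>n. test_function G (\<phi> n)"
        "\<And>n x. 0 \<le> \<phi> n x" "\<And>n x. \<phi> n x \<le> indicator G x" "\<And>x. (\<lambda>n. \<phi> n x) \<longlonglongrightarrow> indicator G x"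
        using test_functions_approx_open[OF G(1)] by blast
      have [measurable]: "\<phi> n \<in> borel_measurable borel" "G \<in> sets borel" for n
        using smooth_borel_test[OF \<phi>(1)] G(1) by auto
      have GV: "G \<subseteq> V" using G(2) cr ball_subset_cball by blast
      have "(LINT x|lborel. \<phi> n x * w x) \<le> 0" for n
      proof -
        have supp: "\<phi> n x = 0" if "x \<notin> cball c r" for x
        proof -
          have "x \<notin> G" using that G(2) by auto
          then show ?thesis using \<phi>(2,3)[of n x] by simp
        qed
        have "\<phi> n x * w x = \<phi> n x * (indicator (cball c r) x * g x) - b * \<phi> n x" for x
          using supp[of x] by (cases "x \<in> cball c r") (auto simp: w_def algebra_simps)
        moreover have "\<phi> n x * (indicator (cball c r) x * g x) = g x * \<phi> n x" for x
          using supp[of x] by (cases "x \<in> cball c r") auto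
        moreover have "integrable lborel (\<lambda>x. g x * \<phi> n x)"
        proof (rule Bochner_Integration.integrable_bound)
          show "integrable lborel (\<lambda>x. indicator (cball c r) x * g x)" by (rule loc) (use cr in auto)
          show "AE x in lborel. norm (g x * \<phi> n x) \<le> norm (indicator (cball c r) x * g x)"
          proof (rule AE_I2)
            fix x
            have "\<phi> n x \<le> 1" using order_trans[OF \<phi>(3)[of n x] indicator_le_1] .
            then show "norm (g x * \<phi> n x) \<le> norm (indicator (cball c r) x * g x)"
              using supp[of x] \<phi>(2)[of n x] by (cases "x \<in> cball c r") (auto simp: abs_mult mult_left_le)
          qed
        qed auto
        moreover have "integrable lborel (\<phi> n)" by (rule test_function_integrable[OF \<phi>(1)])
        ultimately have "(LINT x|lborel. \<phi> n x * w x) = (LINT x|lborel. g x * \<phi> n x) - b * (LINT x|lborel. \<phi> n x)"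
          by simp
        moreover have "test_function V (\<phi> n)" using \<phi>(1) GV by (rule test_function_mono)
        ultimately show ?thesis using test[of "\<phi> n"] \<phi>(2) by simp
      qed
      moreover have "(\<lambda>n. LINT x|lborel. \<phi> n x * w x) \<longlonglongrightarrow> (LINT x|lborel. indicator G x * w x)"
      proof (rule integral_dominated_convergence[where w = "\<lambda>x. norm (w x)"])
        show "AE x in lborel. (\<lambda>n. \<phi> n x * w x) \<longlonglongrightarrow> indicator G x * w x"
          using \<phi>(4) by (intro AE_I2 tendsto_intros)
        show "AE x in lborel. norm (\<phi> n x * w x) \<le> norm (w x)" for n
        proof (rule AE_I2)
          fix x
          have "\<phi> n x \<le> 1" using order_trans[OF \<phi>(3)[of n x] indicator_le_1] .
          then show "norm (\<phi> n x * w x) \<le> norm (w x)"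
            using \<phi>(2)[of n x] by (auto simp: abs_mult mult_left_le_one_le)
        qed
      qed (use w in auto)
      ultimately show ?thesis by (meson LIMSEQ_le_const2)
    qed
    define A where "A = {x \<in> ball c r. g x > b}"
    have A [measurable]: "A \<in> sets borel" unfolding A_def by measurable
    have Aleb: "A \<in> sets lebesgue" using A by simp
    have "\<exists>T. open T \<and> A \<subseteq> T \<and> emeasure lebesgue (T - A) < ennreal (inverse (real (Suc n)))" for n
      using sets_lebesgue_outer_open[OF Aleb, of "inverse (real (Suc n))"] by (metis of_nat_0_less_iff positive_imp_inverse_positive zero_less_Suc)
    then obtain T where T: "\<And>n. open (T n)" "\<And>n. A \<subseteq> T n" "\<And>n. emeasure lebesgue (T n - A) < ennreal (inverse (real (Suc n)))"
      by metis
    \<comment> \<open>Finite intersections make the open neighbourhoods of \<open>A\<close>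
      decrease, so that their indicators converge to that of \<open>A\<close> outside the null set
      \<open>(\<Inter>n. H n) - A\<close>.\<close>
    define H where "H n = ball c r \<inter> (\<Inter>i\<le>n. T i)" for n
    have H: "open (H n)" "H n \<subseteq> ball c r" "A \<subseteq> H n" for n
      unfolding H_def using T(1,2) by (auto simp: A_def)
    have [measurable]: "H n \<in> sets borel" "T n \<in> sets borel" for n using H(1) T(1) by auto
    have null: "(\<Inter>n. H n) - A \<in> null_sets lborel"
    proof -
      have "emeasure lborel ((\<Inter>n. H n) - A) \<le> ennreal (inverse (real (Suc n)))" for n
      proof -
        have "emeasure lborel ((\<Inter>n. H n) - A) \<le> emeasure lborel (T n - A)"
          by (intro emeasure_mono) (auto simp: H_def)
        also have "\<dots> = emeasure lebesgue (T n - A)" by simp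
        finally show ?thesis using T(3)[of n] by (meson less_imp_le order_trans)
      qed
      moreover have "(\<lambda>n. ennreal (inverse (real (Suc n)))) \<longlonglongrightarrow> ennreal 0"
        by (intro tendsto_ennrealI LIMSEQ_inverse_real_of_nat)
      ultimately have "emeasure lborel ((\<Inter>n. H n) - A) \<le> 0"
        unfolding ennreal_0 by (intro LIMSEQ_le_const[of _ 0]) blast+
      then show ?thesis by (intro null_setsI) auto
    qed
    have "(\<lambda>n. LINT x|lborel. indicator (H n) x * w x) \<longlonglongrightarrow> (LINT x|lborel. indicator A x * w x)"
    proof (rule integral_dominated_convergence[where w = "\<lambda>x. norm (w x)"])
      show "AE x in lborel. (\<lambda>n. indicator (H n) x * w x) \<longlonglongrightarrow> indicator A x * w x"
        using AE_not_in[OF null]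
      proof eventually_elim
        case (elim x)
        show ?case
        proof (cases "x \<in> A")
          case True
          then have "x \<in> H n" for n using H(3) by blast
          then show ?thesis using True by simp
        next
          case False
          then obtain k where k: "x \<notin> H k" using elim by blast
          have "\<forall>\<^sub>F n in sequentially. indicator (H n) x * w x = 0"
            using eventually_ge_at_top[of k]
          proof eventually_elim
            case (elim n)
            then have "H n \<subseteq> H k" unfolding H_def by auto
            then have "x \<notin> H n" using k by blast
            then show ?case by simp
          qed
          then show ?thesis using False by (simp add: tendsto_eventually)
        qed
      qed
    qed (use w in \<open>auto simp: indicator_def\<close>)
    moreover have "(LINT x|lborel. indicator (H n) x * w x) \<le> 0" for n by (rule op[OF H(1,2)])
    ultimately have le: "(LINT x|lborel. indicator A x * w x) \<le> 0" by (meson LIMSEQ_le_const2)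
    have nn: "0 \<le> indicator A x * w x" for x
      by (auto simp: A_def w_def indicator_def)
    have int: "integrable lborel (\<lambda>x. indicator A x * w x)"
      by (rule Bochner_Integration.integrable_bound[OF w]) (auto simp: indicator_def)
    have "AE x in lborel. indicator A x * w x = 0"
    proof (rule integral_nonneg_eq_0_iff_AE[OF int, THEN iffD1])
      show "AE x in lborel. 0 \<le> indicator A x * w x" using nn by (rule AE_I2)
      have "0 \<le> (LINT x|lborel. indicator A x * w x)" using nn by (rule Bochner_Integration.integral_nonneg)
      then show "(LINT x|lborel. indicator A x * w x) = 0" using le by simp
    qed
    then show ?thesis
      by eventually_elim (auto simp: A_def w_def indicator_def not_less split: if_splits)
  qed
  \<comment> \<open>Countably many of these balls cover \<open>V\<close>, so the exceptional null
    sets can be united.\<close>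
  define \<B> where "\<B> = {ball c r |c r. cball c r \<subseteq> V}"
  have "open B" if "B \<in> \<B>" for B using that unfolding \<B>_def by auto
  then obtain \<B>' where B': "\<B>' \<subseteq> \<B>" "countable \<B>'" "\<Union>\<B>' = \<Union>\<B>"
    using Lindelof[of \<B>] by metis
  have "AE x in lborel. \<forall>B\<in>\<B>'. x \<in> B \<longrightarrow> g x \<le> b"
    using B'(1) ball by (intro AE_ball_countable' B'(2)) (auto simp: \<B>_def)
  moreover have "V \<subseteq> \<Union>\<B>'"
  proof
    fix x assume "x \<in> V"
    then obtain r where "r > 0" "cball x r \<subseteq> V" using V open_contains_cball by blast
    then show "x \<in> \<Union>\<B>'" unfolding B'(3) \<B>_def using centre_in_ball by blast
  qed
  ultimately show ?thesis by (auto elim!: eventually_mono)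
qed

subsection \<open>Uniqueness and composition of weak derivatives\<close>

lemma lebesgue_on_integral_test:
  fixes D :: "'n::finite rvec set"
  assumes "open D" "locally_integrable D v" "borel_loc_int D g" "AE x in lborel. x \<in> D \<longrightarrow> g x = v x"
    and "test_function D \<phi>"
  shows "(LINT x|lebesgue_on D. v x * \<phi> x) = (LINT x|lborel. g x * \<phi> x)"
  using lebesgue_on_integral_representative assms smooth_borel_test by blast

lemma borel_loc_int_eq_AE:
  fixes g g' :: "'n::finite rvec \<Rightarrow> real"
  assumes D: "open D" and g: "borel_loc_int D g" "borel_loc_int D g'"
    and eq: "\<And>\<phi>. test_function D \<phi> \<Longrightarrow> (LINT x|lborel. g x * \<phi> x) = (LINT x|lborel. g' x * \<phi> x)"
  shows "AE x in lborel. g x = g' x"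
proof -
  have le: "AE x in lborel. x \<in> D \<longrightarrow> f x - f' x \<le> 0"
    if f: "borel_loc_int D f" "borel_loc_int D f'"
      and feq: "\<And>\<phi>. test_function D \<phi> \<Longrightarrow> (LINT x|lborel. f x * \<phi> x) = (LINT x|lborel. f' x * \<phi> x)" for f f'
  proof (rule AE_le_const_of_test_functions[OF D])
    show "(\<lambda>x. f x - f' x) \<in> borel_measurable borel"
      using f by (auto simp: borel_loc_int_def)
    show "integrable lborel (\<lambda>x. indicator K x * (f x - f' x))" if "compact K" "K \<subseteq> D" for K
      using f that by (simp add: borel_loc_int_def right_diff_distrib)
    show "(LINT x|lborel. (f x - f' x) * \<phi> x) \<le> 0 * (LINT x|lborel. \<phi> x)" if \<phi>: "test_function D \<phi>" for \<phi>
      using feq[OF \<phi>] borel_loc_int_times_integrable[OF f(1) \<phi>] borel_loc_int_times_integrable[OF f(2) \<phi>]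
      by (simp add: left_diff_distrib)
  qed
  have "AE x in lborel. x \<in> D \<longrightarrow> g x - g' x \<le> 0" by (rule le[OF g eq])
  moreover have "AE x in lborel. x \<in> D \<longrightarrow> g' x - g x \<le> 0" by (rule le[OF g(2,1) eq[symmetric]])
  ultimately show ?thesis
    by eventually_elim (use g in \<open>fastforce simp: borel_loc_int_def\<close>)
qed

lemma weak_deriv_unique:
  assumes D: "open D" and v: "has_weak_deriv D \<alpha> u v" "has_weak_deriv D \<alpha> u v'"
  shows "AE x in lborel. x \<in> D \<longrightarrow> v x = v' x"
proof -
  have l: "locally_integrable D v" "locally_integrable D v'" using v by (auto simp: has_weak_deriv_def)
  obtain g where g: "borel_loc_int D g" "AE x in lborel. x \<in> D \<longrightarrow> g x = v x"
    using borel_representative[OF D l(1)] by blast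
  obtain g' where g': "borel_loc_int D g'" "AE x in lborel. x \<in> D \<longrightarrow> g' x = v' x"
    using borel_representative[OF D l(2)] by blast
  have "AE x in lborel. g x = g' x"
  proof (rule borel_loc_int_eq_AE[OF D g(1) g'(1)])
    fix \<phi> :: "'a rvec \<Rightarrow> real" assume \<phi>: "test_function D \<phi>"
    have "(LINT x|lebesgue_on D. u x * mi_partial \<alpha> \<phi> x) = (- 1) ^ mi_order \<alpha> * (LINT x|lebesgue_on D. v x * \<phi> x)"
      using v(1) \<phi> by (simp add: has_weak_deriv_def)
    moreover have "(LINT x|lebesgue_on D. u x * mi_partial \<alpha> \<phi> x) = (- 1) ^ mi_order \<alpha> * (LINT x|lebesgue_on D. v' x * \<phi> x)"
      using v(2) \<phi> by (simp add: has_weak_deriv_def)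
    ultimately show "(LINT x|lborel. g x * \<phi> x) = (LINT x|lborel. g' x * \<phi> x)"
      using lebesgue_on_integral_test[OF D l(1) g \<phi>] lebesgue_on_integral_test[OF D l(2) g' \<phi>] by simp
  qed
  with g(2) g'(2) show ?thesis by eventually_elim auto
qed

lemma has_weak_deriv_weak_deriv:
  "has_weak_deriv D \<alpha> u v \<Longrightarrow> has_weak_deriv D \<alpha> u (weak_deriv D \<alpha> u)"
  unfolding weak_deriv_def by (rule someI[of "has_weak_deriv D \<alpha> u"])

definition weak_rep :: "('n::{finite,linorder} rvec) set \<Rightarrow> ('n \<Rightarrow> nat) \<Rightarrow> ('n rvec \<Rightarrow> real) \<Rightarrow> 'n rvec \<Rightarrow> real" where
  "weak_rep D \<alpha> u = (SOME g. borel_loc_int D g \<and> (AE x in lborel. x \<in> D \<longrightarrow> g x = weak_deriv D \<alpha> u x))"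

lemma weak_rep:
  assumes D: "open D" and u: "weakly_differentiable m D u" and \<alpha>: "mi_order \<alpha> \<le> m"
  shows weak_rep_loc_int: "borel_loc_int D (weak_rep D \<alpha> u)"
    and weak_rep_AE: "AE x in lborel. x \<in> D \<longrightarrow> weak_rep D \<alpha> u x = weak_deriv D \<alpha> u x"
    and weak_rep_test: "\<And>\<phi>. test_function D \<phi> \<Longrightarrow>
        (LINT x|lebesgue_on D. u x * mi_partial \<alpha> \<phi> x) = (- 1) ^ mi_order \<alpha> * (LINT x|lborel. weak_rep D \<alpha> u x * \<phi> x)"
proof -
  have h: "has_weak_deriv D \<alpha> u (weak_deriv D \<alpha> u)"
    using u \<alpha> has_weak_deriv_weak_deriv unfolding weakly_differentiable_def mi_upto_def by blast
  then have l: "locally_integrable D (weak_deriv D \<alpha> u)" by (simp add: has_weak_deriv_def)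
  obtain g where "borel_loc_int D g \<and> (AE x in lborel. x \<in> D \<longrightarrow> g x = weak_deriv D \<alpha> u x)"
    using borel_representative[OF D l] by blast
  then have *: "borel_loc_int D (weak_rep D \<alpha> u) \<and> (AE x in lborel. x \<in> D \<longrightarrow> weak_rep D \<alpha> u x = weak_deriv D \<alpha> u x)"
    unfolding weak_rep_def
    by (rule someI[of "\<lambda>g. borel_loc_int D g \<and> (AE x in lborel. x \<in> D \<longrightarrow> g x = weak_deriv D \<alpha> u x)"])
  then show "borel_loc_int D (weak_rep D \<alpha> u)" "AE x in lborel. x \<in> D \<longrightarrow> weak_rep D \<alpha> u x = weak_deriv D \<alpha> u x" by auto
  fix \<phi> :: "'a rvec \<Rightarrow> real" assume \<phi>: "test_function D \<phi>"
  show "(LINT x|lebesgue_on D. u x * mi_partial \<alpha> \<phi> x) = (- 1) ^ mi_order \<alpha> * (LINT x|lborel. weak_rep D \<alpha> u x * \<phi> x)"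
    using h \<phi> lebesgue_on_integral_test[OF D l conjunct1[OF *] conjunct2[OF *] \<phi>]
    by (simp add: has_weak_deriv_def)
qed

text \<open>The only information about the weak derivatives that the Taylor argument uses: one
  integration by parts per letter. With words instead of multi-indices, differentiating along a line
  is a plain sum over the next letter.\<close>

definition weak_family :: "('n::finite rvec) set \<Rightarrow> nat \<Rightarrow> ('n list \<Rightarrow> 'n rvec \<Rightarrow> real) \<Rightarrow> bool" where
  "weak_family D k G \<longleftrightarrow> (\<forall>js. length js \<le> k \<longrightarrow> borel_loc_int D (G js)) \<and>
     (\<forall>js i \<psi>. length js < k \<longrightarrow> test_function D \<psi> \<longrightarrow>
        (LINT x|lborel. G js x * partial i \<psi> x) = - (LINT x|lborel. G (i # js) x * \<psi> x))"

text \<open>Both pairings equal, up to sign, the pairing of \<open>u\<close> itself with the same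
  derivative of the test function, since the order of its letters does not matter. The orders differ
  by one, which leaves the single minus sign.\<close>

lemma weak_family_weak_rep:
  fixes \<beta> :: "'n::{finite,linorder} \<Rightarrow> nat"
  assumes D: "open D" and u: "weakly_differentiable m D u" and k: "mi_order \<beta> + k \<le> m"
  shows "weak_family D k (\<lambda>js. weak_rep D (\<lambda>i. \<beta> i + count (mset js) i) u)"
  unfolding weak_family_def
proof (intro conjI allI impI)
  fix js :: "'n list" assume "length js \<le> k"
  then show "borel_loc_int D (weak_rep D (\<lambda>i. \<beta> i + count (mset js) i) u)"
    using k by (intro weak_rep_loc_int[OF D u]) (simp add: mi_order_add mi_order_count)
next
  fix js :: "'n list" and i \<psi> assume l: "length js < k" and \<psi>: "test_function D \<psi>"
  note sm = test_function_smooth[OF \<psi>]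
  have p: "test_function D (partial i \<psi>)"
    using test_function_iter_partial[OF \<psi>, of "[i]"] by (simp add: iter_partial_Cons)
  let ?a = "\<lambda>i. \<beta> i + count (mset js) i" and ?b = "\<lambda>j. \<beta> j + count (mset (i # js)) j"
  have o: "mi_order ?a \<le> m" "mi_order ?b = Suc (mi_order ?a)" "mi_order ?b \<le> m"
    using k l by (auto simp only: mi_order_add mi_order_count length_Cons)
  have "mi_partial ?a (partial i \<psi>) = iter_partial (mi_list ?a @ [i]) \<psi>"
    by (simp add: mi_partial_eq iter_partial_snoc)
  also have "\<dots> = mi_partial ?b \<psi>"
    unfolding mi_partial_eq by (rule iter_partial_mset_cong[OF sm]) (simp add: multiset_eq_iff count_mi_list)
  finally have "(- 1) ^ mi_order ?a * (LINT x|lborel. weak_rep D ?a u x * partial i \<psi> x)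
      = (- 1) ^ mi_order ?b * (LINT x|lborel. weak_rep D ?b u x * \<psi> x)"
    using weak_rep_test[OF D u o(1) p] weak_rep_test[OF D u o(3) \<psi>] by simp
  then have "(- 1) ^ mi_order ?a * ((LINT x|lborel. weak_rep D ?a u x * partial i \<psi> x) + (LINT x|lborel. weak_rep D ?b u x * \<psi> x)) = 0"
    unfolding o(2) by (simp add: distrib_left)
  then show "(LINT x|lborel. weak_rep D ?a u x * partial i \<psi> x) = - (LINT x|lborel. weak_rep D ?b u x * \<psi> x)"
    unfolding mult_eq_0_iff by (simp add: eq_neg_iff_add_eq_0)
qed

section \<open>Classical derivatives of smooth functions as weak derivatives\<close>

lemma smooth_locally_integrable:
  fixes u :: "'n::finite rvec \<Rightarrow> real"
  assumes u: "smooth_on UNIV u"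
  shows "locally_integrable D u"
  unfolding locally_integrable_def
proof (intro allI impI, elim conjE)
  fix K :: "'n rvec set" assume K: "compact K" "K \<subseteq> D"
  have [measurable]: "K \<in> sets borel" "u \<in> borel_measurable borel"
    using borel_compact[OF K(1)] smooth_borel_measurable[OF u] by auto
  have "integrable lborel (\<lambda>x. indicator K x *\<^sub>R u x)"
    by (rule borel_integrable_compact[OF K(1) smooth_continuous_on[OF u]])
  then have "integrable lebesgue (\<lambda>x. indicator K x *\<^sub>R u x)"
    by (subst integrable_completion) auto
  then show "integrable (lebesgue_on K) u"
    by (subst integrable_restrict_space) auto
qed

lemma smooth_lebesgue_on_integral_test:
  fixes u \<phi> :: "'n::finite rvec \<Rightarrow> real"
  assumes D: "open D" and u: "smooth_on UNIV u" and \<phi>: "test_function D \<phi>"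
  shows "(LINT x|lebesgue_on D. u x * \<phi> x) = (LINT x|lborel. u x * \<phi> x)"
proof -
  obtain K where K: "compact K" "K \<subseteq> D" "\<And>x. x \<notin> K \<Longrightarrow> \<phi> x = 0"
    using test_function_support[OF \<phi>] by blast
  have [measurable]: "u \<in> borel_measurable borel" "\<phi> \<in> borel_measurable borel"
    using smooth_borel_measurable u smooth_borel_test[OF \<phi>] by auto
  have "(LINT x|lebesgue_on D. u x * \<phi> x) = (LINT x|lebesgue. indicator D x *\<^sub>R (u x * \<phi> x))"
    using D by (subst integral_restrict_space) auto
  also have "(\<lambda>x. indicator D x *\<^sub>R (u x * \<phi> x)) = (\<lambda>x. u x * \<phi> x)"
  proof
    fix x show "indicator D x *\<^sub>R (u x * \<phi> x) = u x * \<phi> x"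
      using K(2,3) by (cases "x \<in> D") auto
  qed
  also have "(LINT x|lebesgue. u x * \<phi> x) = (LINT x|lborel. u x * \<phi> x)"
    by (rule integral_completion) auto
  finally show ?thesis .
qed

lemma smooth_has_weak_deriv:
  assumes D: "open D" and u: "smooth_on UNIV u"
  shows "has_weak_deriv D \<alpha> u (mi_partial \<alpha> u)"
  unfolding has_weak_deriv_def
proof (intro conjI allI impI)
  show "locally_integrable D u" "locally_integrable D (mi_partial \<alpha> u)"
    by (auto intro!: smooth_locally_integrable u smooth_on_iter_partial simp: mi_partial_eq)
  fix \<phi> :: "'a rvec \<Rightarrow> real" assume \<phi>: "test_function D \<phi>"
  have "(LINT x|lebesgue_on D. u x * mi_partial \<alpha> \<phi> x) = (LINT x|lborel. u x * mi_partial \<alpha> \<phi> x)"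
    unfolding mi_partial_eq by (rule smooth_lebesgue_on_integral_test[OF D u test_function_iter_partial[OF \<phi>]])
  also have "\<dots> = (- 1) ^ mi_order \<alpha> * (LINT x|lborel. mi_partial \<alpha> u x * \<phi> x)"
    unfolding mi_partial_eq
    using integration_by_parts[OF u test_function_mono[OF \<phi> subset_UNIV], of "mi_list \<alpha>"] by (simp add: length_mi_list)
  also have "(LINT x|lborel. mi_partial \<alpha> u x * \<phi> x) = (LINT x|lebesgue_on D. mi_partial \<alpha> u x * \<phi> x)"
    unfolding mi_partial_eq by (rule smooth_lebesgue_on_integral_test[OF D smooth_on_iter_partial[OF u] \<phi>, symmetric])
  finally show "(LINT x|lebesgue_on D. u x * mi_partial \<alpha> \<phi> x) =
      (- 1) ^ mi_order \<alpha> * (LINT x|lebesgue_on D. mi_partial \<alpha> u x * \<phi> x)" .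
qed

lemma smooth_weakly_differentiable:
  assumes D: "open D" and u: "smooth_on UNIV u"
  shows "weakly_differentiable m D u"
  unfolding weakly_differentiable_def
proof (intro conjI ballI)
  have "u \<in> borel_measurable lebesgue"
    by (intro measurable_completion) (use smooth_borel_measurable[OF u] in auto)
  then show "u \<in> borel_measurable (lebesgue_on D)" by (rule measurable_restrict_space1)
qed (use smooth_has_weak_deriv[OF assms] in blast)

lemma smooth_weak_deriv_AE:
  assumes D: "open D" and u: "smooth_on UNIV u"
  shows "AE x in lborel. x \<in> D \<longrightarrow> weak_deriv D \<alpha> u x = mi_partial \<alpha> u x"
  using smooth_has_weak_deriv[OF assms] by (intro weak_deriv_unique[OF D]) (auto intro: has_weak_deriv_weak_deriv)

section \<open>A pointwise Sobolev inequality on cones\<close>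

lemma test_function_translate:
  fixes \<phi> :: "'n::finite rvec \<Rightarrow> real"
  assumes \<phi>: "test_function V \<phi>" and "\<And>x. x \<in> V \<Longrightarrow> x + z \<in> D"
  shows "test_function D (\<lambda>y. \<phi> (y - z))"
proof -
  obtain K where K: "compact K" "K \<subseteq> V" "\<And>x. x \<notin> K \<Longrightarrow> \<phi> x = 0"
    using test_function_support[OF \<phi>] by blast
  show ?thesis
  proof (rule test_functionI)
    show "smooth_on UNIV (\<lambda>y. \<phi> (y - z))"
      using smooth_on_affine[OF test_function_smooth[OF \<phi>], of "- z" 1 0] by (simp add: add.commute[of "- z"])
    show "compact ((+) z ` K)" using K(1) by (rule compact_translation)
    show "(+) z ` K \<subseteq> D" using K(2) assms(2) by (auto simp: add.commute)
    show "x \<in> (+) z ` K" if "\<phi> (x - z) \<noteq> 0" for x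
      using that K(3) by (intro image_eqI[of _ _ "x - z"]) auto
  qed
qed

lemma partial_translate:
  fixes \<phi> :: "'n::finite rvec \<Rightarrow> real"
  assumes "smooth_on UNIV \<phi>"
  shows "partial i (\<lambda>y. \<phi> (y - z)) = (\<lambda>y. partial i \<phi> (y - z))"
  using iter_partial_affine[OF assms, of "[i]" "- z" 1 0] by (simp add: iter_partial_Cons add.commute[of "- z"])

text \<open>The difference quotient falls on the smooth factor, where the limit is taken under the
  integral; the weak derivative then moves it to \<open>G\<close>. The derivative is relative to
  \<open>{0..h}\<close> because translates by other parameters may leave \<open>D\<close>.\<close>

lemma translated_pairing_deriv:
  fixes G :: "'n::finite list \<Rightarrow> 'n rvec \<Rightarrow> real"
  assumes G: "weak_family D k G" and js: "length js < k" and \<phi>: "test_function V \<phi>"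
    and sub: "\<And>x t. x \<in> V \<Longrightarrow> t \<in> {0..h} \<Longrightarrow> x + t *\<^sub>R w \<in> D" and t: "t \<in> {0..h}"
  shows "((\<lambda>t. LINT y|lborel. G js y * \<phi> (y - t *\<^sub>R w)) has_real_derivative
     (\<Sum>i\<in>UNIV. w $ i * (LINT y|lborel. G (i # js) y * \<phi> (y - t *\<^sub>R w)))) (at t within {0..h})"
proof -
  note sm = test_function_smooth[OF \<phi>]
  let ?D = "\<lambda>z. \<Sum>i\<in>UNIV. w $ i * partial i \<phi> z"
  obtain K where K: "compact K" "K \<subseteq> V" "\<And>x. x \<notin> K \<Longrightarrow> \<phi> x = 0"
    using test_function_support[OF \<phi>] by blast
  \<comment> \<open>The compact set swept out by the translated supports; on it \<open>G js\<close>
    is integrable, which provides the dominating function.\<close>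
  define K' where "K' = (\<lambda>(x, t). x + t *\<^sub>R w) ` (K \<times> {0..h})"
  have K': "compact K'" "K' \<subseteq> D"
  proof -
    show "compact K'" unfolding K'_def
      by (intro compact_continuous_image compact_Times K(1) compact_Icc)
        (auto simp: case_prod_beta intro!: continuous_intros)
    show "K' \<subseteq> D" unfolding K'_def by (rule image_subsetI) (use K(2) in \<open>auto intro!: sub\<close>)
  qed
  have supp: "\<phi> (y - s *\<^sub>R w) = 0" if "s \<in> {0..h}" "y \<notin> K'" for s y
  proof (rule K(3), rule notI)
    assume "y - s *\<^sub>R w \<in> K"
    then have "y \<in> K'" unfolding K'_def using that(1) by (intro image_eqI[of _ _ "(y - s *\<^sub>R w, s)"]) auto
    then show False using that(2) by simp
  qed
  have p: "test_function V (partial i \<phi>)" for i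
    using test_function_iter_partial[OF \<phi>, of "[i]"] by (simp add: iter_partial_Cons)
  have "\<exists>B. B \<ge> 0 \<and> (\<forall>x. \<bar>partial i \<phi> x\<bar> \<le> B)" for i
    using test_function_bounded[OF p[of i]] by metis
  then obtain Bi where Bi: "\<And>i. Bi i \<ge> 0" "\<And>i x. \<bar>partial i \<phi> x\<bar> \<le> Bi i" by metis
  define B where "B = (\<Sum>i\<in>UNIV. \<bar>w $ i\<bar> * Bi i)"
  have B0: "B \<ge> 0" unfolding B_def using Bi(1) by (intro sum_nonneg) auto
  have B: "\<bar>?D z\<bar> \<le> B" for z
    unfolding B_def by (rule order_trans[OF sum_abs]) (auto simp: abs_mult intro!: sum_mono mult_left_mono Bi(2))
  have loc: "borel_loc_int D (G js)" using G js by (simp add: weak_family_def)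
  have [measurable]: "G js \<in> borel_measurable borel" "\<phi> \<in> borel_measurable borel" "\<And>i. partial i \<phi> \<in> borel_measurable borel"
    using loc smooth_borel_test[OF \<phi>] smooth_borel_test[OF p] by (auto simp: borel_loc_int_def)
  have dphi: "((\<lambda>s. \<phi> (y - s *\<^sub>R w)) has_real_derivative - ?D (y - s *\<^sub>R w)) (at s)" for y s
    using smooth_has_derivative_line[OF sm, of y "- w" s] by (simp add: sum_negf)
  have "(\<lambda>n. ((LINT y|lborel. G js y * \<phi> (y - s n *\<^sub>R w)) - (LINT y|lborel. G js y * \<phi> (y - t *\<^sub>R w))) / (s n - t))
      \<longlonglongrightarrow> (LINT y|lborel. G js y * - ?D (y - t *\<^sub>R w))"
    if s: "\<And>n. s n \<in> {0..h} - {t}" "s \<longlonglongrightarrow> t" for s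
  proof -
    have int: "integrable lborel (\<lambda>y. G js y * \<phi> (y - r *\<^sub>R w))" if "r \<in> {0..h}" for r
      using sub that by (intro borel_loc_int_times_integrable[OF loc] test_function_translate[OF \<phi>]) auto
    have "((LINT y|lborel. G js y * \<phi> (y - s n *\<^sub>R w)) - (LINT y|lborel. G js y * \<phi> (y - t *\<^sub>R w))) / (s n - t)
      = (LINT y|lborel. G js y * ((\<phi> (y - s n *\<^sub>R w) - \<phi> (y - t *\<^sub>R w)) / (s n - t)))" for n
      using int[of "s n"] int[OF t] s(1)[of n] by (simp add: right_diff_distrib diff_divide_distrib)
    moreover have "(\<lambda>n. LINT y|lborel. G js y * ((\<phi> (y - s n *\<^sub>R w) - \<phi> (y - t *\<^sub>R w)) / (s n - t)))
        \<longlonglongrightarrow> (LINT y|lborel. G js y * - ?D (y - t *\<^sub>R w))"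
    proof (rule integral_dominated_convergence[where w = "\<lambda>y. B * norm (indicator K' y * G js y)"])
      show "integrable lborel (\<lambda>y. B * norm (indicator K' y * G js y))"
        using loc K' unfolding borel_loc_int_def by (intro integrable_mult_right integrable_norm) blast
      show "AE y in lborel. (\<lambda>n. G js y * ((\<phi> (y - s n *\<^sub>R w) - \<phi> (y - t *\<^sub>R w)) / (s n - t)))
          \<longlonglongrightarrow> G js y * - ?D (y - t *\<^sub>R w)"
      proof (rule AE_I2)
        fix y
        have "filterlim s (at t) sequentially"
          using s by (intro filterlim_atI) (auto intro!: always_eventually)
        from filterlim_compose[OF dphi[of y t, unfolded has_field_derivative_iff] this]
        show "(\<lambda>n. G js y * ((\<phi> (y - s n *\<^sub>R w) - \<phi> (y - t *\<^sub>R w)) / (s n - t)))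
          \<longlonglongrightarrow> G js y * - ?D (y - t *\<^sub>R w)"
          by (rule tendsto_mult_left)
      qed
      show "AE y in lborel. norm (G js y * ((\<phi> (y - s n *\<^sub>R w) - \<phi> (y - t *\<^sub>R w)) / (s n - t)))
          \<le> B * norm (indicator K' y * G js y)" for n
      proof (rule AE_I2)
        fix y
        show "norm (G js y * ((\<phi> (y - s n *\<^sub>R w) - \<phi> (y - t *\<^sub>R w)) / (s n - t))) \<le> B * norm (indicator K' y * G js y)"
        proof (cases "y \<in> K'")
          case False
          then show ?thesis using supp[of "s n" y] supp[OF t] s(1)[of n] by simp
        next
          case True
          have "\<bar>\<phi> (y - s n *\<^sub>R w) - \<phi> (y - t *\<^sub>R w)\<bar> \<le> B * \<bar>s n - t\<bar>"
            using field_differentiable_bound[of UNIV "\<lambda>s. \<phi> (y - s *\<^sub>R w)" "\<lambda>s. - ?D (y - s *\<^sub>R w)" B "s n" t] dphi B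
            by auto
          then have "\<bar>(\<phi> (y - s n *\<^sub>R w) - \<phi> (y - t *\<^sub>R w)) / (s n - t)\<bar> \<le> B"
            using s(1)[of n] by (simp add: abs_divide divide_le_eq)
          then have "\<bar>G js y\<bar> * \<bar>(\<phi> (y - s n *\<^sub>R w) - \<phi> (y - t *\<^sub>R w)) / (s n - t)\<bar> \<le> \<bar>G js y\<bar> * B"
            by (intro mult_left_mono) auto
          then show ?thesis using True by (simp add: abs_mult mult.commute)
        qed
      qed
    qed measurable
    ultimately show ?thesis by (simp only:)
  qed
  then have "((\<lambda>s. ((LINT y|lborel. G js y * \<phi> (y - s *\<^sub>R w)) - (LINT y|lborel. G js y * \<phi> (y - t *\<^sub>R w))) / (s - t))
      \<longlongrightarrow> (LINT y|lborel. G js y * - ?D (y - t *\<^sub>R w))) (at t within {0..h})"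
    unfolding tendsto_at_iff_sequentially o_def by blast
  moreover have "(LINT y|lborel. G js y * - ?D (y - t *\<^sub>R w))
      = (\<Sum>i\<in>UNIV. w $ i * (LINT y|lborel. G (i # js) y * \<phi> (y - t *\<^sub>R w)))"
  proof -
    have test: "test_function D (\<lambda>y. \<psi> (y - t *\<^sub>R w))" if "test_function V \<psi>" for \<psi>
      using sub t by (intro test_function_translate[OF that]) auto
    have "(LINT y|lborel. G js y * partial i \<phi> (y - t *\<^sub>R w)) = - (LINT y|lborel. G (i # js) y * \<phi> (y - t *\<^sub>R w))" for i
    proof -
      have "(LINT y|lborel. G js y * partial i (\<lambda>y. \<phi> (y - t *\<^sub>R w)) y) = - (LINT y|lborel. G (i # js) y * \<phi> (y - t *\<^sub>R w))"
        using G js test[OF \<phi>] unfolding weak_family_def by blast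
      then show ?thesis by (simp only: partial_translate[OF sm])
    qed
    moreover have "(LINT y|lborel. G js y * - ?D (y - t *\<^sub>R w))
      = (\<Sum>i\<in>UNIV. - (w $ i * (LINT y|lborel. G js y * partial i \<phi> (y - t *\<^sub>R w))))"
    proof -
      have "(LINT y|lborel. G js y * - ?D (y - t *\<^sub>R w)) = (LINT y|lborel. (\<Sum>i\<in>UNIV. - w $ i * (G js y * partial i \<phi> (y - t *\<^sub>R w))))"
        by (simp add: sum_distrib_left sum_negf mult_ac)
      also have "\<dots> = (\<Sum>i\<in>UNIV. LINT y|lborel. - w $ i * (G js y * partial i \<phi> (y - t *\<^sub>R w)))"
        by (intro Bochner_Integration.integral_sum integrable_mult_right borel_loc_int_times_integrable[OF loc] test p)
      finally show ?thesis by simp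
    qed
    ultimately show ?thesis by simp
  qed
  ultimately show ?thesis unfolding has_field_derivative_iff by simp
qed

subsection \<open>A one-dimensional Taylor identity\<close>

text \<open>The sum is the Taylor polynomial of order \<open>k - 1\<close> at the moving base point
  \<open>t\<close>, evaluated back at 0. Its derivative telescopes: differentiating each power
  cancels the term before it, and only the last one survives.\<close>

lemma taylor_sum_deriv:
  fixes P :: "nat \<Rightarrow> real \<Rightarrow> real"
  assumes "\<And>j. j < k \<Longrightarrow> (P j has_real_derivative P (Suc j) t) (at t within S)" "k \<ge> 1"
  shows "((\<lambda>t. \<Sum>j<k. (- t) ^ j / fact j * P j t) has_real_derivative
     (- t) ^ (k - 1) / fact (k - 1) * P k t) (at t within S)"
  using assms(2,1)
proof (induction k rule: nat_induct_at_least)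
  case base
  then show ?case by simp
next
  case (Suc k)
  obtain n where k: "k = Suc n" using Suc.hyps by (cases k) auto
  have dk: "((\<lambda>t. (- t) ^ k / fact k) has_real_derivative - ((- t) ^ n / fact n)) (at t within S)"
    unfolding k by (auto intro!: derivative_eq_intros simp: divide_simps simp del: power_Suc)
  have "((\<lambda>t. (\<Sum>j<k. (- t) ^ j / fact j * P j t) + (- t) ^ k / fact k * P k t) has_real_derivative
     (- t) ^ (k - 1) / fact (k - 1) * P k t + (- ((- t) ^ n / fact n) * P k t + P (Suc k) t * ((- t) ^ k / fact k))) (at t within S)"
    by (intro DERIV_add DERIV_mult Suc.IH dk Suc.prems) auto
  then show ?case by (simp add: k mult.commute)
qed

text \<open>The fundamental theorem of calculus yields a gauge integral, while the averaging works
  with nonnegative Lebesgue integrals. Absolute integrability is not known beforehand; where it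
  fails, the right side is infinite.\<close>

lemma has_integral_abs_le_nn_integral:
  fixes f :: "real \<Rightarrow> real"
  assumes I: "(f has_integral I) S" and [measurable]: "f \<in> borel_measurable borel" "S \<in> sets borel"
  shows "ennreal \<bar>I\<bar> \<le> (\<integral>\<^sup>+t. ennreal \<bar>f t\<bar> * indicator S t \<partial>lborel)"
proof (cases "(\<integral>\<^sup>+t. ennreal \<bar>f t\<bar> * indicator S t \<partial>lborel) < \<infinity>")
  case True
  have eq: "(\<integral>\<^sup>+t. ennreal \<bar>f t\<bar> * indicator S t \<partial>lborel) = (\<integral>\<^sup>+t. ennreal (norm (indicator S t *\<^sub>R f t)) \<partial>lborel)"
    by (intro nn_integral_cong) (auto simp: indicator_def)
  have int: "integrable lborel (\<lambda>t. indicator S t *\<^sub>R f t)"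
    using True unfolding eq by (intro integrableI_bounded) auto
  have "((\<lambda>t. indicator S t *\<^sub>R f t) has_integral (LINT t|lborel. indicator S t *\<^sub>R f t)) UNIV"
    by (rule has_integral_integral_lborel[OF int])
  moreover have "((\<lambda>t. if t \<in> S then f t else 0) has_integral I) UNIV"
    using I by (subst has_integral_restrict_UNIV)
  moreover have "(\<lambda>t. if t \<in> S then f t else 0) = (\<lambda>t. indicator S t *\<^sub>R f t)" by (auto simp: fun_eq_iff)
  ultimately have "I = (LINT t|lborel. indicator S t *\<^sub>R f t)"
    using has_integral_unique by metis
  then show ?thesis unfolding eq using integral_norm_bound_ennreal[OF int] by simp
qed (simp add: not_less top.extremum_unique)

text \<open>The Taylor polynomial is multiplied by the cut-off \<open>1 - (t / h) ^ k\<close>, which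
  is 1 at 0 and vanishes at \<open>h\<close>, and the derivative of the product is integrated. This
  cut-off is chosen because its derivative carries the factor \<open>t ^ (k - 1)\<close> of the
  Taylor remainder, so that the terms of all orders share one kernel.\<close>

lemma taylor_cone_bound:
  fixes P :: "nat \<Rightarrow> real \<Rightarrow> real"
  assumes P: "\<And>j t. j < k \<Longrightarrow> t \<in> {0..h} \<Longrightarrow> (P j has_real_derivative P (Suc j) t) (at t within {0..h})"
    and k: "k \<ge> 1" and h: "h > 0" and [measurable]: "\<And>j. P j \<in> borel_measurable borel"
  shows "ennreal \<bar>P 0 0\<bar> \<le> (\<integral>\<^sup>+t. ennreal (\<Sum>j\<le>k. real k * t ^ (k - 1) * (h ^ j / h ^ k) * \<bar>P j t\<bar>) * indicator {0..h} t \<partial>lborel)"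
proof -
  define F where "F t = (\<Sum>j<k. (- t) ^ j / fact j * P j t)" for t
  define F' where "F' t = (- t) ^ (k - 1) / fact (k - 1) * P k t" for t
  define H' where "H' t = (1 - (t / h) ^ k) * F' t - real k * t ^ (k - 1) / h ^ k * F t" for t
  have F: "(F has_real_derivative F' t) (at t within {0..h})" if "t \<in> {0..h}" for t
    unfolding F_def F'_def by (rule taylor_sum_deriv[of k P t "{0..h}"]) (use that P k in auto)
  have c: "((\<lambda>t. 1 - (t / h) ^ k) has_real_derivative - (real k * t ^ (k - 1) / h ^ k)) (at t within {0..h})" for t
    using h k by (auto intro!: derivative_eq_intros simp: power_divide)
  have H: "((\<lambda>t. (1 - (t / h) ^ k) * F t) has_real_derivative H' t) (at t within {0..h})" if "t \<in> {0..h}" for t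
    using DERIV_mult[OF c F[OF that]] by (simp add: H'_def algebra_simps)
  have "(H' has_integral (1 - (h / h) ^ k) * F h - (1 - (0 / h) ^ k) * F 0) {0..h}"
    using H h by (intro fundamental_theorem_of_calculus) (auto simp: has_real_derivative_iff_has_vector_derivative)
  moreover have "F 0 = P 0 0"
  proof -
    have "(- 0) ^ j / fact j * P j 0 = (if j = 0 then P 0 0 else 0)" for j by simp
    then show ?thesis unfolding F_def using k by (subst sum.cong[OF refl]) (auto simp: sum.delta)
  qed
  ultimately have I: "(H' has_integral - P 0 0) {0..h}" using h k by (simp add: power_0_left)
  have [measurable]: "H' \<in> borel_measurable borel" unfolding H'_def F'_def F_def by measurable
  have bd: "\<bar>H' t\<bar> \<le> (\<Sum>j\<le>k. real k * t ^ (k - 1) * (h ^ j / h ^ k) * \<bar>P j t\<bar>)" if t: "t \<in> {0..h}" for t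
  proof -
    have t0: "0 \<le> t" "t \<le> h" using t by auto
    have th: "0 \<le> (t / h) ^ k" "(t / h) ^ k \<le> 1" using t0 h by (auto intro!: power_le_one)
    have f1: "\<bar>x / fact j\<bar> \<le> \<bar>x\<bar>" for x :: real and j
    proof -
      have "\<bar>x\<bar> / fact j \<le> \<bar>x\<bar> / 1" by (intro divide_left_mono) (auto simp: fact_ge_1)
      then show ?thesis by simp
    qed
    have "\<bar>(1 - (t / h) ^ k) * F' t\<bar> \<le> 1 * \<bar>F' t\<bar>"
      unfolding abs_mult using th by (intro mult_right_mono) auto
    also have "\<bar>F' t\<bar> \<le> t ^ (k - 1) * \<bar>P k t\<bar>"
      unfolding F'_def abs_mult using f1[of "(- t) ^ (k - 1)" "k - 1"] t0 by (intro mult_right_mono) (auto simp: power_abs)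
    also have "t ^ (k - 1) * \<bar>P k t\<bar> \<le> k * (t ^ (k - 1) * \<bar>P k t\<bar>)"
      using mult_right_mono[of 1 "real k" "t ^ (k - 1) * \<bar>P k t\<bar>"] k t0 by simp
    finally have 1: "\<bar>(1 - (t / h) ^ k) * F' t\<bar> \<le> real k * t ^ (k - 1) * (h ^ k / h ^ k) * \<bar>P k t\<bar>"
      using h by (simp add: mult.assoc)
    have "\<bar>F t\<bar> \<le> (\<Sum>j<k. h ^ j * \<bar>P j t\<bar>)"
      unfolding F_def
    proof (rule order_trans[OF sum_abs], rule sum_mono)
      fix j
      have "\<bar>(- t) ^ j / fact j\<bar> \<le> h ^ j"
        using f1[of "(- t) ^ j" j] power_mono[OF t0(2,1), of j] t0 by (simp add: power_abs)
      then show "\<bar>(- t) ^ j / fact j * P j t\<bar> \<le> h ^ j * \<bar>P j t\<bar>"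
        unfolding abs_mult by (rule mult_right_mono) simp
    qed
    then have "real k * t ^ (k - 1) / h ^ k * \<bar>F t\<bar> \<le> real k * t ^ (k - 1) / h ^ k * (\<Sum>j<k. h ^ j * \<bar>P j t\<bar>)"
      using t0 h by (intro mult_left_mono) auto
    also have "\<dots> = (\<Sum>j<k. real k * t ^ (k - 1) * (h ^ j / h ^ k) * \<bar>P j t\<bar>)"
      by (simp add: sum_distrib_left sum_divide_distrib mult_ac)
    finally have 2: "\<bar>real k * t ^ (k - 1) / h ^ k * F t\<bar> \<le> (\<Sum>j<k. real k * t ^ (k - 1) * (h ^ j / h ^ k) * \<bar>P j t\<bar>)"
      using t0 h by (simp add: abs_mult)
    have "\<bar>H' t\<bar> \<le> \<bar>(1 - (t / h) ^ k) * F' t\<bar> + \<bar>real k * t ^ (k - 1) / h ^ k * F t\<bar>"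
      unfolding H'_def by (rule abs_triangle_ineq4)
    with 1 2 show ?thesis unfolding lessThan_Suc_atMost[symmetric] sum.lessThan_Suc by linarith
  qed
  have "ennreal \<bar>P 0 0\<bar> \<le> (\<integral>\<^sup>+t. ennreal \<bar>H' t\<bar> * indicator {0..h} t \<partial>lborel)"
    using has_integral_abs_le_nn_integral[OF I] by simp
  also have "\<dots> \<le> (\<integral>\<^sup>+t. ennreal (\<Sum>j\<le>k. real k * t ^ (k - 1) * (h ^ j / h ^ k) * \<bar>P j t\<bar>) * indicator {0..h} t \<partial>lborel)"
  proof (rule nn_integral_mono)
    fix t :: real
    show "ennreal \<bar>H' t\<bar> * indicator {0..h} t \<le> ennreal (\<Sum>j\<le>k. real k * t ^ (k - 1) * (h ^ j / h ^ k) * \<bar>P j t\<bar>) * indicator {0..h} t"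
      using ennreal_leI[OF bd[of t]] by (cases "t \<in> {0..h}") auto
  qed
  finally show ?thesis .
qed

subsection \<open>Averaging over a cone\<close>

definition word_prod :: "'n::finite rvec \<Rightarrow> 'n list \<Rightarrow> real" where
  "word_prod w js = prod_list (map (\<lambda>i. w $ i) js)"

lemma word_prod_bound:
  assumes "norm w \<le> W"
  shows "\<bar>word_prod w js\<bar> \<le> W ^ length js"
proof (induction js)
  case (Cons j js)
  have "\<bar>w $ j\<bar> \<le> W" using component_le_norm_cart[of w j] assms by simp
  with Cons show ?case
    by (simp add: word_prod_def abs_mult) (meson abs_ge_zero mult_mono order_trans)
qed (simp add: word_prod_def)

lemma finite_words_length: "finite {js :: 'n::finite list. length js = j}"
  using finite_lists_length_eq[of "UNIV :: 'n set" j] by simp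

lemma sum_words_Suc:
  fixes f :: "'n::finite list \<Rightarrow> real"
  shows "(\<Sum>js | length js = Suc j. f js) = (\<Sum>js | length js = j. \<Sum>i\<in>UNIV. f (i # js))"
proof -
  have "bij_betw (\<lambda>(js, i). i # js) ({js :: 'n list. length js = j} \<times> UNIV) {js. length js = Suc j}"
    by (rule bij_betwI[of _ _ _ "\<lambda>js. (tl js, hd js)"]) (auto simp: length_Suc_conv)
  from sum.reindex_bij_betw[OF this, of f] show ?thesis
    by (simp add: sum.cartesian_product case_prod_beta)
qed

text \<open>The directional derivatives of the pairing along \<open>w\<close> are sums over words
  with coefficients \<open>word_prod w js\<close>. Each coefficient is at most \<open>W ^ k\<close>
  because \<open>W \<ge> 1\<close>, and the one-dimensional Taylor bound applies to these
  sums.\<close>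

lemma line_bound:
  fixes G :: "'n::finite list \<Rightarrow> 'n rvec \<Rightarrow> real"
  assumes G: "weak_family D k G" and k: "k \<ge> 1" and h: "h > 0" and \<phi>: "test_function V \<phi>"
    and nn: "\<And>x. \<phi> x \<ge> 0" and W: "norm w \<le> W" "W \<ge> 1"
    and sub: "\<And>x t. x \<in> V \<Longrightarrow> t \<in> {0..h} \<Longrightarrow> x + t *\<^sub>R w \<in> D"
  shows "ennreal \<bar>LINT y|lborel. G [] y * \<phi> y\<bar> \<le>
     (\<integral>\<^sup>+t. (\<Sum>js | length js \<le> k. ennreal (real k * W ^ k * (h ^ length js / h ^ k)) * (ennreal (t ^ (k - 1)) * indicator {0..h} t *
        (\<integral>\<^sup>+x. ennreal \<bar>G js (x + t *\<^sub>R w)\<bar> * ennreal (\<phi> x) \<partial>lborel))) \<partial>lborel)"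
proof -
  define \<Psi> where "\<Psi> js t = (LINT y|lborel. G js y * \<phi> (y - t *\<^sub>R w))" for js t
  \<comment> \<open>Nothing is known about \<open>G\<close> on words longer than \<open>k\<close>.
    The default 0 there makes \<open>P j\<close> Borel measurable for every \<open>j\<close>, as
    \<open>taylor_cone_bound\<close> demands.\<close>
  define P where "P j t = (\<Sum>js | length js = j. word_prod w js * (if length js \<le> k then \<Psi> js t else 0))" for j t
  have loc: "borel_loc_int D (G js)" if "length js \<le> k" for js using G that by (simp add: weak_family_def)
  have Gm: "G js \<in> borel_measurable borel" if "length js \<le> k" for js
    using loc[OF that] by (simp add: borel_loc_int_def)
  have pm [measurable]: "\<phi> \<in> borel_measurable borel" by (rule smooth_borel_test[OF \<phi>])
  have Pm: "P j \<in> borel_measurable borel" for j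
  proof -
    have "(\<lambda>t. if length js \<le> k then \<Psi> js t else 0) \<in> borel_measurable borel" for js
    proof (cases "length js \<le> k")
      case True
      note [measurable] = Gm[OF True]
      have "(\<lambda>t::real. \<Psi> js t) \<in> borel_measurable borel" unfolding \<Psi>_def by measurable
      then show ?thesis using True by simp
    qed simp
    then show ?thesis unfolding P_def by (intro borel_measurable_sum borel_measurable_times borel_measurable_const)
  qed
  have dP: "(P j has_real_derivative P (Suc j) t) (at t within {0..h})" if j: "j < k" and t: "t \<in> {0..h}" for j t
  proof -
    have "((\<lambda>t. \<Sum>js | length js = j. word_prod w js * \<Psi> js t) has_real_derivative
        (\<Sum>js | length js = j. word_prod w js * (\<Sum>i\<in>UNIV. w $ i * \<Psi> (i # js) t))) (at t within {0..h})"
      unfolding \<Psi>_def using j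
      by (intro DERIV_sum DERIV_cmult translated_pairing_deriv[OF G _ \<phi> sub t]) auto
    moreover have "(\<lambda>t. \<Sum>js | length js = j. word_prod w js * \<Psi> js t) = P j"
      using j by (auto simp: P_def fun_eq_iff intro!: sum.cong)
    moreover have "(\<Sum>js | length js = j. word_prod w js * (\<Sum>i\<in>UNIV. w $ i * \<Psi> (i # js) t)) = P (Suc j) t"
      using j by (simp add: P_def sum_words_Suc word_prod_def sum_distrib_left mult_ac)
    ultimately show ?thesis by simp
  qed
  have P0: "P 0 0 = (LINT y|lborel. G [] y * \<phi> y)"
    by (simp add: P_def \<Psi>_def word_prod_def)
  have Psib: "ennreal \<bar>\<Psi> js t\<bar> \<le> (\<integral>\<^sup>+x. ennreal \<bar>G js (x + t *\<^sub>R w)\<bar> * ennreal (\<phi> x) \<partial>lborel)"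
    if js: "length js \<le> k" and t: "t \<in> {0..h}" for js t
  proof -
    note [measurable] = Gm[OF js]
    have int: "integrable lborel (\<lambda>y. G js y * \<phi> (y - t *\<^sub>R w))"
      using sub t by (intro borel_loc_int_times_integrable[OF loc[OF js]] test_function_translate[OF \<phi>]) auto
    have "ennreal \<bar>\<Psi> js t\<bar> \<le> (\<integral>\<^sup>+y. ennreal (norm (G js y * \<phi> (y - t *\<^sub>R w))) \<partial>lborel)"
      unfolding \<Psi>_def using integral_norm_bound_ennreal[OF int] by simp
    also have "\<dots> = (\<integral>\<^sup>+x. ennreal (norm (G js (t *\<^sub>R w + x) * \<phi> (t *\<^sub>R w + x - t *\<^sub>R w))) \<partial>lborel)"
      by (rule lborel_nn_integral_translate[symmetric]) measurable
    also have "\<dots> = (\<integral>\<^sup>+x. ennreal \<bar>G js (x + t *\<^sub>R w)\<bar> * ennreal (\<phi> x) \<partial>lborel)"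
      using nn by (intro nn_integral_cong) (simp add: abs_mult ennreal_mult add.commute)
    finally show ?thesis .
  qed
  have "ennreal \<bar>LINT y|lborel. G [] y * \<phi> y\<bar> \<le>
      (\<integral>\<^sup>+t. ennreal (\<Sum>j\<le>k. real k * t ^ (k - 1) * (h ^ j / h ^ k) * \<bar>P j t\<bar>) * indicator {0..h} t \<partial>lborel)"
    unfolding P0[symmetric] by (rule taylor_cone_bound[of k h P]) (use dP k h Pm in auto)
  also have "\<dots> \<le> (\<integral>\<^sup>+t. (\<Sum>js | length js \<le> k. ennreal (real k * W ^ k * (h ^ length js / h ^ k)) * (ennreal (t ^ (k - 1)) * indicator {0..h} t *
        (\<integral>\<^sup>+x. ennreal \<bar>G js (x + t *\<^sub>R w)\<bar> * ennreal (\<phi> x) \<partial>lborel))) \<partial>lborel)"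
  proof (rule nn_integral_mono)
    fix t :: real
    show "ennreal (\<Sum>j\<le>k. real k * t ^ (k - 1) * (h ^ j / h ^ k) * \<bar>P j t\<bar>) * indicator {0..h} t
      \<le> (\<Sum>js | length js \<le> k. ennreal (real k * W ^ k * (h ^ length js / h ^ k)) * (ennreal (t ^ (k - 1)) * indicator {0..h} t *
        (\<integral>\<^sup>+x. ennreal \<bar>G js (x + t *\<^sub>R w)\<bar> * ennreal (\<phi> x) \<partial>lborel)))"
    proof (cases "t \<in> {0..h}")
      case True
      then have t0: "0 \<le> t" by simp
      have "(\<Sum>j\<le>k. real k * t ^ (k - 1) * (h ^ j / h ^ k) * \<bar>P j t\<bar>)
          \<le> (\<Sum>j\<le>k. \<Sum>js | length js = j. real k * t ^ (k - 1) * (h ^ length js / h ^ k) * (W ^ k * \<bar>\<Psi> js t\<bar>))"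
      proof (rule sum_mono)
        fix j assume j: "j \<in> {..k}"
        have "\<bar>P j t\<bar> \<le> (\<Sum>js | length js = j. W ^ k * \<bar>\<Psi> js t\<bar>)"
          unfolding P_def
        proof (rule order_trans[OF sum_abs], rule sum_mono)
          fix js :: "'n list" assume js: "js \<in> {js. length js = j}"
          have "\<bar>word_prod w js\<bar> \<le> W ^ j" using word_prod_bound[OF W(1), of js] js by simp
          also have "\<dots> \<le> W ^ k" using W(2) j by (intro power_increasing) auto
          finally show "\<bar>word_prod w js * (if length js \<le> k then \<Psi> js t else 0)\<bar> \<le> W ^ k * \<bar>\<Psi> js t\<bar>"
            using js j by (simp add: abs_mult mult_right_mono)
        qed
        then have "real k * t ^ (k - 1) * (h ^ j / h ^ k) * \<bar>P j t\<bar> \<le> real k * t ^ (k - 1) * (h ^ j / h ^ k) * (\<Sum>js | length js = j. W ^ k * \<bar>\<Psi> js t\<bar>)"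
          using t0 h by (intro mult_left_mono) auto
        then show "real k * t ^ (k - 1) * (h ^ j / h ^ k) * \<bar>P j t\<bar> \<le> (\<Sum>js | length js = j. real k * t ^ (k - 1) * (h ^ length js / h ^ k) * (W ^ k * \<bar>\<Psi> js t\<bar>))"
          by (simp add: sum_distrib_left)
      qed
      also have "\<dots> = (\<Sum>js | length js \<le> k. real k * t ^ (k - 1) * (h ^ length js / h ^ k) * (W ^ k * \<bar>\<Psi> js t\<bar>))"
      proof -
        have eq: "{js :: 'n list. length js \<le> k} = (\<Union>j\<in>{..k}. {js. length js = j})" by auto
        show ?thesis unfolding eq
          by (rule sum.UNION_disjoint[symmetric]) (auto simp: finite_words_length)
      qed
      finally have "ennreal (\<Sum>j\<le>k. real k * t ^ (k - 1) * (h ^ j / h ^ k) * \<bar>P j t\<bar>)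
          \<le> ennreal (\<Sum>js | length js \<le> k. real k * t ^ (k - 1) * (h ^ length js / h ^ k) * (W ^ k * \<bar>\<Psi> js t\<bar>))"
        by (rule ennreal_leI)
      also have "\<dots> = (\<Sum>js | length js \<le> k. ennreal (real k * t ^ (k - 1) * (h ^ length js / h ^ k) * (W ^ k * \<bar>\<Psi> js t\<bar>)))"
        using t0 h W by (intro sum_ennreal[symmetric]) auto
      also have "\<dots> \<le> (\<Sum>js | length js \<le> k. ennreal (real k * W ^ k * (h ^ length js / h ^ k)) * (ennreal (t ^ (k - 1)) * indicator {0..h} t *
        (\<integral>\<^sup>+x. ennreal \<bar>G js (x + t *\<^sub>R w)\<bar> * ennreal (\<phi> x) \<partial>lborel)))"
      proof (rule sum_mono)
        fix js :: "'n list" assume js: "js \<in> {js. length js \<le> k}"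
        have "ennreal (real k * t ^ (k - 1) * (h ^ length js / h ^ k) * (W ^ k * \<bar>\<Psi> js t\<bar>))
          = ennreal (real k * W ^ k * (h ^ length js / h ^ k)) * (ennreal (t ^ (k - 1)) * ennreal \<bar>\<Psi> js t\<bar>)"
          using t0 h W by (simp add: ennreal_mult[symmetric] mult_ac)
        also have "\<dots> \<le> ennreal (real k * W ^ k * (h ^ length js / h ^ k)) * (ennreal (t ^ (k - 1)) *
            (\<integral>\<^sup>+x. ennreal \<bar>G js (x + t *\<^sub>R w)\<bar> * ennreal (\<phi> x) \<partial>lborel))"
          using js by (intro mult_left_mono Psib True) auto
        finally show "ennreal (real k * t ^ (k - 1) * (h ^ length js / h ^ k) * (W ^ k * \<bar>\<Psi> js t\<bar>))
          \<le> ennreal (real k * W ^ k * (h ^ length js / h ^ k)) * (ennreal (t ^ (k - 1)) * indicator {0..h} t *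
        (\<integral>\<^sup>+x. ennreal \<bar>G js (x + t *\<^sub>R w)\<bar> * ennreal (\<phi> x) \<partial>lborel))"
          using True by simp
      qed
      finally show ?thesis using True by simp
    qed simp
  qed
  finally show ?thesis .
qed

text \<open>The factor \<open>t ^ (k - 1)\<close> is that of the Taylor remainder. For fixed
  \<open>t\<close> the inner integral is \<open>1 / (t * \<kappa>) ^ d\<close> times the integral of
  \<open>\<bar>g\<bar>\<close> over a ball of radius \<open>t * \<kappa>\<close> about
  \<open>x + t *\<^sub>R e\<close>, a cross section of the cone.\<close>

definition cone_average :: "('n::finite rvec \<Rightarrow> real) \<Rightarrow> 'n rvec \<Rightarrow> real \<Rightarrow> nat \<Rightarrow> real \<Rightarrow> 'n rvec \<Rightarrow> ennreal" where
  "cone_average g e \<kappa> k h x = (\<integral>\<^sup>+t. ennreal (t ^ (k - 1)) * indicator {0..h} t *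
     (\<integral>\<^sup>+b. indicator (ball 0 1) b * ennreal \<bar>g (x + t *\<^sub>R (e + \<kappa> *\<^sub>R b))\<bar> \<partial>lborel) \<partial>lborel)"

text \<open>The bound along a line is integrated over the directions
  \<open>e + \<kappa> *\<^sub>R b\<close> with \<open>b\<close> in the unit ball. The left side does
  not depend on \<open>b\<close> and only picks up the volume of that ball; on the right, Tonelli
  moves the vertex \<open>x\<close> outermost.\<close>

lemma averaged_line_bound:
  fixes G :: "'n::finite list \<Rightarrow> 'n rvec \<Rightarrow> real"
  assumes G: "weak_family D k G" and k: "k \<ge> 1" and h: "h > 0" and \<phi>: "test_function V \<phi>"
    and nn: "\<And>x. \<phi> x \<ge> 0" and W: "norm e + \<kappa> \<le> W" "W \<ge> 1" and \<kappa>: "\<kappa> \<ge> 0"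
    and sub: "\<And>x t. x \<in> V \<Longrightarrow> t \<in> {0..h} \<Longrightarrow> cball (x + t *\<^sub>R e) (t * \<kappa>) \<subseteq> D"
  shows "emeasure lborel (ball 0 1 :: 'n rvec set) * ennreal \<bar>LINT y|lborel. G [] y * \<phi> y\<bar> \<le>
     (\<Sum>js | length js \<le> k. ennreal (real k * W ^ k * (h ^ length js / h ^ k)) *
        (\<integral>\<^sup>+x. ennreal (\<phi> x) * cone_average (G js) e \<kappa> k h x \<partial>lborel))"
proof -
  have [measurable]: "ball (0 :: 'n rvec) 1 \<in> sets borel" by simp
  have [measurable]: "\<phi> \<in> borel_measurable borel" by (rule smooth_borel_test[OF \<phi>])
  have Gm: "G js \<in> borel_measurable borel" if "length js \<le> k" for js
    using G that by (simp add: weak_family_def borel_loc_int_def)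
  let ?c = "\<lambda>js :: 'n list. ennreal (real k * W ^ k * (h ^ length js / h ^ k))"
  let ?g = "\<lambda>js b t x. ennreal \<bar>G js (x + t *\<^sub>R (e + \<kappa> *\<^sub>R b))\<bar> * ennreal (\<phi> x)"
  have b: "ennreal \<bar>LINT y|lborel. G [] y * \<phi> y\<bar> \<le>
     (\<Sum>js | length js \<le> k. ?c js * (\<integral>\<^sup>+t. ennreal (t ^ (k - 1)) * indicator {0..h} t * (\<integral>\<^sup>+x. ?g js b t x \<partial>lborel) \<partial>lborel))"
    if b: "b \<in> ball 0 1" for b
  proof -
    have nb: "norm (\<kappa> *\<^sub>R b) \<le> \<kappa>" using b \<kappa> by (simp add: mult_left_le)
    have "norm (e + \<kappa> *\<^sub>R b) \<le> W" using norm_triangle_ineq[of e "\<kappa> *\<^sub>R b"] nb W(1) by linarith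
    moreover have "x + t *\<^sub>R (e + \<kappa> *\<^sub>R b) \<in> D" if "x \<in> V" "t \<in> {0..h}" for x t
    proof -
      have "norm (t *\<^sub>R (\<kappa> *\<^sub>R b)) = t * norm (\<kappa> *\<^sub>R b)" using that(2) by (simp add: abs_mult)
      also have "\<dots> \<le> t * \<kappa>" using nb that(2) by (intro mult_left_mono) auto
      finally have "norm (t *\<^sub>R (\<kappa> *\<^sub>R b)) \<le> t * \<kappa>" .
      then have "x + t *\<^sub>R (e + \<kappa> *\<^sub>R b) \<in> cball (x + t *\<^sub>R e) (t * \<kappa>)"
        by (simp add: dist_norm scaleR_right_distrib norm_minus_commute)
      then show ?thesis using sub[OF that] by blast
    qed
    ultimately have "ennreal \<bar>LINT y|lborel. G [] y * \<phi> y\<bar> \<le>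
     (\<integral>\<^sup>+t. (\<Sum>js | length js \<le> k. ?c js * (ennreal (t ^ (k - 1)) * indicator {0..h} t * (\<integral>\<^sup>+x. ?g js b t x \<partial>lborel))) \<partial>lborel)"
      by (intro line_bound[OF G k h \<phi> nn _ W(2)])
    also have "\<dots> = (\<Sum>js | length js \<le> k. (\<integral>\<^sup>+t. ?c js * (ennreal (t ^ (k - 1)) * indicator {0..h} t * (\<integral>\<^sup>+x. ?g js b t x \<partial>lborel)) \<partial>lborel))"
    proof (rule nn_integral_sum)
      fix js :: "'n list" assume "js \<in> {js. length js \<le> k}"
      then have [measurable]: "G js \<in> borel_measurable borel" using Gm by simp
      show "(\<lambda>t. ?c js * (ennreal (t ^ (k - 1)) * indicator {0..h} t * (\<integral>\<^sup>+x. ?g js b t x \<partial>lborel))) \<in> borel_measurable lborel"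
        by measurable
    qed
    also have "\<dots> = (\<Sum>js | length js \<le> k. ?c js * (\<integral>\<^sup>+t. ennreal (t ^ (k - 1)) * indicator {0..h} t * (\<integral>\<^sup>+x. ?g js b t x \<partial>lborel) \<partial>lborel))"
    proof (rule sum.cong[OF refl], rule nn_integral_cmult)
      fix js :: "'n list" assume "js \<in> {js. length js \<le> k}"
      then have [measurable]: "G js \<in> borel_measurable borel" using Gm by simp
      show "(\<lambda>t. ennreal (t ^ (k - 1)) * indicator {0..h} t * (\<integral>\<^sup>+x. ?g js b t x \<partial>lborel)) \<in> borel_measurable lborel"
        by measurable
    qed
    finally show ?thesis .
  qed
  have "emeasure lborel (ball 0 1 :: 'n rvec set) * ennreal \<bar>LINT y|lborel. G [] y * \<phi> y\<bar>
      = (\<integral>\<^sup>+b. ennreal \<bar>LINT y|lborel. G [] y * \<phi> y\<bar> * indicator (ball (0::'n rvec) 1) b \<partial>lborel)"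
    by (subst nn_integral_cmult_indicator) (auto simp: mult.commute)
  also have "\<dots> \<le> (\<integral>\<^sup>+b. (\<Sum>js | length js \<le> k. indicator (ball (0::'n rvec) 1) b * (?c js *
      (\<integral>\<^sup>+t. ennreal (t ^ (k - 1)) * indicator {0..h} t * (\<integral>\<^sup>+x. ?g js b t x \<partial>lborel) \<partial>lborel))) \<partial>lborel)"
    using b by (intro nn_integral_mono) (auto simp: indicator_def)
  also have "\<dots> = (\<Sum>js | length js \<le> k. (\<integral>\<^sup>+b. indicator (ball (0::'n rvec) 1) b * (?c js *
      (\<integral>\<^sup>+t. ennreal (t ^ (k - 1)) * indicator {0..h} t * (\<integral>\<^sup>+x. ?g js b t x \<partial>lborel) \<partial>lborel)) \<partial>lborel))"
  proof (rule nn_integral_sum)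
    fix js :: "'n list" assume "js \<in> {js. length js \<le> k}"
    then have [measurable]: "G js \<in> borel_measurable borel" using Gm by simp
    show "(\<lambda>b. indicator (ball 0 1) b * (?c js *
      (\<integral>\<^sup>+t. ennreal (t ^ (k - 1)) * indicator {0..h} t * (\<integral>\<^sup>+x. ?g js b t x \<partial>lborel) \<partial>lborel))) \<in> borel_measurable lborel"
      by measurable
  qed
  also have "\<dots> = (\<Sum>js | length js \<le> k. ?c js * (\<integral>\<^sup>+x. ennreal (\<phi> x) * cone_average (G js) e \<kappa> k h x \<partial>lborel))"
  proof (rule sum.cong[OF refl])
    fix js :: "'n list" assume "js \<in> {js. length js \<le> k}"
    then have [measurable]: "G js \<in> borel_measurable borel" using Gm by simp
    let ?t = "\<lambda>t. ennreal (t ^ (k - 1)) * indicator {0..h} t"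
    let ?i = "indicator (ball 0 1) :: 'n rvec \<Rightarrow> ennreal"
    have "(\<integral>\<^sup>+b. ?i b * (?c js * (\<integral>\<^sup>+t. ?t t * (\<integral>\<^sup>+x. ?g js b t x \<partial>lborel) \<partial>lborel)) \<partial>lborel)
      = ?c js * (\<integral>\<^sup>+b. (\<integral>\<^sup>+t. (\<integral>\<^sup>+x. ?i b * (?t t * ?g js b t x) \<partial>lborel) \<partial>lborel) \<partial>lborel)"
    proof -
      have "(\<integral>\<^sup>+b. ?i b * (?c js * (\<integral>\<^sup>+t. ?t t * (\<integral>\<^sup>+x. ?g js b t x \<partial>lborel) \<partial>lborel)) \<partial>lborel)
        = (\<integral>\<^sup>+b. ?c js * (?i b * (\<integral>\<^sup>+t. ?t t * (\<integral>\<^sup>+x. ?g js b t x \<partial>lborel) \<partial>lborel)) \<partial>lborel)"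
        by (simp only: mult.left_commute[of _ "?c js"])
      also have "\<dots> = ?c js * (\<integral>\<^sup>+b. ?i b * (\<integral>\<^sup>+t. ?t t * (\<integral>\<^sup>+x. ?g js b t x \<partial>lborel) \<partial>lborel) \<partial>lborel)"
        by (rule nn_integral_cmult) measurable
      also have "(\<lambda>b. ?i b * (\<integral>\<^sup>+t. ?t t * (\<integral>\<^sup>+x. ?g js b t x \<partial>lborel) \<partial>lborel))
          = (\<lambda>b. \<integral>\<^sup>+t. (\<integral>\<^sup>+x. ?i b * (?t t * ?g js b t x) \<partial>lborel) \<partial>lborel)"
      proof
        fix b
        have "?i b * (\<integral>\<^sup>+t. ?t t * (\<integral>\<^sup>+x. ?g js b t x \<partial>lborel) \<partial>lborel)
          = (\<integral>\<^sup>+t. ?i b * (?t t * (\<integral>\<^sup>+x. ?g js b t x \<partial>lborel)) \<partial>lborel)"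
          by (rule nn_integral_cmult[symmetric]) measurable
        also have "\<dots> = (\<integral>\<^sup>+t. (\<integral>\<^sup>+x. ?i b * (?t t * ?g js b t x) \<partial>lborel) \<partial>lborel)"
          unfolding mult.assoc[symmetric, of "?i b"]
          by (intro nn_integral_cong nn_integral_cmult[symmetric]) measurable
        finally show "?i b * (\<integral>\<^sup>+t. ?t t * (\<integral>\<^sup>+x. ?g js b t x \<partial>lborel) \<partial>lborel)
          = (\<integral>\<^sup>+t. (\<integral>\<^sup>+x. ?i b * (?t t * ?g js b t x) \<partial>lborel) \<partial>lborel)" .
      qed
      finally show ?thesis .
    qed
    \<comment> \<open>Three exchanges turn the order of integration from \<open>b, t, x\<close> into
      \<open>x, t, b\<close>.\<close>
    also have "(\<integral>\<^sup>+b. (\<integral>\<^sup>+t. (\<integral>\<^sup>+x. ?i b * (?t t * ?g js b t x) \<partial>lborel) \<partial>lborel) \<partial>lborel)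
      = (\<integral>\<^sup>+b. (\<integral>\<^sup>+x. (\<integral>\<^sup>+t. ?i b * (?t t * ?g js b t x) \<partial>lborel) \<partial>lborel) \<partial>lborel)"
      by (rule nn_integral_cong, rule lborel_pair.Fubini') measurable
    also have "\<dots> = (\<integral>\<^sup>+x. (\<integral>\<^sup>+b. (\<integral>\<^sup>+t. ?i b * (?t t * ?g js b t x) \<partial>lborel) \<partial>lborel) \<partial>lborel)"
      by (rule lborel_pair.Fubini') measurable
    also have "\<dots> = (\<integral>\<^sup>+x. (\<integral>\<^sup>+t. (\<integral>\<^sup>+b. ?i b * (?t t * ?g js b t x) \<partial>lborel) \<partial>lborel) \<partial>lborel)"
      by (rule nn_integral_cong, rule lborel_pair.Fubini') measurable
    also have "\<dots> = (\<integral>\<^sup>+x. ennreal (\<phi> x) * cone_average (G js) e \<kappa> k h x \<partial>lborel)"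
    proof (rule nn_integral_cong)
      fix x
      have "ennreal (\<phi> x) * cone_average (G js) e \<kappa> k h x
        = (\<integral>\<^sup>+t. ennreal (\<phi> x) * (?t t * (\<integral>\<^sup>+b. ?i b * ennreal \<bar>G js (x + t *\<^sub>R (e + \<kappa> *\<^sub>R b))\<bar> \<partial>lborel)) \<partial>lborel)"
        unfolding cone_average_def by (rule nn_integral_cmult[symmetric]) measurable
      also have "\<dots> = (\<integral>\<^sup>+t. (\<integral>\<^sup>+b. (ennreal (\<phi> x) * ?t t) * (?i b * ennreal \<bar>G js (x + t *\<^sub>R (e + \<kappa> *\<^sub>R b))\<bar>) \<partial>lborel) \<partial>lborel)"
        unfolding mult.assoc[symmetric, of "ennreal (\<phi> x)"]
        by (intro nn_integral_cong nn_integral_cmult[symmetric]) measurable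
      also have "\<dots> = (\<integral>\<^sup>+t. (\<integral>\<^sup>+b. ?i b * (?t t * ?g js b t x) \<partial>lborel) \<partial>lborel)"
        by (simp only: mult_ac)
      finally show "(\<integral>\<^sup>+t. (\<integral>\<^sup>+b. ?i b * (?t t * ?g js b t x) \<partial>lborel) \<partial>lborel)
          = ennreal (\<phi> x) * cone_average (G js) e \<kappa> k h x" by simp
    qed
    finally show "(\<integral>\<^sup>+b. ?i b * (?c js * (\<integral>\<^sup>+t. ?t t * (\<integral>\<^sup>+x. ?g js b t x \<partial>lborel) \<partial>lborel)) \<partial>lborel)
      = ?c js * (\<integral>\<^sup>+x. ennreal (\<phi> x) * cone_average (G js) e \<kappa> k h x \<partial>lborel)" .
  qed
  finally show ?thesis .
qed

lemma cone_average_measurable [measurable]: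
  fixes g :: "'n::finite rvec \<Rightarrow> real"
  assumes [measurable]: "g \<in> borel_measurable borel"
  shows "cone_average g e \<kappa> k h \<in> borel_measurable borel"
proof -
  have [measurable]: "ball (0 :: 'n rvec) 1 \<in> sets borel" by simp
  have "(\<lambda>x. cone_average g e \<kappa> k h x) \<in> borel_measurable borel"
    unfolding cone_average_def by measurable
  then show ?thesis by simp
qed

lemma emeasure_unit_ball:
  "emeasure lborel (ball 0 1 :: 'n::finite rvec set) = ennreal (measure lborel (ball 0 1 :: 'n rvec set))"
  "measure lborel (ball 0 1 :: 'n::finite rvec set) > 0"
proof -
  have fin: "emeasure lborel (ball 0 1 :: 'n rvec set) < \<infinity>"
    by (rule emeasure_bounded_finite[OF bounded_ball])
  show *: "emeasure lborel (ball 0 1 :: 'n rvec set) = ennreal (measure lborel (ball 0 1 :: 'n rvec set))"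
    using fin by (intro emeasure_eq_ennreal_measure) simp
  have "emeasure lborel (ball 0 1 :: 'n rvec set) \<noteq> 0"
    using open_not_negligible[of "ball 0 1 :: 'n rvec set"]
    by (auto simp: negligible_iff_null_sets null_sets_def)
  then show "measure lborel (ball 0 1 :: 'n rvec set) > 0"
    unfolding * using zero_less_measure_iff[of lborel "ball 0 1 :: 'n rvec set"] measure_nonneg
    by (metis ennreal_0 less_eq_real_def)
qed

text \<open>Duality: a bound for the cone averages uniform over \<open>V\<close> controls the
  pairing with every nonnegative test function supported in \<open>V\<close>, and so
  \<open>G []\<close> and \<open>- G []\<close> almost everywhere. One axis \<open>e\<close> and one
  height \<open>h\<close> have to serve all vertices in \<open>V\<close>.\<close>

lemma cone_pointwise_bound:
  fixes G :: "'n::finite list \<Rightarrow> 'n rvec \<Rightarrow> real"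
  assumes V: "open V" and G: "weak_family D k G" and k: "k \<ge> 1" and h: "h > 0"
    and W: "norm e + \<kappa> \<le> W" "W \<ge> 1" and \<kappa>: "\<kappa> \<ge> 0"
    and sub: "\<And>x t. x \<in> V \<Longrightarrow> t \<in> {0..h} \<Longrightarrow> cball (x + t *\<^sub>R e) (t * \<kappa>) \<subseteq> D"
    and Q: "Q \<ge> 0" "\<And>x js. x \<in> V \<Longrightarrow> length js \<le> k \<Longrightarrow>
      ennreal (h ^ length js / h ^ k) * cone_average (G js) e \<kappa> k h x \<le> ennreal Q"
  shows "AE x in lborel. x \<in> V \<longrightarrow>
     \<bar>G [] x\<bar> \<le> real k * W ^ k * real (card {js :: 'n list. length js \<le> k}) / measure lborel (ball 0 1 :: 'n rvec set) * Q"
proof -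
  let ?Z = "measure lborel (ball 0 1 :: 'n rvec set)" and ?N = "real (card {js :: 'n list. length js \<le> k})"
  define c where "c = real k * W ^ k * ?N / ?Z * Q"
  have Gm: "G js \<in> borel_measurable borel" if "length js \<le> k" for js
    using G that by (simp add: weak_family_def borel_loc_int_def)
  have VD: "V \<subseteq> D" using sub[of _ 0] h by auto
  have loc: "borel_loc_int D (G [])" using G by (simp add: weak_family_def)
  have test: "\<bar>LINT x|lborel. G [] x * \<phi> x\<bar> \<le> c * (LINT x|lborel. \<phi> x)"
    if \<phi>: "test_function V \<phi>" and nn: "\<And>x. 0 \<le> \<phi> x" for \<phi>
  proof -
    have [measurable]: "\<phi> \<in> borel_measurable borel" by (rule smooth_borel_test[OF \<phi>])
    have supp: "\<phi> x = 0" if "x \<notin> V" for x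
      using \<phi> that closure_subset[of "{x. \<phi> x \<noteq> 0}"] unfolding test_function_def by blast
    have \<phi>int: "(\<integral>\<^sup>+x. ennreal (\<phi> x) \<partial>lborel) = ennreal (LINT x|lborel. \<phi> x)"
      by (rule nn_integral_eq_integral[OF test_function_integrable[OF \<phi>]]) (use nn in auto)
    have I0: "0 \<le> (LINT x|lborel. \<phi> x)" by (rule Bochner_Integration.integral_nonneg[OF nn])
    have "ennreal (?Z * \<bar>LINT y|lborel. G [] y * \<phi> y\<bar>) = emeasure lborel (ball 0 1 :: 'n rvec set) * ennreal \<bar>LINT y|lborel. G [] y * \<phi> y\<bar>"
      by (simp add: ennreal_mult emeasure_unit_ball)
    also have "\<dots> \<le> (\<Sum>js | length js \<le> k. ennreal (real k * W ^ k * (h ^ length js / h ^ k)) *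
        (\<integral>\<^sup>+x. ennreal (\<phi> x) * cone_average (G js) e \<kappa> k h x \<partial>lborel))"
      by (rule averaged_line_bound[OF G k h \<phi> nn W \<kappa> sub])
    also have "\<dots> \<le> (\<Sum>js :: 'n list | length js \<le> k. ennreal (real k * W ^ k) * (ennreal (LINT x|lborel. \<phi> x) * ennreal Q))"
    proof (rule sum_mono)
      fix js :: "'n list" assume "js \<in> {js. length js \<le> k}"
      then have js: "length js \<le> k" by simp
      note [measurable] = Gm[OF js]
      have "ennreal (h ^ length js / h ^ k) * (\<integral>\<^sup>+x. ennreal (\<phi> x) * cone_average (G js) e \<kappa> k h x \<partial>lborel)
        = (\<integral>\<^sup>+x. ennreal (h ^ length js / h ^ k) * (ennreal (\<phi> x) * cone_average (G js) e \<kappa> k h x) \<partial>lborel)"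
        by (rule nn_integral_cmult[symmetric]) measurable
      also have "\<dots> \<le> (\<integral>\<^sup>+x. ennreal (\<phi> x) * ennreal Q \<partial>lborel)"
      proof (rule nn_integral_mono)
        fix x
        show "ennreal (h ^ length js / h ^ k) * (ennreal (\<phi> x) * cone_average (G js) e \<kappa> k h x) \<le> ennreal (\<phi> x) * ennreal Q"
        proof (cases "x \<in> V")
          case True
          from mult_left_mono[OF Q(2)[OF True js], of "ennreal (\<phi> x)"]
          show ?thesis by (simp add: mult.left_commute)
        qed (simp add: supp)
      qed
      also have "\<dots> = ennreal (LINT x|lborel. \<phi> x) * ennreal Q"
        by (subst nn_integral_multc) (auto simp: \<phi>int)
      finally have "ennreal (real k * W ^ k) * (ennreal (h ^ length js / h ^ k) * (\<integral>\<^sup>+x. ennreal (\<phi> x) * cone_average (G js) e \<kappa> k h x \<partial>lborel))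
         \<le> ennreal (real k * W ^ k) * (ennreal (LINT x|lborel. \<phi> x) * ennreal Q)"
        by (rule mult_left_mono) simp
      moreover have "ennreal (real k * W ^ k * (h ^ length js / h ^ k)) = ennreal (real k * W ^ k) * ennreal (h ^ length js / h ^ k)"
        using h W by (intro ennreal_mult) auto
      ultimately show "ennreal (real k * W ^ k * (h ^ length js / h ^ k)) * (\<integral>\<^sup>+x. ennreal (\<phi> x) * cone_average (G js) e \<kappa> k h x \<partial>lborel)
         \<le> ennreal (real k * W ^ k) * (ennreal (LINT x|lborel. \<phi> x) * ennreal Q)"
        by (simp add: mult.assoc)
    qed
    also have "\<dots> = ennreal (?N * (real k * W ^ k * ((LINT x|lborel. \<phi> x) * Q)))"
    proof -
      have "(\<Sum>js :: 'n list | length js \<le> k. ennreal (real k * W ^ k) * (ennreal (LINT x|lborel. \<phi> x) * ennreal Q))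
        = of_nat (card {js :: 'n list. length js \<le> k}) * (ennreal (real k * W ^ k) * (ennreal (LINT x|lborel. \<phi> x) * ennreal Q))"
        by simp
      also have "\<dots> = ennreal ?N * (ennreal (real k * W ^ k) * (ennreal (LINT x|lborel. \<phi> x) * ennreal Q))"
        by (simp add: ennreal_of_nat_eq_real_of_nat)
      also have "\<dots> = ennreal (?N * (real k * W ^ k * ((LINT x|lborel. \<phi> x) * Q)))"
        using I0 Q(1) W by (simp add: ennreal_mult)
      finally show ?thesis .
    qed
    finally have "?Z * \<bar>LINT y|lborel. G [] y * \<phi> y\<bar> \<le> ?N * (real k * W ^ k * ((LINT x|lborel. \<phi> x) * Q))"
      using I0 Q(1) W by (subst (asm) ennreal_le_iff) auto
    then show ?thesis
      using emeasure_unit_ball(2)[where 'n = 'n] by (simp add: c_def field_simps)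
  qed
  have loc': "integrable lborel (\<lambda>x. indicator K x * G [] x)" if "compact K" "K \<subseteq> V" for K
    using loc that VD unfolding borel_loc_int_def by blast
  have "AE x in lborel. x \<in> V \<longrightarrow> G [] x \<le> c"
  proof (rule AE_le_const_of_test_functions[OF V _ loc'])
    show "(LINT x|lborel. G [] x * \<phi> x) \<le> c * (LINT x|lborel. \<phi> x)"
      if "test_function V \<phi>" "\<And>x. 0 \<le> \<phi> x" for \<phi>
      using test[OF that] by linarith
  qed (use Gm in auto)
  moreover have "AE x in lborel. x \<in> V \<longrightarrow> - G [] x \<le> c"
  proof (rule AE_le_const_of_test_functions[OF V])
    show "integrable lborel (\<lambda>x. indicator K x * - G [] x)" if "compact K" "K \<subseteq> V" for K
      using loc'[OF that] by simp
    show "(LINT x|lborel. - G [] x * \<phi> x) \<le> c * (LINT x|lborel. \<phi> x)"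
      if "test_function V \<phi>" "\<And>x. 0 \<le> \<phi> x" for \<phi>
      using test[OF that] by simp
  qed (use Gm in auto)
  ultimately show ?thesis unfolding c_def[symmetric] by eventually_elim auto
qed

subsection \<open>Bounds for the cone averages\<close>

lemma nn_integral_affine:
  fixes f :: "'n::finite rvec \<Rightarrow> ennreal"
  assumes [measurable]: "f \<in> borel_measurable borel" and a: "a > 0"
  shows "(\<integral>\<^sup>+b. f (c + a *\<^sub>R b) \<partial>lborel) = ennreal (1 / a ^ CARD('n)) * (\<integral>\<^sup>+z. f z \<partial>lborel)"
proof -
  have "(\<integral>\<^sup>+z. f z \<partial>lborel) = (\<integral>\<^sup>+z. f z \<partial>density (distr lborel borel (\<lambda>x. c + a *\<^sub>R x)) (\<lambda>_. \<bar>a\<bar> ^ DIM('n rvec)))"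
    using lborel_affine[of a c] a by simp
  also have "\<dots> = ennreal (a ^ CARD('n)) * (\<integral>\<^sup>+b. f (c + a *\<^sub>R b) \<partial>lborel)"
    using a by (simp add: nn_integral_density nn_integral_distr nn_integral_cmult)
  finally have "ennreal (1 / a ^ CARD('n)) * (\<integral>\<^sup>+z. f z \<partial>lborel)
     = (ennreal (1 / a ^ CARD('n)) * ennreal (a ^ CARD('n))) * (\<integral>\<^sup>+b. f (c + a *\<^sub>R b) \<partial>lborel)"
    by (simp add: mult.assoc)
  also have "ennreal (1 / a ^ CARD('n)) * ennreal (a ^ CARD('n)) = 1"
    using a by (simp add: ennreal_mult[symmetric])
  finally show ?thesis by simp
qed

lemma nn_integral_powr_Icc:
  assumes q: "q > 0" and h: "h > 0"
  shows "(\<integral>\<^sup>+t. ennreal (t powr (q - 1)) * indicator {0..h} t \<partial>lborel) = ennreal (h powr q / q)"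
proof -
  have "((\<lambda>t. if t \<in> {0..h} then t powr (q - 1) else 0) has_integral (h powr q / q)) UNIV"
    using has_integral_powr_from_0[of "q - 1" h] q h by (subst has_integral_restrict_UNIV) auto
  then have "(\<integral>\<^sup>+t. ennreal (if t \<in> {0..h} then t powr (q - 1) else 0) \<partial>lborel) = ennreal (h powr q / q)"
    by (intro nn_integral_has_integral_lborel) auto
  then show ?thesis
    by (rule subst[rotated]) (auto intro!: nn_integral_cong)
qed

text \<open>An average over a ball of radius \<open>t * \<kappa>\<close> is of size
  \<open>N * t powr - (d / p)\<close> when the L_p norm is at most \<open>N\<close>. Together with
  \<open>t ^ (k - 1)\<close> the exponent exceeds -1 because \<open>k > d / p\<close>.\<close>

lemma cone_average_bound:
  fixes g :: "'n::finite rvec \<Rightarrow> real"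
  assumes g [measurable]: "g \<in> borel_measurable borel" and S [measurable]: "S \<in> sets borel"
    and p: "p \<ge> 1" and k: "real k > real CARD('n) / p" "k \<ge> 1" and \<kappa>: "\<kappa> > 0" and h: "h > 0" and N: "N > 0"
    and sub: "\<And>t. t \<in> {0..h} \<Longrightarrow> cball (x + t *\<^sub>R e) (t * \<kappa>) \<subseteq> S"
    and bd: "(\<integral>\<^sup>+z. ennreal (\<bar>g z\<bar> powr p) * indicator S z \<partial>lborel) \<le> ennreal (N powr p)"
  shows "cone_average g e \<kappa> k h x \<le>
     ennreal (N * (measure lborel (ball 0 1 :: 'n rvec set) + 1 / \<kappa> ^ CARD('n)) * (h powr (k - CARD('n) / p) / (k - CARD('n) / p)))"
proof -
  have [measurable]: "ball (0 :: 'n rvec) 1 \<in> sets borel" by simp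
  let ?d = "CARD('n)" and ?Z = "measure lborel (ball 0 1 :: 'n rvec set)" and ?i = "indicator (ball 0 1) :: 'n rvec \<Rightarrow> ennreal"
  have inner: "(\<integral>\<^sup>+b. ?i b * ennreal \<bar>g (x + t *\<^sub>R (e + \<kappa> *\<^sub>R b))\<bar> \<partial>lborel)
      \<le> ennreal (N * (?Z + 1 / \<kappa> ^ ?d) * t powr - (?d / p))" if t: "0 < t" "t \<le> h" for t
  proof -
    \<comment> \<open>The size expected of the average. It balances the two terms of
      \<open>young\<close>, a pointwise inequality that replaces Hoelder's and holds for
      \<open>p = 1\<close> as well.\<close>
    define s where "s = N * t powr - (?d / p)"
    have s: "s > 0" using N t by (simp add: s_def)
    have young: "r \<le> s + s powr (1 - p) * r powr p" if "r \<ge> 0" for r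
    proof (cases "r \<le> s")
      case False
      then have "r = r powr (1 - p) * r powr p" using s by (simp add: powr_add[symmetric])
      also have "\<dots> \<le> s powr (1 - p) * r powr p"
        using False s p by (intro mult_right_mono powr_mono2') auto
      finally show ?thesis using s by simp
    qed (use s in \<open>simp add: add_increasing2\<close>)
    have eq: "x + t *\<^sub>R (e + \<kappa> *\<^sub>R b) = (x + t *\<^sub>R e) + (t * \<kappa>) *\<^sub>R b" for b
      by (simp add: scaleR_right_distrib)
    have "(\<integral>\<^sup>+b. ?i b * ennreal \<bar>g (x + t *\<^sub>R (e + \<kappa> *\<^sub>R b))\<bar> \<partial>lborel)
      \<le> (\<integral>\<^sup>+b. ennreal s * ?i b + ennreal (s powr (1 - p)) * (ennreal (\<bar>g ((x + t *\<^sub>R e) + (t * \<kappa>) *\<^sub>R b)\<bar> powr p) * indicator S ((x + t *\<^sub>R e) + (t * \<kappa>) *\<^sub>R b)) \<partial>lborel)"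
    proof (rule nn_integral_mono)
      fix b :: "'n rvec"
      show "?i b * ennreal \<bar>g (x + t *\<^sub>R (e + \<kappa> *\<^sub>R b))\<bar>
        \<le> ennreal s * ?i b + ennreal (s powr (1 - p)) * (ennreal (\<bar>g ((x + t *\<^sub>R e) + (t * \<kappa>) *\<^sub>R b)\<bar> powr p) * indicator S ((x + t *\<^sub>R e) + (t * \<kappa>) *\<^sub>R b))"
      proof (cases "b \<in> ball 0 1")
        case True
        have "norm ((t * \<kappa>) *\<^sub>R b) = (t * \<kappa>) * norm b" using t \<kappa> by simp
        also have "\<dots> \<le> t * \<kappa>" using True t \<kappa> by (intro mult_left_le) auto
        finally have "(x + t *\<^sub>R e) + (t * \<kappa>) *\<^sub>R b \<in> cball (x + t *\<^sub>R e) (t * \<kappa>)"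
          by (simp add: dist_norm)
        then have "(x + t *\<^sub>R e) + (t * \<kappa>) *\<^sub>R b \<in> S" using sub[of t] t by auto
        then show ?thesis
          using True young[of "\<bar>g ((x + t *\<^sub>R e) + (t * \<kappa>) *\<^sub>R b)\<bar>"] s unfolding eq
          by (simp add: ennreal_plus[symmetric] ennreal_mult[symmetric] del: ennreal_plus)
      qed simp
    qed
    also have "\<dots> = ennreal s * ennreal ?Z + ennreal (s powr (1 - p)) * (ennreal (1 / (t * \<kappa>) ^ ?d) * (\<integral>\<^sup>+z. ennreal (\<bar>g z\<bar> powr p) * indicator S z \<partial>lborel))"
    proof -
      let ?f = "\<lambda>z. ennreal (\<bar>g z\<bar> powr p) * indicator S z"
      have "(\<integral>\<^sup>+b. ennreal s * ?i b + ennreal (s powr (1 - p)) * ?f ((x + t *\<^sub>R e) + (t * \<kappa>) *\<^sub>R b) \<partial>lborel)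
        = (\<integral>\<^sup>+b. ennreal s * ?i b \<partial>lborel) + (\<integral>\<^sup>+b. ennreal (s powr (1 - p)) * ?f ((x + t *\<^sub>R e) + (t * \<kappa>) *\<^sub>R b) \<partial>lborel)"
        by (rule nn_integral_add) measurable
      also have "(\<integral>\<^sup>+b. ennreal s * ?i b \<partial>lborel) = ennreal s * ennreal ?Z"
        by (subst nn_integral_cmult_indicator) (simp_all only: emeasure_unit_ball, simp)
      also have "(\<integral>\<^sup>+b. ennreal (s powr (1 - p)) * ?f ((x + t *\<^sub>R e) + (t * \<kappa>) *\<^sub>R b) \<partial>lborel)
        = ennreal (s powr (1 - p)) * (\<integral>\<^sup>+b. ?f ((x + t *\<^sub>R e) + (t * \<kappa>) *\<^sub>R b) \<partial>lborel)"
        by (rule nn_integral_cmult) measurable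
      also have "(\<integral>\<^sup>+b. ?f ((x + t *\<^sub>R e) + (t * \<kappa>) *\<^sub>R b) \<partial>lborel) = ennreal (1 / (t * \<kappa>) ^ ?d) * (\<integral>\<^sup>+z. ?f z \<partial>lborel)"
        by (rule nn_integral_affine) (use t \<kappa> in auto)
      finally show ?thesis .
    qed
    also have "\<dots> \<le> ennreal s * ennreal ?Z + ennreal (s powr (1 - p)) * (ennreal (1 / (t * \<kappa>) ^ ?d) * ennreal (N powr p))"
      by (intro add_left_mono mult_left_mono bd) auto
    also have "\<dots> = ennreal (s * ?Z + s powr (1 - p) * (1 / (t * \<kappa>) ^ ?d * N powr p))"
      using s t \<kappa> by (simp add: ennreal_mult[symmetric] ennreal_plus[symmetric] del: ennreal_plus)
    \<comment> \<open>Both terms scale alike: \<open>s powr (1 - p) * N powr p\<close> is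
      \<open>N * t powr (d - d / p)\<close>, and the volume of the ball takes away
      \<open>t ^ d\<close>.\<close>
    also have "s * ?Z + s powr (1 - p) * (1 / (t * \<kappa>) ^ ?d * N powr p) = N * (?Z + 1 / \<kappa> ^ ?d) * t powr - (?d / p)"
    proof -
      have 1: "s powr (1 - p) * N powr p = N * t powr (?d - ?d / p)"
      proof -
        have "s powr (1 - p) * N powr p = (N powr (1 - p) * N powr p) * (t powr - (?d / p)) powr (1 - p)"
          using N t by (simp add: s_def powr_mult)
        also have "N powr (1 - p) * N powr p = N" using N by (simp add: powr_add[symmetric])
        also have "(t powr - (?d / p)) powr (1 - p) = t powr (?d - ?d / p)"
        proof -
          have "- (?d / p) * (1 - p) = ?d - ?d / p" using p by (simp add: field_simps)
          then show ?thesis by (simp only: powr_powr)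
        qed
        finally show ?thesis .
      qed
      have 2: "t powr (?d - ?d / p) = t ^ ?d * t powr - (?d / p)"
        using t by (simp add: powr_add[symmetric] powr_realpow[symmetric])
      have "s powr (1 - p) * (1 / (t * \<kappa>) ^ ?d * N powr p) = (s powr (1 - p) * N powr p) / (t * \<kappa>) ^ ?d" by simp
      also have "\<dots> = N * t powr - (?d / p) / \<kappa> ^ ?d"
        unfolding 1 2 using t by (simp add: power_mult_distrib)
      finally show ?thesis by (simp add: s_def algebra_simps)
    qed
    finally show ?thesis .
  qed
  define q where "q = real k - ?d / p"
  have q: "q > 0" using k by (simp add: q_def)
  let ?c = "N * (?Z + 1 / \<kappa> ^ ?d)"
  have c0: "?c \<ge> 0" using N \<kappa> by simp
  have "cone_average g e \<kappa> k h x \<le> (\<integral>\<^sup>+t. ennreal ?c * (ennreal (t powr (q - 1)) * indicator {0..h} t) \<partial>lborel)"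
    unfolding cone_average_def
  proof (rule nn_integral_mono_AE)
    have "AE t in lborel. t \<noteq> (0::real)" by (rule AE_lborel_singleton)
    then show "AE t in lborel. ennreal (t ^ (k - 1)) * indicator {0..h} t * (\<integral>\<^sup>+b. ?i b * ennreal \<bar>g (x + t *\<^sub>R (e + \<kappa> *\<^sub>R b))\<bar> \<partial>lborel)
        \<le> ennreal ?c * (ennreal (t powr (q - 1)) * indicator {0..h} t)"
    proof eventually_elim
      case (elim t)
      show ?case
      proof (cases "t \<in> {0..h}")
        case True
        then have t: "0 < t" "t \<le> h" using elim by auto
        have "ennreal (t ^ (k - 1)) * (\<integral>\<^sup>+b. ?i b * ennreal \<bar>g (x + t *\<^sub>R (e + \<kappa> *\<^sub>R b))\<bar> \<partial>lborel)
          \<le> ennreal (t ^ (k - 1)) * ennreal (?c * t powr - (?d / p))"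
          by (intro mult_left_mono inner t) simp
        also have "\<dots> = ennreal ?c * ennreal (t powr (q - 1))"
        proof -
          have "t ^ (k - 1) * t powr - (?d / p) = t powr (q - 1)"
            using t k(2) by (simp add: q_def powr_realpow[symmetric] powr_add[symmetric] of_nat_diff algebra_simps)
          then have "t ^ (k - 1) * (?c * t powr - (?d / p)) = ?c * t powr (q - 1)" by (simp add: mult_ac)
          then show ?thesis using c0 t by (simp add: ennreal_mult[symmetric])
        qed
        finally show ?thesis using True by simp
      qed simp
    qed
  qed
  also have "\<dots> = ennreal ?c * ennreal (h powr q / q)"
    using nn_integral_powr_Icc[OF q h] by (subst nn_integral_cmult) auto
  also have "\<dots> = ennreal (?c * (h powr q / q))"
    using c0 q by (intro ennreal_mult[symmetric]) auto
  finally show ?thesis by (simp only: q_def)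
qed

text \<open>In the limiting case \<open>p = 1\<close>, \<open>k = d\<close> the kernel is bounded, because a point lies
  in the cross sections of the cone only for parameters \<open>t\<close> in an interval \<open>{r..3 r}\<close>.\<close>

lemma cone_average_bound_1:
  fixes g :: "'n::finite rvec \<Rightarrow> real"
  assumes g [measurable]: "g \<in> borel_measurable borel" and S [measurable]: "S \<in> sets borel"
    and \<kappa>: "\<kappa> > 0" and e: "norm e \<ge> 2 * \<kappa>" and h: "h > 0"
    and sub: "\<And>t. t \<in> {0..h} \<Longrightarrow> cball (x + t *\<^sub>R e) (t * \<kappa>) \<subseteq> S"
    and bd: "(\<integral>\<^sup>+z. ennreal \<bar>g z\<bar> * indicator S z \<partial>lborel) \<le> ennreal N"
  shows "cone_average g e \<kappa> CARD('n) h x \<le> ennreal (2 / \<kappa> ^ CARD('n)) * ennreal N"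
proof -
  have [measurable]: "ball (0 :: 'n rvec) 1 \<in> sets borel" by simp
  let ?d = "CARD('n)" and ?i = "indicator (ball 0 1) :: 'n rvec \<Rightarrow> ennreal"
  \<comment> \<open>Selects the parameters whose cross section contains \<open>z\<close>. The factor
    \<open>1 / t\<close> is what \<open>t ^ (d - 1)\<close> leaves of the Jacobian
    \<open>1 / (t * \<kappa>) ^ d\<close>, apart from the power of \<open>\<kappa>\<close>.\<close>
  let ?J = "\<lambda>t z. indicator {t. 0 < t \<and> norm (z - (x + t *\<^sub>R e)) \<le> t * \<kappa>} t * ennreal (1 / t)"
  let ?f = "\<lambda>z. ennreal \<bar>g z\<bar> * indicator S z"
  have inner: "ennreal (t ^ (?d - 1)) * (\<integral>\<^sup>+b. ?i b * ennreal \<bar>g (x + t *\<^sub>R (e + \<kappa> *\<^sub>R b))\<bar> \<partial>lborel)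
      \<le> (\<integral>\<^sup>+z. ennreal (1 / \<kappa> ^ ?d) * (?f z * ?J t z) \<partial>lborel)" if t: "0 < t" "t \<le> h" for t
  proof -
    let ?F = "\<lambda>z. ?f z * indicator {z. norm (z - (x + t *\<^sub>R e)) \<le> t * \<kappa>} z"
    have eq: "x + t *\<^sub>R (e + \<kappa> *\<^sub>R b) = (x + t *\<^sub>R e) + (t * \<kappa>) *\<^sub>R b" for b
      by (simp add: scaleR_right_distrib)
    have "(\<integral>\<^sup>+b. ?i b * ennreal \<bar>g (x + t *\<^sub>R (e + \<kappa> *\<^sub>R b))\<bar> \<partial>lborel) \<le> (\<integral>\<^sup>+b. ?F ((x + t *\<^sub>R e) + (t * \<kappa>) *\<^sub>R b) \<partial>lborel)"
    proof (rule nn_integral_mono)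
      fix b :: "'n rvec"
      show "?i b * ennreal \<bar>g (x + t *\<^sub>R (e + \<kappa> *\<^sub>R b))\<bar> \<le> ?F ((x + t *\<^sub>R e) + (t * \<kappa>) *\<^sub>R b)"
      proof (cases "b \<in> ball 0 1")
        case True
        have "norm ((t * \<kappa>) *\<^sub>R b) = (t * \<kappa>) * norm b" using t \<kappa> by simp
        also have "\<dots> \<le> t * \<kappa>" using True t \<kappa> by (intro mult_left_le) auto
        finally have n: "norm ((t * \<kappa>) *\<^sub>R b) \<le> t * \<kappa>" .
        then have "(x + t *\<^sub>R e) + (t * \<kappa>) *\<^sub>R b \<in> cball (x + t *\<^sub>R e) (t * \<kappa>)"
          by (simp add: dist_norm)
        then have "(x + t *\<^sub>R e) + (t * \<kappa>) *\<^sub>R b \<in> S" using sub[of t] t by auto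
        then show ?thesis using True n unfolding eq by simp
      qed simp
    qed
    also have "\<dots> = ennreal (1 / (t * \<kappa>) ^ ?d) * (\<integral>\<^sup>+z. ?F z \<partial>lborel)"
      by (rule nn_integral_affine) (use t \<kappa> in auto)
    finally have "ennreal (t ^ (?d - 1)) * (\<integral>\<^sup>+b. ?i b * ennreal \<bar>g (x + t *\<^sub>R (e + \<kappa> *\<^sub>R b))\<bar> \<partial>lborel)
       \<le> ennreal (t ^ (?d - 1)) * (ennreal (1 / (t * \<kappa>) ^ ?d) * (\<integral>\<^sup>+z. ?F z \<partial>lborel))"
      by (rule mult_left_mono) simp
    also have "\<dots> = (ennreal (1 / \<kappa> ^ ?d) * ennreal (1 / t)) * (\<integral>\<^sup>+z. ?F z \<partial>lborel)"
    proof -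
      obtain n where n: "?d = Suc n" using zero_less_card_finite[where 'a = 'n] by (cases ?d) auto
      have "t ^ (?d - 1) * (1 / (t * \<kappa>) ^ ?d) = (1 / \<kappa> ^ ?d) * (1 / t)"
        using t \<kappa> unfolding n by (simp add: power_mult_distrib field_simps)
      then show ?thesis using t \<kappa> by (simp add: mult.assoc[symmetric] ennreal_mult[symmetric])
    qed
    also have "\<dots> = (\<integral>\<^sup>+z. (ennreal (1 / \<kappa> ^ ?d) * ennreal (1 / t)) * ?F z \<partial>lborel)"
      by (rule nn_integral_cmult[symmetric]) measurable
    also have "\<dots> = (\<integral>\<^sup>+z. ennreal (1 / \<kappa> ^ ?d) * (?f z * ?J t z) \<partial>lborel)"
      using t by (intro nn_integral_cong) (auto simp: indicator_def mult_ac)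
    finally show ?thesis .
  qed
  \<comment> \<open>With \<open>y = norm (z - x)\<close> the parameter lies between
    \<open>y / (norm e + \<kappa>)\<close> and \<open>y / (norm e - \<kappa>)\<close>, where
    \<open>1 / t\<close> is at most \<open>(norm e + \<kappa>) / y\<close>. Length times bound is
    \<open>2 * \<kappa> / (norm e - \<kappa>)\<close>, which is at most 2 because
    \<open>norm e \<ge> 2 * \<kappa>\<close>.\<close>
  have J: "(\<integral>\<^sup>+t. ?J t z \<partial>lborel) \<le> 2" for z
  proof -
    define y where "y = norm (z - x)"
    have e0: "norm e > \<kappa>" "norm e + \<kappa> > 0" using e \<kappa> by auto
    have "?J t z \<le> ennreal ((norm e + \<kappa>) / y) * indicator {y / (norm e + \<kappa>)..y / (norm e - \<kappa>)} t" for t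
    proof (cases "0 < t \<and> norm (z - (x + t *\<^sub>R e)) \<le> t * \<kappa>")
      case True
      then have t: "0 < t" and le: "norm ((z - x) - t *\<^sub>R e) \<le> t * \<kappa>" by (auto simp: algebra_simps)
      have "norm (t *\<^sub>R e) = t * norm e" using t by simp
      then have "y \<le> t * (norm e + \<kappa>)" "t * (norm e - \<kappa>) \<le> y"
        using norm_triangle_sub[of "z - x" "t *\<^sub>R e"] norm_triangle_sub[of "t *\<^sub>R e" "z - x"] le
        unfolding norm_minus_commute[of "t *\<^sub>R e"] y_def distrib_left right_diff_distrib by linarith+
      moreover from this(2) have "y > 0" using t e0 by (smt (verit) mult_pos_pos)
      ultimately show ?thesis using True t e0
        by (auto simp: indicator_def divide_simps mult.commute intro!: ennreal_leI)
    qed auto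
    then have "(\<integral>\<^sup>+t. ?J t z \<partial>lborel) \<le> (\<integral>\<^sup>+t. ennreal ((norm e + \<kappa>) / y) * indicator {y / (norm e + \<kappa>)..y / (norm e - \<kappa>)} t \<partial>lborel)"
      by (intro nn_integral_mono)
    also have "\<dots> = ennreal ((norm e + \<kappa>) / y) * ennreal (y / (norm e - \<kappa>) - y / (norm e + \<kappa>))"
    proof -
      have "y / (norm e + \<kappa>) \<le> y / (norm e - \<kappa>)" using e0 \<kappa> by (intro divide_left_mono) (auto simp: y_def)
      then show ?thesis by (subst nn_integral_cmult_indicator) auto
    qed
    also have "\<dots> = ennreal ((norm e + \<kappa>) / y * (y / (norm e - \<kappa>) - y / (norm e + \<kappa>)))"
      using e0 by (intro ennreal_mult[symmetric] divide_nonneg_nonneg) (auto simp: y_def divide_left_mono \<kappa> less_imp_le intro!: divide_left_mono)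
    also have "(norm e + \<kappa>) / y * (y / (norm e - \<kappa>) - y / (norm e + \<kappa>)) \<le> 2"
    proof (cases "y = 0")
      case False
      then have "(norm e + \<kappa>) / y * (y / (norm e - \<kappa>) - y / (norm e + \<kappa>)) = 2 * \<kappa> / (norm e - \<kappa>)"
      proof -
        have "(norm e + \<kappa>) / y * (y / (norm e - \<kappa>) - y / (norm e + \<kappa>)) = (norm e + \<kappa>) / (norm e - \<kappa>) - 1"
          using False e0 by (simp add: right_diff_distrib)
        also have "\<dots> = 2 * \<kappa> / (norm e - \<kappa>)"
          using e0 by (simp add: divide_simps)
        finally show ?thesis .
      qed
      also have "\<dots> \<le> 2" using e \<kappa> by (simp add: divide_le_eq)
      finally show ?thesis .
    qed simp
    finally show ?thesis by (simp add: ennreal_leI)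
  qed
  have "cone_average g e \<kappa> ?d h x \<le> (\<integral>\<^sup>+t. (\<integral>\<^sup>+z. ennreal (1 / \<kappa> ^ ?d) * (?f z * ?J t z) \<partial>lborel) \<partial>lborel)"
    unfolding cone_average_def
  proof (rule nn_integral_mono_AE)
    have "AE t in lborel. t \<noteq> (0::real)" by (rule AE_lborel_singleton)
    then show "AE t in lborel. ennreal (t ^ (?d - 1)) * indicator {0..h} t * (\<integral>\<^sup>+b. ?i b * ennreal \<bar>g (x + t *\<^sub>R (e + \<kappa> *\<^sub>R b))\<bar> \<partial>lborel)
        \<le> (\<integral>\<^sup>+z. ennreal (1 / \<kappa> ^ ?d) * (?f z * ?J t z) \<partial>lborel)"
    proof eventually_elim
      case (elim t)
      then show ?case using inner[of t] by (cases "t \<in> {0..h}") auto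
    qed
  qed
  also have "\<dots> = (\<integral>\<^sup>+z. (\<integral>\<^sup>+t. ennreal (1 / \<kappa> ^ ?d) * (?f z * ?J t z) \<partial>lborel) \<partial>lborel)"
    by (rule lborel_pair.Fubini') measurable
  also have "\<dots> \<le> (\<integral>\<^sup>+z. ennreal (2 / \<kappa> ^ ?d) * ?f z \<partial>lborel)"
  proof (rule nn_integral_mono)
    fix z
    have "(\<integral>\<^sup>+t. ennreal (1 / \<kappa> ^ ?d) * (?f z * ?J t z) \<partial>lborel) = (ennreal (1 / \<kappa> ^ ?d) * ?f z) * (\<integral>\<^sup>+t. ?J t z \<partial>lborel)"
      unfolding mult.assoc[symmetric] by (subst nn_integral_cmult[symmetric]) (auto simp: mult.assoc)
    also have "\<dots> \<le> (ennreal (1 / \<kappa> ^ ?d) * ?f z) * ennreal 2"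
      by (intro mult_left_mono) (use J[of z] in auto)
    also have "\<dots> = (ennreal (1 / \<kappa> ^ ?d) * ennreal 2) * ?f z" by (simp only: mult_ac)
    also have "ennreal (1 / \<kappa> ^ ?d) * ennreal 2 = ennreal (2 / \<kappa> ^ ?d)"
      using \<kappa> by (subst ennreal_mult[symmetric]) auto
    finally show "(\<integral>\<^sup>+t. ennreal (1 / \<kappa> ^ ?d) * (?f z * ?J t z) \<partial>lborel) \<le> ennreal (2 / \<kappa> ^ ?d) * ?f z" .
  qed
  also have "\<dots> = ennreal (2 / \<kappa> ^ ?d) * (\<integral>\<^sup>+z. ?f z \<partial>lborel)"
    by (rule nn_integral_cmult) measurable
  also have "\<dots> \<le> ennreal (2 / \<kappa> ^ ?d) * ennreal N"
    by (intro mult_left_mono bd) simp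
  finally show ?thesis .
qed

text \<open>In the limiting case \<open>k - d / p\<close> is 0, so the power of \<open>h\<close> is
  1 and the two estimates take a common form.\<close>

lemma cone_average_bound_cases:
  fixes p \<kappa> :: real
  assumes p: "p \<ge> 1" and k: "k \<ge> 1" "real k > real CARD('n) / p \<or> p = 1 \<and> k = CARD('n)" and \<kappa>: "\<kappa> > 0"
  obtains C where "C > 0" "\<And>(g :: 'n::finite rvec \<Rightarrow> real) S e h x N. g \<in> borel_measurable borel \<Longrightarrow> S \<in> sets borel \<Longrightarrow>
    norm e \<ge> 2 * \<kappa> \<Longrightarrow> h > 0 \<Longrightarrow> N > 0 \<Longrightarrow>
    (\<And>t. t \<in> {0..h} \<Longrightarrow> cball (x + t *\<^sub>R e) (t * \<kappa>) \<subseteq> S) \<Longrightarrow>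
    (\<integral>\<^sup>+z. ennreal (\<bar>g z\<bar> powr p) * indicator S z \<partial>lborel) \<le> ennreal (N powr p) \<Longrightarrow>
    cone_average g e \<kappa> k h x \<le> ennreal (C * N * h powr (real k - real CARD('n) / p))"
proof (cases "real k > real CARD('n) / p")
  case True
  let ?Z = "measure lborel (ball 0 1 :: 'n rvec set)"
  define C where "C = (?Z + 1 / \<kappa> ^ CARD('n)) / (real k - real CARD('n) / p)"
  have C: "C > 0"
    unfolding C_def using True \<kappa> emeasure_unit_ball(2)[where 'n = 'n] by (intro divide_pos_pos add_pos_pos) auto
  show ?thesis
  proof (rule that[OF C])
    fix g :: "'n rvec \<Rightarrow> real" and S e h x N
    assume "g \<in> borel_measurable borel" "S \<in> sets borel"
    "norm e \<ge> 2 * \<kappa>" "h > 0" "N > 0"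
    "\<And>t. t \<in> {0..h} \<Longrightarrow> cball (x + t *\<^sub>R e) (t * \<kappa>) \<subseteq> S"
    "(\<integral>\<^sup>+z. ennreal (\<bar>g z\<bar> powr p) * indicator S z \<partial>lborel) \<le> ennreal (N powr p)"
    from cone_average_bound[OF this(1,2) p True k(1) \<kappa> this(4-)]
    show "cone_average g e \<kappa> k h x \<le> ennreal (C * N * h powr (real k - real CARD('n) / p))"
      by (simp add: C_def mult_ac)
  qed
next
  case False
  then have pk: "p = 1" "k = CARD('n)" using k(2) by auto
  have C: "2 / \<kappa> ^ CARD('n) > 0" using \<kappa> by simp
  show ?thesis
  proof (rule that[OF C])
    fix g :: "'n rvec \<Rightarrow> real" and S e h x N
    assume a: "g \<in> borel_measurable borel" "S \<in> sets borel"
    "norm e \<ge> 2 * \<kappa>" "h > 0" "N > 0"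
    "\<And>t. t \<in> {0..h} \<Longrightarrow> cball (x + t *\<^sub>R e) (t * \<kappa>) \<subseteq> S"
    "(\<integral>\<^sup>+z. ennreal (\<bar>g z\<bar> powr p) * indicator S z \<partial>lborel) \<le> ennreal (N powr p)"
    then have "(\<integral>\<^sup>+z. ennreal \<bar>g z\<bar> * indicator S z \<partial>lborel) \<le> ennreal N" by (simp add: pk)
    from cone_average_bound_1[OF a(1,2) \<kappa> a(3,4,6) this]
    have "cone_average g e \<kappa> k h x \<le> ennreal (2 / \<kappa> ^ CARD('n)) * ennreal N" unfolding pk by blast
    also have "\<dots> = ennreal (2 / \<kappa> ^ CARD('n) * N * h powr (real k - real CARD('n) / p))"
      using \<kappa> a(4,5) by (simp add: pk ennreal_mult[symmetric])
    finally show "cone_average g e \<kappa> k h x \<le> ennreal (2 / \<kappa> ^ CARD('n) * N * h powr (real k - real CARD('n) / p))" .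
  qed
qed

section \<open>The cone condition and the weighted inequality\<close>

text \<open>The axis \<open>e\<close> need not be normalised and may be 0, in which case the cone is
  a ball; only a common bound \<open>L\<close> is imposed. The set \<open>A\<close> restricts the
  vertices and not the cones, which makes covering arguments possible.\<close>

definition cone_condition_on :: "'n::finite rvec set \<Rightarrow> 'n rvec set \<Rightarrow> bool" where
  "cone_condition_on A D \<longleftrightarrow> (\<exists>\<kappa>>0. \<exists>h>0. \<exists>L. \<forall>x\<in>A \<inter> D. \<exists>e. norm e \<le> L \<and>
     (\<forall>t\<in>{0..h}. cball (x + t *\<^sub>R e) (t * \<kappa>) \<subseteq> D))"

abbreviation cone_condition :: "'n::finite rvec set \<Rightarrow> bool" where
  "cone_condition \<equiv> cone_condition_on UNIV"

text \<open>Almost everywhere bounds can be combined over countably many axes only. Moving an axis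
  by at most \<open>5 / 8 * \<kappa>\<close> into a countable dense set leaves room for cones with
  opening \<open>\<kappa> / 8\<close> inside the old ones.\<close>

lemma cone_condition_countable:
  fixes D :: "'n::finite rvec set"
  assumes "cone_condition D"
  obtains \<kappa> h L E where "\<kappa> > 0" "h > 0" "countable E" "\<And>e. e \<in> E \<Longrightarrow> 2 * \<kappa> \<le> norm e \<and> norm e \<le> L"
    "\<And>x. x \<in> D \<Longrightarrow> \<exists>e\<in>E. \<forall>t\<in>{0..h}. cball (x + t *\<^sub>R e) (t * \<kappa>) \<subseteq> D"
proof -
  obtain \<kappa> h L where \<kappa>: "\<kappa> > 0" and h: "h > 0" and
    c: "\<forall>x\<in>D. \<exists>e. norm e \<le> L \<and> (\<forall>t\<in>{0..h}. cball (x + t *\<^sub>R e) (t * \<kappa>) \<subseteq> D)"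
    using assms unfolding cone_condition_on_def Int_UNIV_left by blast
  obtain X :: "'n rvec set" where X: "countable X" "\<And>Y. open Y \<Longrightarrow> Y \<noteq> {} \<Longrightarrow> \<exists>d\<in>X. d \<in> Y"
    using countable_dense_setE by blast
  define E where "E = {e \<in> X. 2 * (\<kappa> / 8) \<le> norm e \<and> norm e \<le> L + \<kappa>}"
  show ?thesis
  proof (rule that[of "\<kappa> / 8" h E "L + \<kappa>"])
    show "countable E" unfolding E_def using X(1) by (rule countable_subset[rotated]) auto
    fix x assume "x \<in> D"
    then obtain e where e: "norm e \<le> L" "\<And>t. t \<in> {0..h} \<Longrightarrow> cball (x + t *\<^sub>R e) (t * \<kappa>) \<subseteq> D"
      using c by blast
    \<comment> \<open>Lengthening the axis by \<open>\<kappa> / 2\<close> keeps it away from 0, so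
      that after the approximation it is still at least twice the new opening, as the limiting case
      requires.\<close>
    obtain e1 :: "'n rvec" where e1: "norm (e1 - e) = \<kappa> / 2" "norm e1 \<ge> \<kappa> / 2"
    proof (cases "e = 0")
      case True
      show ?thesis by (rule that[of "(\<kappa> / 2) *\<^sub>R axis undefined 1"]) (use \<kappa> True in auto)
    next
      case False
      have "e + (\<kappa> / 2) *\<^sub>R sgn e = (1 + \<kappa> / 2 / norm e) *\<^sub>R e"
        by (simp only: sgn_div_norm scaleR_left_distrib scaleR_scaleR scaleR_one divide_inverse)
      then have "norm (e + (\<kappa> / 2) *\<^sub>R sgn e) = \<bar>1 + \<kappa> / 2 / norm e\<bar> * norm e" by simp
      also have "\<dots> = norm e + \<kappa> / 2" using False \<kappa> by (simp add: field_simps add_pos_pos abs_of_pos)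
      finally have "norm (e + (\<kappa> / 2) *\<^sub>R sgn e) \<ge> \<kappa> / 2" by simp
      then show ?thesis
        by (intro that[of "e + (\<kappa> / 2) *\<^sub>R sgn e"]) (use \<kappa> False in \<open>auto simp: norm_sgn\<close>)
    qed
    obtain e' where e': "e' \<in> X" "e' \<in> ball e1 (\<kappa> / 8)" using X(2)[of "ball e1 (\<kappa> / 8)"] \<kappa> by auto
    then have d1: "norm (e' - e1) < \<kappa> / 8" by (simp add: dist_norm norm_minus_commute)
    have d: "norm (e' - e) \<le> \<kappa> / 8 + \<kappa> / 2"
      using norm_triangle_ineq[of "e' - e1" "e1 - e"] d1 e1(1) by simp
    have "e' \<in> E"
      using e'(1) d d1 e1(2) e(1) \<kappa> norm_triangle_ineq2[of e1 e'] norm_triangle_ineq2[of e' e]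
      by (auto simp: E_def norm_minus_commute)
    moreover have "cball (x + t *\<^sub>R e') (t * (\<kappa> / 8)) \<subseteq> D" if t: "t \<in> {0..h}" for t
    proof -
      have "dist (x + t *\<^sub>R e') (x + t *\<^sub>R e) = t * norm (e' - e)"
        using t by (simp add: dist_norm scaleR_diff_right[symmetric])
      also have "\<dots> \<le> t * (\<kappa> / 8 + \<kappa> / 2)" using t d by (intro mult_left_mono) auto
      finally have "dist (x + t *\<^sub>R e') (x + t *\<^sub>R e) + t * (\<kappa> / 8) \<le> t * (3 / 4 * \<kappa>)" by (simp add: algebra_simps)
      also have "\<dots> \<le> t * \<kappa>" using t \<kappa> by (intro mult_left_mono) auto
      finally have "cball (x + t *\<^sub>R e') (t * (\<kappa> / 8)) \<subseteq> cball (x + t *\<^sub>R e) (t * \<kappa>)"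
        by (simp add: cball_subset_cball_iff)
      then show ?thesis using e(2)[OF t] by blast
    qed
    ultimately show "\<exists>e\<in>E. \<forall>t\<in>{0..h}. cball (x + t *\<^sub>R e) (t * (\<kappa> / 8)) \<subseteq> D" by blast
  qed (use \<kappa> h in \<open>auto simp: E_def\<close>)
qed

section \<open>The weight and weighted energies\<close>

lemma continuous_on_weight: "continuous_on A (weight M)"
  unfolding weight_def by (intro continuous_intros)

lemma weight_measurable [measurable]: "weight (M :: 'n::finite rvec set) \<in> borel_measurable borel"
  by (intro borel_measurable_continuous_onI continuous_on_weight)

lemma weight_le_1: "weight M x \<le> 1"
  by (simp add: weight_def)

lemma weight_nonneg: "weight M x \<ge> 0"
  by (simp add: weight_def infdist_nonneg)

lemma weight_Lipschitz: "\<bar>weight M x - weight M y\<bar> \<le> dist x y"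
  using infdist_triangle[of x M y] infdist_triangle[of y M x]
  by (auto simp: weight_def dist_commute min_def)

lemma weight_ge_ball:
  assumes "M \<noteq> {}" "M \<inter> ball x r = {}" "r \<le> 1"
  shows "weight M x \<ge> r"
proof -
  have "r \<le> infdist x M"
    unfolding infdist_def using assms by (auto intro!: cINF_greatest simp: disjoint_iff not_less)
  then show ?thesis using assms(3) by (simp add: weight_def)
qed

lemma weight_pos:
  assumes "open D" "M \<noteq> {}" "M \<inter> D = {}" "x \<in> D"
  shows "weight M x > 0"
proof -
  obtain r where "r > 0" "ball x r \<subseteq> D" using assms(1,4) open_contains_ball by blast
  then have "weight M x \<ge> min r 1"
    using assms(2,3) by (intro weight_ge_ball) auto
  then show ?thesis using \<open>r > 0\<close> by linarith
qed

text \<open>The exponents \<open>mi_order \<alpha> - a\<close> have no fixed sign; the constant with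
  \<open>\<bar>\<gamma>\<bar>\<close> covers both signs at once.\<close>

lemma powr_two_sided:
  fixes x r c \<gamma> :: real
  assumes "r > 0" "c \<ge> 1" "r / c \<le> x" "x \<le> c * r"
  shows "x powr \<gamma> \<le> c powr \<bar>\<gamma>\<bar> * r powr \<gamma>" "r powr \<gamma> \<le> c powr \<bar>\<gamma>\<bar> * x powr \<gamma>"
proof -
  have x: "x > 0" using assms by (smt (verit) divide_pos_pos)
  have *: "u powr \<gamma> \<le> c powr \<bar>\<gamma>\<bar> * v powr \<gamma>" if "u > 0" "v > 0" "u \<le> c * v" "v \<le> c * u" for u v
  proof (cases "\<gamma> \<ge> 0")
    case True
    then have "u powr \<gamma> \<le> (c * v) powr \<gamma>" using that by (intro powr_mono2) auto
    then show ?thesis using True that assms by (simp add: powr_mult)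
  next
    case False
    have "u powr \<gamma> \<le> (v / c) powr \<gamma>"
      using that assms False by (intro powr_mono2') (auto simp: field_simps)
    also have "\<dots> = c powr \<bar>\<gamma>\<bar> * v powr \<gamma>"
      using False that assms by (simp add: powr_divide powr_minus field_simps)
    finally show ?thesis .
  qed
  show "x powr \<gamma> \<le> c powr \<bar>\<gamma>\<bar> * r powr \<gamma>" "r powr \<gamma> \<le> c powr \<bar>\<gamma>\<bar> * x powr \<gamma>"
    using *[of x r] *[of r x] assms x by (auto simp: field_simps)
qed

lemma nn_integral_lebesgue_on_eq:
  fixes D :: "'n::finite rvec set"
  assumes D: "open D" and eq: "AE x in lborel. x \<in> D \<longrightarrow> f x = f' x"
  shows "(\<integral>\<^sup>+x. f x \<partial>lebesgue_on D) = (\<integral>\<^sup>+x. f' x * indicator D x \<partial>lborel)"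
proof -
  have "(\<integral>\<^sup>+x. f x \<partial>lebesgue_on D) = (\<integral>\<^sup>+x. f x * indicator D x \<partial>lebesgue)"
    using D by (intro nn_integral_restrict_space) auto
  also have "\<dots> = (\<integral>\<^sup>+x. f x * indicator D x \<partial>lborel)" by (rule nn_integral_completion)
  also have "\<dots> = (\<integral>\<^sup>+x. f' x * indicator D x \<partial>lborel)"
    using eq by (intro nn_integral_cong_AE) (auto elim!: eventually_mono simp: indicator_def)
  finally show ?thesis .
qed

lemma kondratiev_energy_weak_rep:
  fixes D :: "('n::{finite,linorder} rvec) set"
  assumes D: "open D" and u: "weakly_differentiable m D u"
  shows "kondratiev_energy D M m a p u = (\<Sum>\<alpha>\<in>mi_upto m. \<integral>\<^sup>+x. ennreal
     ((weight M x powr (real (mi_order \<alpha>) - a) * \<bar>weak_rep D \<alpha> u x\<bar>) powr p) * indicator D x \<partial>lborel)"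
  unfolding kondratiev_energy_def
proof (rule sum.cong[OF refl], rule nn_integral_lebesgue_on_eq[OF D])
  fix \<alpha> :: "'n \<Rightarrow> nat" assume "\<alpha> \<in> mi_upto m"
  then have "mi_order \<alpha> \<le> m" by (simp add: mi_upto_def)
  from weak_rep_AE[OF D u this]
  show "AE x in lborel. x \<in> D \<longrightarrow> ennreal (\<bar>weighted_deriv D M a \<alpha> u x\<bar> powr p)
     = ennreal ((weight M x powr (real (mi_order \<alpha>) - a) * \<bar>weak_rep D \<alpha> u x\<bar>) powr p)"
    by eventually_elim (auto simp: weighted_deriv_def abs_mult)
qed

text \<open>Shows that the vertices admitting a given compact cone form an open set: the complement
  consists of differences between a closed and a compact set.\<close>

lemma open_translates_subset:
  fixes C D :: "'n::finite rvec set"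
  assumes "compact C" "open D"
  shows "open {x. \<forall>z\<in>C. x + z \<in> D}"
proof -
  have eq: "{x. \<forall>z\<in>C. x + z \<in> D} = - (\<Union>y\<in>- D. \<Union>z\<in>C. {y - z})" by force
  have "closed (\<Union>y\<in>- D. \<Union>z\<in>C. {y - z})"
    using closed_compact_differences[of "- D" C] assms by (simp add: closed_def)
  then show ?thesis unfolding eq by (rule open_Compl)
qed

lemma compact_cone:
  fixes e :: "'n::finite rvec"
  assumes "\<kappa> \<ge> 0"
  shows "compact (\<Union>t\<in>{0..h}. cball (t *\<^sub>R e) (t * \<kappa>))"
proof -
  have "(\<Union>t\<in>{0..h}. cball (t *\<^sub>R e) (t * \<kappa>)) = (\<lambda>(t, b). t *\<^sub>R e + (t * \<kappa>) *\<^sub>R b) ` ({0..h} \<times> cball 0 1)"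
  proof (intro equalityI subsetI)
    fix z assume "z \<in> (\<Union>t\<in>{0..h}. cball (t *\<^sub>R e) (t * \<kappa>))"
    then obtain t where t: "t \<in> {0..h}" "norm (z - t *\<^sub>R e) \<le> t * \<kappa>" by (auto simp: dist_norm norm_minus_commute)
    show "z \<in> (\<lambda>(t, b). t *\<^sub>R e + (t * \<kappa>) *\<^sub>R b) ` ({0..h} \<times> cball 0 1)"
    proof (cases "t * \<kappa> = 0")
      case True
      then show ?thesis using t by (intro image_eqI[of _ _ "(t, 0)"]) auto
    next
      case False
      then have "t * \<kappa> > 0" using t assms by (simp add: order_less_le)
      then show ?thesis using t
        by (intro image_eqI[of _ _ "(t, (1 / (t * \<kappa>)) *\<^sub>R (z - t *\<^sub>R e))"]) (auto simp: divide_le_eq)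
    qed
  next
    fix z assume "z \<in> (\<lambda>(t, b). t *\<^sub>R e + (t * \<kappa>) *\<^sub>R b) ` ({0..h} \<times> cball 0 1)"
    then obtain t b where tb: "t \<in> {0..h}" "norm b \<le> 1" "z = t *\<^sub>R e + (t * \<kappa>) *\<^sub>R b" by auto
    have "norm ((t * \<kappa>) *\<^sub>R b) = (t * \<kappa>) * norm b" using tb assms by simp
    also have "\<dots> \<le> t * \<kappa>" using tb assms by (intro mult_left_le) auto
    finally have "z \<in> cball (t *\<^sub>R e) (t * \<kappa>)" by (simp add: tb(3) dist_norm)
    then show "z \<in> (\<Union>t\<in>{0..h}. cball (t *\<^sub>R e) (t * \<kappa>))" using tb(1) by blast
  qed
  moreover have "compact ((\<lambda>(t, b). t *\<^sub>R e + (t * \<kappa>) *\<^sub>R b) ` ({0..h} \<times> cball 0 1))"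
    by (intro compact_continuous_image compact_Times) (auto simp: case_prod_beta intro!: continuous_intros)
  ultimately show ?thesis by simp
qed

lemma cball_cone_translate:
  fixes x e :: "'n::finite rvec"
  shows "(\<forall>z\<in>(\<Union>t\<in>T. cball (t *\<^sub>R e) (t * \<kappa>)). x + z \<in> D) \<longleftrightarrow> (\<forall>t\<in>T. cball (x + t *\<^sub>R e) (t * \<kappa>) \<subseteq> D)"
proof safe
  fix t y assume a: "\<forall>z\<in>(\<Union>t\<in>T. cball (t *\<^sub>R e) (t * \<kappa>)). x + z \<in> D" and t: "t \<in> T" and y: "y \<in> cball (x + t *\<^sub>R e) (t * \<kappa>)"
  have "y - x \<in> cball (t *\<^sub>R e) (t * \<kappa>)" using y by (simp add: dist_norm algebra_simps)
  then have "x + (y - x) \<in> D" using a t by blast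
  then show "y \<in> D" by simp
next
  fix t z assume a: "\<forall>t\<in>T. cball (x + t *\<^sub>R e) (t * \<kappa>) \<subseteq> D" and t: "t \<in> T" and z: "z \<in> cball (t *\<^sub>R e) (t * \<kappa>)"
  have "x + z \<in> cball (x + t *\<^sub>R e) (t * \<kappa>)" using z by (simp add: dist_norm)
  then show "x + z \<in> D" using a t by blast
qed

text \<open>The least such \<open>n\<close> even gives \<open>w \<le> 2 * (1 / 2) ^ n\<close>; the
  factor 4 allows strict inequalities on both sides, so that the dyadic shells of the weight are
  open.\<close>

lemma dyadic_bracket:
  fixes w :: real
  assumes "0 < w" "w \<le> 1"
  obtains n :: nat where "(1 / 2) ^ n < w" "w < 4 * (1 / 2) ^ n"
proof -
  have ex: "\<exists>n::nat. (1 / 2) ^ n < w" using assms(1) by (intro real_arch_pow_inv) auto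
  define n where "n = (LEAST n::nat. (1 / 2) ^ n < w)"
  have n: "(1 / 2) ^ n < w" unfolding n_def using ex by (rule LeastI_ex)
  then obtain k where k: "n = Suc k" using assms(2) by (cases n) auto
  then have "\<not> (1 / 2) ^ k < w" unfolding n_def using not_less_Least by (metis lessI)
  moreover have "(1 / 2 :: real) ^ k = 2 * (1 / 2) ^ n" "(0::real) < (1 / 2) ^ n" by (auto simp: k)
  ultimately show ?thesis using n by (intro that[of n]) linarith+
qed

text \<open>On a shell where the weight is comparable to \<open>r\<close>, it stays comparable to
  \<open>r\<close> along cones of height \<open>c * r\<close>. The energy then bounds unweighted L_p
  norms over these cones up to powers of \<open>r\<close>, and all powers combine to
  \<open>r powr - \<sigma>\<close> with constants independent of the shell and of the axis.\<close>

lemma weighted_sobolev_bound: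
  fixes D M :: "('n::{finite,linorder} rvec) set"
  assumes D: "open D" and M: "M \<noteq> {}" "M \<inter> D = {}" and cone: "cone_condition D"
    and p: "p \<ge> 1" and k: "k \<ge> 1" "real k > real CARD('n) / p \<or> p = 1 \<and> k = CARD('n)"
    and \<beta>: "mi_order \<beta> + k \<le> m"
  shows "\<exists>C\<ge>0. \<forall>u N. weakly_differentiable m D u \<longrightarrow> N > 0 \<longrightarrow>
     kondratiev_energy D M m a p u \<le> ennreal (N powr p) \<longrightarrow>
     (AE x in lborel. x \<in> D \<longrightarrow> weight M x powr (real (mi_order \<beta>) - a + real CARD('n) / p) * \<bar>weak_rep D \<beta> u x\<bar> \<le> C * N)"
proof -
  let ?d = "real CARD('n)" and ?b = "real (mi_order \<beta>)"
  obtain \<kappa> h0 L E where \<kappa>: "\<kappa> > 0" and h0: "h0 > 0" and E: "countable E"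
    "\<And>e. e \<in> E \<Longrightarrow> 2 * \<kappa> \<le> norm e \<and> norm e \<le> L"
    "\<And>x. x \<in> D \<Longrightarrow> \<exists>e\<in>E. \<forall>t\<in>{0..h0}. cball (x + t *\<^sub>R e) (t * \<kappa>) \<subseteq> D"
    using cone_condition_countable[OF cone] by metis
  obtain C1 where C1: "C1 > 0" "\<And>(g :: 'n rvec \<Rightarrow> real) S e h x N. g \<in> borel_measurable borel \<Longrightarrow> S \<in> sets borel \<Longrightarrow>
    norm e \<ge> 2 * \<kappa> \<Longrightarrow> h > 0 \<Longrightarrow> N > 0 \<Longrightarrow>
    (\<And>t. t \<in> {0..h} \<Longrightarrow> cball (x + t *\<^sub>R e) (t * \<kappa>) \<subseteq> S) \<Longrightarrow>
    (\<integral>\<^sup>+z. ennreal (\<bar>g z\<bar> powr p) * indicator S z \<partial>lborel) \<le> ennreal (N powr p) \<Longrightarrow>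
    cone_average g e \<kappa> k h x \<le> ennreal (C1 * N * h powr (real k - ?d / p))"
    using cone_average_bound_cases[OF p k \<kappa>] by blast
  define W where "W = max 1 (L + \<kappa>)"
  \<comment> \<open>Relative height of the cones: their points are within
    \<open>c * r * W \<le> r / 2\<close> of the vertex, and the weight is Lipschitz with constant
    1.\<close>
  define c where "c = min h0 (1 / (2 * W))"
  have W: "W \<ge> 1" "L + \<kappa> \<le> W" by (auto simp: W_def)
  have c: "c > 0" "c \<le> h0" "c * W \<le> 1 / 2"
  proof -
    show "c > 0" "c \<le> h0" using h0 W by (auto simp: c_def)
    have "c * W \<le> 1 / (2 * W) * W" unfolding c_def using W by (intro mult_right_mono) auto
    then show "c * W \<le> 1 / 2" using W by simp
  qed
  \<comment> \<open>The sum over all orders \<open>l \<le> k\<close> serves as a common upper bound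
    for the constants of the single orders.\<close>
  define C2 where "C2 = (\<Sum>l\<le>k. C1 * 8 powr \<bar>?b + real l - a\<bar> * c powr (real l - ?d / p))"
  define C3 where "C3 = real k * W ^ k * real (card {js :: 'n list. length js \<le> k}) / measure lborel (ball 0 1 :: 'n rvec set)"
  define \<sigma> where "\<sigma> = ?b - a + ?d / p"
  have C2: "C2 \<ge> 0" unfolding C2_def using C1(1) by (intro sum_nonneg) auto
  have C3: "C3 \<ge> 0" unfolding C3_def using W by auto
  show ?thesis
  proof (intro exI[of _ "4 powr \<bar>\<sigma>\<bar> * (C3 * C2)"] conjI allI impI)
    show "4 powr \<bar>\<sigma>\<bar> * (C3 * C2) \<ge> 0" using C2 C3 by auto
    fix u :: "'n rvec \<Rightarrow> real" and N :: real
    assume u: "weakly_differentiable m D u" and N: "N > 0" and en: "kondratiev_energy D M m a p u \<le> ennreal (N powr p)"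
    define G where "G js = weak_rep D (\<lambda>i. \<beta> i + count (mset js) i) u" for js
    have G: "weak_family D k G" unfolding G_def by (rule weak_family_weak_rep[OF D u \<beta>])
    have G0: "G [] = weak_rep D \<beta> u" by (simp add: G_def)
    have Gm [measurable]: "G js \<in> borel_measurable borel" if "length js \<le> k" for js
      using G that by (simp add: weak_family_def borel_loc_int_def)
    have energy_le: "(\<integral>\<^sup>+x. ennreal ((weight M x powr (?b + real (length js) - a) * \<bar>G js x\<bar>) powr p) * indicator D x \<partial>lborel)
        \<le> ennreal (N powr p)" if js: "length js \<le> k" for js
    proof -
      let ?\<alpha> = "\<lambda>i. \<beta> i + count (mset js) i"
      have o: "mi_order ?\<alpha> = mi_order \<beta> + length js" by (simp only: mi_order_add mi_order_count)
      have mem: "?\<alpha> \<in> mi_upto m" using o js \<beta> by (simp add: mi_upto_def)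
      have "(\<integral>\<^sup>+x. ennreal ((weight M x powr (real (mi_order ?\<alpha>) - a) * \<bar>weak_rep D ?\<alpha> u x\<bar>) powr p) * indicator D x \<partial>lborel)
        \<le> kondratiev_energy D M m a p u"
        unfolding kondratiev_energy_weak_rep[OF D u]
        by (rule member_le_sum[OF mem]) (auto simp: finite_mi_upto)
      then show ?thesis using en unfolding o G_def by (simp add: order_trans)
    qed
    \<comment> \<open>Vertices in the \<open>n\<close>-th shell that admit the cone with axis
      \<open>e\<close> and height \<open>c * (1 / 2) ^ n\<close>. Fixing \<open>e\<close> and
      \<open>n\<close> makes the set open, so that test functions supported in it can be
      used.\<close>
    define V where "V e n = {x. \<forall>z\<in>(\<Union>t\<in>{0..c * (1/2)^n}. cball (t *\<^sub>R e) (t * \<kappa>)). x + z \<in> D} \<inter>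
       ({x. (1/2)^n < weight M x} \<inter> {x. weight M x < 4 * (1/2)^n})" for e and n :: nat
    have main: "AE x in lborel. x \<in> V e n \<longrightarrow> weight M x powr \<sigma> * \<bar>G [] x\<bar> \<le> 4 powr \<bar>\<sigma>\<bar> * (C3 * C2) * N" if e: "e \<in> E" for e n
    proof -
      define r where "r = (1 / 2 :: real) ^ n"
      define h where "h = c * r"
      have r: "r > 0" "r \<le> 1" by (auto simp: r_def power_le_one)
      have h: "h > 0" using c r by (simp add: h_def)
      have Vo: "open (V e n)"
        unfolding V_def using D \<kappa>
        by (intro open_Int open_translates_subset compact_cone open_Collect_less continuous_on_weight continuous_on_const) auto
      \<comment> \<open>Contains all cones with vertices in \<open>V e n\<close>: from values in
        \<open>(r, 4 * r)\<close> at the vertex the weight moves by at most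
        \<open>r / 2\<close>.\<close>
      define S where "S = D \<inter> ({x. r / 2 < weight M x} \<inter> {x. weight M x < 8 * r})"
      have "open S" unfolding S_def
        by (intro open_Int D open_Collect_less continuous_on_weight continuous_on_const)
      then have Sm [measurable]: "S \<in> sets borel" by simp
      have Vx: "r < weight M x" "weight M x < 4 * r" "\<And>t. t \<in> {0..h} \<Longrightarrow> cball (x + t *\<^sub>R e) (t * \<kappa>) \<subseteq> D"
        if "x \<in> V e n" for x
        using that unfolding V_def r_def h_def Int_iff mem_Collect_eq cball_cone_translate by blast+
      have sub: "cball (x + t *\<^sub>R e) (t * \<kappa>) \<subseteq> S" if x: "x \<in> V e n" and t: "t \<in> {0..h}" for x t
      proof
        fix y assume y: "y \<in> cball (x + t *\<^sub>R e) (t * \<kappa>)"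
        have "dist x y \<le> dist x (x + t *\<^sub>R e) + dist (x + t *\<^sub>R e) y" by (rule dist_triangle)
        also have "\<dots> \<le> t * norm e + t * \<kappa>" using y t by (simp add: dist_norm)
        also have "\<dots> = t * (norm e + \<kappa>)" by (simp add: distrib_left)
        also have "\<dots> \<le> h * W" using t h E(2)[OF e] W \<kappa> by (intro mult_mono) (auto intro: add_nonneg_nonneg)
        also have "\<dots> = (c * W) * r" by (simp add: h_def)
        also have "\<dots> \<le> (1 / 2) * r" using c(3) r by (intro mult_right_mono) auto
        finally have "\<bar>weight M x - weight M y\<bar> \<le> r / 2" using weight_Lipschitz[of M x y] by simp
        then have "r / 2 < weight M y" "weight M y < 8 * r" using Vx(1,2)[OF x] r by linarith+
        then show "y \<in> S" using Vx(3)[OF x t] y by (auto simp: S_def)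
      qed
      have Gbd: "(\<integral>\<^sup>+z. ennreal (\<bar>G js z\<bar> powr p) * indicator S z \<partial>lborel)
          \<le> ennreal ((8 powr \<bar>?b + real (length js) - a\<bar> * r powr - (?b + real (length js) - a) * N) powr p)"
        if js: "length js \<le> k" for js
      proof -
        note [measurable] = Gm[OF js]
        define \<gamma> where "\<gamma> = ?b + real (length js) - a"
        define A where "A = 8 powr \<bar>\<gamma>\<bar> * r powr - \<gamma>"
        have A: "A > 0" using r by (simp add: A_def)
        have "(\<integral>\<^sup>+z. ennreal (\<bar>G js z\<bar> powr p) * indicator S z \<partial>lborel)
            \<le> (\<integral>\<^sup>+z. ennreal (A powr p) * (ennreal ((weight M z powr \<gamma> * \<bar>G js z\<bar>) powr p) * indicator D z) \<partial>lborel)"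
        proof (rule nn_integral_mono)
          fix z
          show "ennreal (\<bar>G js z\<bar> powr p) * indicator S z \<le> ennreal (A powr p) * (ennreal ((weight M z powr \<gamma> * \<bar>G js z\<bar>) powr p) * indicator D z)"
          proof (cases "z \<in> S")
            case True
            then have z: "z \<in> D" "r / 2 < weight M z" "weight M z < 8 * r" by (auto simp: S_def)
            have "r powr \<gamma> \<le> 8 powr \<bar>\<gamma>\<bar> * weight M z powr \<gamma>"
              by (rule powr_two_sided(2)) (use z r in auto)
            then have "1 \<le> A * weight M z powr \<gamma>"
              using r by (simp add: A_def powr_minus field_simps)
            then have "\<bar>G js z\<bar> \<le> A * (weight M z powr \<gamma> * \<bar>G js z\<bar>)"
              using mult_right_mono[of 1 "A * weight M z powr \<gamma>" "\<bar>G js z\<bar>"] by (simp add: mult.assoc)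
            then have "\<bar>G js z\<bar> powr p \<le> (A * (weight M z powr \<gamma> * \<bar>G js z\<bar>)) powr p"
              using p by (intro powr_mono2) auto
            also have "\<dots> = A powr p * (weight M z powr \<gamma> * \<bar>G js z\<bar>) powr p"
              using A by (simp add: powr_mult)
            finally show ?thesis using True z A by (simp add: ennreal_mult[symmetric] ennreal_leI)
          qed simp
        qed
        also have "\<dots> = ennreal (A powr p) * (\<integral>\<^sup>+z. ennreal ((weight M z powr \<gamma> * \<bar>G js z\<bar>) powr p) * indicator D z \<partial>lborel)"
          using D by (intro nn_integral_cmult) auto
        also have "\<dots> \<le> ennreal (A powr p) * ennreal (N powr p)"
          using energy_le[OF js] unfolding \<gamma>_def by (intro mult_left_mono) auto
        also have "\<dots> = ennreal ((A * N) powr p)"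
          using A N by (simp add: ennreal_mult[symmetric] powr_mult)
        finally show ?thesis by (simp add: A_def \<gamma>_def)
      qed
      define Q where "Q = C2 * r powr - \<sigma> * N"
      have Q: "Q \<ge> 0" using C2 N by (simp add: Q_def)
      have "AE x in lborel. x \<in> V e n \<longrightarrow> \<bar>G [] x\<bar> \<le> C3 * Q"
        unfolding C3_def
      proof (rule cone_pointwise_bound[OF Vo G k(1) h])
        show "norm e + \<kappa> \<le> W" using E(2)[OF e] W by linarith
        show "1 \<le> W" "0 \<le> \<kappa>" "0 \<le> Q" using W \<kappa> Q by auto
        show "cball (x + t *\<^sub>R e) (t * \<kappa>) \<subseteq> D" if "x \<in> V e n" "t \<in> {0..h}" for x t
          using Vx(3) that by blast
        fix x js assume x: "x \<in> V e n" and js: "length (js :: 'n list) \<le> k"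
        define \<gamma> where "\<gamma> = ?b + real (length js) - a"
        define N' where "N' = 8 powr \<bar>\<gamma>\<bar> * r powr - \<gamma> * N"
        have N': "N' > 0" using N r by (simp add: N'_def)
        have "cone_average (G js) e \<kappa> k h x \<le> ennreal (C1 * N' * h powr (real k - ?d / p))"
          using Gbd[OF js] unfolding \<gamma>_def[symmetric] N'_def[symmetric]
          by (intro C1(2)[OF Gm[OF js] Sm _ h N' sub[OF x]]) (use E(2)[OF e] in auto)
        then have "ennreal (h ^ length js / h ^ k) * cone_average (G js) e \<kappa> k h x
           \<le> ennreal (h ^ length js / h ^ k) * ennreal (C1 * N' * h powr (real k - ?d / p))"
          by (rule mult_left_mono) simp
        also have "\<dots> = ennreal (h ^ length js / h ^ k * (C1 * N' * h powr (real k - ?d / p)))"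
          using h C1(1) N' by (intro ennreal_mult[symmetric]) auto
        \<comment> \<open>A word of length \<open>l\<close> contributes
          \<open>h powr (l - d / p)\<close> from the cone and \<open>r powr - (b + l - a)\<close>
          from the weight, where \<open>b\<close> is the order of \<open>\<beta>\<close>; since
          \<open>h = c * r\<close>, the length \<open>l\<close> cancels in the power of
          \<open>r\<close>.\<close>
        also have "h ^ length js / h ^ k * (C1 * N' * h powr (real k - ?d / p))
            = C1 * 8 powr \<bar>\<gamma>\<bar> * c powr (real (length js) - ?d / p) * r powr - \<sigma> * N"
        proof -
          have "h ^ length js / h ^ k * h powr (real k - ?d / p) = h powr (real (length js) - ?d / p)"
            using h by (simp add: powr_realpow[symmetric] powr_diff[symmetric] powr_add[symmetric])
          also have "\<dots> = c powr (real (length js) - ?d / p) * r powr (real (length js) - ?d / p)"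
            using c r by (simp add: h_def powr_mult)
          finally have hh: "h ^ length js / h ^ k * h powr (real k - ?d / p)
            = c powr (real (length js) - ?d / p) * r powr (real (length js) - ?d / p)" .
          have "h ^ length js / h ^ k * (C1 * N' * h powr (real k - ?d / p))
            = (h ^ length js / h ^ k * h powr (real k - ?d / p)) * (C1 * N')" by (simp only: mult_ac)
          also have "\<dots> = C1 * 8 powr \<bar>\<gamma>\<bar> * c powr (real (length js) - ?d / p) * (r powr - \<gamma> * r powr (real (length js) - ?d / p)) * N"
            unfolding hh N'_def by (simp only: mult_ac)
          also have "r powr - \<gamma> * r powr (real (length js) - ?d / p) = r powr - \<sigma>"
            by (simp add: powr_add[symmetric] \<gamma>_def \<sigma>_def algebra_simps)
          finally show ?thesis .
        qed
        also have "\<dots> \<le> Q"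
        proof -
          have "C1 * 8 powr \<bar>\<gamma>\<bar> * c powr (real (length js) - ?d / p) \<le> C2"
            unfolding C2_def \<gamma>_def using js C1(1)
            by (intro member_le_sum[of _ "{..k}" "\<lambda>l. C1 * 8 powr \<bar>?b + real l - a\<bar> * c powr (real l - ?d / p)"]) auto
          then show ?thesis unfolding Q_def using N by (intro mult_right_mono) auto
        qed
        finally show "ennreal (h ^ length js / h ^ k) * cone_average (G js) e \<kappa> k h x \<le> ennreal Q"
          by (simp add: ennreal_leI)
      qed
      then show ?thesis
      proof eventually_elim
        case (elim x)
        show ?case
        proof
          assume x: "x \<in> V e n"
          have "weight M x powr \<sigma> \<le> 4 powr \<bar>\<sigma>\<bar> * r powr \<sigma>"
            by (rule powr_two_sided(1)) (use Vx(1,2)[OF x] r in auto)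
          then have "weight M x powr \<sigma> * \<bar>G [] x\<bar> \<le> (4 powr \<bar>\<sigma>\<bar> * r powr \<sigma>) * (C3 * Q)"
            using elim x C3 Q by (intro mult_mono) auto
          also have "\<dots> = 4 powr \<bar>\<sigma>\<bar> * (C3 * C2) * N"
            using r by (simp add: Q_def powr_minus field_simps)
          finally show "weight M x powr \<sigma> * \<bar>G [] x\<bar> \<le> 4 powr \<bar>\<sigma>\<bar> * (C3 * C2) * N" .
        qed
      qed
    qed
    have "AE x in lborel. \<forall>e\<in>E. \<forall>n. x \<in> V e n \<longrightarrow> weight M x powr \<sigma> * \<bar>G [] x\<bar> \<le> 4 powr \<bar>\<sigma>\<bar> * (C3 * C2) * N"
    proof (rule AE_ball_countable'[OF _ E(1)])
      show "AE x in lborel. \<forall>n. x \<in> V e n \<longrightarrow> weight M x powr \<sigma> * \<bar>G [] x\<bar> \<le> 4 powr \<bar>\<sigma>\<bar> * (C3 * C2) * N" if "e \<in> E" for e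
        unfolding AE_all_countable using main[OF that] by blast
    qed
    then show "AE x in lborel. x \<in> D \<longrightarrow> weight M x powr (?b - a + ?d / p) * \<bar>weak_rep D \<beta> u x\<bar> \<le> 4 powr \<bar>\<sigma>\<bar> * (C3 * C2) * N"
      unfolding G0 \<sigma>_def[symmetric]
    proof eventually_elim
      case (elim x)
      show ?case
      proof
        assume x: "x \<in> D"
        obtain e where e: "e \<in> E" "\<forall>t\<in>{0..h0}. cball (x + t *\<^sub>R e) (t * \<kappa>) \<subseteq> D" using E(3)[OF x] by blast
        obtain n :: nat where n: "(1 / 2) ^ n < weight M x" "weight M x < 4 * (1 / 2) ^ n"
          using dyadic_bracket[OF weight_pos[OF D M x] weight_le_1] by blast
        have "c * (1 / 2) ^ n \<le> h0"
        proof -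
          have "c * (1 / 2) ^ n \<le> c * 1" using c(1) by (intro mult_left_mono) (auto simp: power_le_one)
          then show ?thesis using c(2) by simp
        qed
        then have "x \<in> V e n"
          unfolding V_def Int_iff mem_Collect_eq cball_cone_translate using e(2) n by auto
        then show "weight M x powr \<sigma> * \<bar>weak_rep D \<beta> u x\<bar> \<le> 4 powr \<bar>\<sigma>\<bar> * (C3 * C2) * N"
          using elim e(1) by blast
      qed
    qed
  qed
qed

section \<open>From pointwise bounds to the embedding\<close>

lemma weakly_differentiable_mono: "weakly_differentiable m D u \<Longrightarrow> m' \<le> m \<Longrightarrow> weakly_differentiable m' D u"
  by (auto simp: weakly_differentiable_def mi_upto_def)

lemma weighted_deriv_measurable:
  assumes D: "open D" and u: "weakly_differentiable m D u" and \<alpha>: "mi_order \<alpha> \<le> m"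
  shows "weighted_deriv D M a \<alpha> u \<in> borel_measurable (lebesgue_on D)"
proof -
  have "has_weak_deriv D \<alpha> u (weak_deriv D \<alpha> u)"
    using u \<alpha> has_weak_deriv_weak_deriv unfolding weakly_differentiable_def mi_upto_def by blast
  then have "locally_integrable D (weak_deriv D \<alpha> u)" by (simp add: has_weak_deriv_def)
  from locally_integrable_measurable[OF D this]
  have 1: "weak_deriv D \<alpha> u \<in> borel_measurable (lebesgue_on D)"
    using D by (subst borel_measurable_restrict_space_iff) auto
  have "(\<lambda>x. weight M x powr (real (mi_order \<alpha>) - a)) \<in> borel_measurable lborel" by measurable
  then have 2: "(\<lambda>x. weight M x powr (real (mi_order \<alpha>) - a)) \<in> borel_measurable (lebesgue_on D)"
    by (intro measurable_restrict_space1 measurable_completion)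
  have "weighted_deriv D M a \<alpha> u = (\<lambda>x. weight M x powr (real (mi_order \<alpha>) - a) * weak_deriv D \<alpha> u x)"
    by (simp add: fun_eq_iff weighted_deriv_def)
  then show ?thesis using borel_measurable_times[OF 2 1] by simp
qed

text \<open>The pointwise bounds carry the exponent \<open>mi_order \<beta> - a + d / p\<close>. It
  may be raised to \<open>mi_order \<beta> - a'\<close> because the weight is at most 1. They are
  used for every \<open>N\<close> strictly above the norm, so that \<open>N > 0\<close> also when
  the norm is 0, and \<open>N\<close> then tends to the norm.\<close>

theorem embedding_sufficient:
  fixes D M :: "('n::{finite,linorder} rvec) set"
  assumes D: "open D" and M: "M \<noteq> {}" "M \<inter> D = {}" and cone: "cone_condition D"
    and p: "p \<ge> 1" and k: "k \<ge> 1" "real k > real CARD('n) / p \<or> p = 1 \<and> k = CARD('n)"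
    and m: "m' + k \<le> m" and a: "a - real CARD('n) / p \<ge> a'"
  shows "continuously_embedded
     (kondratiev_space D M m a p) (kondratiev_norm D M m a p)
     (kondratiev_space_inf D M m' a') (kondratiev_norm_inf D M m' a')"
proof -
  have "\<exists>C\<ge>0. \<forall>u N. weakly_differentiable m D u \<longrightarrow> N > 0 \<longrightarrow>
     kondratiev_energy D M m a p u \<le> ennreal (N powr p) \<longrightarrow>
     (AE x in lborel. x \<in> D \<longrightarrow> weight M x powr (real (mi_order \<beta>) - a + real CARD('n) / p) * \<bar>weak_rep D \<beta> u x\<bar> \<le> C * N)"
    if "\<beta> \<in> mi_upto m'" for \<beta>
  proof -
    have "mi_order \<beta> + k \<le> m" using that m by (simp add: mi_upto_def)
    then show ?thesis by (rule weighted_sobolev_bound[OF D M cone p k])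
  qed
  then have "\<forall>\<beta>\<in>mi_upto m'. \<exists>C. C \<ge> 0 \<and> (\<forall>u N. weakly_differentiable m D u \<longrightarrow> N > 0 \<longrightarrow>
     kondratiev_energy D M m a p u \<le> ennreal (N powr p) \<longrightarrow>
     (AE x in lborel. x \<in> D \<longrightarrow> weight M x powr (real (mi_order \<beta>) - a + real CARD('n) / p) * \<bar>weak_rep D \<beta> u x\<bar> \<le> C * N))"
    by blast
  from bchoice[OF this] obtain C where CC: "\<forall>\<beta>\<in>mi_upto m'. C \<beta> \<ge> 0 \<and> (\<forall>u N. weakly_differentiable m D u \<longrightarrow> N > 0 \<longrightarrow>
     kondratiev_energy D M m a p u \<le> ennreal (N powr p) \<longrightarrow>
     (AE x in lborel. x \<in> D \<longrightarrow> weight M x powr (real (mi_order \<beta>) - a + real CARD('n) / p) * \<bar>weak_rep D \<beta> u x\<bar> \<le> C \<beta> * N))" ..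
  then have C: "\<And>\<beta>. \<beta> \<in> mi_upto m' \<Longrightarrow> C \<beta> \<ge> 0"
    "\<And>\<beta> u N. \<beta> \<in> mi_upto m' \<Longrightarrow> weakly_differentiable m D u \<Longrightarrow> N > 0 \<Longrightarrow>
     kondratiev_energy D M m a p u \<le> ennreal (N powr p) \<Longrightarrow>
     AE x in lborel. x \<in> D \<longrightarrow> weight M x powr (real (mi_order \<beta>) - a + real CARD('n) / p) * \<bar>weak_rep D \<beta> u x\<bar> \<le> C \<beta> * N"
    by blast+
  define K where "K = (\<Sum>\<beta>\<in>mi_upto m'. C \<beta>)"
  have K: "K \<ge> 0" unfolding K_def using C(1) by (rule sum_nonneg)
  have sup: "kondratiev_sup D M m' a' u \<le> ennreal (K * N)"
    if u: "weakly_differentiable m D u" and N: "N > 0" and en: "kondratiev_energy D M m a p u \<le> ennreal (N powr p)" for u N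
  proof -
    have "kondratiev_sup D M m' a' u \<le> (\<Sum>\<beta>\<in>mi_upto m'. ennreal (C \<beta> * N))"
      unfolding kondratiev_sup_def
    proof (rule sum_mono)
      fix \<beta> :: "'n \<Rightarrow> nat" assume \<beta>: "\<beta> \<in> mi_upto m'"
      then have o: "mi_order \<beta> \<le> m" using m by (simp add: mi_upto_def)
      show "esssup (lebesgue_on D) (\<lambda>x. ennreal \<bar>weighted_deriv D M a' \<beta> u x\<bar>) \<le> ennreal (C \<beta> * N)"
      proof (rule esssup_I)
        show "(\<lambda>x. ennreal \<bar>weighted_deriv D M a' \<beta> u x\<bar>) \<in> borel_measurable (lebesgue_on D)"
          using weighted_deriv_measurable[OF D u o] by measurable
        have "AE x in lborel. x \<in> D \<longrightarrow> ennreal \<bar>weighted_deriv D M a' \<beta> u x\<bar> \<le> ennreal (C \<beta> * N)"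
          using C(2)[OF \<beta> u N en] weak_rep_AE[OF D u o]
        proof eventually_elim
          case (elim x)
          show ?case
          proof
            assume x: "x \<in> D"
            have w: "weight M x > 0" "weight M x \<le> 1" using weight_pos[OF D M x] weight_le_1 by auto
            have "\<bar>weighted_deriv D M a' \<beta> u x\<bar> = weight M x powr (real (mi_order \<beta>) - a') * \<bar>weak_rep D \<beta> u x\<bar>"
              using elim x by (simp add: weighted_deriv_def abs_mult)
            also have "\<dots> \<le> weight M x powr (real (mi_order \<beta>) - a + real CARD('n) / p) * \<bar>weak_rep D \<beta> u x\<bar>"
              using w a by (intro mult_right_mono powr_mono') auto
            also have "\<dots> \<le> C \<beta> * N" using elim x by blast
            finally show "ennreal \<bar>weighted_deriv D M a' \<beta> u x\<bar> \<le> ennreal (C \<beta> * N)" by (rule ennreal_leI)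
          qed
        qed
        then have "AE x in lebesgue. x \<in> D \<longrightarrow> ennreal \<bar>weighted_deriv D M a' \<beta> u x\<bar> \<le> ennreal (C \<beta> * N)"
          by (rule AE_completion)
        then show "AE x in lebesgue_on D. ennreal \<bar>weighted_deriv D M a' \<beta> u x\<bar> \<le> ennreal (C \<beta> * N)"
          using D by (subst AE_restrict_space_iff) auto
      qed
    qed
    also have "\<dots> = ennreal (\<Sum>\<beta>\<in>mi_upto m'. C \<beta> * N)"
      using C(1) N by (intro sum_ennreal) auto
    also have "(\<Sum>\<beta>\<in>mi_upto m'. C \<beta> * N) = K * N" by (simp add: K_def sum_distrib_right)
    finally show ?thesis .
  qed
  have bound: "kondratiev_sup D M m' a' u < \<infinity> \<and> kondratiev_norm_inf D M m' a' u \<le> K * kondratiev_norm D M m a p u"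
    if u: "u \<in> kondratiev_space D M m a p" for u
  proof -
    have wd: "weakly_differentiable m D u" and fin: "kondratiev_energy D M m a p u < \<infinity>"
      using u by (auto simp: kondratiev_space_def)
    let ?n = "kondratiev_norm D M m a p u"
    have n0: "?n \<ge> 0" by (simp add: kondratiev_norm_def)
    have en: "kondratiev_energy D M m a p u = ennreal (?n powr p)"
      using fin p by (simp add: kondratiev_norm_def powr_powr)
    have le: "kondratiev_sup D M m' a' u \<le> ennreal (K * N)" if "N > ?n" for N
      using that n0 p by (intro sup[OF wd]) (auto simp: en intro!: ennreal_leI powr_mono2)
    have 1: "kondratiev_sup D M m' a' u < \<infinity>"
      using le[of "?n + 1"] by (simp add: order_le_less_trans)
    have 2: "kondratiev_norm_inf D M m' a' u \<le> K * N" if "N > ?n" for N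
      unfolding kondratiev_norm_inf_def using le[OF that] K n0 that by (intro enn2real_leI) auto
    have "kondratiev_norm_inf D M m' a' u \<le> K * ?n + \<epsilon>" if "\<epsilon> > 0" for \<epsilon>
    proof -
      have "kondratiev_norm_inf D M m' a' u \<le> K * (?n + \<epsilon> / (K + 1))" using 2 that K by simp
      also have "\<dots> \<le> K * ?n + \<epsilon>" using that K by (simp add: distrib_left divide_le_eq mult_left_mono)
      finally show ?thesis .
    qed
    then have "kondratiev_norm_inf D M m' a' u \<le> K * ?n" by (rule field_le_epsilon)
    with 1 show ?thesis by blast
  qed
  show ?thesis
    unfolding continuously_embedded_def
  proof (intro conjI exI[of _ K] ballI subsetI)
    fix u assume u: "u \<in> kondratiev_space D M m a p"
    then have "weakly_differentiable m' D u"
      using m by (auto simp: kondratiev_space_def intro: weakly_differentiable_mono)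
    then show "u \<in> kondratiev_space_inf D M m' a'" using bound[OF u] by (simp add: kondratiev_space_inf_def)
    show "kondratiev_norm_inf D M m' a' u \<le> K * kondratiev_norm D M m a p u" using bound[OF u] by blast
  qed
qed

section \<open>Necessity of the conditions\<close>

lemma kondratiev_energy_smooth:
  fixes D :: "('n::{finite,linorder} rvec) set"
  assumes D: "open D" and u: "smooth_on UNIV u"
  shows "kondratiev_energy D M m a p u = (\<Sum>\<alpha>\<in>mi_upto m. \<integral>\<^sup>+x. ennreal
     ((weight M x powr (real (mi_order \<alpha>) - a) * \<bar>mi_partial \<alpha> u x\<bar>) powr p) * indicator D x \<partial>lborel)"
  unfolding kondratiev_energy_def
proof (rule sum.cong[OF refl], rule nn_integral_lebesgue_on_eq[OF D])
  fix \<alpha> :: "'n \<Rightarrow> nat"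
  from smooth_weak_deriv_AE[OF D u, of \<alpha>]
  show "AE x in lborel. x \<in> D \<longrightarrow> ennreal (\<bar>weighted_deriv D M a \<alpha> u x\<bar> powr p)
     = ennreal ((weight M x powr (real (mi_order \<alpha>) - a) * \<bar>mi_partial \<alpha> u x\<bar>) powr p)"
    by eventually_elim (auto simp: weighted_deriv_def abs_mult)
qed

lemma kondratiev_norm_smooth_le:
  fixes D :: "('n::{finite,linorder} rvec) set"
  assumes D: "open D" and u: "smooth_on UNIV u" and p: "p \<ge> 1" and B: "B \<ge> 0"
    and bd: "\<And>\<alpha>. mi_order \<alpha> \<le> m \<Longrightarrow> (\<integral>\<^sup>+x. ennreal
     ((weight M x powr (real (mi_order \<alpha>) - a) * \<bar>mi_partial \<alpha> u x\<bar>) powr p) * indicator D x \<partial>lborel) \<le> ennreal B"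
  shows "u \<in> kondratiev_space D M m a p"
    and "kondratiev_norm D M m a p u \<le> (real (card (mi_upto m :: ('n \<Rightarrow> nat) set)) * B) powr (1 / p)"
proof -
  let ?c = "real (card (mi_upto m :: ('n \<Rightarrow> nat) set))"
  have "kondratiev_energy D M m a p u \<le> (\<Sum>\<alpha>\<in>(mi_upto m :: ('n \<Rightarrow> nat) set). ennreal B)"
    unfolding kondratiev_energy_smooth[OF D u] using bd by (intro sum_mono) (simp add: mi_upto_def)
  also have "\<dots> = ennreal (?c * B)"
    using B by (simp add: ennreal_mult ennreal_of_nat_eq_real_of_nat)
  finally have le: "kondratiev_energy D M m a p u \<le> ennreal (?c * B)" .
  then show "u \<in> kondratiev_space D M m a p"
    using smooth_weakly_differentiable[OF D u] by (auto simp: kondratiev_space_def intro: order_le_less_trans)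
  show "kondratiev_norm D M m a p u \<le> (?c * B) powr (1 / p)"
    unfolding kondratiev_norm_def using le B p by (intro powr_mono2 enn2real_leI) auto
qed

text \<open>Turns an essential supremum into a bound at a chosen point: a violation would extend to
  a nonempty open set, which is not null.\<close>

lemma AE_le_continuous_imp_le:
  fixes f :: "'n::finite rvec \<Rightarrow> real"
  assumes D: "open D" and f: "continuous_on D f" and ae: "AE x in lborel. x \<in> D \<longrightarrow> f x \<le> c" and x: "x \<in> D"
  shows "f x \<le> c"
proof (rule ccontr)
  assume "\<not> f x \<le> c"
  define U where "U = {x \<in> D. c < f x}"
  have "open U"
  proof -
    have "open (f -` {c<..} \<inter> D)" 
      by (rule continuous_on_open_vimage[OF D, THEN iffD1, OF f, rule_format, OF open_greaterThan])
    moreover have "U = f -` {c<..} \<inter> D" by (auto simp: U_def)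
    ultimately show ?thesis by simp
  qed
  moreover have "x \<in> U" using x \<open>\<not> f x \<le> c\<close> by (simp add: U_def)
  ultimately have "\<not> negligible U" using open_not_negligible by blast
  moreover have "U \<in> null_sets lborel"
  proof -
    have "AE x in lborel. x \<notin> U" using ae by eventually_elim (auto simp: U_def)
    then show ?thesis using \<open>open U\<close> by (subst AE_iff_null_sets) auto
  qed
  ultimately show False
    by (simp add: negligible_iff_null_sets null_sets_completionI)
qed

text \<open>Lower bounds for the target norm are read off at one point. For smooth \<open>u\<close>
  this is legitimate since the weighted derivative is continuous on \<open>D\<close>, where the
  weight is positive.\<close>

lemma kondratiev_norm_inf_ge:
  fixes D :: "('n::{finite,linorder} rvec) set"
  assumes D: "open D" and M: "M \<noteq> {}" "M \<inter> D = {}" and u: "smooth_on UNIV u"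
    and mem: "u \<in> kondratiev_space_inf D M m' a'" and \<alpha>: "mi_order \<alpha> \<le> m'" and x: "x \<in> D"
  shows "weight M x powr (real (mi_order \<alpha>) - a') * \<bar>mi_partial \<alpha> u x\<bar> \<le> kondratiev_norm_inf D M m' a' u"
proof (rule AE_le_continuous_imp_le[OF D _ _ x])
  have "continuous_on D (mi_partial \<alpha> u)"
    unfolding mi_partial_eq by (rule smooth_continuous_on[OF smooth_on_iter_partial[OF u]])
  then show "continuous_on D (\<lambda>x. weight M x powr (real (mi_order \<alpha>) - a') * \<bar>mi_partial \<alpha> u x\<bar>)"
    using weight_pos[OF D M] by (intro continuous_intros continuous_on_weight) force+
  let ?s = "kondratiev_sup D M m' a' u"
  have fin: "?s < \<infinity>" using mem by (simp add: kondratiev_space_inf_def)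
  have "AE x in lebesgue_on D. ennreal \<bar>weighted_deriv D M a' \<alpha> u x\<bar> \<le> esssup (lebesgue_on D) (\<lambda>x. ennreal \<bar>weighted_deriv D M a' \<alpha> u x\<bar>)"
    by (rule esssup_AE)
  moreover have "esssup (lebesgue_on D) (\<lambda>x. ennreal \<bar>weighted_deriv D M a' \<alpha> u x\<bar>) \<le> ?s"
    unfolding kondratiev_sup_def
    by (rule member_le_sum[of \<alpha> "mi_upto m'" "\<lambda>\<alpha>. esssup (lebesgue_on D) (\<lambda>x. ennreal \<bar>weighted_deriv D M a' \<alpha> u x\<bar>)"])
      (use \<alpha> in \<open>auto simp: mi_upto_def finite_mi_upto[unfolded mi_upto_def]\<close>)
  ultimately have "AE x in lebesgue_on D. ennreal \<bar>weighted_deriv D M a' \<alpha> u x\<bar> \<le> ?s"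
    by (auto elim!: eventually_mono)
  then have "AE x in lebesgue. x \<in> D \<longrightarrow> ennreal \<bar>weighted_deriv D M a' \<alpha> u x\<bar> \<le> ?s"
    using D by (subst (asm) AE_restrict_space_iff) auto
  then have "AE x in lborel. x \<in> D \<longrightarrow> ennreal \<bar>weighted_deriv D M a' \<alpha> u x\<bar> \<le> ?s"
    by (simp add: AE_completion_iff)
  then show "AE x in lborel. x \<in> D \<longrightarrow> weight M x powr (real (mi_order \<alpha>) - a') * \<bar>mi_partial \<alpha> u x\<bar> \<le> kondratiev_norm_inf D M m' a' u"
    using smooth_weak_deriv_AE[OF D u, of \<alpha>]
  proof eventually_elim
    case (elim x)
    show ?case
    proof
      assume x: "x \<in> D"
      have "ennreal (weight M x powr (real (mi_order \<alpha>) - a') * \<bar>mi_partial \<alpha> u x\<bar>) \<le> ennreal (kondratiev_norm_inf D M m' a' u)"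
        using elim x fin by (simp add: weighted_deriv_def abs_mult kondratiev_norm_inf_def)
      then show "weight M x powr (real (mi_order \<alpha>) - a') * \<bar>mi_partial \<alpha> u x\<bar> \<le> kondratiev_norm_inf D M m' a' u"
        by (subst (asm) ennreal_le_iff) (auto simp: kondratiev_norm_inf_def)
    qed
  qed
qed

section \<open>Concentrated bumps and the condition on the weight exponents\<close>

lemma emeasure_lborel_cball_scale:
  fixes y :: "'n::finite rvec"
  assumes "\<rho> > 0"
  shows "emeasure lborel (cball y \<rho>) = ennreal (measure lborel (cball 0 1 :: 'n rvec set) * \<rho> ^ CARD('n))"
proof -
  have "(\<integral>\<^sup>+b. indicator (cball y \<rho>) (y + \<rho> *\<^sub>R b) \<partial>lborel) = ennreal (1 / \<rho> ^ CARD('n)) * (\<integral>\<^sup>+z. indicator (cball y \<rho>) z \<partial>lborel)"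
    by (rule nn_integral_affine) (use assms in \<open>auto intro!: borel_measurable_indicator\<close>)
  moreover have "indicator (cball y \<rho>) (y + \<rho> *\<^sub>R b) = (indicator (cball 0 1) b :: ennreal)" for b :: "'n rvec"
    using assms by (auto simp: indicator_def dist_norm)
  ultimately have "emeasure lborel (cball 0 1 :: 'n rvec set) = ennreal (1 / \<rho> ^ CARD('n)) * emeasure lborel (cball y \<rho>)"
    by simp
  then have "ennreal (\<rho> ^ CARD('n)) * emeasure lborel (cball 0 1 :: 'n rvec set)
      = (ennreal (\<rho> ^ CARD('n)) * ennreal (1 / \<rho> ^ CARD('n))) * emeasure lborel (cball y \<rho>)"
    by (simp add: mult.assoc)
  also have "ennreal (\<rho> ^ CARD('n)) * ennreal (1 / \<rho> ^ CARD('n)) = 1"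
    using assms by (subst ennreal_mult[symmetric]) auto
  finally have "emeasure lborel (cball y \<rho>) = ennreal (\<rho> ^ CARD('n)) * emeasure lborel (cball 0 1 :: 'n rvec set)" by simp
  also have "emeasure lborel (cball 0 1 :: 'n rvec set) = ennreal (measure lborel (cball 0 1 :: 'n rvec set))"
    using emeasure_bounded_finite[OF bounded_cball] by (intro emeasure_eq_ennreal_measure) (auto simp: less_top[symmetric])
  finally show ?thesis using assms by (simp add: ennreal_mult mult.commute)
qed

lemma test_function_bump: "r > 0 \<Longrightarrow> cball c r \<subseteq> \<Omega> \<Longrightarrow> test_function \<Omega> (bump c r)"
  using bump_pos_iff[of r c] bump_nonneg[of c r] ball_subset_cball[of c r]
  by (intro test_functionI[of _ "cball c r"] smooth_on_bump) (auto simp: less_le)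

lemma mi_partial_bounds:
  fixes \<phi> :: "'n::{finite,linorder} rvec \<Rightarrow> real"
  assumes \<phi>: "test_function UNIV \<phi>"
  obtains B where "B > 0" "\<And>\<alpha> x. mi_order \<alpha> \<le> m \<Longrightarrow> \<bar>mi_partial \<alpha> \<phi> x\<bar> \<le> B"
proof -
  have "\<exists>B\<ge>0. \<forall>x. \<bar>mi_partial \<alpha> \<phi> x\<bar> \<le> B" for \<alpha>
    using test_function_bounded[OF test_function_iter_partial[OF \<phi>]] unfolding mi_partial_eq by metis
  then obtain b where b: "\<And>\<alpha>. b \<alpha> \<ge> 0" "\<And>\<alpha> x. \<bar>mi_partial \<alpha> \<phi> x\<bar> \<le> b \<alpha>" by metis
  have "b \<alpha> \<le> (\<Sum>\<alpha>\<in>mi_upto m. b \<alpha>)" if "mi_order \<alpha> \<le> m" for \<alpha>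
    using that b(1) by (intro member_le_sum) (auto simp: finite_mi_upto mi_upto_def finite_mi_upto[unfolded mi_upto_def])
  note le = this
  show ?thesis
  proof (rule that)
    show "(\<Sum>\<alpha>\<in>mi_upto m. b \<alpha>) + 1 > 0" using b(1) by (simp add: sum_nonneg add_nonneg_pos)
    show "\<bar>mi_partial \<alpha> \<phi> x\<bar> \<le> (\<Sum>\<alpha>\<in>mi_upto m. b \<alpha>) + 1" if "mi_order \<alpha> \<le> m" for \<alpha> x
      using b(2)[of \<alpha> x] le[OF that] by linarith
  qed
qed

lemma nn_integral_indicator_le:
  fixes f :: "'n::finite rvec \<Rightarrow> real"
  assumes "\<rho> > 0" "c \<ge> 0" "\<And>x. x \<in> D \<Longrightarrow> f x \<le> c * indicator (cball y \<rho>) x"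
  shows "(\<integral>\<^sup>+x. ennreal (f x) * indicator D x \<partial>lborel) \<le> ennreal (c * (measure lborel (cball 0 1 :: 'n rvec set) * \<rho> ^ CARD('n)))"
proof -
  have "(\<integral>\<^sup>+x. ennreal (f x) * indicator D x \<partial>lborel) \<le> (\<integral>\<^sup>+x. ennreal c * indicator (cball y \<rho>) x \<partial>lborel)"
  proof (rule nn_integral_mono)
    fix x
    show "ennreal (f x) * indicator D x \<le> ennreal c * indicator (cball y \<rho>) x"
    proof (cases "x \<in> D")
      case True
      then have "ennreal (f x) \<le> ennreal (c * indicator (cball y \<rho>) x)" using assms(3) by (intro ennreal_leI)
      then show ?thesis using True by (cases "x \<in> cball y \<rho>") auto
    qed simp
  qed
  also have "\<dots> = ennreal c * emeasure lborel (cball y \<rho>)" by (rule nn_integral_cmult_indicator) auto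
  also have "\<dots> = ennreal (c * (measure lborel (cball 0 1 :: 'n rvec set) * \<rho> ^ CARD('n)))"
    using assms(1,2) by (simp add: emeasure_lborel_cball_scale ennreal_mult)
  finally show ?thesis .
qed

text \<open>For a bump of radius \<open>\<rho>\<close> at distance comparable to
  \<open>\<rho>\<close> from \<open>M\<close>, the factor \<open>\<rho> powr - j\<close> of a
  derivative of order \<open>j\<close> is balanced by the weight, so the source norm is at most of
  order \<open>\<rho> powr (d / p - a)\<close>. The target norm is at least of order
  \<open>\<rho> powr - a'\<close>, and \<open>\<rho>\<close> tends to 0.\<close>

theorem embedding_necessary_weight:
  fixes D M :: "('n::{finite,linorder} rvec) set"
  assumes D: "open D" and M: "M \<noteq> {}" "M \<subseteq> frontier D" and cone: "cone_condition D" and p: "p \<ge> 1"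
    and emb: "continuously_embedded
     (kondratiev_space D M m a p) (kondratiev_norm D M m a p)
     (kondratiev_space_inf D M m' a') (kondratiev_norm_inf D M m' a')"
  shows "a - real CARD('n) / p \<ge> a'"
proof (rule ccontr)
  assume "\<not> a - real CARD('n) / p \<ge> a'"
  then have neg: "a - real CARD('n) / p - a' < 0" by simp
  have MD: "M \<inter> D = {}" using M(2) D by (auto simp: frontier_def interior_open)
  obtain C where XY: "kondratiev_space D M m a p \<subseteq> kondratiev_space_inf D M m' a'"
    and C: "\<And>u. u \<in> kondratiev_space D M m a p \<Longrightarrow> kondratiev_norm_inf D M m' a' u \<le> C * kondratiev_norm D M m a p u"
    using emb unfolding continuously_embedded_def by blast
  obtain \<kappa> h L where \<kappa>: "\<kappa> > 0" and h: "h > 0" and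
    cn: "\<forall>x\<in>D. \<exists>e. norm e \<le> L \<and> (\<forall>t\<in>{0..h}. cball (x + t *\<^sub>R e) (t * \<kappa>) \<subseteq> D)"
    using cone unfolding cone_condition_on_def Int_UNIV_left by blast
  obtain s where s: "s \<in> M" using M(1) by blast
  then have sc: "s \<in> closure D" using M(2) by (auto simp: frontier_def)
  define \<phi> :: "'n rvec \<Rightarrow> real" where "\<phi> = bump 0 1"
  have \<phi>: "test_function UNIV \<phi>" unfolding \<phi>_def by (rule test_function_bump) auto
  have \<phi>0: "\<phi> 0 > 0" unfolding \<phi>_def using bump_pos_iff[of 1 0 0] by simp
  note sm = test_function_smooth[OF \<phi>]
  have supp: "iter_partial js \<phi> x = 0" if "x \<notin> cball 0 1" for js x
  proof (rule iter_partial_zero_outside[of "cball 0 1"])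
    show "\<phi> x = 0" if "x \<notin> cball 0 1" for x
      using that bump_pos_iff[of 1 0 x] bump_nonneg[of 0 1 x] ball_subset_cball[of 0 1] unfolding \<phi>_def by force
  qed (use that in auto)
  obtain B where B: "B > 0" "\<And>\<alpha> x. mi_order \<alpha> \<le> m \<Longrightarrow> \<bar>mi_partial \<alpha> \<phi> x\<bar> \<le> B"
    using mi_partial_bounds[OF \<phi>] by blast
  define L' where "L' = max L 0"
  \<comment> \<open>Points of the bump lie within \<open>\<rho> + \<delta> * L' + \<delta>\<close>
    of \<open>M\<close>, where \<open>\<delta> = 2 * \<rho> / \<kappa>\<close>;
    \<open>c * \<rho>\<close> is an upper bound for this.\<close>
  define c where "c = 2 * (1 + L' + \<kappa>) / \<kappa>"
  have c1: "c \<ge> 1" using \<kappa> by (simp add: c_def L'_def field_simps)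
  define c2 where "c2 = (\<Sum>l\<le>m. c powr \<bar>real l - a\<bar>)"
  have c2: "c powr \<bar>real l - a\<bar> \<le> c2" if "l \<le> m" for l
    unfolding c2_def using that by (intro member_le_sum[of _ "{..m}" "\<lambda>l. c powr \<bar>real l - a\<bar>"]) auto
  have c2': "c2 \<ge> 0" unfolding c2_def by (intro sum_nonneg) auto
  define \<omega> where "\<omega> = measure lborel (cball 0 1 :: 'n rvec set)"
  define Nm where "Nm = real (card (mi_upto m :: ('n \<Rightarrow> nat) set))"
  define K where "K = \<bar>C\<bar> * (Nm * ((c2 * B) powr p * \<omega>)) powr (1 / p) * c powr \<bar>0 - a'\<bar> / \<phi> 0"
  have key: "\<rho> powr (a - real CARD('n) / p - a') \<le> K" if \<rho>: "0 < \<rho>" "\<rho> \<le> 1" "2 * \<rho> / \<kappa> \<le> h" for \<rho>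
  proof -
    \<comment> \<open>At this parameter the cone has radius \<open>2 * \<rho>\<close>, so the
      concentric ball of radius \<open>\<rho>\<close> keeps distance \<open>\<rho>\<close> from the
      complement of \<open>D\<close>, which contains \<open>M\<close>. The vertex is chosen within
      \<open>\<delta>\<close> of \<open>M\<close> as well.\<close>
    define \<delta> where "\<delta> = 2 * \<rho> / \<kappa>"
    have \<delta>: "\<delta> > 0" "\<delta> \<le> h" "\<delta> * \<kappa> = 2 * \<rho>" using \<rho> \<kappa> by (auto simp: \<delta>_def)
    obtain x where x: "x \<in> D" "dist x s < \<delta>" using sc \<delta>(1) by (meson closure_approachable)
    obtain e where e: "norm e \<le> L" "\<forall>t\<in>{0..h}. cball (x + t *\<^sub>R e) (t * \<kappa>) \<subseteq> D" using cn x(1) by blast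
    define y where "y = x + \<delta> *\<^sub>R e"
    have yD: "cball y (2 * \<rho>) \<subseteq> D" using e(2) \<delta> unfolding y_def by (metis atLeastAtMost_iff less_imp_le)
    have wy: "\<rho> / c \<le> weight M z" "weight M z \<le> c * \<rho>" "\<rho> \<le> weight M z" if z: "z \<in> cball y \<rho>" for z
    proof -
      have "ball z \<rho> \<subseteq> cball y (2 * \<rho>)"
      proof
        fix q assume "q \<in> ball z \<rho>"
        then show "q \<in> cball y (2 * \<rho>)" using z dist_triangle[of y q z] by simp
      qed
      then have "M \<inter> ball z \<rho> = {}" using yD MD by blast
      then show 1: "\<rho> \<le> weight M z" using M(1) \<rho> by (intro weight_ge_ball) auto
      have "\<rho> / c \<le> \<rho>" using \<rho> c1 by (simp add: divide_le_eq)
      then show "\<rho> / c \<le> weight M z" using 1 by simp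
      have "weight M z \<le> infdist z M" by (simp add: weight_def)
      also have "\<dots> \<le> dist z s" by (rule infdist_le[OF s])
      also have "\<dots> \<le> dist z y + dist y x + dist x s"
        by (meson add_mono dist_triangle order_refl order_trans add_right_mono)
      also have "\<dots> \<le> \<rho> + \<delta> * L' + \<delta>"
      proof -
        have "dist y x = \<delta> * norm e" using \<delta> by (simp add: y_def dist_norm)
        also have "\<dots> \<le> \<delta> * L'" using \<delta> e by (intro mult_left_mono) (auto simp: L'_def)
        finally show ?thesis using z x(2) by (simp add: dist_commute)
      qed
      also have "\<dots> \<le> c * \<rho>"
      proof -
        have "c * \<rho> = (1 + L' + \<kappa>) * \<delta>" using \<kappa> by (simp add: c_def \<delta>_def)
        also have "\<dots> = \<delta> + \<delta> * L' + 2 * \<rho>" using \<delta>(3) by (simp add: algebra_simps)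
        finally show ?thesis using \<rho> by simp
      qed
      finally show "weight M z \<le> c * \<rho>" .
    qed
    define u where "u x = \<phi> (0 + (1 / \<rho>) *\<^sub>R (x - y))" for x
    have su: "smooth_on UNIV u" unfolding u_def by (rule smooth_on_affine[OF sm])
    have du: "mi_partial \<alpha> u x = (1 / \<rho>) ^ mi_order \<alpha> * mi_partial \<alpha> \<phi> ((1 / \<rho>) *\<^sub>R (x - y))" for \<alpha> x
      unfolding u_def mi_partial_eq iter_partial_affine[OF sm] length_mi_list by simp
    have out: "mi_partial \<alpha> u x = 0" if "x \<notin> cball y \<rho>" for \<alpha> x
    proof -
      have "(1 / \<rho>) *\<^sub>R (x - y) \<notin> cball 0 1" using that \<rho> by (simp add: dist_norm norm_minus_commute divide_simps)
      from supp[OF this] show ?thesis unfolding du by (simp add: mi_partial_eq)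
    qed
    define A where "A = c2 * \<rho> powr - a * B"
    have A: "A \<ge> 0" using c2' B by (simp add: A_def)
    have bd: "(\<integral>\<^sup>+x. ennreal ((weight M x powr (real (mi_order \<alpha>) - a) * \<bar>mi_partial \<alpha> u x\<bar>) powr p) * indicator D x \<partial>lborel)
        \<le> ennreal (A powr p * (\<omega> * \<rho> ^ CARD('n)))" if \<alpha>: "mi_order \<alpha> \<le> m" for \<alpha>
      unfolding \<omega>_def
    proof (rule nn_integral_indicator_le[OF \<rho>(1)])
      fix x
      show "(weight M x powr (real (mi_order \<alpha>) - a) * \<bar>mi_partial \<alpha> u x\<bar>) powr p \<le> A powr p * indicator (cball y \<rho>) x"
      proof (cases "x \<in> cball y \<rho>")
        case True
        have "weight M x powr (real (mi_order \<alpha>) - a) \<le> c powr \<bar>real (mi_order \<alpha>) - a\<bar> * \<rho> powr (real (mi_order \<alpha>) - a)"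
          by (rule powr_two_sided(1)[OF \<rho>(1) c1]) (use wy[OF True] in auto)
        also have "\<dots> \<le> c2 * \<rho> powr (real (mi_order \<alpha>) - a)" using c2[OF \<alpha>] by (intro mult_right_mono) auto
        finally have "weight M x powr (real (mi_order \<alpha>) - a) * \<bar>mi_partial \<alpha> u x\<bar>
          \<le> (c2 * \<rho> powr (real (mi_order \<alpha>) - a)) * ((1 / \<rho>) ^ mi_order \<alpha> * B)"
          using B(2)[OF \<alpha>] \<rho> c2' by (intro mult_mono) (auto simp: du abs_mult intro!: mult_left_mono)
        also have "\<dots> = A"
        proof -
          have "\<rho> powr (real (mi_order \<alpha>) - a) * (1 / \<rho>) ^ mi_order \<alpha> = \<rho> powr - a"
            using \<rho> by (simp add: powr_diff powr_realpow power_divide powr_minus field_simps)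
          then show ?thesis by (simp add: A_def mult_ac)
        qed
        finally show ?thesis using True p weight_nonneg by (simp add: powr_mono2)
      qed (simp add: out)
    qed auto
    have "A powr p * (\<omega> * \<rho> ^ CARD('n)) \<ge> 0" using \<rho> by (simp add: \<omega>_def)
    note le = kondratiev_norm_smooth_le[OF D su p this bd]
    have uY: "u \<in> kondratiev_space_inf D M m' a'" using le(1) XY by blast
    have yy: "y \<in> D" using yD \<rho> by auto
    have u0: "mi_partial (\<lambda>_. 0) u y = \<phi> 0"
    proof -
      have "mi_list (\<lambda>_::'n. 0) = []" using length_mi_list[of "\<lambda>_::'n. 0"] by (simp add: mi_order_def)
      then show ?thesis unfolding du by (simp add: mi_order_def mi_partial_eq)
    qed
    have "\<rho> powr (0 - a') * \<phi> 0 \<le> (c powr \<bar>0 - a'\<bar> * weight M y powr (0 - a')) * \<phi> 0"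
      using powr_two_sided(2)[OF \<rho>(1) c1, of "weight M y" "0 - a'"] wy[of y] \<rho> \<phi>0 by (intro mult_right_mono) auto
    also have "\<dots> = c powr \<bar>0 - a'\<bar> * (weight M y powr (real (mi_order (\<lambda>_::'n. 0)) - a') * \<bar>mi_partial (\<lambda>_. 0) u y\<bar>)"
      using \<phi>0 by (simp add: u0 mi_order_def)
    also have "\<dots> \<le> c powr \<bar>0 - a'\<bar> * kondratiev_norm_inf D M m' a' u"
      by (intro mult_left_mono kondratiev_norm_inf_ge[OF D M(1) MD su uY _ yy]) (auto simp: mi_order_def)
    also have "\<dots> \<le> c powr \<bar>0 - a'\<bar> * (\<bar>C\<bar> * kondratiev_norm D M m a p u)"
      using C[OF le(1)] by (intro mult_left_mono order_trans[OF C[OF le(1)]] mult_right_mono) (auto simp: kondratiev_norm_def)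
    also have "\<dots> \<le> c powr \<bar>0 - a'\<bar> * (\<bar>C\<bar> * (Nm * (A powr p * (\<omega> * \<rho> ^ CARD('n)))) powr (1 / p))"
      using le(2) unfolding Nm_def by (intro mult_left_mono) auto
    also have "(Nm * (A powr p * (\<omega> * \<rho> ^ CARD('n)))) powr (1 / p)
        = (Nm * ((c2 * B) powr p * \<omega>)) powr (1 / p) * \<rho> powr (real CARD('n) / p - a)"
    proof -
      have "A powr p * \<rho> ^ CARD('n) = (c2 * B) powr p * \<rho> powr (real CARD('n) - a * p)"
      proof -
        have "A powr p = (c2 * B) powr p * \<rho> powr (- a * p)"
          using c2' B \<rho> by (simp add: A_def powr_mult powr_powr mult_ac)
        then show ?thesis using \<rho> by (simp add: powr_realpow[symmetric] powr_add[symmetric] algebra_simps)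
      qed
      then have "Nm * (A powr p * (\<omega> * \<rho> ^ CARD('n))) = Nm * ((c2 * B) powr p * \<omega>) * \<rho> powr (real CARD('n) - a * p)"
        by (simp add: mult_ac)
      also have "\<dots> powr (1 / p) = (Nm * ((c2 * B) powr p * \<omega>)) powr (1 / p) * (\<rho> powr (real CARD('n) - a * p)) powr (1 / p)"
        by (rule powr_mult) 
      also have "(\<rho> powr (real CARD('n) - a * p)) powr (1 / p) = \<rho> powr (real CARD('n) / p - a)"
        using p by (simp add: powr_powr field_simps)
      finally show ?thesis .
    qed
    finally have "\<rho> powr (0 - a') * \<phi> 0 \<le> c powr \<bar>0 - a'\<bar> * (\<bar>C\<bar> * ((Nm * ((c2 * B) powr p * \<omega>)) powr (1 / p) * \<rho> powr (real CARD('n) / p - a)))" .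
    then have "\<rho> powr (0 - a') * \<rho> powr (a - real CARD('n) / p) \<le> K * (\<rho> powr (real CARD('n) / p - a) * \<rho> powr (a - real CARD('n) / p))"
      using \<phi>0 \<rho> by (simp add: K_def field_simps)
    then show ?thesis using \<rho> by (simp add: powr_add[symmetric] algebra_simps)
  qed
  have "filterlim (\<lambda>\<rho>. \<rho> powr (a - real CARD('n) / p - a')) at_top (at_right 0)"
    using neg by real_asymp
  then have "\<forall>\<^sub>F \<rho> in at_right 0. K < \<rho> powr (a - real CARD('n) / p - a')"
    by (simp add: filterlim_at_top_dense)
  moreover have "\<forall>\<^sub>F \<rho> in at_right 0. \<rho> < min 1 (h * \<kappa> / 2)"
    using h \<kappa> by (intro eventually_at_right_less eventually_at_rightI[of 0 "min 1 (h * \<kappa> / 2)"]) auto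
  moreover have "\<forall>\<^sub>F \<rho> in at_right (0::real). 0 < \<rho>" by (simp add: eventually_at_filter)
  ultimately have "\<forall>\<^sub>F \<rho> in at_right (0::real). False"
  proof eventually_elim
    case (elim \<rho>)
    then show ?case using key[of \<rho>] \<kappa> by (simp add: field_simps)
  qed
  then show False by simp
qed

section \<open>Dyadic superpositions and the condition on the orders\<close>

lemma partial_nonzero:
  fixes \<phi> :: "'n::finite rvec \<Rightarrow> real"
  assumes \<phi>: "test_function UNIV \<phi>" and x: "\<phi> x \<noteq> 0"
  shows "\<exists>z. partial i \<phi> z \<noteq> 0"
proof (rule ccontr)
  assume "\<not> ?thesis"
  then have z: "partial i \<phi> z = 0" for z by simp
  obtain K where K: "compact K" "K \<subseteq> UNIV" "\<And>x. x \<notin> K \<Longrightarrow> \<phi> x = 0" using test_function_support[OF \<phi>] by blast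
  obtain R where R: "\<And>x. x \<in> K \<Longrightarrow> norm x \<le> R" using compact_imp_bounded[OF K(1)] bounded_iff by blast
  \<comment> \<open>Long enough to leave the support on a line along which \<open>\<phi>\<close>
    would be constant.\<close>
  define t where "t = norm x + \<bar>R\<bar> + 1"
  have t: "t > 0" unfolding t_def by (simp add: add_nonneg_pos)
  have "\<exists>s. 0 < s \<and> s < t \<and> \<phi> (x + t *\<^sub>R axis i 1) - \<phi> (x + 0 *\<^sub>R axis i 1) = (t - 0) * partial i \<phi> (x + s *\<^sub>R axis i 1)"
    using MVT2[OF t, of "\<lambda>t. \<phi> (x + t *\<^sub>R axis i 1)", OF smooth_has_derivative_axis[OF test_function_smooth[OF \<phi>]]] .
  then have "\<phi> (x + t *\<^sub>R axis i 1) = \<phi> x" using z by auto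
  moreover have "x + t *\<^sub>R axis i 1 \<notin> K"
  proof
    assume "x + t *\<^sub>R axis i 1 \<in> K"
    then have "norm (x + t *\<^sub>R axis i 1) \<le> R" by (rule R)
    moreover have "norm (t *\<^sub>R axis i (1::real) :: 'n rvec) \<le> norm (x + t *\<^sub>R axis i 1) + norm x"
      by (metis add_diff_cancel_left' norm_triangle_ineq4)
    ultimately show False using t by (simp add: t_def)
  qed
  ultimately show False using K(3) x by simp
qed

lemma iter_partial_nonzero:
  fixes \<phi> :: "'n::finite rvec \<Rightarrow> real"
  assumes \<phi>: "test_function UNIV \<phi>" and x: "\<phi> x \<noteq> 0"
  shows "\<exists>z. iter_partial js \<phi> z \<noteq> 0"
proof (induction js)
  case (Cons j js)
  then obtain z where "iter_partial js \<phi> z \<noteq> 0" by blast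
  from partial_nonzero[OF test_function_iter_partial[OF \<phi>] this] show ?case by (simp add: iter_partial_Cons)
qed (use x in auto)

text \<open>The active indices form an initial segment, and a geometric sum is at most
  \<open>q / (q - 1)\<close> times its last term. Hence the power \<open>p\<close> can be moved
  inside at the cost of that constant.\<close>

lemma geometric_sum_powr:
  fixes q p :: real and b :: "nat \<Rightarrow> bool"
  assumes q: "q > 1" and p: "p \<ge> 1" and b: "\<And>k. b (Suc k) \<Longrightarrow> b k"
  shows "(\<Sum>k<n. q ^ k * of_bool (b k)) powr p \<le> (q / (q - 1)) powr p * (\<Sum>k<n. (q ^ k) powr p * of_bool (b k))"
proof (induction n)
  case (Suc n)
  have nn: "0 \<le> (\<Sum>k<n. (q ^ k) powr p * of_bool (b k))" by (intro sum_nonneg) auto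
  show ?case
  proof (cases "b n")
    case False
    then show ?thesis using Suc by simp
  next
    case True
    have "(\<Sum>k<Suc n. q ^ k * of_bool (b k)) \<le> (\<Sum>k<Suc n. q ^ k)"
      using q by (intro sum_mono) auto
    also have "\<dots> = (q ^ Suc n - 1) / (q - 1)" using q by (subst geometric_sum) auto
    also have "\<dots> \<le> q / (q - 1) * q ^ n" using q by (simp add: divide_le_cancel)
    finally have "(\<Sum>k<Suc n. q ^ k * of_bool (b k)) powr p \<le> (q / (q - 1) * q ^ n) powr p"
      using q p by (intro powr_mono2 sum_nonneg) auto
    also have "\<dots> = (q / (q - 1)) powr p * (q ^ n) powr p" by (rule powr_mult)
    also have "\<dots> \<le> (q / (q - 1)) powr p * (\<Sum>k<Suc n. (q ^ k) powr p * of_bool (b k))"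
      using True nn by (intro mult_left_mono) auto
    finally show ?thesis .
  qed
qed simp

text \<open>Dyadic superpositions \<open>\<Sum>k<n. c\<^sub>k \<phi> (z + 2\<^sup>k (x - x\<^sub>0))\<close> in a ball around \<open>x\<^sub>0\<close>; a single
  summand detects \<open>m - d/p < m'\<close>, and \<open>n\<close> summands of equal strength detect the limiting case
  \<open>m - d/p = m'\<close>, where the norm grows like \<open>n\<^bsup>1/p\<^esup>\<close> but the derivative at \<open>x\<^sub>0\<close> grows like \<open>n\<close>.\<close>

lemma dyadic_profile:
  fixes D M :: "('n::{finite,linorder} rvec) set"
  assumes D: "open D" and M: "M \<noteq> {}" "M \<inter> D = {}" and x0: "x0 \<in> D"
  obtains \<psi> :: "nat \<Rightarrow> 'n rvec \<Rightarrow> real" and \<alpha> and \<theta> B A :: real where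
    "mi_order \<alpha> = m'" "\<theta> > 0" "B > 0" "A > 0" "\<And>k. smooth_on UNIV (\<psi> k)"
    "\<And>k. mi_partial \<alpha> (\<psi> k) x0 = \<theta> * 2 ^ (k * m') \<or> mi_partial \<alpha> (\<psi> k) x0 = - \<theta> * 2 ^ (k * m')"
    "\<And>k l. mi_partial \<alpha> (\<psi> k) x0 / 2 ^ (k * m') = mi_partial \<alpha> (\<psi> l) x0 / 2 ^ (l * m')"
    "\<And>k \<beta> x. mi_order \<beta> \<le> m \<Longrightarrow> x \<in> D \<Longrightarrow> weight M x powr (real (mi_order \<beta>) - a) * \<bar>mi_partial \<beta> (\<psi> k) x\<bar> \<le> B * 2 ^ (k * m) * indicator (cball x0 (A * (1 / 2) ^ k)) x"
proof -
  define \<phi> :: "'n rvec \<Rightarrow> real" where "\<phi> = bump 0 1"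
  have \<phi>: "test_function UNIV \<phi>" unfolding \<phi>_def by (rule test_function_bump) auto
  have \<phi>0: "\<phi> 0 > 0" unfolding \<phi>_def using bump_pos_iff[of 1 0 0] by simp
  note sm = test_function_smooth[OF \<phi>]
  have supp: "iter_partial js \<phi> x = 0" if "x \<notin> cball 0 1" for js x
  proof (rule iter_partial_zero_outside[of "cball 0 1"])
    show "\<phi> x = 0" if "x \<notin> cball 0 1" for x
      using that bump_pos_iff[of 1 0 x] bump_nonneg[of 0 1 x] ball_subset_cball[of 0 1] unfolding \<phi>_def by force
  qed (use that in auto)
  obtain B0 where B0: "B0 > 0" "\<And>\<beta> x. mi_order \<beta> \<le> m \<Longrightarrow> \<bar>mi_partial \<beta> \<phi> x\<bar> \<le> B0"
    using mi_partial_bounds[OF \<phi>] by blast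
  define i :: 'n where "i = undefined"
  define \<alpha> where "\<alpha> = (\<lambda>j. if j = i then m' else 0)"
  have \<alpha>: "mi_order \<alpha> = m'" by (simp add: \<alpha>_def mi_order_def)
  \<comment> \<open>No iterated derivative of a nonzero test function vanishes identically. The
    profile is shifted so that \<open>x0\<close> corresponds to a point \<open>z\<close> where the
    chosen derivative is nonzero.\<close>
  obtain z where z: "mi_partial \<alpha> \<phi> z \<noteq> 0"
    using iter_partial_nonzero[OF \<phi>, of 0 "mi_list \<alpha>"] \<phi>0 by (auto simp: mi_partial_eq)
  then have z1: "norm z \<le> 1" using supp[of z] by (fastforce simp: mi_partial_eq)
  obtain r where r: "r > 0" "r \<le> 1" "ball x0 r \<subseteq> D"
  proof -
    obtain r where "r > 0" "ball x0 r \<subseteq> D" using D x0 open_contains_ball by blast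
    then show ?thesis by (intro that[of "min r 1"]) auto
  qed
  \<comment> \<open>The coarsest scale: all supports lie within \<open>r / 2\<close> of
    \<open>x0\<close>, where the weight is between \<open>r / 2\<close> and 1 and costs only a
    constant factor.\<close>
  define k0 where "k0 = nat \<lceil>log 2 (4 / r)\<rceil>"
  have k0: "2 / 2 ^ k0 \<le> r / 2"
  proof -
    have "4 / r = 2 powr log 2 (4 / r)" using r by simp
    also have "\<dots> \<le> 2 powr real k0" unfolding k0_def by (intro powr_mono) (auto intro: real_nat_ceiling_ge)
    finally have "4 / r \<le> 2 ^ k0" by (simp add: powr_realpow)
    then show ?thesis using r by (simp add: field_simps)
  qed
  define \<psi> where "\<psi> k x = \<phi> (z + 2 ^ (k0 + k) *\<^sub>R (x - x0))" for k x
  have d\<psi>: "mi_partial \<beta> (\<psi> k) x = (2 ^ (k0 + k)) ^ mi_order \<beta> * mi_partial \<beta> \<phi> (z + 2 ^ (k0 + k) *\<^sub>R (x - x0))" for \<beta> k x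
    unfolding \<psi>_def mi_partial_eq iter_partial_affine[OF sm] length_mi_list by simp
  define W where "W = (\<Sum>l\<le>m. (2 / r) powr \<bar>real l - a\<bar>)"
  have W: "(2 / r) powr \<bar>real l - a\<bar> \<le> W" if "l \<le> m" for l
    unfolding W_def using that by (intro member_le_sum[of _ "{..m}" "\<lambda>l. (2 / r) powr \<bar>real l - a\<bar>"]) auto
  have W0: "W > 0"
    using W[of 0] r by (smt (verit) powr_gt_zero divide_pos_pos le0)
  show ?thesis
  proof (rule that[of \<alpha> "2 ^ (k0 * m') * \<bar>mi_partial \<alpha> \<phi> z\<bar>" "W * 2 ^ (k0 * m) * B0" "2 / 2 ^ k0" \<psi>])
    show "smooth_on UNIV (\<psi> k)" for k unfolding \<psi>_def by (rule smooth_on_affine[OF sm])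
    have v: "mi_partial \<alpha> (\<psi> k) x0 = 2 ^ (k0 * m') * mi_partial \<alpha> \<phi> z * 2 ^ (k * m')" for k
      by (simp add: d\<psi> \<alpha> power_add power_mult power_mult_distrib)
    show "mi_partial \<alpha> (\<psi> k) x0 = 2 ^ (k0 * m') * \<bar>mi_partial \<alpha> \<phi> z\<bar> * 2 ^ (k * m') \<or>
      mi_partial \<alpha> (\<psi> k) x0 = - (2 ^ (k0 * m') * \<bar>mi_partial \<alpha> \<phi> z\<bar>) * 2 ^ (k * m')" for k
      unfolding v by (cases "mi_partial \<alpha> \<phi> z \<ge> 0") auto
    show "mi_partial \<alpha> (\<psi> k) x0 / 2 ^ (k * m') = mi_partial \<alpha> (\<psi> l) x0 / 2 ^ (l * m')" for k l
      unfolding v by simp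
    fix k and \<beta> :: "'n \<Rightarrow> nat" and x assume \<beta>: "mi_order \<beta> \<le> m" and x: "x \<in> D"
    show "weight M x powr (real (mi_order \<beta>) - a) * \<bar>mi_partial \<beta> (\<psi> k) x\<bar>
      \<le> W * 2 ^ (k0 * m) * B0 * 2 ^ (k * m) * indicator (cball x0 (2 / 2 ^ k0 * (1 / 2) ^ k)) x"
    proof (cases "x \<in> cball x0 (2 / 2 ^ k0 * (1 / 2) ^ k)")
      case False
      have "z + 2 ^ (k0 + k) *\<^sub>R (x - x0) \<notin> cball 0 1"
      proof
        assume "z + 2 ^ (k0 + k) *\<^sub>R (x - x0) \<in> cball 0 1"
        then have n1: "norm (z + 2 ^ (k0 + k) *\<^sub>R (x - x0)) \<le> 1" by simp
        have "2 ^ (k0 + k) * norm (x - x0) = norm (2 ^ (k0 + k) *\<^sub>R (x - x0))" by simp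
        also have "\<dots> \<le> norm (z + 2 ^ (k0 + k) *\<^sub>R (x - x0)) + norm z"
          by (metis add_diff_cancel_left' norm_triangle_ineq4)
        also have "\<dots> \<le> 2" using n1 z1 by simp
        finally have "norm (x - x0) \<le> 2 / 2 ^ k0 * (1 / 2) ^ k"
          by (simp add: field_simps power_add power_divide)
        then show False using False by (simp add: dist_norm norm_minus_commute)
      qed
      then show ?thesis using supp False unfolding d\<psi> by (simp add: mi_partial_eq)
    next
      case True
      have "2 / 2 ^ k0 * (1 / 2) ^ k \<le> (2 / 2 ^ k0) * (1::real)" by (intro mult_left_mono) (auto simp: power_le_one)
      then have dx: "dist x0 x \<le> r / 2" using True k0 by simp
      have "ball x (r / 2) \<subseteq> ball x0 r"
      proof
        fix q assume "q \<in> ball x (r / 2)"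
        then show "q \<in> ball x0 r" using dx dist_triangle[of x0 q x] by simp
      qed
      then have w: "r / 2 \<le> weight M x" using r M by (intro weight_ge_ball) auto
      have "r * weight M x \<le> 1 * 1" using r weight_le_1 weight_nonneg by (intro mult_mono) auto
      note rw = this
      have "weight M x powr (real (mi_order \<beta>) - a) \<le> (2 / r) powr \<bar>real (mi_order \<beta>) - a\<bar> * 1 powr (real (mi_order \<beta>) - a)"
        by (rule powr_two_sided(1)) (use w r rw in \<open>auto simp: field_simps\<close>)
      also have "\<dots> \<le> W" using W[OF \<beta>] by simp
      finally have w2: "weight M x powr (real (mi_order \<beta>) - a) \<le> W" .
      have "\<bar>mi_partial \<beta> (\<psi> k) x\<bar> \<le> (2 ^ (k0 + k)) ^ m * B0"
        unfolding d\<psi> abs_mult using B0(2)[OF \<beta>] \<beta> by (intro mult_mono) (auto intro!: power_increasing)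
      then have "weight M x powr (real (mi_order \<beta>) - a) * \<bar>mi_partial \<beta> (\<psi> k) x\<bar> \<le> W * ((2 ^ (k0 + k)) ^ m * B0)"
        using w2 W0 by (intro mult_mono) auto
      also have "\<dots> = W * 2 ^ (k0 * m) * B0 * 2 ^ (k * m)"
        by (simp add: power_add power_mult power_mult_distrib)
      finally show ?thesis using True by simp
    qed
  qed (use \<alpha> z W0 B0 in auto)
qed

text \<open>A single bump compares \<open>2 powr (k * m')\<close> with
  \<open>2 powr (k * (m - d / p))\<close>. In the limiting case every scale contributes the same
  energy, and \<open>geometric_sum_powr\<close> prevents interaction between the nested scales; the
  resulting \<open>n \<le> K * n powr (1 / p)\<close> fails for large \<open>n\<close> when
  \<open>p > 1\<close>.\<close>

theorem embedding_necessary_order: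
  fixes D M :: "('n::{finite,linorder} rvec) set"
  assumes D: "open D" "D \<noteq> {}" and M: "M \<noteq> {}" "M \<inter> D = {}" and p: "p \<ge> 1"
    and emb: "continuously_embedded
     (kondratiev_space D M m a p) (kondratiev_norm D M m a p)
     (kondratiev_space_inf D M m' a') (kondratiev_norm_inf D M m' a')"
  shows "real m - real CARD('n) / p \<ge> real m'" and "p > 1 \<Longrightarrow> real m - real CARD('n) / p > real m'"
proof -
  obtain C where XY: "kondratiev_space D M m a p \<subseteq> kondratiev_space_inf D M m' a'"
    and C: "\<And>u. u \<in> kondratiev_space D M m a p \<Longrightarrow> kondratiev_norm_inf D M m' a' u \<le> C * kondratiev_norm D M m a p u"
    using emb unfolding continuously_embedded_def by blast
  obtain x0 where x0: "x0 \<in> D" using D(2) by blast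
  obtain \<psi> :: "nat \<Rightarrow> 'n rvec \<Rightarrow> real" and \<alpha> and \<theta> B A :: real where
    \<alpha>: "mi_order \<alpha> = m'" and \<theta>: "\<theta> > 0" and B: "B > 0" and A: "A > 0" and sm: "\<And>k. smooth_on UNIV (\<psi> k)"
    and v: "\<And>k. mi_partial \<alpha> (\<psi> k) x0 = \<theta> * 2 ^ (k * m') \<or> mi_partial \<alpha> (\<psi> k) x0 = - \<theta> * 2 ^ (k * m')"
    and v': "\<And>k l. mi_partial \<alpha> (\<psi> k) x0 / 2 ^ (k * m') = mi_partial \<alpha> (\<psi> l) x0 / 2 ^ (l * m')"
    and bd: "\<And>k \<beta> x. mi_order \<beta> \<le> m \<Longrightarrow> x \<in> D \<Longrightarrow> weight M x powr (real (mi_order \<beta>) - a) * \<bar>mi_partial \<beta> (\<psi> k) x\<bar> \<le> B * 2 ^ (k * m) * indicator (cball x0 (A * (1 / 2) ^ k)) x"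
    by (rule dyadic_profile[OF D(1) M x0, of m' m a]) (rule that; assumption)
  define Nm where "Nm = real (card (mi_upto m :: ('n \<Rightarrow> nat) set))"
  define \<omega> where "\<omega> = measure lborel (cball 0 1 :: 'n rvec set)"
  define w where "w = weight M x0 powr (real m' - a')"
  have w: "w > 0" using weight_pos[OF D(1) M x0] by (simp add: w_def)
  have lower: "w * \<bar>mi_partial \<alpha> u x0\<bar> \<le> \<bar>C\<bar> * (Nm * E) powr (1 / p)"
    if su: "smooth_on UNIV u" and E: "E \<ge> 0" and
      bE: "\<And>\<beta>. mi_order \<beta> \<le> m \<Longrightarrow> (\<integral>\<^sup>+x. ennreal
     ((weight M x powr (real (mi_order \<beta>) - a) * \<bar>mi_partial \<beta> u x\<bar>) powr p) * indicator D x \<partial>lborel) \<le> ennreal E" for u E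
  proof -
    note le = kondratiev_norm_smooth_le[OF D(1) su p E bE]
    have uY: "u \<in> kondratiev_space_inf D M m' a'" using le(1) XY by blast
    have "w * \<bar>mi_partial \<alpha> u x0\<bar> \<le> kondratiev_norm_inf D M m' a' u"
      using kondratiev_norm_inf_ge[OF D(1) M su uY _ x0, of \<alpha>] by (simp add: \<alpha> w_def)
    also have "\<dots> \<le> C * kondratiev_norm D M m a p u" by (rule C[OF le(1)])
    also have "\<dots> \<le> \<bar>C\<bar> * kondratiev_norm D M m a p u" by (intro mult_right_mono) (auto simp: kondratiev_norm_def)
    also have "\<dots> \<le> \<bar>C\<bar> * (Nm * E) powr (1 / p)"
      using le(2) unfolding Nm_def by (intro mult_left_mono) auto
    finally show ?thesis .
  qed
  show ge: "real m - real CARD('n) / p \<ge> real m'"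
  proof (rule ccontr)
    assume "\<not> ?thesis"
    then have s: "real m' - (real m - real CARD('n) / p) > 0" by simp
    define s where "s = real m' - (real m - real CARD('n) / p)"
    define K where "K = \<bar>C\<bar> * (Nm * (B powr p * (\<omega> * A ^ CARD('n)))) powr (1 / p) / (w * \<theta>)"
    have key: "2 powr (s * real k) \<le> K" for k
    proof -
      define E where "E = (B * 2 ^ (k * m)) powr p * (\<omega> * (A * (1 / 2) ^ k) ^ CARD('n))"
      have E: "E \<ge> 0" using A by (simp add: E_def \<omega>_def)
      have "(\<integral>\<^sup>+x. ennreal ((weight M x powr (real (mi_order \<beta>) - a) * \<bar>mi_partial \<beta> (\<psi> k) x\<bar>) powr p) * indicator D x \<partial>lborel) \<le> ennreal E"
        if \<beta>: "mi_order \<beta> \<le> m" for \<beta>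
        unfolding E_def \<omega>_def
      proof (rule nn_integral_indicator_le)
        fix x assume "x \<in> D"
        from powr_mono2[OF _ _ bd[OF \<beta> this], of p k] p
        have "(weight M x powr (real (mi_order \<beta>) - a) * \<bar>mi_partial \<beta> (\<psi> k) x\<bar>) powr p
          \<le> (B * 2 ^ (k * m) * indicator (cball x0 (A * (1 / 2) ^ k)) x) powr p" by simp
        then show "(weight M x powr (real (mi_order \<beta>) - a) * \<bar>mi_partial \<beta> (\<psi> k) x\<bar>) powr p
          \<le> (B * 2 ^ (k * m)) powr p * indicator (cball x0 (A * (1 / 2) ^ k)) x"
          using p by (cases "x \<in> cball x0 (A * (1 / 2) ^ k)") auto
      qed (use A in auto)
      from lower[OF sm E this] have "w * \<bar>mi_partial \<alpha> (\<psi> k) x0\<bar> \<le> \<bar>C\<bar> * (Nm * E) powr (1 / p)" .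
      moreover have "\<bar>mi_partial \<alpha> (\<psi> k) x0\<bar> = \<theta> * 2 ^ (k * m')" using v[of k] \<theta> by (auto simp: abs_mult)
      moreover have "(Nm * E) powr (1 / p) = (Nm * (B powr p * (\<omega> * A ^ CARD('n)))) powr (1 / p) * 2 powr (real k * (real m - real CARD('n) / p))"
      proof -
        have "(2 ^ (k * m)) powr p * ((1 / 2) ^ k) ^ CARD('n) = 2 powr (real k * (real m * p - real CARD('n)))"
        proof -
          have "((1 / 2 :: real) ^ k) ^ CARD('n) = 2 powr - (real k * real CARD('n))"
            by (simp add: power_mult[symmetric] power_one_over powr_minus powr_realpow[symmetric] powr_powr inverse_eq_divide)
          moreover have "(2 ^ (k * m)) powr p = (2::real) powr (real k * real m * p)"
            by (simp add: powr_realpow[symmetric] powr_powr)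
          ultimately show ?thesis by (simp add: powr_add[symmetric] algebra_simps)
        qed
        moreover have "Nm * E = Nm * (B powr p * (\<omega> * A ^ CARD('n))) * ((2 ^ (k * m)) powr p * ((1 / 2) ^ k) ^ CARD('n))"
          unfolding E_def using B by (simp add: powr_mult power_mult_distrib mult_ac)
        ultimately have "Nm * E = Nm * (B powr p * (\<omega> * A ^ CARD('n))) * 2 powr (real k * (real m * p - real CARD('n)))" by simp
        then have "(Nm * E) powr (1 / p) = (Nm * (B powr p * (\<omega> * A ^ CARD('n)))) powr (1 / p) * (2 powr (real k * (real m * p - real CARD('n)))) powr (1 / p)"
          using powr_mult by metis
        also have "(2 powr (real k * (real m * p - real CARD('n)))) powr (1 / p) = 2 powr (real k * (real m - real CARD('n) / p))"
        proof -
          have "real k * (real m * p - real CARD('n)) * (1 / p) = real k * (real m - real CARD('n) / p)" using p by (simp add: field_simps)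
          then show ?thesis by (simp only: powr_powr)
        qed
        finally show ?thesis .
      qed
      ultimately have "w * (\<theta> * 2 powr (real k * real m')) \<le> \<bar>C\<bar> * ((Nm * (B powr p * (\<omega> * A ^ CARD('n)))) powr (1 / p) * 2 powr (real k * (real m - real CARD('n) / p)))"
        by (simp add: powr_realpow[symmetric])
      then have "2 powr (real k * real m') \<le> K * 2 powr (real k * (real m - real CARD('n) / p))"
        using w \<theta> by (simp add: K_def field_simps)
      from mult_right_mono[OF this, of "2 powr - (real k * (real m - real CARD('n) / p))"]
      have "2 powr (real k * real m') * 2 powr - (real k * (real m - real CARD('n) / p)) \<le> K"
        by (simp add: powr_minus mult.assoc)
      then show ?thesis by (simp add: powr_add[symmetric] s_def algebra_simps)
    qed
    have s0: "s > 0" using s by (simp add: s_def)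
    have "filterlim (\<lambda>k. 2 powr (s * real k)) at_top sequentially" using s0 by real_asymp
    then have "\<forall>\<^sub>F k in sequentially. K < 2 powr (s * real k)" by (simp add: filterlim_at_top_dense)
    then obtain k where "K < 2 powr (s * real k)" using eventually_happens by fastforce
    then show False using key[of k] by simp
  qed
  assume p1: "p > 1"
  show "real m - real CARD('n) / p > real m'"
  proof (rule ccontr)
    assume "\<not> ?thesis"
    then have eq: "real m - real m' = real CARD('n) / p" using ge by simp
    have "real CARD('n) / p > 0" using p by simp
    then have mm: "m' < m" using eq by (cases "m' < m") auto
    \<comment> \<open>Growth per scale of the normalised derivatives of order \<open>m\<close>: the
      quotient of \<open>2 ^ (k * m)\<close> by \<open>2 ^ (k * m')\<close> is
      \<open>q ^ k\<close>.\<close>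
    define q where "q = (2 :: real) ^ (m - m')"
    have q: "q > 1" unfolding q_def using mm by (simp add: one_less_power)
    define K1 where "K1 = B powr p * (q / (q - 1)) powr p * (\<omega> * A ^ CARD('n))"
    define K where "K = \<bar>C\<bar> * (Nm * K1) powr (1 / p) / (w * \<theta>)"
    have key: "real n \<le> K * real n powr (1 / p)" for n
    proof -
      \<comment> \<open>The normalisation gives all summands the same
        \<open>\<alpha>\<close>-derivative at \<open>x0\<close>, including its sign, so that nothing
        cancels there.\<close>
      define u where "u x = (\<Sum>k<n. (1 / 2 ^ (k * m')) * \<psi> k x)" for x
      have smk: "smooth_on UNIV (\<lambda>x. (1 / 2 ^ (k * m')) * \<psi> k x)" for k
        by (intro smooth_on_mult smooth_on_const sm)
      have su: "smooth_on UNIV u" unfolding u_def by (intro smooth_on_sum smk)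
      have du: "mi_partial \<beta> u x = (\<Sum>k<n. (1 / 2 ^ (k * m')) * mi_partial \<beta> (\<psi> k) x)" for \<beta> x
        unfolding u_def mi_partial_eq by (subst iter_partial_sum[OF smk]) (simp only: iter_partial_cmult[OF sm])
      have dx0: "\<bar>mi_partial \<alpha> u x0\<bar> = real n * \<theta>"
      proof -
        have "mi_partial \<alpha> u x0 = (\<Sum>k<n. mi_partial \<alpha> (\<psi> 0) x0)"
          unfolding du using v'[of _ 0] by (intro sum.cong) auto
        then have "\<bar>mi_partial \<alpha> u x0\<bar> = real n * \<bar>mi_partial \<alpha> (\<psi> 0) x0\<bar>" by (simp add: abs_mult)
        then show ?thesis using v[of 0] \<theta> by auto
      qed
      have E0: "real n * K1 \<ge> 0" using A by (simp add: K1_def \<omega>_def)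
      have "(\<integral>\<^sup>+x. ennreal ((weight M x powr (real (mi_order \<beta>) - a) * \<bar>mi_partial \<beta> u x\<bar>) powr p) * indicator D x \<partial>lborel) \<le> ennreal (real n * K1)"
        if \<beta>: "mi_order \<beta> \<le> m" for \<beta>
      proof -
        let ?b = "\<lambda>x k. x \<in> cball x0 (A * (1 / 2) ^ k)"
        have pw: "(weight M x powr (real (mi_order \<beta>) - a) * \<bar>mi_partial \<beta> u x\<bar>) powr p
           \<le> (\<Sum>k<n. B powr p * (q / (q - 1)) powr p * (q ^ k) powr p * indicator (cball x0 (A * (1 / 2) ^ k)) x)" if x: "x \<in> D" for x
        proof -
          have "weight M x powr (real (mi_order \<beta>) - a) * \<bar>mi_partial \<beta> u x\<bar>
            \<le> weight M x powr (real (mi_order \<beta>) - a) * (\<Sum>k<n. (1 / 2 ^ (k * m')) * \<bar>mi_partial \<beta> (\<psi> k) x\<bar>)"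
            unfolding du by (intro mult_left_mono order_trans[OF sum_abs] sum_mono) (auto simp: abs_mult)
          also have "\<dots> = (\<Sum>k<n. (1 / 2 ^ (k * m')) * (weight M x powr (real (mi_order \<beta>) - a) * \<bar>mi_partial \<beta> (\<psi> k) x\<bar>))"
            by (simp add: sum_distrib_left mult_ac)
          also have "\<dots> \<le> (\<Sum>k<n. (1 / 2 ^ (k * m')) * (B * 2 ^ (k * m) * indicator (cball x0 (A * (1 / 2) ^ k)) x))"
            by (intro sum_mono mult_left_mono bd \<beta> x) auto
          also have "\<dots> = B * (\<Sum>k<n. q ^ k * of_bool (?b x k))"
          proof -
            have "(1 / 2 ^ (k * m')) * (B * 2 ^ (k * m) * indicator (cball x0 (A * (1 / 2) ^ k)) x) = B * (q ^ k * of_bool (?b x k))" for k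
            proof -
              have "(2::real) ^ (k * m) = 2 ^ (k * m') * q ^ k"
                using mm by (simp add: q_def power_mult[symmetric] power_add[symmetric] mult.commute[of _ k] add_mult_distrib2[symmetric])
              then show ?thesis by (simp add: indicator_def)
            qed
            then show ?thesis by (simp only: sum_distrib_left)
          qed
          finally have "(weight M x powr (real (mi_order \<beta>) - a) * \<bar>mi_partial \<beta> u x\<bar>) powr p \<le> (B * (\<Sum>k<n. q ^ k * of_bool (?b x k))) powr p"
            using p by (intro powr_mono2) auto
          also have "\<dots> = B powr p * (\<Sum>k<n. q ^ k * of_bool (?b x k)) powr p" by (rule powr_mult)
          \<comment> \<open>The balls are nested, so the scales whose ball contains \<open>x\<close>
            form an initial segment.\<close>
          also have "\<dots> \<le> B powr p * ((q / (q - 1)) powr p * (\<Sum>k<n. (q ^ k) powr p * of_bool (?b x k)))"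
          proof (intro mult_left_mono geometric_sum_powr q p)
            fix k assume "?b x (Suc k)"
            moreover have "A * (1 / 2) ^ Suc k \<le> A * (1 / 2) ^ k" using A by simp
            ultimately show "?b x k" by (meson mem_cball order_trans)
          qed simp
          also have "\<dots> = (\<Sum>k<n. B powr p * (q / (q - 1)) powr p * (q ^ k) powr p * indicator (cball x0 (A * (1 / 2) ^ k)) x)"
            unfolding indicator_def sum_distrib_left by (simp only: mult_ac)
          finally show ?thesis .
        qed
        have "(\<integral>\<^sup>+x. ennreal ((weight M x powr (real (mi_order \<beta>) - a) * \<bar>mi_partial \<beta> u x\<bar>) powr p) * indicator D x \<partial>lborel)
          \<le> (\<integral>\<^sup>+x. (\<Sum>k<n. ennreal (B powr p * (q / (q - 1)) powr p * (q ^ k) powr p) * indicator (cball x0 (A * (1 / 2) ^ k)) x) \<partial>lborel)"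
        proof (rule nn_integral_mono)
          fix x
          show "ennreal ((weight M x powr (real (mi_order \<beta>) - a) * \<bar>mi_partial \<beta> u x\<bar>) powr p) * indicator D x
            \<le> (\<Sum>k<n. ennreal (B powr p * (q / (q - 1)) powr p * (q ^ k) powr p) * indicator (cball x0 (A * (1 / 2) ^ k)) x)"
          proof (cases "x \<in> D")
            case True
            have "ennreal ((weight M x powr (real (mi_order \<beta>) - a) * \<bar>mi_partial \<beta> u x\<bar>) powr p)
              \<le> ennreal (\<Sum>k<n. B powr p * (q / (q - 1)) powr p * (q ^ k) powr p * indicator (cball x0 (A * (1 / 2) ^ k)) x)"
              by (rule ennreal_leI[OF pw[OF True]])
            also have "\<dots> = (\<Sum>k<n. ennreal (B powr p * (q / (q - 1)) powr p * (q ^ k) powr p * indicator (cball x0 (A * (1 / 2) ^ k)) x))"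
              by (rule sum_ennreal[symmetric]) auto
            also have "\<dots> = (\<Sum>k<n. ennreal (B powr p * (q / (q - 1)) powr p * (q ^ k) powr p) * indicator (cball x0 (A * (1 / 2) ^ k)) x)"
              by (intro sum.cong refl) (auto simp: indicator_def)
            finally show ?thesis using True by simp
          qed simp
        qed
        also have "\<dots> = (\<Sum>k<n. ennreal (B powr p * (q / (q - 1)) powr p * (q ^ k) powr p) * emeasure lborel (cball x0 (A * (1 / 2) ^ k)))"
        proof -
          have "(\<integral>\<^sup>+x. (\<Sum>k<n. ennreal (B powr p * (q / (q - 1)) powr p * (q ^ k) powr p) * indicator (cball x0 (A * (1 / 2) ^ k)) x) \<partial>lborel)
            = (\<Sum>k<n. (\<integral>\<^sup>+x. ennreal (B powr p * (q / (q - 1)) powr p * (q ^ k) powr p) * indicator (cball x0 (A * (1 / 2) ^ k)) x \<partial>lborel))"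
            by (intro nn_integral_sum borel_measurable_times_ennreal borel_measurable_const borel_measurable_indicator) simp
          also have "\<dots> = (\<Sum>k<n. ennreal (B powr p * (q / (q - 1)) powr p * (q ^ k) powr p) * emeasure lborel (cball x0 (A * (1 / 2) ^ k)))"
            by (intro sum.cong refl nn_integral_cmult_indicator) simp
          finally show ?thesis .
        qed
        also have "\<dots> = (\<Sum>k<n. ennreal K1)"
        proof (rule sum.cong[OF refl])
          fix k
          \<comment> \<open>The limiting identity \<open>(m - m') * p = d\<close>: the growth of the
            p-th power compensates exactly the shrinking volume of the \<open>k\<close>-th
            ball.\<close>
          have "(q ^ k) powr p * ((1 / 2) ^ k) ^ CARD('n) = 1"
          proof -
            have "((1 / 2 :: real) ^ k) ^ CARD('n) = 2 powr - (real k * real CARD('n))"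
              by (simp add: power_mult[symmetric] power_one_over powr_minus powr_realpow[symmetric] powr_powr inverse_eq_divide)
            moreover have "(q ^ k) powr p = 2 powr (real k * real CARD('n))"
            proof -
              have "(q ^ k) powr p = 2 powr (real ((m - m') * k) * p)"
                by (simp add: q_def power_mult[symmetric] powr_realpow[symmetric] powr_powr)
              also have "real ((m - m') * k) * p = real k * real CARD('n)"
              proof -
                have "(real m - real m') * p = real CARD('n)" using eq p by (simp add: field_simps)
                moreover have "real ((m - m') * k) * p = real k * ((real m - real m') * p)"
                  using mm by (simp add: of_nat_diff less_imp_le mult_ac)
                ultimately show ?thesis by simp
              qed
              finally show ?thesis .
            qed
            ultimately show ?thesis by (simp add: powr_add[symmetric])
          qed
          then have "B powr p * (q / (q - 1)) powr p * (q ^ k) powr p * (\<omega> * (A * (1 / 2) ^ k) ^ CARD('n)) = K1"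
            by (simp add: K1_def power_mult_distrib mult_ac)
          then show "ennreal (B powr p * (q / (q - 1)) powr p * (q ^ k) powr p) * emeasure lborel (cball x0 (A * (1 / 2) ^ k)) = ennreal K1"
            using A by (simp add: emeasure_lborel_cball_scale \<omega>_def ennreal_mult[symmetric])
        qed
        also have "\<dots> = ennreal (real n * K1)"
        proof -
          have "K1 \<ge> 0" using A by (simp add: K1_def \<omega>_def)
          then show ?thesis by (simp add: ennreal_mult ennreal_of_nat_eq_real_of_nat)
        qed
        finally show ?thesis .
      qed
      from lower[OF su E0 this] have "w * (real n * \<theta>) \<le> \<bar>C\<bar> * (Nm * (real n * K1)) powr (1 / p)" by (simp only: dx0)
      also have "(Nm * (real n * K1)) powr (1 / p) = (Nm * K1) powr (1 / p) * real n powr (1 / p)"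
        by (metis powr_mult mult.assoc mult.commute)
      finally show ?thesis using w \<theta> by (simp add: K_def field_simps)
    qed
    define s where "s = 1 - 1 / p"
    have s: "s > 0" using p1 by (simp add: s_def)
    have le: "real (Suc n) powr s \<le> K" for n
    proof -
      have "real (Suc n) powr s * real (Suc n) powr (1 / p) = real (Suc n)"
        by (simp add: s_def powr_add[symmetric])
      then have "real (Suc n) powr s * real (Suc n) powr (1 / p) \<le> K * real (Suc n) powr (1 / p)"
        using key[of "Suc n"] by simp
      then show ?thesis by (rule mult_right_le_imp_le) simp
    qed
    have "filterlim (\<lambda>n. real (Suc n) powr s) at_top sequentially" using s by real_asymp
    then have "\<forall>\<^sub>F n in sequentially. K < real (Suc n) powr s" by (simp add: filterlim_at_top_dense)
    then obtain n where "K < real (Suc n) powr s" using eventually_happens by fastforce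
    then show False using le[of n] by simp
  qed
qed

section \<open>Localization of the cone condition\<close>

lemma cone_condition_onI:
  assumes "\<kappa> > 0" "h > 0" "\<And>x. x \<in> A \<Longrightarrow> x \<in> D \<Longrightarrow> \<exists>e. norm e \<le> L \<and>
     (\<forall>t\<in>{0..h}. cball (x + t *\<^sub>R e) (t * \<kappa>) \<subseteq> D)"
  shows "cone_condition_on A D"
  unfolding cone_condition_on_def using assms by blast

lemma cone_condition_onE:
  assumes "cone_condition_on A D"
  obtains \<kappa> h L where "\<kappa> > 0" "h > 0" "\<And>x. x \<in> A \<Longrightarrow> x \<in> D \<Longrightarrow> \<exists>e. norm e \<le> L \<and>
     (\<forall>t\<in>{0..h}. cball (x + t *\<^sub>R e) (t * \<kappa>) \<subseteq> D)"
  using assms unfolding cone_condition_on_def by blast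

lemma cone_condition_on_mono:
  assumes B: "cone_condition_on B D" and sub: "A \<inter> D \<subseteq> B"
  shows "cone_condition_on A D"
proof (rule cone_condition_onE[OF B])
  fix \<kappa> h L assume *: "\<kappa> > 0" "h > 0" "\<And>x. x \<in> B \<Longrightarrow> x \<in> D \<Longrightarrow> \<exists>e. norm e \<le> L \<and>
     (\<forall>t\<in>{0..h}. cball (x + t *\<^sub>R e) (t * \<kappa>) \<subseteq> D)"
  show ?thesis by (rule cone_condition_onI[OF *(1,2)]) (use *(3) sub in blast)
qed

lemma cone_condition_on_Un:
  assumes "cone_condition_on A D" "cone_condition_on B D"
  shows "cone_condition_on (A \<union> B) D"
proof -
  obtain \<kappa>1 h1 L1 where 1: "\<kappa>1 > 0" "h1 > 0" "\<forall>x\<in>A \<inter> D. \<exists>e. norm e \<le> L1 \<and> (\<forall>t\<in>{0..h1}. cball (x + t *\<^sub>R e) (t * \<kappa>1) \<subseteq> D)"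
    using assms(1) unfolding cone_condition_on_def by blast
  obtain \<kappa>2 h2 L2 where 2: "\<kappa>2 > 0" "h2 > 0" "\<forall>x\<in>B \<inter> D. \<exists>e. norm e \<le> L2 \<and> (\<forall>t\<in>{0..h2}. cball (x + t *\<^sub>R e) (t * \<kappa>2) \<subseteq> D)"
    using assms(2) unfolding cone_condition_on_def by blast
  have "\<exists>e. norm e \<le> max L1 L2 \<and> (\<forall>t\<in>{0..min h1 h2}. cball (x + t *\<^sub>R e) (t * min \<kappa>1 \<kappa>2) \<subseteq> D)"
    if x: "x \<in> (A \<union> B) \<inter> D" for x
  proof (cases "x \<in> A")
    case True
    then obtain e where e: "norm e \<le> L1" "\<forall>t\<in>{0..h1}. cball (x + t *\<^sub>R e) (t * \<kappa>1) \<subseteq> D" using 1(3) x by blast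
    have "cball (x + t *\<^sub>R e) (t * min \<kappa>1 \<kappa>2) \<subseteq> D" if t: "t \<in> {0..min h1 h2}" for t
    proof -
      have "t * min \<kappa>1 \<kappa>2 \<le> t * \<kappa>1" using t by (intro mult_left_mono) auto
      moreover have "cball (x + t *\<^sub>R e) (t * \<kappa>1) \<subseteq> D" using e(2) t by auto
      ultimately show ?thesis using subset_cball by blast
    qed
    then show ?thesis using e(1) by (intro exI[of _ e]) auto
  next
    case False
    then obtain e where e: "norm e \<le> L2" "\<forall>t\<in>{0..h2}. cball (x + t *\<^sub>R e) (t * \<kappa>2) \<subseteq> D" using 2(3) x by blast
    have "cball (x + t *\<^sub>R e) (t * min \<kappa>1 \<kappa>2) \<subseteq> D" if t: "t \<in> {0..min h1 h2}" for t
    proof -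
      have "t * min \<kappa>1 \<kappa>2 \<le> t * \<kappa>2" using t by (intro mult_left_mono) auto
      moreover have "cball (x + t *\<^sub>R e) (t * \<kappa>2) \<subseteq> D" using e(2) t by auto
      ultimately show ?thesis using subset_cball by blast
    qed
    then show ?thesis using e(1) by (intro exI[of _ e]) auto
  qed
  then show ?thesis
    using 1(1,2) 2(1,2) by (intro cone_condition_onI[of "min \<kappa>1 \<kappa>2" "min h1 h2" _ _ "max L1 L2"]) auto
qed

lemma cone_condition_on_empty: "cone_condition_on {} D"
  by (rule cone_condition_onI[of 1 1]) auto

lemma cone_condition_on_UN:
  "finite I \<Longrightarrow> (\<And>i. i \<in> I \<Longrightarrow> cone_condition_on (A i) D) \<Longrightarrow> cone_condition_on (\<Union>i\<in>I. A i) D"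
proof (induction I rule: finite_induct)
  case (insert i I)
  then have "cone_condition_on (A i \<union> (\<Union>i\<in>I. A i)) D" by (intro cone_condition_on_Un) auto
  then show ?case by simp
qed (simp add: cone_condition_on_empty)

text \<open>Cones only have to be contained in the set, so a union inherits the cones of its members
  at their own points.\<close>

lemma cone_condition_on_superset:
  assumes "cone_condition_on A D" "D \<subseteq> D'"
  shows "cone_condition_on (A \<inter> D) D'"
proof -
  obtain \<kappa> h L where 1: "\<kappa> > 0" "h > 0" "\<forall>x\<in>A \<inter> D. \<exists>e. norm e \<le> L \<and> (\<forall>t\<in>{0..h}. cball (x + t *\<^sub>R e) (t * \<kappa>) \<subseteq> D)"
    using assms(1) unfolding cone_condition_on_def by blast
  then have "\<forall>x\<in>(A \<inter> D) \<inter> D'. \<exists>e. norm e \<le> L \<and> (\<forall>t\<in>{0..h}. cball (x + t *\<^sub>R e) (t * \<kappa>) \<subseteq> D')"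
    using assms(2) by (meson Int_iff subset_trans)
  then show ?thesis unfolding cone_condition_on_def using 1(1,2) by blast
qed

lemma cone_condition_UN:
  assumes "finite I" "\<And>i. i \<in> I \<Longrightarrow> cone_condition (D i)"
  shows "cone_condition (\<Union>i\<in>I. D i)"
proof -
  have "cone_condition_on (\<Union>i\<in>I. UNIV \<inter> D i) (\<Union>i\<in>I. D i)"
    using assms by (intro cone_condition_on_UN cone_condition_on_superset) auto
  then show ?thesis by (rule cone_condition_on_mono) auto
qed

text \<open>The local form is used at the points of the closure of \<open>D\<close>, boundary points
  included; compactness of the closure turns it into uniform constants.\<close>

definition cone_at :: "'n::finite rvec set \<Rightarrow> 'n rvec \<Rightarrow> bool" where
  "cone_at D p \<longleftrightarrow> (\<exists>\<delta>>0. cone_condition_on (ball p \<delta>) D)"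

lemma cone_condition_imp_cone_at: "cone_condition D \<Longrightarrow> cone_at D p"
  unfolding cone_at_def using cone_condition_on_mono[of UNIV D "ball p 1"] zero_less_one by blast

lemma cone_condition_on_compact:
  assumes K: "compact K" and at: "\<And>p. p \<in> K \<Longrightarrow> cone_at D p"
  shows "cone_condition_on K D"
proof -
  obtain \<delta> where \<delta>: "\<And>p. p \<in> K \<Longrightarrow> \<delta> p > 0 \<and> cone_condition_on (ball p (\<delta> p)) D"
    using at unfolding cone_at_def by metis
  have "K \<subseteq> (\<Union>p\<in>K. ball p (\<delta> p))" using \<delta> by force
  then obtain F where F: "F \<subseteq> K" "finite F" "K \<subseteq> (\<Union>p\<in>F. ball p (\<delta> p))"
    using compactE_image[OF K, of K "\<lambda>p. ball p (\<delta> p)"] by auto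
  have "cone_condition_on (\<Union>p\<in>F. ball p (\<delta> p)) D"
    using F \<delta> by (intro cone_condition_on_UN) auto
  then show ?thesis by (rule cone_condition_on_mono) (use F in auto)
qed

lemma cone_condition_of_cone_at:
  assumes "bounded D" "\<And>p. p \<in> closure D \<Longrightarrow> cone_at D p"
  shows "cone_condition D"
proof -
  have "cone_condition_on (closure D) D"
    using assms by (intro cone_condition_on_compact) (auto simp: compact_closure)
  then show ?thesis by (rule cone_condition_on_mono) (use closure_subset in auto)
qed

text \<open>No direction has to be found here: the axis 0 turns the cones into balls about the
  vertex.\<close>

lemma cone_at_interior:
  assumes "open D" "p \<in> D"
  shows "cone_at D p"
proof -
  obtain r where r: "r > 0" "ball p r \<subseteq> D" using assms open_contains_ball by blast
  have "cone_condition_on (ball p (r / 2)) D"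
  proof (rule cone_condition_onI[of 1 "r / 2"])
    fix x assume x: "x \<in> ball p (r / 2)"
    show "\<exists>e. norm e \<le> 0 \<and> (\<forall>t\<in>{0..r / 2}. cball (x + t *\<^sub>R e) (t * 1) \<subseteq> D)"
    proof (intro exI[of _ 0] conjI ballI subsetI)
      fix t y assume "t \<in> {0..r / 2}" "y \<in> cball (x + t *\<^sub>R 0) (t * 1)"
      then have "dist p y < r" using x dist_triangle[of p y x] by simp
      then show "y \<in> D" using r(2) by auto
    qed simp
  qed (use r in auto)
  then show ?thesis unfolding cone_at_def using r(1) by (meson half_gt_zero)
qed

text \<open>Strict differentiability: the linear approximation is controlled for pairs of points
  near \<open>p\<close>. Differentiability at \<open>p\<close> alone would not do, because the
  vertex of the cone to be transported varies in a neighbourhood of \<open>p\<close>.\<close>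

definition strict_deriv :: "('n::finite rvec \<Rightarrow> 'n rvec) \<Rightarrow> ('n rvec \<Rightarrow> 'n rvec) \<Rightarrow> 'n rvec \<Rightarrow> bool" where
  "strict_deriv f F p \<longleftrightarrow> linear F \<and> (\<forall>\<epsilon>>0. \<exists>\<delta>>0. \<forall>x\<in>ball p \<delta>. \<forall>y\<in>ball p \<delta>.
     norm (f y - f x - F (y - x)) \<le> \<epsilon> * norm (y - x))"

lemma strict_deriv_Lipschitz:
  assumes "strict_deriv f F p"
  obtains \<delta> C where "\<delta> > 0" "C > 0" "\<And>x y. x \<in> ball p \<delta> \<Longrightarrow> y \<in> ball p \<delta> \<Longrightarrow> norm (f y - f x) \<le> C * norm (y - x)"
proof -
  obtain \<delta> where \<delta>: "\<delta> > 0" "\<forall>x\<in>ball p \<delta>. \<forall>y\<in>ball p \<delta>. norm (f y - f x - F (y - x)) \<le> 1 * norm (y - x)"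
    using assms unfolding strict_deriv_def using zero_less_one by blast
  have "linear F" using assms by (simp add: strict_deriv_def)
  then obtain b where b: "b > 0" "\<And>x. norm (F x) \<le> b * norm x" using linear_bounded_pos by blast
  show ?thesis
  proof (rule that[of \<delta> "b + 1"])
    fix x y assume xy: "x \<in> ball p \<delta>" "y \<in> ball p \<delta>"
    have "norm (f y - f x) \<le> norm (f y - f x - F (y - x)) + norm (F (y - x))"
      by (metis diff_add_cancel norm_triangle_ineq)
    also have "\<dots> \<le> 1 * norm (y - x) + b * norm (y - x)" using \<delta>(2) xy b(2) by (intro add_mono) auto
    finally show "norm (f y - f x) \<le> (b + 1) * norm (y - x)" by (simp add: algebra_simps)
  qed (use \<delta> b in auto)
qed

lemma strict_deriv_compose:
  assumes f: "strict_deriv f F p" and g: "strict_deriv g G (f p)"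
  shows "strict_deriv (\<lambda>x. g (f x)) (\<lambda>v. G (F v)) p"
  unfolding strict_deriv_def
proof (intro conjI allI impI)
  have lin: "linear F" "linear G" using f g by (auto simp: strict_deriv_def)
  then show "linear (\<lambda>v. G (F v))" using linear_compose[of F G] by (simp add: o_def)
  obtain b where b: "b > 0" "\<And>x. norm (G x) \<le> b * norm x" using linear_bounded_pos[OF lin(2)] by blast
  obtain \<delta>1 C where \<delta>1: "\<delta>1 > 0" "C > 0" "\<And>x y. x \<in> ball p \<delta>1 \<Longrightarrow> y \<in> ball p \<delta>1 \<Longrightarrow> norm (f y - f x) \<le> C * norm (y - x)"
    using strict_deriv_Lipschitz[OF f] by metis
  fix \<epsilon> :: real assume \<epsilon>: "\<epsilon> > 0"
  obtain \<delta>2 where \<delta>2: "\<delta>2 > 0" "\<forall>x\<in>ball p \<delta>2. \<forall>y\<in>ball p \<delta>2. norm (f y - f x - F (y - x)) \<le> \<epsilon> / (2 * b) * norm (y - x)"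
    using f \<epsilon> b(1) unfolding strict_deriv_def by (metis divide_pos_pos mult_pos_pos zero_less_numeral)
  obtain \<delta>3 where \<delta>3: "\<delta>3 > 0" "\<forall>x\<in>ball (f p) \<delta>3. \<forall>y\<in>ball (f p) \<delta>3. norm (g y - g x - G (y - x)) \<le> \<epsilon> / (2 * C) * norm (y - x)"
    using g \<epsilon> \<delta>1(2) unfolding strict_deriv_def by (metis divide_pos_pos mult_pos_pos zero_less_numeral)
  define \<delta> where "\<delta> = min \<delta>1 (min \<delta>2 (\<delta>3 / C))"
  have \<delta>: "\<delta> > 0" "\<delta> \<le> \<delta>1" "\<delta> \<le> \<delta>2" "\<delta> \<le> \<delta>3 / C" using \<delta>1 \<delta>2 \<delta>3 by (auto simp: \<delta>_def)
  have fb: "f x \<in> ball (f p) \<delta>3" if x: "x \<in> ball p \<delta>" for x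
  proof -
    have "norm (f x - f p) \<le> C * norm (x - p)" using x \<delta> \<delta>1 by (intro \<delta>1(3)) auto
    also have "\<dots> < C * (\<delta>3 / C)" using x \<delta> \<delta>1(2) by (intro mult_strict_left_mono) (auto simp: dist_norm norm_minus_commute)
    finally show ?thesis using \<delta>1(2) by (simp add: dist_norm norm_minus_commute)
  qed
  show "\<exists>\<delta>>0. \<forall>x\<in>ball p \<delta>. \<forall>y\<in>ball p \<delta>. norm (g (f y) - g (f x) - G (F (y - x))) \<le> \<epsilon> * norm (y - x)"
  proof (intro exI[of _ \<delta>] conjI ballI)
    fix x y assume x: "x \<in> ball p \<delta>" and y: "y \<in> ball p \<delta>"
    have "g (f y) - g (f x) - G (F (y - x)) = (g (f y) - g (f x) - G (f y - f x)) + G (f y - f x - F (y - x))"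
      by (simp add: linear_diff[OF lin(2)])
    then have "norm (g (f y) - g (f x) - G (F (y - x))) \<le> norm (g (f y) - g (f x) - G (f y - f x)) + norm (G (f y - f x - F (y - x)))"
      by (metis norm_triangle_ineq)
    also have "\<dots> \<le> \<epsilon> / (2 * C) * norm (f y - f x) + b * norm (f y - f x - F (y - x))"
      using \<delta>3(2) fb[OF x] fb[OF y] b(2) by (intro add_mono) blast+
    also have "\<dots> \<le> \<epsilon> / (2 * C) * (C * norm (y - x)) + b * (\<epsilon> / (2 * b) * norm (y - x))"
      using \<delta>2(2) x y \<delta> \<delta>1 b(1) \<epsilon> by (intro add_mono mult_left_mono \<delta>1(3)) auto
    also have "\<dots> = \<epsilon> * norm (y - x)" using \<delta>1(2) b(1) by simp
    finally show "norm (g (f y) - g (f x) - G (F (y - x))) \<le> \<epsilon> * norm (y - x)" .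
  qed (use \<delta> in auto)
qed

lemma strict_deriv_add:
  assumes f: "strict_deriv f F p" and g: "strict_deriv g G p"
  shows "strict_deriv (\<lambda>x. f x + g x) (\<lambda>v. F v + G v) p"
  unfolding strict_deriv_def
proof (intro conjI allI impI)
  show "linear (\<lambda>v. F v + G v)" using f g by (intro linear_compose_add) (auto simp: strict_deriv_def)
  fix \<epsilon> :: real assume \<epsilon>: "\<epsilon> > 0"
  obtain \<delta>1 where \<delta>1: "\<delta>1 > 0" "\<forall>x\<in>ball p \<delta>1. \<forall>y\<in>ball p \<delta>1. norm (f y - f x - F (y - x)) \<le> \<epsilon> / 2 * norm (y - x)"
    using f \<epsilon> unfolding strict_deriv_def by (metis half_gt_zero)
  obtain \<delta>2 where \<delta>2: "\<delta>2 > 0" "\<forall>x\<in>ball p \<delta>2. \<forall>y\<in>ball p \<delta>2. norm (g y - g x - G (y - x)) \<le> \<epsilon> / 2 * norm (y - x)"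
    using g \<epsilon> unfolding strict_deriv_def by (metis half_gt_zero)
  show "\<exists>\<delta>>0. \<forall>x\<in>ball p \<delta>. \<forall>y\<in>ball p \<delta>. norm (f y + g y - (f x + g x) - (F (y - x) + G (y - x))) \<le> \<epsilon> * norm (y - x)"
  proof (intro exI[of _ "min \<delta>1 \<delta>2"] conjI ballI)
    fix x y assume x: "x \<in> ball p (min \<delta>1 \<delta>2)" and y: "y \<in> ball p (min \<delta>1 \<delta>2)"
    have "f y + g y - (f x + g x) - (F (y - x) + G (y - x)) = (f y - f x - F (y - x)) + (g y - g x - G (y - x))" by simp
    then have "norm (f y + g y - (f x + g x) - (F (y - x) + G (y - x))) \<le> norm (f y - f x - F (y - x)) + norm (g y - g x - G (y - x))"
      by (metis norm_triangle_ineq)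
    also have "\<dots> \<le> \<epsilon> / 2 * norm (y - x) + \<epsilon> / 2 * norm (y - x)"
      using \<delta>1(2) \<delta>2(2) x y by (intro add_mono) auto
    finally show "norm (f y + g y - (f x + g x) - (F (y - x) + G (y - x))) \<le> \<epsilon> * norm (y - x)" by (simp add: algebra_simps)
  qed (use \<delta>1 \<delta>2 in auto)
qed

text \<open>The mean value inequality for \<open>f - f' p\<close>, whose derivative is small near
  \<open>p\<close> since the columns of \<open>f'\<close> are continuous at
  \<open>p\<close>.\<close>

lemma strict_deriv_C1:
  fixes f :: "'n::finite rvec \<Rightarrow> 'n rvec"
  assumes W: "open W" "p \<in> W" and f: "\<And>x. x \<in> W \<Longrightarrow> (f has_derivative f' x) (at x)"
    and c: "\<And>i. isCont (\<lambda>x. f' x (axis i 1)) p"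
  shows "strict_deriv f (f' p) p"
  unfolding strict_deriv_def
proof (intro conjI allI impI)
  have lin: "linear (f' x)" if "x \<in> W" for x using f[OF that] by (rule has_derivative_linear)
  then show "linear (f' p)" using W(2) by blast
  have exp: "f' x v = (\<Sum>i\<in>UNIV. (v $ i) *\<^sub>R f' x (axis i 1))" if "x \<in> W" for x v
  proof -
    have "v = (\<Sum>i\<in>UNIV. (v $ i) *\<^sub>R axis i 1)"
      by (simp add: vec_eq_iff axis_def if_distrib cong: if_cong)
    then have "f' x v = f' x (\<Sum>i\<in>UNIV. (v $ i) *\<^sub>R axis i 1)" by simp
    also have "\<dots> = (\<Sum>i\<in>UNIV. (v $ i) *\<^sub>R f' x (axis i 1))"
      by (simp add: linear_sum[OF lin[OF that]] linear_scale[OF lin[OF that]])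
    finally show ?thesis .
  qed
  fix \<epsilon> :: real assume \<epsilon>: "\<epsilon> > 0"
  define N where "N = real CARD('n)"
  have N: "N > 0" by (simp add: N_def)
  have "\<forall>i. \<exists>\<delta>>0. \<forall>x. dist x p < \<delta> \<longrightarrow> dist (f' x (axis i 1)) (f' p (axis i 1)) < \<epsilon> / N"
    using c \<epsilon> N unfolding continuous_at_eps_delta by (metis divide_pos_pos)
  then obtain \<delta> where \<delta>: "\<And>i. \<delta> i > 0" "\<And>i x. dist x p < \<delta> i \<Longrightarrow> dist (f' x (axis i 1)) (f' p (axis i 1)) < \<epsilon> / N"
    by metis
  obtain r where r: "r > 0" "ball p r \<subseteq> W" using W open_contains_ball by blast
  define d where "d = min r (Min (range \<delta>))"
  have d: "d > 0" "d \<le> r" "\<And>i. d \<le> \<delta> i" using r \<delta>(1) by (auto simp: d_def min_le_iff_disj)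
  have bd: "onorm (\<lambda>v. f' x v - f' p v) \<le> \<epsilon>" if x: "x \<in> ball p d" for x
  proof (rule onorm_le)
    fix v
    have xW: "x \<in> W" using x d r by auto
    have "f' x v - f' p v = (\<Sum>i\<in>UNIV. (v $ i) *\<^sub>R (f' x (axis i 1) - f' p (axis i 1)))"
      by (simp add: exp[OF xW, of v] exp[OF W(2), of v] sum_subtractf[symmetric] scaleR_diff_right)
    also have "norm \<dots> \<le> (\<Sum>i\<in>(UNIV :: 'n set). norm v * (\<epsilon> / N))"
    proof (rule order_trans[OF norm_sum], rule sum_mono)
      fix i
      have "dist x p < \<delta> i" using x d(3)[of i] by (simp add: dist_commute)
      then have "norm (f' x (axis i 1) - f' p (axis i 1)) \<le> \<epsilon> / N" using \<delta>(2) by (simp add: dist_norm less_imp_le)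
      then show "norm ((v $ i) *\<^sub>R (f' x (axis i 1) - f' p (axis i 1))) \<le> norm v * (\<epsilon> / N)"
        unfolding norm_scaleR by (intro mult_mono component_le_norm_cart) auto
    qed
    also have "\<dots> = \<epsilon> * norm v" using N by (simp add: N_def)
    finally show "norm (f' x v - f' p v) \<le> \<epsilon> * norm v" .
  qed
  show "\<exists>\<delta>>0. \<forall>x\<in>ball p \<delta>. \<forall>y\<in>ball p \<delta>. norm (f y - f x - f' p (y - x)) \<le> \<epsilon> * norm (y - x)"
  proof (intro exI[of _ d] conjI ballI)
    fix x y assume x: "x \<in> ball p d" and y: "y \<in> ball p d"
    have bl: "bounded_linear (f' p)" using f[OF W(2)] by (rule has_derivative_bounded_linear)
    have "norm ((\<lambda>x. f x - f' p x) y - (\<lambda>x. f x - f' p x) x) \<le> \<epsilon> * norm (y - x)"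
    proof (rule differentiable_bound[OF convex_ball _ bd y x])
      fix z assume z: "z \<in> ball p d"
      then have "z \<in> W" using d r by auto
      from has_derivative_diff[OF f[OF this] bounded_linear_imp_has_derivative[OF bl]]
      show "((\<lambda>x. f x - f' p x) has_derivative (\<lambda>v. f' z v - f' p v)) (at z within ball p d)"
        by (rule has_derivative_at_withinI)
    qed
    then show "norm (f y - f x - f' p (y - x)) \<le> \<epsilon> * norm (y - x)"
      by (simp add: linear_diff[OF lin[OF W(2)]] algebra_simps)
  qed (use d in auto)
qed

lemma strict_deriv_smooth:
  assumes W: "open W" "p \<in> W" and f: "smooth_on W f"
  shows "strict_deriv f (frechet_derivative f (at p)) p"
proof (rule strict_deriv_C1[OF W])
  show "(f has_derivative frechet_derivative f (at x)) (at x)" if "x \<in> W" for x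
    using smooth_onD[OF f that] frechet_derivative_works by blast
  show "isCont (\<lambda>x. frechet_derivative f (at x) (axis i 1)) p" for i
    using smooth_onD[OF smooth_on_partial[OF f] W(2), of i] differentiable_imp_continuous_within[of "partial i f" p UNIV]
    by (simp add: partial_def[abs_def])
qed

text \<open>The axis at \<open>f x\<close> is pulled back by the right inverse \<open>A\<close> of
  the differential. If \<open>y\<close> lies in the new cone at \<open>x\<close>, the distance of
  \<open>f y\<close> from the old axis has two sources, the distance of \<open>y\<close> from the
  new axis and the linearisation error; each gets half of the old radius
  \<open>t * \<kappa>\<close>.\<close>

lemma cone_at_pullback:
  fixes f :: "'n::finite rvec \<Rightarrow> 'n rvec"
  assumes f: "strict_deriv f F p" and A: "linear A" "\<And>v. F (A v) = v"
    and loc: "r > 0" "\<And>y. y \<in> ball p r \<Longrightarrow> y \<in> D \<longleftrightarrow> f y \<in> \<Omega>" and at: "cone_at \<Omega> (f p)"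
  shows "cone_at D p"
proof -
  obtain \<delta>1 \<kappa> h L0 where \<delta>1: "\<delta>1 > 0" and \<kappa>: "\<kappa> > 0" and h: "h > 0" and
    cn: "\<forall>x\<in>ball (f p) \<delta>1 \<inter> \<Omega>. \<exists>e. norm e \<le> L0 \<and> (\<forall>t\<in>{0..h}. cball (x + t *\<^sub>R e) (t * \<kappa>) \<subseteq> \<Omega>)"
    using at unfolding cone_at_def cone_condition_on_def by blast
  have lin: "linear F" using f by (simp add: strict_deriv_def)
  obtain b where b: "b > 0" "\<And>x. norm (F x) \<le> b * norm x" using linear_bounded_pos[OF lin] by blast
  obtain a where a: "a > 0" "\<And>x. norm (A x) \<le> a * norm x" using linear_bounded_pos[OF A(1)] by blast
  obtain \<delta>0 C where \<delta>0: "\<delta>0 > 0" "C > 0" "\<And>x y. x \<in> ball p \<delta>0 \<Longrightarrow> y \<in> ball p \<delta>0 \<Longrightarrow> norm (f y - f x) \<le> C * norm (y - x)"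
    using strict_deriv_Lipschitz[OF f] by metis
  define L where "L = max L0 0"
  \<comment> \<open>Half of the old opening, divided by the bound \<open>b\<close> for the
    differential.\<close>
  define \<kappa>' where "\<kappa>' = \<kappa> / (2 * b)"
  \<comment> \<open>Bounds the speed along the new cone, so that
    \<open>norm (y - x) \<le> t * S\<close>. Linearisation with error
    \<open>\<kappa> / (2 * S)\<close> then costs at most \<open>t * \<kappa> / 2\<close>.\<close>
  define S where "S = a * L + \<kappa>'"
  have \<kappa>': "\<kappa>' > 0" using \<kappa> b by (simp add: \<kappa>'_def)
  have S: "S > 0" using a \<kappa>' by (simp add: S_def L_def add_nonneg_pos)
  obtain \<delta>2 where \<delta>2: "\<delta>2 > 0" "\<forall>x\<in>ball p \<delta>2. \<forall>y\<in>ball p \<delta>2. norm (f y - f x - F (y - x)) \<le> \<kappa> / (2 * S) * norm (y - x)"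
    using f \<kappa> S unfolding strict_deriv_def by (metis divide_pos_pos mult_pos_pos zero_less_numeral)
  define R where "R = min r \<delta>2"
  define \<delta> where "\<delta> = min (R / 2) (min \<delta>0 (\<delta>1 / C))"
  \<comment> \<open>Keeps the new cone within \<open>R / 2\<close> of its vertex, which is itself
    within \<open>R / 2\<close> of \<open>p\<close>.\<close>
  define h' where "h' = min h (R / (2 * S))"
  have R: "R > 0" "R \<le> r" "R \<le> \<delta>2" using loc(1) \<delta>2(1) by (auto simp: R_def)
  have "\<delta>1 / C > 0" using \<delta>0 \<delta>1 by simp
  then have \<delta>: "\<delta> > 0" "\<delta> \<le> R / 2" "\<delta> \<le> \<delta>0" "\<delta> \<le> \<delta>1 / C" unfolding \<delta>_def using R \<delta>0 by linarith+
  have h': "h' > 0" "h' \<le> h" "h' \<le> R / (2 * S)" using h R S by (auto simp: h'_def)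
  have "cone_condition_on (ball p \<delta>) D"
  proof (rule cone_condition_onI[of \<kappa>' h'])
    fix x assume x: "x \<in> ball p \<delta>" "x \<in> D"
    have xr: "x \<in> ball p r" "x \<in> ball p \<delta>2" using x \<delta> R by auto
    then have fx: "f x \<in> \<Omega>" using loc(2) x by blast
    have "norm (f x - f p) \<le> C * norm (x - p)" using x \<delta> \<delta>0 by (intro \<delta>0(3)) auto
    also have "\<dots> < C * (\<delta>1 / C)" using x \<delta> \<delta>0(2) by (intro mult_strict_left_mono) (auto simp: dist_norm norm_minus_commute)
    finally have "f x \<in> ball (f p) \<delta>1" using \<delta>0(2) by (simp add: dist_norm norm_minus_commute)
    then obtain e where e: "norm e \<le> L0" "\<forall>t\<in>{0..h}. cball (f x + t *\<^sub>R e) (t * \<kappa>) \<subseteq> \<Omega>" using cn fx by blast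
    have eL: "norm e \<le> L" using e(1) by (simp add: L_def)
    have Ae: "norm (A e) \<le> a * L" using a(2)[of e] eL a(1) by (meson less_imp_le mult_left_mono order_trans)
    show "\<exists>e. norm e \<le> a * L \<and> (\<forall>t\<in>{0..h'}. cball (x + t *\<^sub>R e) (t * \<kappa>') \<subseteq> D)"
    proof (intro exI[of _ "A e"] conjI ballI subsetI Ae)
      fix t y assume t: "t \<in> {0..h'}" and y: "y \<in> cball (x + t *\<^sub>R A e) (t * \<kappa>')"
      have d: "norm (y - x - t *\<^sub>R A e) \<le> t * \<kappa>'" using y by (simp add: dist_norm norm_minus_commute algebra_simps)
      have yx: "norm (y - x) \<le> t * S"
      proof -
        have "norm (y - x) \<le> norm (y - x - t *\<^sub>R A e) + norm (t *\<^sub>R A e)" by (metis diff_add_cancel norm_triangle_ineq)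
        also have "\<dots> \<le> t * \<kappa>' + t * (a * L)" using d Ae t by (intro add_mono) (auto intro: mult_left_mono)
        finally show ?thesis by (simp add: S_def algebra_simps)
      qed
      also have "t * S \<le> R / (2 * S) * S" using t h' S by (intro mult_right_mono) auto
      also have "\<dots> = R / 2" using S by simp
      finally have "dist x y \<le> R / 2" by (simp add: dist_norm norm_minus_commute)
      then have "dist p y < R" using x \<delta> dist_triangle[of p y x] by simp
      then have yr: "y \<in> ball p r" "y \<in> ball p \<delta>2" using R by auto
      have "f y - f x - t *\<^sub>R e = (f y - f x - F (y - x)) + F (y - x - t *\<^sub>R A e)"
        by (simp add: linear_diff[OF lin] linear_scale[OF lin] A(2))
      then have "norm (f y - f x - t *\<^sub>R e) \<le> norm (f y - f x - F (y - x)) + norm (F (y - x - t *\<^sub>R A e))"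
        by (metis norm_triangle_ineq)
      also have "\<dots> \<le> \<kappa> / (2 * S) * norm (y - x) + b * norm (y - x - t *\<^sub>R A e)"
        using \<delta>2(2) xr(2) yr(2) b(2) by (intro add_mono) auto
      also have "\<dots> \<le> \<kappa> / (2 * S) * (t * S) + b * (t * \<kappa>')"
        using yx d b(1) \<kappa> S by (intro add_mono mult_left_mono) auto
      also have "\<dots> = t * \<kappa>" using S b(1) by (simp add: \<kappa>'_def)
      finally have "f y \<in> cball (f x + t *\<^sub>R e) (t * \<kappa>)" by (simp add: dist_norm norm_minus_commute algebra_simps)
      moreover have "t \<in> {0..h}" using t h' by simp
      ultimately have "f y \<in> \<Omega>" using e(2) by blast
      then show "y \<in> D" using loc(2) yr(1) by blast
    qed
  qed (use \<kappa>' h' in auto)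
  then show ?thesis unfolding cone_at_def using \<delta>(1) by blast
qed

section \<open>Invariance of the cone condition under diffeomorphisms\<close>

lemma smooth_inverse_derivative:
  fixes f g :: "'n::finite rvec \<Rightarrow> 'n rvec"
  assumes W: "open W" and f: "smooth_on W f" and g: "smooth_on W' g"
    and inv: "\<And>x. x \<in> W \<Longrightarrow> f x \<in> W' \<and> g (f x) = x" and p: "p \<in> W"
  shows "frechet_derivative g (at (f p)) (frechet_derivative f (at p) v) = v"
proof -
  have df: "(f has_derivative frechet_derivative f (at p)) (at p)"
    using smooth_onD[OF f p] frechet_derivative_works by blast
  have dg: "(g has_derivative frechet_derivative g (at (f p))) (at (f p))"
    using smooth_onD[OF g] inv[OF p] frechet_derivative_works by blast
  have "((\<lambda>x. g (f x)) has_derivative (\<lambda>v. frechet_derivative g (at (f p)) (frechet_derivative f (at p) v))) (at p)"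
    by (rule has_derivative_compose[OF df dg])
  moreover have "((\<lambda>x. g (f x)) has_derivative (\<lambda>v. v)) (at p)"
    by (rule has_derivative_transform_within_open[of "\<lambda>x. x" _ _ _ W]) (use W p inv in \<open>auto intro!: derivative_eq_intros\<close>)
  ultimately show ?thesis using has_derivative_unique by metis
qed

lemma cone_at_pullback_smooth:
  fixes f g :: "'n::finite rvec \<Rightarrow> 'n rvec"
  assumes W: "open W" "open W'" and f: "smooth_on W f" and g: "smooth_on W' g"
    and inv: "\<And>x. x \<in> W \<Longrightarrow> f x \<in> W' \<and> g (f x) = x" "\<And>y. y \<in> W' \<Longrightarrow> g y \<in> W \<and> f (g y) = y"
    and p: "p \<in> W" and loc: "r > 0" "\<And>y. y \<in> ball p r \<Longrightarrow> y \<in> W \<Longrightarrow> y \<in> D \<longleftrightarrow> f y \<in> \<Omega>" and at: "cone_at \<Omega> (f p)"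
  shows "cone_at D p"
proof -
  have q: "f p \<in> W'" "g (f p) = p" using inv(1)[OF p] by auto
  obtain s where s: "s > 0" "ball p s \<subseteq> W" using W p open_contains_ball by blast
  show ?thesis
  proof (rule cone_at_pullback[OF strict_deriv_smooth[OF W(1) p f] _ _ _ _ at])
    show "linear (frechet_derivative g (at (f p)))"
      using smooth_onD[OF g q(1)] by (rule linear_frechet_derivative)
    show "frechet_derivative f (at p) (frechet_derivative g (at (f p)) v) = v" for v
      using smooth_inverse_derivative[OF W(2) g f inv(2) q(1)] q(2) by simp
    show "min r s > 0" using s loc by simp
    show "y \<in> D \<longleftrightarrow> f y \<in> \<Omega>" if "y \<in> ball p (min r s)" for y
      using that s(2) by (intro loc(2)) auto
  qed
qed

lemma diffeo_openD:
  assumes "diffeo_open W \<eta>"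
  shows "open W" "open (\<eta> ` W)" "smooth_on W \<eta>" "smooth_on (\<eta> ` W) (inv_into W \<eta>)"
    "\<And>x. x \<in> W \<Longrightarrow> \<eta> x \<in> \<eta> ` W \<and> inv_into W \<eta> (\<eta> x) = x"
    "\<And>y. y \<in> \<eta> ` W \<Longrightarrow> inv_into W \<eta> y \<in> W \<and> \<eta> (inv_into W \<eta> y) = y"
    "inj_on \<eta> W"
  using assms by (auto simp: diffeo_open_def inv_into_into f_inv_into_f)

lemma cone_at_diffeo:
  assumes d: "diffeo_open W \<eta>" and p: "p \<in> W" and r: "r > 0"
    and loc: "\<And>y. y \<in> ball p r \<Longrightarrow> y \<in> W \<Longrightarrow> y \<in> D \<longleftrightarrow> \<eta> y \<in> \<Omega>" and at: "cone_at \<Omega> (\<eta> p)"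
  shows "cone_at D p"
  by (rule cone_at_pullback_smooth[OF diffeo_openD(1-4)[OF d] diffeo_openD(5)[OF d] diffeo_openD(6)[OF d] p r loc at])

text \<open>The map is defined near the compact closure, so the closure of the image lies in the
  image of the closure. At each of its points the inverse map pulls cones back, and compactness
  makes them uniform.\<close>

lemma cone_condition_diffeo_image:
  assumes d: "diffeo_open W \<eta>" and sub: "closure \<Omega> \<subseteq> W" and b: "bounded \<Omega>" and c: "cone_condition \<Omega>"
  shows "cone_condition (\<eta> ` \<Omega>)"
proof (rule cone_condition_of_cone_at)
  note D = diffeo_openD[OF d]
  have cont: "continuous_on (closure \<Omega>) \<eta>"
    using D(3) sub by (intro continuous_at_imp_continuous_on ballI)
      (meson differentiable_imp_continuous_within smooth_onD subsetD)
  have comp: "compact (\<eta> ` closure \<Omega>)" using b by (intro compact_continuous_image cont) (simp add: compact_closure)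
  have cl: "closure (\<eta> ` \<Omega>) \<subseteq> \<eta> ` closure \<Omega>"
    using comp closure_subset by (intro closure_minimal compact_imp_closed image_mono)
  then show "bounded (\<eta> ` \<Omega>)"
    using comp closure_subset by (meson bounded_subset compact_imp_bounded image_mono)
  fix p assume "p \<in> closure (\<eta> ` \<Omega>)"
  then have p: "p \<in> \<eta> ` W" using cl sub by blast
  show "cone_at (\<eta> ` \<Omega>) p"
  proof (rule cone_at_pullback_smooth[OF D(2,1,4,3) D(6) D(5) p zero_less_one])
    have OW: "\<Omega> \<subseteq> W" using sub closure_subset by blast
    show "y \<in> \<eta> ` \<Omega> \<longleftrightarrow> inv_into W \<eta> y \<in> \<Omega>" if "y \<in> \<eta> ` W" for y
    proof
      assume "y \<in> \<eta> ` \<Omega>"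
      then obtain x where "x \<in> \<Omega>" "y = \<eta> x" by blast
      then show "inv_into W \<eta> y \<in> \<Omega>" using D(5) OW by auto
    next
      assume "inv_into W \<eta> y \<in> \<Omega>"
      then show "y \<in> \<eta> ` \<Omega>" using D(6)[OF that] by (metis imageI)
    qed
    show "cone_at \<Omega> (inv_into W \<eta> p)" by (rule cone_condition_imp_cone_at[OF c])
  qed
qed

section \<open>Standard pairs and domains of generalized polyhedral type\<close>

text \<open>A fixed closed ball inside \<open>D\<close>, contracted towards \<open>x\<close>, sweeps
  out the cone at \<open>x\<close>; convexity keeps it in \<open>D\<close>.\<close>

lemma cone_condition_convex:
  fixes D :: "'n::finite rvec set"
  assumes D: "open D" "convex D" "bounded D"
  shows "cone_condition D"
proof (cases "D = {}")
  case False
  then obtain c where c: "c \<in> D" by blast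
  obtain R where R: "R > 0" "cball c R \<subseteq> D" using D(1) c open_contains_cball by blast
  obtain B where B: "\<And>x. x \<in> D \<Longrightarrow> norm x \<le> B" using D(3) bounded_iff by blast
  show ?thesis
  proof (rule cone_condition_onI[of R 1])
    fix x assume x: "x \<in> D"
    show "\<exists>e. norm e \<le> 2 * B \<and> (\<forall>t\<in>{0..1}. cball (x + t *\<^sub>R e) (t * R) \<subseteq> D)"
    proof (intro exI[of _ "c - x"] conjI ballI subsetI)
      show "norm (c - x) \<le> 2 * B" using B[OF c] B[OF x] norm_triangle_ineq4[of c x] by linarith
      fix t y assume t: "t \<in> {0..1}" and y: "y \<in> cball (x + t *\<^sub>R (c - x)) (t * R)"
      show "y \<in> D"
      proof (cases "t = 0")
        case False
        then have t0: "t > 0" using t by simp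
        \<comment> \<open>The point of the fixed ball that the contraction towards \<open>x\<close>
          sends to \<open>y\<close>.\<close>
        define b where "b = c + (1 / t) *\<^sub>R (y - (x + t *\<^sub>R (c - x)))"
        have "norm (y - (x + t *\<^sub>R (c - x))) \<le> t * R" using y by (simp add: dist_norm norm_minus_commute)
        then have "b \<in> cball c R" using t0 by (simp add: b_def dist_norm divide_le_eq mult.commute)
        then have "b \<in> D" using R(2) by blast
        have "y = (1 - t) *\<^sub>R x + t *\<^sub>R b" using t0 by (simp add: b_def algebra_simps)
        then show ?thesis using convexD[OF D(2) x \<open>b \<in> D\<close>, of "1 - t" t] t by simp
      qed (use x y in simp)
    qed
  qed (use R in auto)
qed (simp add: cone_condition_on_def, auto intro: exI[of _ 1])

text \<open>Round cones and cylinders over plane sectors are both of the form \<open>u \<bullet> x > c \<bar>P x\<bar>\<close>. Such a set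
  is stable under adding vectors \<open>z\<close> with \<open>u \<bullet> z \<ge> \<bar>c\<bar> \<bar>P z\<bar>\<close>, hence satisfies a cone condition in
  the direction \<open>u\<close>, also when it is not convex.\<close>

lemma cone_stable:
  fixes u :: "'n::finite rvec"
  assumes u: "norm u = 1" and P: "linear P" "\<And>x. norm (P x) \<le> norm x" and c: "\<bar>c\<bar> < 1"
    and x: "u \<bullet> x > c * norm (P x)" and t: "t \<ge> 0" and y: "y \<in> cball (x + t *\<^sub>R u) (t * ((1 - \<bar>c\<bar>) / 2))"
  shows "u \<bullet> y > c * norm (P y)"
proof -
  \<comment> \<open>With this opening
    \<open>\<bar>c\<bar> * (1 + \<kappa>) \<le> 1 - \<kappa>\<close>, so the gain in
    \<open>u \<bullet> z\<close> outweighs what \<open>P z\<close> can cost.\<close>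
  define \<kappa> where "\<kappa> = (1 - \<bar>c\<bar>) / 2"
  define z where "z = y - x"
  have w: "norm (z - t *\<^sub>R u) \<le> t * \<kappa>"
    using y by (simp add: z_def \<kappa>_def dist_norm norm_minus_commute algebra_simps)
  have "\<bar>u \<bullet> (z - t *\<^sub>R u)\<bar> \<le> t * \<kappa>" using Cauchy_Schwarz_ineq2[of u "z - t *\<^sub>R u"] w u by simp
  moreover have "u \<bullet> (z - t *\<^sub>R u) = u \<bullet> z - t" using u by (simp add: inner_diff_right norm_eq_1)
  ultimately have uz: "u \<bullet> z \<ge> t - t * \<kappa>" by linarith
  have "norm (P z) \<le> norm (P (z - t *\<^sub>R u)) + norm (P (t *\<^sub>R u))"
    using norm_triangle_ineq[of "P (z - t *\<^sub>R u)" "P (t *\<^sub>R u)"] by (simp add: linear_add[OF P(1), symmetric])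
  also have "\<dots> \<le> t * \<kappa> + t" using P(2)[of "z - t *\<^sub>R u"] w P(2)[of "t *\<^sub>R u"] u t by simp
  finally have Pz: "norm (P z) \<le> t + t * \<kappa>" by simp
  have Py: "P y = P x + P z" by (simp add: z_def linear_diff[OF P(1)])
  have "c * norm (P y) \<le> c * norm (P x) + \<bar>c\<bar> * norm (P z)"
  proof (cases "c \<ge> 0")
    case True
    then show ?thesis using mult_left_mono[OF norm_triangle_ineq[of "P x" "P z"] True] by (simp add: Py distrib_left)
  next
    case False
    have "norm (P x) \<le> norm (P y) + norm (P z)" using norm_triangle_ineq4[of "P y" "P z"] by (simp add: Py)
    then have "(- c) * norm (P x) \<le> (- c) * (norm (P y) + norm (P z))" using False by (intro mult_left_mono) auto
    then show ?thesis using False by (simp add: distrib_left abs_if)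
  qed
  also have "\<bar>c\<bar> * norm (P z) \<le> \<bar>c\<bar> * (t + t * \<kappa>)" using Pz by (rule mult_left_mono) simp
  also have "\<bar>c\<bar> * (t + t * \<kappa>) \<le> t - t * \<kappa>"
  proof -
    have "\<kappa> * (1 + \<bar>c\<bar>) \<le> \<kappa> * 2" using c by (intro mult_left_mono) (auto simp: \<kappa>_def)
    moreover have "\<kappa> * 2 = 1 - \<bar>c\<bar>" by (simp add: \<kappa>_def)
    moreover have "\<bar>c\<bar> * (1 + \<kappa>) = \<bar>c\<bar> + (\<kappa> * (1 + \<bar>c\<bar>) - \<kappa>)" by (simp add: algebra_simps)
    ultimately have "\<bar>c\<bar> * (1 + \<kappa>) \<le> 1 - \<kappa>" by linarith
    then have "t * (\<bar>c\<bar> * (1 + \<kappa>)) \<le> t * (1 - \<kappa>)" using t by (rule mult_left_mono)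
    then show ?thesis by (simp add: algebra_simps)
  qed
  finally have "c * norm (P y) \<le> c * norm (P x) + (u \<bullet> z)" using uz by linarith
  also have "\<dots> < u \<bullet> x + u \<bullet> z" using x by simp
  also have "\<dots> = u \<bullet> y" by (simp add: z_def inner_diff_right)
  finally show ?thesis .
qed

lemma cone_condition_linear_cone:
  fixes u :: "'n::finite rvec"
  assumes u: "norm u = 1" and P: "linear P" "\<And>x. norm (P x) \<le> norm x" and c: "\<bar>c\<bar> < 1"
  shows "cone_condition {x. u \<bullet> x > c * norm (P x)}"
proof (rule cone_condition_onI[of "(1 - \<bar>c\<bar>) / 2" 1])
  fix x assume "x \<in> {x. u \<bullet> x > c * norm (P x)}"
  then show "\<exists>e. norm e \<le> 1 \<and> (\<forall>t\<in>{0..1}. cball (x + t *\<^sub>R e) (t * ((1 - \<bar>c\<bar>) / 2)) \<subseteq> {x. u \<bullet> x > c * norm (P x)})"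
    using u cone_stable[OF u P c] by (intro exI[of _ u]) auto
qed (use c in auto)

section \<open>Round cones, truncated by a ball or by the cube\<close>

definition crd_index :: "nat \<Rightarrow> 'n::{finite,linorder}" where
  "crd_index k = sorted_list_of_set (UNIV :: 'n set) ! (k - 1)"

lemma crd_eq: "crd x k = axis (crd_index k) 1 \<bullet> x"
  by (simp add: crd_def crd_index_def inner_axis')

lemma crd_index_inj:
  assumes "1 \<le> j" "j \<le> CARD('n::{finite,linorder})" "1 \<le> k" "k \<le> CARD('n)" "j \<noteq> k"
  shows "crd_index j \<noteq> (crd_index k :: 'n)"
proof -
  have "distinct (sorted_list_of_set (UNIV :: 'n set))" "length (sorted_list_of_set (UNIV :: 'n set)) = CARD('n)" by auto
  moreover have "j - 1 \<noteq> k - 1" using assms by simp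
  ultimately show ?thesis unfolding crd_index_def using assms by (subst nth_eq_iff_index_eq) auto
qed

lemma crd_add: "crd (x + y) k = crd x k + crd y k"
  and crd_scaleR: "crd (s *\<^sub>R x) k = s * crd x k"
  and crd_diff: "crd (x - y) k = crd x k - crd y k"
  and abs_crd_le: "\<bar>crd x k\<bar> \<le> norm x"
  by (auto simp: crd_def component_le_norm_cart)

lemma round_cone_eq:
  "(round_cone \<gamma> :: 'n::{finite,linorder} rvec set) = {x. axis (crd_index CARD('n)) 1 \<bullet> x > cos \<gamma> * norm x}"
proof -
  have "x \<in> round_cone \<gamma> \<longleftrightarrow> cos \<gamma> * norm x < crd x CARD('n)" for x :: "'n rvec"
  proof (cases "x = 0")
    case False
    then show ?thesis by (simp add: round_cone_def infinite_cone_def crd_scaleR field_simps)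
  qed (simp add: round_cone_def infinite_cone_def crd_def)
  then show ?thesis by (auto simp: crd_eq)
qed

lemma cos_bound: "0 < \<gamma> \<Longrightarrow> \<gamma> < pi \<Longrightarrow> \<bar>cos \<gamma>\<bar> < 1"
  using cos_monotone_0_pi[of 0 \<gamma>] cos_monotone_0_pi[of \<gamma> pi] by auto

text \<open>Adding a multiple of \<open>- x\<close> to the direction of a conical set keeps the cones inside the
  truncating ball or half space.\<close>

lemma cone_condition_smooth_cone:
  fixes \<gamma> :: real
  assumes \<gamma>: "0 < \<gamma>" "\<gamma> < pi"
  shows "cone_condition (round_cone \<gamma> \<inter> ball 0 1 :: 'n::{finite,linorder} rvec set)"
proof -
  define u :: "'n rvec" where "u = axis (crd_index CARD('n)) 1"
  define c where "c = cos \<gamma>"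
  define \<kappa> where "\<kappa> = (1 - \<bar>c\<bar>) / 2"
  have u: "norm u = 1" by (simp add: u_def)
  have c: "\<bar>c\<bar> < 1" unfolding c_def by (rule cos_bound[OF \<gamma>])
  have \<kappa>: "\<kappa> > 0" "\<kappa> \<le> 1 / 2" using c by (auto simp: \<kappa>_def)
  have K: "(round_cone \<gamma> :: 'n rvec set) = {x. u \<bullet> x > c * norm x}" unfolding round_cone_eq u_def c_def ..
  show ?thesis
  proof (rule cone_condition_onI[of "\<kappa> / 2" "1 / 2"])
    fix x :: "'n rvec" assume x: "x \<in> round_cone \<gamma> \<inter> ball 0 1"
    then have xK: "u \<bullet> x > c * norm x" and nx: "norm x < 1" by (auto simp: K)
    show "\<exists>e. norm e \<le> 2 \<and> (\<forall>t\<in>{0..1 / 2}. cball (x + t *\<^sub>R e) (t * (\<kappa> / 2)) \<subseteq> round_cone \<gamma> \<inter> ball 0 1)"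
    \<comment> \<open>At parameter \<open>t\<close> the centre is
      \<open>(1 - t) *\<^sub>R x + (t / 2) *\<^sub>R u\<close>: the point is contracted within the
      cone and then moved along its axis. The factor 1/2 leaves room for the opening inside the unit
      ball.\<close>
    proof (intro exI[of _ "(1 / 2) *\<^sub>R u - x"] conjI ballI subsetI IntI)
      show "norm ((1 / 2) *\<^sub>R u - x) \<le> 2" using norm_triangle_ineq4[of "(1 / 2) *\<^sub>R u" x] u nx by simp
      fix t y assume t: "t \<in> {0..1 / 2}" and y: "y \<in> cball (x + t *\<^sub>R ((1 / 2) *\<^sub>R u - x)) (t * (\<kappa> / 2))"
      have eq: "x + t *\<^sub>R ((1 / 2) *\<^sub>R u - x) = (1 - t) *\<^sub>R x + (t / 2) *\<^sub>R u" by (simp add: algebra_simps)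
      have "u \<bullet> ((1 - t) *\<^sub>R x) > c * norm ((1 - t) *\<^sub>R x)"
        using mult_strict_left_mono[OF xK, of "1 - t"] t by (simp add: mult.left_commute)
      moreover have "y \<in> cball ((1 - t) *\<^sub>R x + (t / 2) *\<^sub>R u) ((t / 2) * \<kappa>)" using y unfolding eq by simp
      ultimately show "y \<in> round_cone \<gamma>"
        unfolding K using cone_stable[OF u linear_ident _ c, of "(1 - t) *\<^sub>R x" "t / 2" y] t by (simp add: \<kappa>_def)
      have "norm y \<le> norm (y - ((1 - t) *\<^sub>R x + (t / 2) *\<^sub>R u)) + norm ((1 - t) *\<^sub>R x + (t / 2) *\<^sub>R u)"
        by (metis diff_add_cancel norm_triangle_ineq)
      also have "\<dots> \<le> t * (\<kappa> / 2) + ((1 - t) * norm x + t / 2)"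
      proof (rule add_mono)
        show "norm (y - ((1 - t) *\<^sub>R x + (t / 2) *\<^sub>R u)) \<le> t * (\<kappa> / 2)"
          using y unfolding eq by (simp add: dist_norm norm_minus_commute)
        show "norm ((1 - t) *\<^sub>R x + (t / 2) *\<^sub>R u) \<le> (1 - t) * norm x + t / 2"
          using norm_triangle_ineq[of "(1 - t) *\<^sub>R x" "(t / 2) *\<^sub>R u"] t u by simp
      qed
      also have "\<dots> < 1"
      proof -
        have "(1 - t) * norm x < (1 - t) * 1" using t nx by (intro mult_strict_left_mono) auto
        moreover have "t * (\<kappa> / 2) \<le> t * (1 / 2)" using t \<kappa> by (intro mult_left_mono) auto
        ultimately show ?thesis by simp
      qed
      finally show "y \<in> ball 0 1" by simp
    qed
  qed (use \<kappa> in auto)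
qed

lemma unit_cube_eq_box: "unit_cube = box (0 :: 'n::finite rvec) 1"
  by (auto simp: unit_cube_def mem_box_cart)

lemma convex_round_cone:
  assumes "cos \<gamma> \<ge> 0"
  shows "convex (round_cone \<gamma> :: 'n::{finite,linorder} rvec set)"
  unfolding round_cone_eq convex_def
proof clarsimp
  fix x y :: "'n rvec" and s t :: real
  let ?u = "axis (crd_index CARD('n)) 1 :: 'n rvec"
  assume x: "cos \<gamma> * norm x < ?u \<bullet> x" and y: "cos \<gamma> * norm y < ?u \<bullet> y" and st: "0 \<le> s" "0 \<le> t" "s + t = 1"
  have "cos \<gamma> * norm (s *\<^sub>R x + t *\<^sub>R y) \<le> cos \<gamma> * (s * norm x + t * norm y)"
    using norm_triangle_ineq[of "s *\<^sub>R x" "t *\<^sub>R y"] st assms by (intro mult_left_mono) auto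
  also have "\<dots> = s * (cos \<gamma> * norm x) + t * (cos \<gamma> * norm y)" by (simp add: algebra_simps)
  also have "\<dots> < s * (?u \<bullet> x) + t * (?u \<bullet> y)"
  proof (cases "s = 0")
    case True
    then show ?thesis using y st by simp
  next
    case False
    then have "s * (cos \<gamma> * norm x) < s * (?u \<bullet> x)" using x st by (intro mult_strict_left_mono) auto
    moreover have "t * (cos \<gamma> * norm y) \<le> t * (?u \<bullet> y)" using y st by (intro mult_left_mono) auto
    ultimately show ?thesis by linarith
  qed
  finally show "cos \<gamma> * norm (s *\<^sub>R x + t *\<^sub>R y) < ?u \<bullet> (s *\<^sub>R x + t *\<^sub>R y)"
    by (simp add: inner_add_right)
qed

lemma open_round_cone: "open (round_cone \<gamma> :: 'n::{finite,linorder} rvec set)"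
  unfolding round_cone_eq by (intro open_Collect_less continuous_intros)

text \<open>The truncated set is convex for every aperture: if \<open>cos \<gamma> \<ge> 0\<close>
  the round cone is convex, and otherwise it contains the whole cube, whose points have positive
  last coordinate.\<close>

lemma cone_condition_nonsmooth_cone:
  "cone_condition (round_cone \<gamma> \<inter> unit_cube :: 'n::{finite,linorder} rvec set)"
proof -
  have "convex (round_cone \<gamma> \<inter> unit_cube :: 'n rvec set)"
  proof (cases "cos \<gamma> \<ge> 0")
    case True
    then show ?thesis by (intro convex_Int convex_round_cone) (auto simp: unit_cube_eq_box)
  next
    case False
    have "(unit_cube :: 'n rvec set) \<subseteq> round_cone \<gamma>"
    proof
      fix x :: "'n rvec" assume "x \<in> unit_cube"
      then have "crd x CARD('n) > 0" by (simp add: unit_cube_def crd_def)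
      moreover have "cos \<gamma> * norm x \<le> 0" using False by (simp add: mult_nonpos_nonneg)
      ultimately show "x \<in> round_cone \<gamma>" unfolding round_cone_eq crd_eq[symmetric] by simp
    qed
    then have "round_cone \<gamma> \<inter> unit_cube = (unit_cube :: 'n rvec set)" by blast
    then show ?thesis by (simp add: unit_cube_eq_box)
  qed
  moreover have "open (round_cone \<gamma> \<inter> unit_cube :: 'n rvec set)"
    by (intro open_Int open_round_cone) (simp add: unit_cube_eq_box open_box)
  moreover have "bounded (round_cone \<gamma> \<inter> unit_cube :: 'n rvec set)"
    by (rule bounded_subset[of "box 0 1"]) (auto simp: unit_cube_eq_box)
  ultimately show ?thesis by (intro cone_condition_convex)
qed

lemma cone_condition_unit_cube: "cone_condition (unit_cube :: 'n::finite rvec set)"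
  by (rule cone_condition_convex) (auto simp: unit_cube_eq_box open_box)

subsection \<open>Polyhedral cones\<close>

text \<open>The sector consists of the vectors at an angle less than \<open>\<theta> / 2\<close>
  from its bisector. As \<open>\<theta> / 2 < pi\<close>, cosine is strictly decreasing on the
  relevant range, and one inequality describes convex and reflex sectors alike.\<close>

lemma sector_iff:
  assumes \<theta>: "0 < \<theta>" "\<theta> < 2 * pi"
  shows "(\<exists>r>0. \<exists>\<phi>. 0 < \<phi> \<and> \<phi> < \<theta> \<and> a = r * cos \<phi> \<and> b = r * sin \<phi>)
     \<longleftrightarrow> a * cos (\<theta> / 2) + b * sin (\<theta> / 2) > cos (\<theta> / 2) * sqrt (a\<^sup>2 + b\<^sup>2)"
proof -
  define \<beta> where "\<beta> = \<theta> / 2"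
  have \<beta>: "0 < \<beta>" "\<beta> < pi" using \<theta> by (auto simp: \<beta>_def)
  have polar: "a * cos \<beta> + b * sin \<beta> > cos \<beta> * sqrt (a\<^sup>2 + b\<^sup>2) \<longleftrightarrow> cos (\<phi> - \<beta>) > cos \<beta>"
    if r: "r > 0" and ab: "a = r * cos \<phi>" "b = r * sin \<phi>" for r \<phi> :: real
  proof -
    have "a\<^sup>2 + b\<^sup>2 = r\<^sup>2 * ((cos \<phi>)\<^sup>2 + (sin \<phi>)\<^sup>2)" by (simp only: ab power_mult_distrib distrib_left)
    then have "sqrt (a\<^sup>2 + b\<^sup>2) = r" using r by simp
    moreover have "a * cos \<beta> + b * sin \<beta> = r * cos (\<phi> - \<beta>)" by (simp add: ab cos_diff algebra_simps)
    ultimately show ?thesis using r by (simp add: mult.commute)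
  qed
  show ?thesis unfolding \<beta>_def[symmetric]
  proof
    assume "\<exists>r>0. \<exists>\<phi>. 0 < \<phi> \<and> \<phi> < \<theta> \<and> a = r * cos \<phi> \<and> b = r * sin \<phi>"
    then obtain r \<phi> where r: "r > 0" and \<phi>: "0 < \<phi>" "\<phi> < \<theta>" and ab: "a = r * cos \<phi>" "b = r * sin \<phi>" by blast
    have "\<bar>\<phi> - \<beta>\<bar> < \<beta>" using \<phi> by (auto simp: \<beta>_def abs_if)
    then have "cos \<beta> < cos \<bar>\<phi> - \<beta>\<bar>" using \<beta> by (intro cos_monotone_0_pi) auto
    then show "a * cos \<beta> + b * sin \<beta> > cos \<beta> * sqrt (a\<^sup>2 + b\<^sup>2)" using polar[OF r ab] by simp
  next
    assume l: "a * cos \<beta> + b * sin \<beta> > cos \<beta> * sqrt (a\<^sup>2 + b\<^sup>2)"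
    define r where "r = sqrt (a\<^sup>2 + b\<^sup>2)"
    have r: "r > 0"
    proof (rule ccontr)
      assume "\<not> r > 0"
      then have "a\<^sup>2 + b\<^sup>2 = 0" unfolding r_def by (metis real_sqrt_gt_zero sum_power2_gt_zero_iff sum_power2_eq_zero_iff)
      then have "a = 0" "b = 0" by (auto simp: sum_power2_eq_zero_iff)
      then show False using l by simp
    qed
    have "(a / r)\<^sup>2 + (b / r)\<^sup>2 = 1"
    proof -
      have "r\<^sup>2 = a\<^sup>2 + b\<^sup>2" by (simp add: r_def)
      then have "a\<^sup>2 / r\<^sup>2 + b\<^sup>2 / r\<^sup>2 = r\<^sup>2 / r\<^sup>2" by (simp add: add_divide_distrib[symmetric])
      then show ?thesis using r by (simp add: power_divide)
    qed
    then obtain \<phi> where \<phi>: "0 \<le> \<phi>" "\<phi> < 2 * pi" "a / r = cos \<phi>" "b / r = sin \<phi>"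
      using sincos_total_2pi by metis
    have ab: "a = r * cos \<phi>" "b = r * sin \<phi>" using \<phi>(3,4) r by (auto simp: field_simps)
    have cc: "cos (\<phi> - \<beta>) > cos \<beta>" using polar[OF r ab] l by simp
    have "0 < \<phi>" using cc \<phi>(1) by (cases "\<phi> = 0") auto
    moreover have "\<phi> < \<theta>"
    proof (rule ccontr)
      assume "\<not> \<phi> < \<theta>"
      then have g: "\<phi> - \<beta> \<ge> \<beta>" by (simp add: \<beta>_def)
      show False
      proof (cases "\<phi> - \<beta> \<le> pi")
        case True
        then show False using cos_monotone_0_pi_le[of \<beta> "\<phi> - \<beta>"] g \<beta> cc by simp
      next
        case False
        \<comment> \<open>Reflection returns the angle to the range where cosine decreases;
          \<open>\<phi> < 2 * pi\<close> makes the reflected angle larger than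
          \<open>\<beta>\<close>.\<close>
        have "cos (\<phi> - \<beta>) = cos (2 * pi - (\<phi> - \<beta>))" by (simp add: cos_diff)
        also have "\<dots> \<le> cos \<beta>" using False \<phi>(2) \<beta> by (intro cos_monotone_0_pi_le) auto
        finally show False using cc by simp
      qed
    qed
    ultimately show "\<exists>r>0. \<exists>\<phi>. 0 < \<phi> \<and> \<phi> < \<theta> \<and> a = r * cos \<phi> \<and> b = r * sin \<phi>" using r ab by blast
  qed
qed

text \<open>In dimension three the third coordinate is free, so this is a cylinder over a sector:
  the straightened form of a polyhedral cone near a boundary point other than its vertex.\<close>

definition plane_sector :: "real \<Rightarrow> 'n::{finite,linorder} rvec set" where
  "plane_sector \<theta> = {y. \<exists>r>0. \<exists>\<phi>. 0 < \<phi> \<and> \<phi> < \<theta> \<and> crd y 1 = r * cos \<phi> \<and> crd y 2 = r * sin \<phi>}"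

lemma cone_condition_plane_sector:
  assumes d: "CARD('n) = 3" and \<theta>: "0 < \<theta>" "\<theta> < 2 * pi"
  shows "cone_condition (plane_sector \<theta> :: 'n::{finite,linorder} rvec set)"
proof -
  define e1 e2 :: "'n rvec" where "e1 = axis (crd_index 1) 1" and "e2 = axis (crd_index 2) 1"
  have ne: "crd_index 1 \<noteq> (crd_index 2 :: 'n)" using d by (intro crd_index_inj) auto
  have e: "norm e1 = 1" "norm e2 = 1" "e1 \<bullet> e2 = 0" "e2 \<bullet> e1 = 0" "e1 \<bullet> e1 = 1" "e2 \<bullet> e2 = 1"
    using ne by (auto simp: e1_def e2_def inner_axis_axis)
  \<comment> \<open>The orthogonal projection onto the plane of the sector. With \<open>u\<close>
    the unit vector along the bisector, the cylinder takes the form of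
    \<open>cone_condition_linear_cone\<close>.\<close>
  define P where "P y = (e1 \<bullet> y) *\<^sub>R e1 + (e2 \<bullet> y) *\<^sub>R e2" for y
  define \<beta> where "\<beta> = \<theta> / 2"
  define u where "u = cos \<beta> *\<^sub>R e1 + sin \<beta> *\<^sub>R e2"
  have P2: "P y \<bullet> P y = (e1 \<bullet> y)\<^sup>2 + (e2 \<bullet> y)\<^sup>2" for y
    by (simp add: P_def inner_add_left inner_add_right e power2_eq_square)
  have nP: "norm (P y) = sqrt ((e1 \<bullet> y)\<^sup>2 + (e2 \<bullet> y)\<^sup>2)" for y by (simp add: norm_eq_sqrt_inner P2)
  have lin: "linear P"
    by (rule linearI) (auto simp: P_def inner_add_right algebra_simps)
  have le: "norm (P y) \<le> norm y" for y
  proof -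
    have "P y \<bullet> y = P y \<bullet> P y" unfolding P2 by (simp add: P_def inner_add_left power2_eq_square)
    then have "(norm (P y))\<^sup>2 \<le> norm (P y) * norm y"
      using norm_cauchy_schwarz[of "P y" y] by (simp add: power2_norm_eq_inner)
    then show ?thesis by (cases "P y = 0") (auto simp: power2_eq_square)
  qed
  have nu: "norm u = 1"
    by (simp add: u_def norm_eq_1 inner_add_left inner_add_right e power2_eq_square[symmetric])
  have c: "\<bar>cos \<beta>\<bar> < 1" using \<theta> by (intro cos_bound) (auto simp: \<beta>_def)
  have "y \<in> plane_sector \<theta> \<longleftrightarrow> y \<in> {y. u \<bullet> y > cos \<beta> * norm (P y)}" for y :: "'n rvec"
  proof -
    have "crd y 1 = e1 \<bullet> y" "crd y 2 = e2 \<bullet> y" by (auto simp: crd_eq e1_def e2_def)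
    moreover have "u \<bullet> y = (e1 \<bullet> y) * cos \<beta> + (e2 \<bullet> y) * sin \<beta>" by (simp add: u_def inner_add_left mult.commute)
    ultimately show ?thesis
      unfolding plane_sector_def mem_Collect_eq sector_iff[OF \<theta>] nP by (simp add: \<beta>_def)
  qed
  then have "plane_sector \<theta> = {y. u \<bullet> y > cos \<beta> * norm (P y)}" by blast
  then show ?thesis using cone_condition_linear_cone[OF nu lin le c] by simp
qed

text \<open>Serves the injectivity of a differential later: a chart of the sphere composed with
  \<open>sgn\<close> stays in the plane \<open>crd y 3 = 0\<close>, so its differential has no third
  component.\<close>

lemma strict_deriv_zero_functional:
  assumes f: "strict_deriv f F p" and r: "r > 0" "\<And>x. x \<in> ball p r \<Longrightarrow> crd (f x) k = 0"
  shows "crd (F v) k = 0"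
proof (rule ccontr)
  assume ne: "crd (F v) k \<noteq> 0"
  have lin: "linear F" using f by (simp add: strict_deriv_def)
  have v: "v \<noteq> 0" using ne linear_0[OF lin] by (auto simp: crd_def)
  define \<epsilon> where "\<epsilon> = \<bar>crd (F v) k\<bar> / (2 * norm v)"
  have \<epsilon>: "\<epsilon> > 0" using ne v by (simp add: \<epsilon>_def)
  obtain \<delta> where \<delta>: "\<delta> > 0" "\<forall>x\<in>ball p \<delta>. \<forall>y\<in>ball p \<delta>. norm (f y - f x - F (y - x)) \<le> \<epsilon> * norm (y - x)"
    using f \<epsilon> unfolding strict_deriv_def by blast
  define s where "s = min r \<delta> / (2 * norm v)"
  have s: "s > 0" using r \<delta> v by (simp add: s_def)
  have "norm (s *\<^sub>R v) = s * norm v" using s by simp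
  also have "\<dots> = min r \<delta> / 2" using v by (simp add: s_def)
  finally have "norm (s *\<^sub>R v) = min r \<delta> / 2" .
  then have y: "p + s *\<^sub>R v \<in> ball p r" "p + s *\<^sub>R v \<in> ball p \<delta>" using r \<delta> by (auto simp: dist_norm)
  have "norm (f (p + s *\<^sub>R v) - f p - F (s *\<^sub>R v)) \<le> \<epsilon> * norm (s *\<^sub>R v)"
    using bspec[OF bspec[OF \<delta>(2), of p] y(2)] \<delta>(1) by simp
  then have "\<bar>crd (f (p + s *\<^sub>R v) - f p - F (s *\<^sub>R v)) k\<bar> \<le> \<epsilon> * norm (s *\<^sub>R v)"
    using abs_crd_le order_trans by blast
  moreover have "crd (f (p + s *\<^sub>R v) - f p - F (s *\<^sub>R v)) k = - (s * crd (F v) k)"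
    using r(2)[OF y(1)] r(2)[of p] r(1) by (simp add: crd_diff linear_scale[OF lin] crd_scaleR)
  ultimately have "s * \<bar>crd (F v) k\<bar> \<le> \<epsilon> * (s * norm v)" using s by (simp add: abs_mult)
  also have "\<dots> = s * (\<bar>crd (F v) k\<bar> / 2)" using v by (simp add: \<epsilon>_def)
  finally show False using s ne by simp
qed

text \<open>The differential at \<open>p\<close> is the orthogonal projection onto the tangent plane
  of the unit sphere. The derivative is computed on the whole punctured space, since continuity at
  \<open>p\<close> is what yields strictness.\<close>

lemma strict_deriv_sgn:
  fixes p :: "'n::finite rvec"
  assumes p: "norm p = 1"
  shows "strict_deriv sgn (\<lambda>v. v - (p \<bullet> v) *\<^sub>R p) p"
proof -
  let ?f' = "\<lambda>x v. inverse (norm x) *\<^sub>R v - (inverse (norm x) ^ 3 * (x \<bullet> v)) *\<^sub>R x"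
  have "strict_deriv sgn (?f' p) p"
  proof (rule strict_deriv_C1[of "- {0}"])
    show "open (- {0 :: 'n rvec})" "p \<in> - {0}" using p by auto
    fix x :: "'n rvec" assume "x \<in> - {0}"
    then have x: "x \<noteq> 0" by simp
    have "((\<lambda>x. inverse (norm x) *\<^sub>R x) has_derivative ?f' x) (at x)"
    proof -
      have dn: "(norm has_derivative (\<lambda>h. h \<bullet> sgn x)) (at x)"
        using has_derivative_norm[OF x] by simp
      have "norm x \<noteq> 0" using x by simp
      from has_derivative_scaleR[OF Deriv.has_derivative_inverse[OF this dn] has_derivative_ident]
      show ?thesis
        by (simp add: sgn_div_norm inner_commute power3_eq_cube mult_ac)
    qed
    then show "(sgn has_derivative ?f' x) (at x)" by (simp add: sgn_div_norm[abs_def])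
  next
    show "isCont (\<lambda>x. ?f' x (axis i 1)) p" for i
      using p by (intro continuous_intros) auto
  qed
  then show ?thesis using p by simp
qed

lemma strict_deriv_norm_scaleR:
  fixes p e :: "'n::finite rvec"
  assumes p: "norm p = 1"
  shows "strict_deriv (\<lambda>x. (norm x - 1) *\<^sub>R e) (\<lambda>v. (p \<bullet> v) *\<^sub>R e) p"
proof -
  let ?f' = "\<lambda>x v. ((sgn x) \<bullet> v) *\<^sub>R e"
  have "strict_deriv (\<lambda>x. (norm x - 1) *\<^sub>R e) (?f' p) p"
  proof (rule strict_deriv_C1[of "- {0}"])
    show "open (- {0 :: 'n rvec})" "p \<in> - {0}" using p by auto
    show "((\<lambda>x. (norm x - 1) *\<^sub>R e) has_derivative ?f' x) (at x)" if "x \<in> - {0}" for x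
    proof -
      have "(norm has_derivative (\<lambda>h. h \<bullet> sgn x)) (at x)"
        using has_derivative_norm[of x] that by simp
      from has_derivative_scaleR_left[OF has_derivative_diff[OF this has_derivative_const], of 1 e]
      show ?thesis by (simp add: inner_commute)
    qed
    show "isCont (\<lambda>x. ?f' x (axis i 1)) p" for i
      using p by (intro continuous_intros) auto
  qed
  moreover have "sgn p = p" using p by (simp add: sgn_div_norm)
  ultimately show ?thesis by simp
qed

text \<open>The map \<open>x \<mapsto> \<eta> (x / \<bar>x\<bar>) + (\<bar>x\<bar> - 1) e\<^sub>3\<close> extends the chart \<open>\<eta>\<close> of the sphere radially and
  straightens the cone to a cylinder over a plane sector.\<close>

lemma cone_at_spherical_angle:
  fixes K :: "'n::{finite,linorder} rvec set"
  assumes d: "CARD('n) = 3" and \<xi>: "norm \<xi> = 1" and \<theta>: "0 < \<theta>" "\<theta> < 2 * pi"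
    and ang: "spherical_angle_at (K \<inter> sphere 0 1) \<xi> \<theta>"
    and hom: "\<And>x. x \<noteq> 0 \<Longrightarrow> x \<in> K \<longleftrightarrow> sgn x \<in> K"
  shows "cone_at K \<xi>"
proof -
  obtain W \<eta> where W: "\<xi> \<in> W" "diffeo_open W \<eta>" "\<eta> \<xi> = 0"
    and sph: "\<eta> ` (W \<inter> sphere 0 1) = \<eta> ` W \<inter> {y. crd y 3 = 0}"
    and sec: "\<eta> ` (W \<inter> (K \<inter> sphere 0 1)) = \<eta> ` W \<inter> {y. crd y 3 = 0 \<and>
              (\<exists>r>0. \<exists>\<phi>. 0 < \<phi> \<and> \<phi> < \<theta> \<and> crd y 1 = r * cos \<phi> \<and> crd y 2 = r * sin \<phi>)}"
    using ang unfolding spherical_angle_at_def by (elim exE conjE) (rule that; assumption)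
  note D = diffeo_openD[OF W(2)]
  define e3 :: "'n rvec" where "e3 = axis (crd_index 3) 1"
  have e3: "crd e3 3 = 1" "crd e3 1 = 0" "crd e3 2 = 0"
    using crd_index_inj[where 'n = 'n, of 3 1] crd_index_inj[where 'n = 'n, of 3 2] d
    by (auto simp: crd_eq e3_def inner_axis_axis)
  define G where "G = frechet_derivative \<eta> (at \<xi>)"
  have sgn\<xi>: "sgn \<xi> = \<xi>" using \<xi> by (simp add: sgn_div_norm)
  have sG: "strict_deriv \<eta> G \<xi>" unfolding G_def by (rule strict_deriv_smooth[OF D(1) W(1) D(3)])
  have comp: "strict_deriv (\<lambda>x. \<eta> (sgn x)) (\<lambda>v. G (v - (\<xi> \<bullet> v) *\<^sub>R \<xi>)) \<xi>"
    using strict_deriv_compose[OF strict_deriv_sgn[OF \<xi>]] sG unfolding sgn\<xi> by blast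
  define \<Phi> where "\<Phi> x = \<eta> (sgn x) + (norm x - 1) *\<^sub>R e3" for x
  \<comment> \<open>The differential of \<open>\<Phi>\<close> at \<open>\<xi>\<close>: the
    tangential part passes through the chart, the radial part goes into the third axis.\<close>
  define B where "B v = G (v - (\<xi> \<bullet> v) *\<^sub>R \<xi>) + (\<xi> \<bullet> v) *\<^sub>R e3" for v
  have sB: "strict_deriv \<Phi> B \<xi>"
    unfolding \<Phi>_def[abs_def] B_def[abs_def] by (rule strict_deriv_add[OF comp strict_deriv_norm_scaleR[OF \<xi>]])
  obtain r where r: "r > 0" "\<And>x. x \<in> ball \<xi> r \<Longrightarrow> x \<noteq> 0 \<and> sgn x \<in> W"
  proof -
    have "isCont sgn \<xi>" using \<xi> by (intro continuous_intros) auto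
    then have "((\<lambda>x. sgn x) \<longlongrightarrow> \<xi>) (at \<xi>)" unfolding isCont_def sgn\<xi> .
    then have "\<forall>\<^sub>F x in at \<xi>. sgn x \<in> W" using D(1) W(1) by (rule topological_tendstoD)
    then obtain r1 where r1: "r1 > 0" "\<And>x. x \<noteq> \<xi> \<Longrightarrow> dist x \<xi> < r1 \<Longrightarrow> sgn x \<in> W"
      unfolding eventually_at by blast
    show ?thesis
    proof (rule that[of "min r1 1"])
      fix x assume x: "x \<in> ball \<xi> (min r1 1)"
      then have "x \<noteq> 0" using \<xi> by auto
      moreover have "sgn x \<in> W" using r1(2)[of x] x W(1) sgn\<xi> by (cases "x = \<xi>") (auto simp: dist_commute)
      ultimately show "x \<noteq> 0 \<and> sgn x \<in> W" by blast
    qed (use r1 in auto)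
  qed
  have z3: "crd (\<eta> (sgn x)) 3 = 0" if x: "x \<in> ball \<xi> r" for x
  proof -
    have "sgn x \<in> W \<inter> sphere 0 1" using r(2)[OF x] by (auto simp: norm_sgn)
    then have "\<eta> (sgn x) \<in> \<eta> ` W \<inter> {y. crd y 3 = 0}" unfolding sph[symmetric] by blast
    then show ?thesis by simp
  qed
  have linG: "linear G" using sG by (simp add: strict_deriv_def)
  \<comment> \<open>The tangential part has no third component, so the third component of
    \<open>B v\<close> is \<open>\<xi> \<bullet> v\<close>. If that vanishes, \<open>B v\<close> is
    \<open>G v\<close>, and the inverse chart recovers \<open>v\<close>.\<close>
  have injB: "inj B"
  proof -
    have linB: "linear B" using sB by (simp add: strict_deriv_def)
    have "v = 0" if "B v = 0" for v
    proof -
      have "crd (G (v - (\<xi> \<bullet> v) *\<^sub>R \<xi>)) 3 = 0"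
        by (rule strict_deriv_zero_functional[OF comp r(1)]) (use z3 in auto)
      then have "crd (B v) 3 = \<xi> \<bullet> v" by (simp add: B_def crd_add crd_scaleR e3)
      then have x0: "\<xi> \<bullet> v = 0" using that by (simp add: crd_def)
      then have "G v = 0" using that by (simp add: B_def)
      moreover have "frechet_derivative (inv_into W \<eta>) (at (\<eta> \<xi>)) (G v) = v"
        unfolding G_def by (rule smooth_inverse_derivative[OF D(1,3,4,5) W(1)])
      moreover have "linear (frechet_derivative (inv_into W \<eta>) (at (\<eta> \<xi>)))"
        using smooth_onD[OF D(4)] W(1) by (intro linear_frechet_derivative) blast
      ultimately show "v = 0" using linear_0 by metis
    qed
    then show ?thesis using linear_injective_0[OF linB] by blast
  qed
  obtain A where A: "linear A" "\<And>v. B (A v) = v"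
    using linear_injective_isomorphism[of B] sB injB unfolding strict_deriv_def by metis
  have \<Phi>\<xi>: "\<Phi> \<xi> = 0" by (simp add: \<Phi>_def sgn\<xi> W(3) \<xi>)
  show ?thesis
  proof (rule cone_at_pullback[OF sB A r(1)])
    show "cone_at (plane_sector \<theta>) (\<Phi> \<xi>)"
      by (rule cone_condition_imp_cone_at[OF cone_condition_plane_sector[OF d \<theta>]])
    fix y assume y: "y \<in> ball \<xi> r"
    have yW: "y \<noteq> 0" "sgn y \<in> W" using r(2)[OF y] by auto
    have "y \<in> K \<longleftrightarrow> sgn y \<in> W \<inter> (K \<inter> sphere 0 1)" using hom[OF yW(1)] yW by (auto simp: norm_sgn)
    also have "\<dots> \<longleftrightarrow> \<eta> (sgn y) \<in> \<eta> ` (W \<inter> (K \<inter> sphere 0 1))"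
      using inj_on_image_mem_iff[OF D(7) yW(2), of "W \<inter> (K \<inter> sphere 0 1)"] by blast
    also have "\<dots> \<longleftrightarrow> \<eta> (sgn y) \<in> plane_sector \<theta>"
      unfolding sec using yW(2) z3[OF y] by (auto simp: plane_sector_def)
    \<comment> \<open>The radial term changes only the third coordinate, on which the cylinder does
      not depend.\<close>
    also have "\<dots> \<longleftrightarrow> \<Phi> y \<in> plane_sector \<theta>"
      by (simp add: plane_sector_def \<Phi>_def crd_add crd_scaleR e3 del: One_nat_def)
    finally show "y \<in> K \<longleftrightarrow> \<Phi> y \<in> plane_sector \<theta>" .
  qed
qed

lemma infinite_cone_iff: "x \<in> infinite_cone \<omega> \<longleftrightarrow> x \<noteq> 0 \<and> sgn x \<in> \<omega>"
  by (simp add: infinite_cone_def sgn_div_norm)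

lemma open_infinite_cone:
  assumes "openin (top_of_set (sphere 0 1)) \<omega>"
  shows "open (infinite_cone \<omega> :: 'n::finite rvec set)"
proof -
  obtain T where T: "open T" "\<omega> = sphere 0 1 \<inter> T" using assms unfolding openin_open by blast
  have "infinite_cone \<omega> = sgn -` T \<inter> - {0}"
    by (auto simp: infinite_cone_iff T(2) norm_sgn split: if_splits)
  moreover have "continuous_on (- {0 :: 'n rvec}) sgn" by (intro continuous_intros) auto
  ultimately show ?thesis
    using continuous_on_open_vimage[of "- {0 :: 'n rvec}" sgn] T(1) by auto
qed

text \<open>The unit sphere meets the closure of \<open>K\<close> in a compact set, where the angle
  conditions give cones of uniform size; homogeneity carries them to all of \<open>K\<close>. The
  axis is corrected twice, by a multiple of \<open>\<xi>\<close> to keep the size of the cones near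
  the vertex 0, and by \<open>- x\<close> to stay below height 1.\<close>

lemma cone_condition_polyhedral:
  fixes K :: "'n::{finite,linorder} rvec set"
  assumes pc: "polyhedral_cone n E K" and bd: "bounded (K \<inter> {x. 0 < crd x 3 \<and> crd x 3 < 1})"
  shows "cone_condition (K \<inter> {x. 0 < crd x 3 \<and> crd x 3 < 1})"
proof -
  have d: "CARD('n) = 3" and up: "K \<subseteq> {x. crd x 3 > 0}" using pc by (auto simp: polyhedral_cone_def)
  obtain \<omega> where \<omega>: "openin (top_of_set (sphere 0 1)) \<omega>" "K = infinite_cone \<omega>"
    using pc unfolding polyhedral_cone_def by blast
  obtain v \<Gamma> where v: "\<forall>k\<in>{1..n}. norm (v k) = 1 \<and> E k = {t *\<^sub>R v k |t. t \<ge> 0}"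
    and fr: "frontier K = {0} \<union> (\<Union>k\<in>{1..n}. E k) \<union> (\<Union>k\<in>{1..n}. \<Gamma> k)"
    and face: "\<forall>k\<in>{1..n}. \<forall>\<xi> \<in> \<Gamma> k \<inter> sphere 0 1. spherical_angle_at (K \<inter> sphere 0 1) \<xi> pi"
    and edge: "\<forall>k\<in>{1..n}. \<exists>\<theta>. 0 < \<theta> \<and> \<theta> < 2 * pi \<and> spherical_angle_at (K \<inter> sphere 0 1) (v k) \<theta>"
    using pc unfolding polyhedral_cone_def by (elim exE conjE) (rule that; assumption)
  have K0: "x \<noteq> 0" if "x \<in> K" for x using that by (simp add: \<omega>(2) infinite_cone_iff)
  have scale: "s *\<^sub>R x \<in> K" if "x \<in> K" "s > 0" for s x
    using that by (simp add: \<omega>(2) infinite_cone_iff sgn_scaleR)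
  have hom: "x \<in> K \<longleftrightarrow> sgn x \<in> K" if "x \<noteq> 0" for x
    using that by (simp add: \<omega>(2) infinite_cone_iff sgn_zero_iff sgn_div_norm[of "sgn x"] norm_sgn)
  have at: "cone_at K p" if p: "p \<in> sphere 0 1 \<inter> closure K" for p
  proof (cases "p \<in> K")
    case True
    then show ?thesis using open_infinite_cone[OF \<omega>(1)] \<omega>(2) by (intro cone_at_interior) auto
  next
    case False
    have np: "norm p = 1" using p by simp
    have "p \<in> frontier K" using p False by (auto simp: frontier_def interior_open open_infinite_cone[OF \<omega>(1)] \<omega>(2))
    then consider k where "k \<in> {1..n}" "p \<in> E k" | k where "k \<in> {1..n}" "p \<in> \<Gamma> k"
      using np unfolding fr by auto
    then show ?thesis
    proof cases
      case 1
      then obtain t where t: "t \<ge> 0" "p = t *\<^sub>R v k" using v by blast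
      then have "p = v k" using np v 1(1) by auto
      then show ?thesis using edge 1(1) cone_at_spherical_angle[OF d np _ _ _ hom] by blast
    next
      case 2
      then have "spherical_angle_at (K \<inter> sphere 0 1) p pi" using face p by blast
      then show ?thesis by (intro cone_at_spherical_angle[OF d np _ _ _ hom, of pi]) auto
    qed
  qed
  have "cone_condition_on (sphere 0 1 \<inter> closure K) K"
    by (rule cone_condition_on_compact[OF _ at]) (auto intro: compact_Int_closed)
  then obtain \<kappa> h L0 where \<kappa>: "\<kappa> > 0" and h: "h > 0" and cn: "\<And>x. x \<in> sphere 0 1 \<inter> closure K \<Longrightarrow> x \<in> K \<Longrightarrow>
      \<exists>e. norm e \<le> L0 \<and> (\<forall>t\<in>{0..h}. cball (x + t *\<^sub>R e) (t * \<kappa>) \<subseteq> K)"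
    by (rule cone_condition_onE) blast
  define L where "L = max L0 0"
  \<comment> \<open>With \<open>l *\<^sub>R \<xi>\<close> added to the axis, the rescaled parameter
    \<open>t / (r + t * l)\<close> is at most \<open>h\<close> for all \<open>r > 0\<close> and
    \<open>t \<ge> 0\<close>, however close \<open>r *\<^sub>R \<xi>\<close> is to the vertex of
    \<open>K\<close>.\<close>
  define l where "l = 1 / h"
  have l: "l > 0" using h by (simp add: l_def)
  have grow: "y \<in> K" if \<xi>: "\<xi> \<in> K" and e: "\<forall>t\<in>{0..h}. cball (\<xi> + t *\<^sub>R e) (t * \<kappa>) \<subseteq> K"
    and r: "r > 0" and t: "t \<ge> 0" and y: "y \<in> cball (r *\<^sub>R \<xi> + t *\<^sub>R (l *\<^sub>R \<xi> + e)) (t * \<kappa>)" for \<xi> e r t y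
  proof -
    define s where "s = r + t * l"
    define \<tau> where "\<tau> = t / s"
    have s: "s > 0" using r t l by (simp add: s_def add_pos_nonneg)
    have \<tau>: "\<tau> \<in> {0..h}"
    proof -
      have "t \<le> h * s" using r t h by (simp add: s_def l_def distrib_left)
      then show ?thesis using s t by (simp add: \<tau>_def divide_le_eq)
    qed
    have eq: "r *\<^sub>R \<xi> + t *\<^sub>R (l *\<^sub>R \<xi> + e) = s *\<^sub>R (\<xi> + \<tau> *\<^sub>R e)"
      using s by (simp add: s_def[symmetric] \<tau>_def scaleR_right_distrib) (simp add: s_def algebra_simps)
    define w where "w = (1 / s) *\<^sub>R y"
    have yw: "y = s *\<^sub>R w" using s by (simp add: w_def)
    have "s * norm (\<xi> + \<tau> *\<^sub>R e - w) = norm (s *\<^sub>R (\<xi> + \<tau> *\<^sub>R e - w))" using s by simp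
    also have "\<dots> = dist (s *\<^sub>R (\<xi> + \<tau> *\<^sub>R e)) y" by (simp add: yw dist_norm scaleR_diff_right)
    also have "\<dots> \<le> t * \<kappa>" using y unfolding eq by simp
    also have "\<dots> = s * (\<tau> * \<kappa>)" using s by (simp add: \<tau>_def)
    finally have "w \<in> cball (\<xi> + \<tau> *\<^sub>R e) (\<tau> * \<kappa>)" using s by (simp add: dist_norm)
    then have "w \<in> K" using e \<tau> by blast
    then show ?thesis unfolding yw using s by (intro scale)
  qed
  obtain R where "\<forall>x\<in>K \<inter> {x. 0 < crd x 3 \<and> crd x 3 < 1}. norm x \<le> R" using bd unfolding bounded_iff ..
  note R = bspec[OF this]
  \<comment> \<open>Normalises the scaled axis together with its opening to total size at most 1, so
    that the third coordinate in the cone is at most \<open>t + (1 - t) * crd x 3\<close>, which is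
    below 1.\<close>
  define \<delta> where "\<delta> = 1 / (l + L + \<kappa>)"
  have S: "l + L + \<kappa> > 0" using l \<kappa> by (simp add: L_def)
  have \<delta>: "\<delta> > 0" "\<delta> * (l + L + \<kappa>) = 1" using S by (auto simp: \<delta>_def)
  show ?thesis
  proof (rule cone_condition_onI[of "\<delta> * \<kappa>" "1 / 2"])
    fix x assume x: "x \<in> K \<inter> {x. 0 < crd x 3 \<and> crd x 3 < 1}"
    define \<xi> where "\<xi> = sgn x"
    have x0: "x \<noteq> 0" using x K0 by blast
    have \<xi>K: "\<xi> \<in> K" "norm \<xi> = 1" using x hom[OF x0] x0 by (auto simp: \<xi>_def norm_sgn)
    then obtain e where e: "norm e \<le> L0" "\<forall>t\<in>{0..h}. cball (\<xi> + t *\<^sub>R e) (t * \<kappa>) \<subseteq> K"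
      using cn[of \<xi>] closure_subset[of K] by auto
    define e1 where "e1 = l *\<^sub>R \<xi> + e"
    have ne1: "norm e1 \<le> l + L"
      using norm_triangle_ineq[of "l *\<^sub>R \<xi>" e] \<xi>K(2) l e(1) by (simp add: e1_def L_def)
    show "\<exists>e. norm e \<le> R + \<delta> * (l + L) \<and> (\<forall>t\<in>{0..1 / 2}. cball (x + t *\<^sub>R e) (t * (\<delta> * \<kappa>)) \<subseteq> K \<inter> {x. 0 < crd x 3 \<and> crd x 3 < 1})"
    proof (intro exI[of _ "\<delta> *\<^sub>R e1 - x"] conjI ballI subsetI)
      have "norm (\<delta> *\<^sub>R e1 - x) \<le> \<delta> * norm e1 + norm x"
        using norm_triangle_ineq4[of "\<delta> *\<^sub>R e1" x] \<delta>(1) by simp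
      also have "\<dots> \<le> \<delta> * (l + L) + R" using ne1 \<delta>(1) R[OF x] by (intro add_mono mult_left_mono) auto
      finally show "norm (\<delta> *\<^sub>R e1 - x) \<le> R + \<delta> * (l + L)" by simp
      fix t y assume t: "t \<in> {0..1 / 2}" and y: "y \<in> cball (x + t *\<^sub>R (\<delta> *\<^sub>R e1 - x)) (t * (\<delta> * \<kappa>))"
      have xx: "norm x *\<^sub>R \<xi> = x" using x0 by (simp add: \<xi>_def sgn_div_norm)
      have "x + t *\<^sub>R (\<delta> *\<^sub>R e1 - x) = (1 - t) *\<^sub>R x + (t * \<delta>) *\<^sub>R e1" by (simp add: algebra_simps)
      also have "(1 - t) *\<^sub>R x = ((1 - t) * norm x) *\<^sub>R \<xi>" by (simp add: xx flip: scaleR_scaleR)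
      finally have eq: "x + t *\<^sub>R (\<delta> *\<^sub>R e1 - x) = ((1 - t) * norm x) *\<^sub>R \<xi> + (t * \<delta>) *\<^sub>R (l *\<^sub>R \<xi> + e)" by (simp add: e1_def)
      have yK: "y \<in> K"
      proof (rule grow[OF \<xi>K(1) e(2)])
        show "(1 - t) * norm x > 0" using t x0 by simp
        show "t * \<delta> \<ge> 0" using t \<delta> by simp
        show "y \<in> cball (((1 - t) * norm x) *\<^sub>R \<xi> + (t * \<delta>) *\<^sub>R (l *\<^sub>R \<xi> + e)) (t * \<delta> * \<kappa>)"
          using y unfolding eq by (simp add: mult.assoc)
      qed
      have "crd y 3 = crd (y - (x + t *\<^sub>R (\<delta> *\<^sub>R e1 - x))) 3 + ((1 - t) * crd x 3 + (t * \<delta>) * crd e1 3)"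
        by (simp add: crd_diff crd_add crd_scaleR algebra_simps)
      also have "\<dots> \<le> t * (\<delta> * \<kappa>) + ((1 - t) * crd x 3 + (t * \<delta>) * (l + L))"
      proof (intro add_mono mult_left_mono order_refl)
        have "norm (y - (x + t *\<^sub>R (\<delta> *\<^sub>R e1 - x))) \<le> t * (\<delta> * \<kappa>)" using y by (simp add: dist_norm norm_minus_commute)
        then show "crd (y - (x + t *\<^sub>R (\<delta> *\<^sub>R e1 - x))) 3 \<le> t * (\<delta> * \<kappa>)"
          using abs_crd_le[of "y - (x + t *\<^sub>R (\<delta> *\<^sub>R e1 - x))" 3] by linarith
        show "crd e1 3 \<le> l + L" using abs_crd_le[of e1 3] ne1 by linarith
        show "t * \<delta> \<ge> 0" using t \<delta> by simp
      qed (use t in auto)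
      also have "\<dots> = t * (\<delta> * (l + L + \<kappa>)) + (1 - t) * crd x 3" by (simp add: algebra_simps)
      also have "\<dots> = t + (1 - t) * crd x 3" by (simp add: \<delta>(2))
      also have "\<dots> < t + (1 - t) * 1" using x t by (intro add_strict_left_mono mult_strict_left_mono) auto
      finally have "crd y 3 < 1" by simp
      then show "y \<in> K \<inter> {x. 0 < crd x 3 \<and> crd x 3 < 1}" using yK up by auto
    qed
  qed (use \<delta> \<kappa> in auto)
qed

section \<open>The cone condition for standard pairs and near regular boundary points\<close>

lemma standard_pair_cone_condition:
  assumes "standard_pair \<Omega> M"
  shows "cone_condition \<Omega> \<and> bounded \<Omega>"
  using assms
proof cases
  case (smooth_cone \<gamma>)
  then show ?thesis
    using cone_condition_smooth_cone[OF smooth_cone(3,4)] bounded_subset[of "ball 0 1" \<Omega>] by auto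
next
  case (nonsmooth_cone \<gamma>)
  then show ?thesis
    using cone_condition_nonsmooth_cone bounded_subset[of "box 0 1" \<Omega>] by (auto simp: unit_cube_eq_box)
next
  case (dihedral l)
  then show ?thesis using cone_condition_unit_cube by (auto simp: unit_cube_eq_box)
next
  case (polyhedral n E K')
  then show ?thesis using cone_condition_polyhedral by auto
qed

lemma diffeomorphic_cone_condition:
  assumes "diffeomorphic_to_standard_pair D M"
  shows "cone_condition D"
proof -
  obtain \<Omega> M0 \<eta> W where "standard_pair \<Omega> M0" "closure \<Omega> \<subseteq> W" "diffeo_open W \<eta>" "D = \<eta> ` \<Omega>"
    using assms unfolding diffeomorphic_to_standard_pair_def diffeo_on_def by blast
  then show ?thesis using cone_condition_diffeo_image standard_pair_cone_condition by blast
qed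

text \<open>Near a regular boundary point the domain occupies one or both sides of a hypersurface.\<close>

lemma cone_at_half_spaces:
  fixes D :: "'n::{finite,linorder} rvec set"
  assumes \<rho>: "\<rho> > 0" and side: "\<And>s x y. s \<in> {-1, 1} \<Longrightarrow> x \<in> ball p \<rho> \<Longrightarrow> y \<in> ball p \<rho> \<Longrightarrow>
     s * crd x k > 0 \<Longrightarrow> s * crd y k > 0 \<Longrightarrow> x \<in> D \<Longrightarrow> y \<in> D"
    and off: "\<And>x. x \<in> ball p \<rho> \<Longrightarrow> x \<in> D \<Longrightarrow> crd x k \<noteq> 0"
  shows "cone_at D p"
proof -
  define u :: "'n rvec" where "u = axis (crd_index k) 1"
  have u: "norm u = 1" "crd u k = 1" by (auto simp: u_def crd_eq inner_axis_axis)
  have "cone_condition_on (ball p (\<rho> / 2)) D"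
  proof (rule cone_condition_onI[of "1 / 2" "\<rho> / 4"])
    fix x assume x: "x \<in> ball p (\<rho> / 2)" "x \<in> D"
    have xr: "x \<in> ball p \<rho>" using x \<rho> by auto
    \<comment> \<open>The side of the hyperplane on which \<open>x\<close> lies; the axis points
      deeper into that side.\<close>
    define s where "s = sgn (crd x k)"
    have s: "s \<in> {-1, 1}" "s * crd x k > 0" using off[OF xr x(2)] by (auto simp: s_def sgn_if)
    show "\<exists>e. norm e \<le> 1 \<and> (\<forall>t\<in>{0..\<rho> / 4}. cball (x + t *\<^sub>R e) (t * (1 / 2)) \<subseteq> D)"
    proof (intro exI[of _ "s *\<^sub>R u"] conjI ballI subsetI)
      show "norm (s *\<^sub>R u) \<le> 1" using s(1) u by auto
      fix t y assume t: "t \<in> {0..\<rho> / 4}" and y: "y \<in> cball (x + t *\<^sub>R s *\<^sub>R u) (t * (1 / 2))"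
      define w where "w = y - (x + t *\<^sub>R s *\<^sub>R u)"
      have w: "norm w \<le> t / 2" using y by (simp add: w_def dist_norm norm_minus_commute)
      have yw: "y = x + t *\<^sub>R s *\<^sub>R u + w" by (simp add: w_def)
      have "s * crd y k = s * crd x k + t * (s * s) + s * crd w k"
        by (simp add: yw crd_add crd_scaleR u algebra_simps)
      also have "s * s = 1" using s(1) by auto
      finally have "s * crd y k = s * crd x k + t + s * crd w k" by simp
      moreover have "\<bar>s * crd w k\<bar> \<le> t / 2" using abs_crd_le[of w k] w s(1) by (auto simp: abs_mult)
      ultimately have pos: "s * crd y k > 0" using s(2) t by auto
      have "y - x = t *\<^sub>R s *\<^sub>R u + w" by (simp add: yw)
      then have "dist x y = norm (t *\<^sub>R s *\<^sub>R u + w)" by (metis dist_commute dist_norm)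
      also have "\<dots> \<le> t + t / 2" using norm_triangle_ineq[of "t *\<^sub>R s *\<^sub>R u" w] w u t s(1) by auto
      finally have "dist p y < \<rho>" using dist_triangle[of p y x] x t \<rho> by simp
      then have "y \<in> ball p \<rho>" by simp
      then show "y \<in> D" using side[OF s(1) xr _ s(2) pos x(2)] by blast
    qed
  qed (use \<rho> in auto)
  then show ?thesis unfolding cone_at_def using \<rho> by (meson half_gt_zero)
qed

text \<open>In the flattening chart the frontier is a hyperplane. The preimage of each open half
  ball is connected and misses the frontier, so it lies entirely in \<open>D\<close> or entirely
  outside.\<close>

lemma cone_at_regular_boundary:
  fixes D :: "'n::{finite,linorder} rvec set"
  assumes D: "open D" and p: "p \<in> frontier D" "p \<notin> singularity_set D"
  shows "cone_at D p"
proof -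
  obtain \<epsilon> where \<epsilon>: "\<epsilon> > 0" "smooth_hypersurface (frontier D \<inter> ball p \<epsilon>)"
    using p unfolding singularity_set_def by blast
  have "p \<in> frontier D \<inter> ball p \<epsilon>" using p \<epsilon> by simp
  from bspec[OF \<epsilon>(2)[unfolded smooth_hypersurface_def] this] obtain W \<eta> where W: "p \<in> W" "diffeo_open W \<eta>"
    "\<eta> ` (W \<inter> (frontier D \<inter> ball p \<epsilon>)) = \<eta> ` W \<inter> {y. crd y CARD('n) = 0}"
    by (elim exE conjE) (rule that; assumption)
  note d = diffeo_openD[OF W(2)]
  let ?g = "inv_into W \<eta>"
  have gcont: "continuous_on (\<eta> ` W) ?g"
    by (intro continuous_at_imp_continuous_on ballI) (meson d(4) differentiable_imp_continuous_within smooth_onD)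
  have op: "open (?g -` (W \<inter> ball p \<epsilon>) \<inter> \<eta> ` W)"
    by (rule continuous_on_open_vimage[OF d(2), THEN iffD1, OF gcont, rule_format]) (use d(1) in auto)
  have "\<eta> p \<in> ?g -` (W \<inter> ball p \<epsilon>) \<inter> \<eta> ` W" using W(1) d(5) \<epsilon> by simp
  then obtain \<rho> where \<rho>: "\<rho> > 0" "ball (\<eta> p) \<rho> \<subseteq> ?g -` (W \<inter> ball p \<epsilon>) \<inter> \<eta> ` W" using op open_contains_ball by blast
  have bW: "y \<in> \<eta> ` W" "?g y \<in> ball p \<epsilon>" if "y \<in> ball (\<eta> p) \<rho>" for y using \<rho>(2) that by auto
  have front: "?g y \<in> frontier D \<longleftrightarrow> crd y CARD('n) = 0" if y: "y \<in> ball (\<eta> p) \<rho>" for y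
  proof -
    have gy: "?g y \<in> W" "\<eta> (?g y) = y" using d(6)[OF bW(1)[OF y]] by auto
    have "?g y \<in> frontier D \<longleftrightarrow> ?g y \<in> W \<inter> (frontier D \<inter> ball p \<epsilon>)" using gy bW(2)[OF y] by blast
    also have "\<dots> \<longleftrightarrow> \<eta> (?g y) \<in> \<eta> ` (W \<inter> (frontier D \<inter> ball p \<epsilon>))"
      using inj_on_image_mem_iff[OF d(7) gy(1), of "W \<inter> (frontier D \<inter> ball p \<epsilon>)"] by blast
    also have "\<dots> \<longleftrightarrow> crd y CARD('n) = 0" unfolding W(3) gy(2) using bW(1)[OF y] by simp
    finally show ?thesis .
  qed
  have mem: "y \<in> \<eta> ` (W \<inter> D) \<longleftrightarrow> ?g y \<in> D" if "y \<in> \<eta> ` W" for y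
    using d(5,6) that by (metis IntD2 IntI IntD1 imageE imageI)
  have "cone_at (\<eta> ` (W \<inter> D)) (\<eta> p)"
  proof (rule cone_at_half_spaces[OF \<rho>(1)])
    fix x assume x: "x \<in> ball (\<eta> p) \<rho>" "x \<in> \<eta> ` (W \<inter> D)"
    then have "?g x \<in> D" using mem bW by blast
    then have "?g x \<notin> frontier D" using D by (simp add: frontier_def interior_open)
    then show "crd x CARD('n) \<noteq> 0" using front[OF x(1)] by simp
  next
    fix s :: real and x y assume s: "s \<in> {-1, 1}" and x: "x \<in> ball (\<eta> p) \<rho>" and y: "y \<in> ball (\<eta> p) \<rho>"
      and pos: "s * crd x CARD('n) > 0" "s * crd y CARD('n) > 0" and xD: "x \<in> \<eta> ` (W \<inter> D)"
    define H where "H = ball (\<eta> p) \<rho> \<inter> {z. (s *\<^sub>R axis (crd_index CARD('n)) 1) \<bullet> z > 0}"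
    have Hmem: "z \<in> H \<longleftrightarrow> z \<in> ball (\<eta> p) \<rho> \<and> s * crd z CARD('n) > 0" for z by (simp add: H_def crd_eq)
    have "connected H"
      unfolding H_def by (intro convex_connected convex_Int convex_ball convex_halfspace_gt)
    moreover have "H \<subseteq> \<eta> ` W" using bW by (auto simp: H_def)
    ultimately have conn: "connected (?g ` H)" using gcont by (meson connected_continuous_image continuous_on_subset)
    have "?g ` H \<inter> frontier D = {}"
      using front by (auto simp: Hmem)
    moreover have "?g x \<in> ?g ` H \<inter> D" using x pos(1) xD mem bW by (auto simp: Hmem)
    ultimately have "?g ` H \<subseteq> D" using connected_Int_frontier[OF conn, of D] by blast
    then have "?g y \<in> D" using y pos(2) Hmem by blast
    then show "y \<in> \<eta> ` (W \<inter> D)" using mem bW(1)[OF y] by blast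
  qed
  then show ?thesis
  proof (rule cone_at_diffeo[OF W(2,1) zero_less_one, rotated])
    show "y \<in> D \<longleftrightarrow> \<eta> y \<in> \<eta> ` (W \<inter> D)" if "y \<in> W" for y
      using mem[of "\<eta> y"] d(5)[OF that] by auto
  qed
qed

text \<open>Frontier points in the balls of the cover are regular. In any other set of the cover the
  chart identifies \<open>D\<close> near the point with a standard domain, whose cones are pulled
  back.\<close>

lemma polyhedral_type_cone_condition:
  assumes "polyhedral_type D"
  shows "cone_condition D"
proof (rule cone_condition_of_cone_at)
  have D: "open D" "bounded D" using assms by (auto simp: polyhedral_type_def bounded_domain_def)
  then show "bounded D" by blast
  fix p assume p: "p \<in> closure D"
  obtain \<U> where \<U>: "closure D \<subseteq> \<Union>\<U>" "\<forall>U\<in>\<U>. open U \<and> bounded U \<and>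
           ((\<exists>c r. U = ball c r \<and> closure U \<inter> singularity_set D = {}) \<or>
            (\<exists>\<eta> \<Omega>\<^sub>0 M\<^sub>0. standard_pair \<Omega>\<^sub>0 M\<^sub>0 \<and> diffeo_on (closure U) \<eta> \<and> \<eta> ` (U \<inter> D) = \<Omega>\<^sub>0 \<and>
               equivalent_on (U \<inter> D) (\<lambda>x. infdist x (singularity_set D))
                 (\<lambda>x. infdist x {y \<in> closure U. \<eta> y \<in> M\<^sub>0})))"
    using assms unfolding polyhedral_type_def by blast
  obtain U where U: "U \<in> \<U>" "p \<in> U" using \<U>(1) p by blast
  have oU: "open U" using \<U>(2) U(1) by blast
  show "cone_at D p"
  proof (cases "p \<in> D")
    case False
    then have fr: "p \<in> frontier D" using p D(1) by (simp add: frontier_def interior_open)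
    from \<U>(2) U(1) consider "closure U \<inter> singularity_set D = {}"
      | \<eta> \<Omega> M0 where "standard_pair \<Omega> M0" "diffeo_on (closure U) \<eta>" "\<eta> ` (U \<inter> D) = \<Omega>" by blast
    then show ?thesis
    proof cases
      case 1
      then have "p \<notin> singularity_set D" using U(2) closure_subset by blast
      then show ?thesis by (rule cone_at_regular_boundary[OF D(1) fr])
    next
      case 2
      then obtain W where W: "closure U \<subseteq> W" "diffeo_open W \<eta>" unfolding diffeo_on_def by blast
      have UW: "U \<subseteq> W" using W(1) closure_subset by blast
      obtain r where r: "r > 0" "ball p r \<subseteq> U" using oU U(2) open_contains_ball by blast
      show ?thesis
      proof (rule cone_at_diffeo[OF W(2) _ r(1)])
        show "p \<in> W" using UW U(2) by blast
        show "cone_at \<Omega> (\<eta> p)" using cone_condition_imp_cone_at standard_pair_cone_condition[OF 2(1)] by blast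
        fix y assume y: "y \<in> ball p r" "y \<in> W"
        show "y \<in> D \<longleftrightarrow> \<eta> y \<in> \<Omega>"
          unfolding 2(3)[symmetric]
          using inj_on_image_mem_iff[OF diffeo_openD(7)[OF W(2)] y(2), of "U \<inter> D"] UW y r(2) by blast
      qed
    qed
  qed (rule cone_at_interior[OF D(1)])
qed

section \<open>Generalized polyhedral type and the embedding criterion\<close>

lemma generalized_polyhedral_type_cone_condition:
  assumes "generalized_polyhedral_type D M"
  shows "cone_condition D"
proof -
  have "standard_pair D M \<or> polyhedral_type D \<or> (\<exists>N D'. D = (\<Union>j\<in>{1..N::nat}. D' j) \<and>
      (\<forall>j\<in>{1..N}. diffeomorphic_to_standard_pair (D' j) (M \<inter> closure (D' j))))"
    using assms unfolding generalized_polyhedral_type_def by (elim conjE disjE exE) metis+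
  then show ?thesis
  proof (elim disjE exE conjE)
    fix N D' assume D': "D = (\<Union>j\<in>{1..N::nat}. D' j)"
      "\<forall>j\<in>{1..N}. diffeomorphic_to_standard_pair (D' j) (M \<inter> closure (D' j))"
    show ?thesis
      unfolding D'(1) 
      by (rule cone_condition_UN[OF finite_atLeastAtMost diffeomorphic_cone_condition[OF bspec[OF D'(2)]]])
  qed (use standard_pair_cone_condition polyhedral_type_cone_condition in blast)+
qed

theorem theorem27:
  fixes D M :: "('n::{finite,linorder} rvec) set"
    and a a' :: real and m m' :: nat
  assumes "CARD('n) \<ge> 2"
    and "m \<ge> 1"
    and "generalized_polyhedral_type D M"
  shows "(\<forall>p::real. 1 < p \<longrightarrow>
            (continuously_embedded
               (kondratiev_space D M m a p) (kondratiev_norm D M m a p)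
               (kondratiev_space_inf D M m' a') (kondratiev_norm_inf D M m' a')
             \<longleftrightarrow> real m - real CARD('n) / p > real m' \<and> a - real CARD('n) / p \<ge> a')) \<and>
         (continuously_embedded
            (kondratiev_space D M m a 1) (kondratiev_norm D M m a 1)
            (kondratiev_space_inf D M m' a') (kondratiev_norm_inf D M m' a')
          \<longleftrightarrow> real m - real CARD('n) \<ge> real m' \<and> a - real CARD('n) \<ge> a')"
proof -
  have D: "open D" and M: "M \<noteq> {}" "M \<subseteq> frontier D"
    using assms(3) by (auto simp: generalized_polyhedral_type_def bounded_domain_def)
  have MD: "M \<inter> D = {}" using M(2) D by (auto simp: frontier_def interior_open)
  have ne: "D \<noteq> {}" using M by auto
  have cone: "cone_condition D" by (rule generalized_polyhedral_type_cone_condition[OF assms(3)])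
  note nec_w = embedding_necessary_weight[OF D M cone]
    and nec_o = embedding_necessary_order[OF D ne M(1) MD]
    and suff = embedding_sufficient[OF D M(1) MD cone]
  show ?thesis
  proof (intro conjI allI impI iffI)
    fix p :: real assume p: "1 < p"
    then have p1: "p \<ge> 1" by simp
    let ?emb = "continuously_embedded
               (kondratiev_space D M m a p) (kondratiev_norm D M m a p)
               (kondratiev_space_inf D M m' a') (kondratiev_norm_inf D M m' a')"
    show "real m - real CARD('n) / p > real m'" if ?emb using nec_o(2)[OF p1 that p] .
    show "a - real CARD('n) / p \<ge> a'" if ?emb using nec_w[OF p1 that] .
    assume c: "real m - real CARD('n) / p > real m' \<and> a - real CARD('n) / p \<ge> a'"
    \<comment> \<open>Positivity gives \<open>m' < m\<close>, so that the natural number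
      \<open>m - m'\<close> is a genuine difference; it is the number of derivatives spent.\<close>
    have "real CARD('n) / p > 0" using p by simp
    then have mm: "m' < m" using c by linarith
    then have "real (m - m') > real CARD('n) / p" using c by (simp add: of_nat_diff)
    then show ?emb using mm c by (intro suff[OF p1, of "m - m'"]) auto
  next
    let ?emb = "continuously_embedded
            (kondratiev_space D M m a 1) (kondratiev_norm D M m a 1)
            (kondratiev_space_inf D M m' a') (kondratiev_norm_inf D M m' a')"
    show "real m - real CARD('n) \<ge> real m'" if ?emb using nec_o(1)[OF order_refl that] by simp
    show "a - real CARD('n) \<ge> a'" if ?emb using nec_w[OF order_refl that] by simp
    assume c: "real m - real CARD('n) \<ge> real m' \<and> a - real CARD('n) \<ge> a'"
    \<comment> \<open>Exactly \<open>d\<close> derivatives are spent, so that the limiting estimate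
      applies and equality \<open>m - d = m'\<close> is included.\<close>
    have "m' + CARD('n) \<le> m" using c by linarith
    then show ?emb using c assms(1) by (intro suff[OF order_refl, of "CARD('n)"]) auto
  qed
qed

end
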